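(* Consider the linear regression model $Y=X\beta+\epsilon$ of the context, where the error process $(\epsilon_i)_{i\in\mathbb{Z}}$ is strictly stationary, centered, square integrable, independent of the design, with $\mathcal{F}_{-\infty}$ trivial and $\epsilon_0$ $\mathcal{F}_\infty$-measurable. Assume Hannan's condition $$\sum_{i\in\mathbb{Z}}\|P_0(\epsilon_i)\|_{\mathbb{L}^2}<+\infty .$$ Assume that the design satisfies, almost surely: (i) for all $j\in\{1,\dots,p\}$, $\lim_{n\to\infty}d_j(n)=\infty$; (ii) for all $j\in\{1,\dots,p\}$, $\lim_{n\to\infty}\frac{\sup_{1\le i\le n}|x_{i,j}|}{d_j(n)}=0$; (iii) for all $j,l\in\{1,\dots,p\}$ and all integers $k\ge 0$, the limit $\rho_{j,l}(k)=\lim_{n\to\infty}\sum_{m=1}^{n-k}\frac{x_{m,j}x_{m+k,l}}{d_j(n)d_l(n)}$ exists; (iv) the matrix $R(0)=[\rho_{j,l}(0)]_{1\le j,l\le p}$ is positive definite. Assume also that $C=F^{-1}GF^{-1}$ is almost surely positive definite. Let $(h_n)$ be a sequence of positive reals such that $h_n\to\infty$, $h_n/n\to0$, and $$h_n\,\mathbb{E}\left(|\epsilon_0|^2\left(1\wedge\frac{h_n}{n}|\epsilon_0|^2\right)\right)\xrightarrow[n\to\infty]{}0 ,$$ and let $C_n=[c_{n,(j,l)}]_{1\le j,l\le p}$ be the estimator defined in the context (built with the bandwidth $h_n$ and a kernel $K$ as there). Let $1\le p_0\le p$ and let $j_1,\dots,j_{p_0}$ be distinct elements of $\{1,\dots,p\}$.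 Let $C_{n_{p_0}}$ be the $p_0\times p_0$ matrix obtained from $C_n$ by removing the rows and columns whose index is not in $\{j_1,\dots,j_{p_0}\}$ (i.e. $C_{n_{p_0}}=[c_{n,(j_a,j_b)}]_{1\le a,b\le p_0}$). Put $$(Z_{1,n},\dots,Z_{p_0,n})^t=C_{n_{p_0}}^{-1/2}\left(d_{j_1}(n)\hat\beta_{j_1},\dots,d_{j_{p_0}}(n)\hat\beta_{j_{p_0}}\right)^t,\qquad \Xi=Z_{1,n}^2+\cdots+Z_{p_0,n}^2 .$$ If $\beta_{j_1}=\dots=\beta_{j_{p_0}}=0$ (the null hypothesis $H_0$), then, as $n\to\infty$, $(Z_{1,n},\dots,Z_{p_0,n})^t$ converges in distribution to $\mathcal{N}(0_{p_0\times1},I_{p_0})$, and $\Xi$ converges in distribution to a $\chi^2$-distribution with parameter (degrees of freedom) $p_0$.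
   Context: Model. All random variables live on a probability space $(\Omega,\mathcal{F},\mathbb{P})$. Fix $p\ge1$. The design is a (random or deterministic) array $(x_{i,j})_{i\ge1,\,1\le j\le p}$ of real numbers; for each $n$, $X$ is the $n\times p$ matrix $[x_{i,j}]_{1\le i\le n,1\le j\le p}$. One observes $Y=X\beta+\epsilon\in\mathbb{R}^n$ with $\beta\in\mathbb{R}^p$ an unknown deterministic vector and $\epsilon=(\epsilon_1,\dots,\epsilon_n)^t$. The process $(\epsilon_i)_{i\in\mathbb{Z}}$ is independent of the design. The superscript $t$ denotes transpose. Errors. $\epsilon_i=\epsilon_0\circ\mathbb{T}^i$ for all $i\in\mathbb{Z}$, where $\mathbb{T}:\Omega\to\Omega$ is a bijective bimeasurable transformation preserving $\mathbb{P}$; $\mathbb{E}(\epsilon_0)=0$, $\mathbb{E}(\epsilon_0^2)<\infty$. $\mathcal{F}_0\subseteq\mathcal{F}$ is a sub-$\sigma$-algebra with $\mathcal{F}_0\subseteq\mathbb{T}^{-1}(\mathcal{F}_0)$, $\mathcal{F}_i=\mathbb{T}^{-i}(\mathcal{F}_0)$, $\mathcal{F}_{-\infty}=\bigcap_{i\in\mathbb{Z}}\mathcal{F}_i$, $\mathcal{F}_\infty=\sigma(\bigcup_{i\in\mathbb{Z}}\mathcal{F}_i)$. For $Z\in\mathbb{L}^2(\Omega)$, $P_j(Z)=\mathbb{E}(Z|\mathcal{F}_j)-\mathbb{E}(Z|\mathcal{F}_{j-1})$ and $\|Z\|_{\mathbb{L}^2}=(\mathbb{E}(Z^2))^{1/2}$.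 The autocovariance is $\gamma(k)=\mathbb{E}(\epsilon_0\epsilon_k)$ (absolutely summable under Hannan's condition) and the spectral density is $f(\lambda)=\frac1{2\pi}\sum_{k\in\mathbb{Z}}\gamma(k)e^{ik\lambda}$, $\lambda\in[-\pi,\pi]$. Design quantities. $d_j(n)=\left(\sum_{i=1}^nx_{i,j}^2\right)^{1/2}$ and $D(n)=\mathrm{diag}(d_1(n),\dots,d_p(n))$. For $k\ge0$, $R(k)=[\rho_{j,l}(k)]_{1\le j,l\le p}$, and $F_X$ is the associated spectral measure, i.e. the Hermitian nonnegative-definite $p\times p$ matrix-valued measure on $[-\pi,\pi]$ such that $R(k)=\int_{-\pi}^{\pi}e^{ik\lambda}F_X(d\lambda)$ for all $k\ge 0$. Set $$F=\frac1{2\pi}\int_{-\pi}^{\pi}F_X(d\lambda),\qquad G=\frac1{2\pi}\int_{-\pi}^{\pi}f(\lambda)\,F_X(d\lambda).$$ Estimator. $\hat\beta=(X^tX)^{-1}X^tY$ is the least square estimator (under the positive definiteness of $R(0)$, $X^tX$ is a.s. invertible for $n$ large). The residuals are $\hat\epsilon_j=Y_j-(x_j)^t\hat\beta$, where $(x_j)^t$ is the $j$-th row of $X$, and $\hat\gamma_k^*=\frac1n\sum_{j=1}^{n-|k|}\hat\epsilon_j\hat\epsilon_{j+|k|}$ for $0\le|k|\le n-1$. The kernel $K:\mathbb{R}\to\mathbb{R}$ is continuous, nonnegative, symmetric, with $K(0)=1$, compact support, and integrable Fourier transform. Set $$\widehat\Gamma^*_{n,h_n}=\left[K\left(\frac{j-l}{h_n}\right)\hat\gamma^*_{j-l}\right]_{1\le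 j,l\le n},\qquad C_n=D(n)(X^tX)^{-1}X^t\,\widehat\Gamma^*_{n,h_n}\,X(X^tX)^{-1}D(n).$$ For a symmetric random matrix $M$, such as $C_{n_{p_0}}$, $M^{-1/2}$ denotes the inverse of its symmetric positive definite square root on the event that $M$ is positive definite (for $C_{n_{p_0}}$ an event whose probability tends to $1$), with an arbitrary measurable definition elsewhere. $I_{p_0}$ is the $p_0\times p_0$ identity matrix and $0_{p_0\times1}$ the zero vector of $\mathbb{R}^{p_0}$. *)

theory Defs
  imports "HOL-Probability.Probability"
begin

section \<open>Stationary errors\<close>

text \<open>Integer iterates of a bijection of \<^term>\<open>space M\<close>; the value of the map outside
  \<^term>\<open>space M\<close> is irrelevant, hence the inverse relative to \<^term>\<open>space M\<close>.\<close>

definition iterate :: "'w measure \<Rightarrow> ('w \<Rightarrow> 'w) \<Rightarrow> int \<Rightarrow> 'w \<Rightarrow> 'w" where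
  "iterate M T i = (if 0 \<le> i then T ^^ nat i else inv_into (space M) T ^^ nat (- i))"

definition invertible_measure_preserving :: "'w measure \<Rightarrow> ('w \<Rightarrow> 'w) \<Rightarrow> bool" where
  "invertible_measure_preserving M T \<longleftrightarrow>
     bij_betw T (space M) (space M) \<and> T \<in> measurable M M \<and>
     inv_into (space M) T \<in> measurable M M \<and> distr M M T = M"

definition err :: "'w measure \<Rightarrow> ('w \<Rightarrow> 'w) \<Rightarrow> ('w \<Rightarrow> real) \<Rightarrow> int \<Rightarrow> 'w \<Rightarrow> real" where
  "err M T \<epsilon>0 i = \<epsilon>0 \<circ> iterate M T i"

text \<open>The sigma-algebra $T^{-i}(\mathcal F_0)$.\<close>

definition filt :: "'w measure \<Rightarrow> ('w \<Rightarrow> 'w) \<Rightarrow> 'w measure \<Rightarrow> int \<Rightarrow> 'w measure" where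
  "filt M T F0 i = vimage_algebra (space M) (iterate M T i) F0"

definition filt_infinity :: "'w measure \<Rightarrow> ('w \<Rightarrow> 'w) \<Rightarrow> 'w measure \<Rightarrow> 'w measure" where
  "filt_infinity M T F0 = sigma (space M) (\<Union>i. sets (filt M T F0 i))"

definition filt_minus_infinity_trivial :: "'w measure \<Rightarrow> ('w \<Rightarrow> 'w) \<Rightarrow> 'w measure \<Rightarrow> bool" where
  "filt_minus_infinity_trivial M T F0 \<longleftrightarrow>
     (\<forall>A \<in> (\<Inter>i. sets (filt M T F0 i)). measure M A = 0 \<or> measure M A = 1)"

definition proj :: "'w measure \<Rightarrow> ('w \<Rightarrow> 'w) \<Rightarrow> 'w measure \<Rightarrow> int \<Rightarrow> ('w \<Rightarrow> real) \<Rightarrow> 'w \<Rightarrow> real" where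
  "proj M T F0 j Z \<omega> =
     real_cond_exp M (filt M T F0 j) Z \<omega> - real_cond_exp M (filt M T F0 (j - 1)) Z \<omega>"

definition L2_norm :: "'w measure \<Rightarrow> ('w \<Rightarrow> real) \<Rightarrow> real" where
  "L2_norm M Z = sqrt (\<integral>\<omega>. (Z \<omega>)\<^sup>2 \<partial>M)"

definition autocov :: "'w measure \<Rightarrow> ('w \<Rightarrow> 'w) \<Rightarrow> ('w \<Rightarrow> real) \<Rightarrow> int \<Rightarrow> real" where
  "autocov M T \<epsilon>0 k = (\<integral>\<omega>. err M T \<epsilon>0 0 \<omega> * err M T \<epsilon>0 k \<omega> \<partial>M)"

text \<open>Complex-valued only by type: the sum is real because the autocovariance is even.\<close>

definition spectral_density :: "(int \<Rightarrow> real) \<Rightarrow> real \<Rightarrow> complex" where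
  "spectral_density \<gamma> t = (\<Sum>\<^sub>\<infinity>k. complex_of_real (\<gamma> k) * cis (of_int k * t)) / (2 * pi)"

definition generated_sigma ::
  "'w measure \<Rightarrow> 'i set \<Rightarrow> ('i \<Rightarrow> 'w \<Rightarrow> 'b::topological_space) \<Rightarrow> 'w measure" where
  "generated_sigma M I V = sigma (space M) (\<Union>i\<in>I. {V i -` A \<inter> space M | A. A \<in> sets borel})"


section \<open>Matrices\<close>

definition posdef :: "real^'n^'n \<Rightarrow> bool" where
  "posdef A \<longleftrightarrow> transpose A = A \<and> (\<forall>v. v \<noteq> 0 \<longrightarrow> v \<bullet> (A *v v) > 0)"

text \<open>Meaningful only for positive definite matrices, where the square root is unique.\<close>

definition inv_sqrt :: "real^'n^'n \<Rightarrow> real^'n^'n" where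
  "inv_sqrt A = matrix_inv (THE B. posdef B \<and> B ** B = A)"

definition hermitian :: "complex^'n^'n \<Rightarrow> bool" where
  "hermitian A \<longleftrightarrow> (\<forall>j l. A $ l $ j = cnj (A $ j $ l))"

definition quad_form :: "complex^'n^'n \<Rightarrow> complex^'n \<Rightarrow> complex" where
  "quad_form A v = (\<Sum>j\<in>UNIV. \<Sum>l\<in>UNIV. cnj (v $ j) * A $ j $ l * v $ l)"

definition hermitian_psd :: "complex^'n^'n \<Rightarrow> bool" where
  "hermitian_psd A \<longleftrightarrow> hermitian A \<and> (\<forall>v. Re (quad_form A v) \<ge> 0)"

definition hermitian_pd :: "complex^'n^'n \<Rightarrow> bool" where
  "hermitian_pd A \<longleftrightarrow> hermitian A \<and> (\<forall>v. v \<noteq> 0 \<longrightarrow> Re (quad_form A v) > 0)"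


section \<open>Matrix-valued measures on $[-\pi,\pi]$\<close>

abbreviation circle_sets :: "real set set" where
  "circle_sets \<equiv> sets (restrict_space borel {-pi..pi})"

definition psd_matrix_measure :: "(real set \<Rightarrow> complex^'n^'n) \<Rightarrow> bool" where
  "psd_matrix_measure \<nu> \<longleftrightarrow>
     (\<forall>A\<in>circle_sets. hermitian_psd (\<nu> A)) \<and>
     (\<forall>A::nat \<Rightarrow> real set. range A \<subseteq> circle_sets \<longrightarrow> disjoint_family A \<longrightarrow>
        (\<lambda>i. \<nu> (A i)) sums \<nu> (\<Union>i. A i))"

text \<open>For such a \<open>\<nu>\<close>, $A \mapsto v^* \nu(A) v$ is a finite nonnegative measure. With
  $v = e_j + \mathrm{i}^r e_l$, polarization writes the entry $\nu_{jl} = e_j^* \nu e_l$ as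
  $\frac14\sum_{r<4} \mathrm{i}^{-r} v^*\nu v$, a linear combination of four finite nonnegative
  measures; this defines the entrywise integral.\<close>

definition quad_measure :: "(real set \<Rightarrow> complex^'n^'n) \<Rightarrow> complex^'n \<Rightarrow> real measure" where
  "quad_measure \<nu> v =
     measure_of {-pi..pi} circle_sets (\<lambda>A. ennreal (Re (quad_form (\<nu> A) v)))"

definition matrix_integral ::
  "(real set \<Rightarrow> complex^'n^'n) \<Rightarrow> (real \<Rightarrow> complex) \<Rightarrow> complex^'n^'n" where
  "matrix_integral \<nu> g =
     (\<chi> j l. (\<Sum>r<4. (- \<i>) ^ r * (\<integral>t. g t \<partial>quad_measure \<nu> (axis j 1 + \<i> ^ r *s axis l 1))) / 4)"


section \<open>Design\<close>

text \<open>A realization of the design is its sequence of rows \<open>x i\<close>, \<open>i \<ge> 1\<close> (\<open>x 0\<close> is never used);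
  the design matrix at stage \<open>n\<close> has the rows \<open>x 1, \<dots>, x n\<close>.\<close>

definition col_norm :: "(nat \<Rightarrow> real^'p) \<Rightarrow> nat \<Rightarrow> 'p \<Rightarrow> real" where
  "col_norm x n j = sqrt (\<Sum>i=1..n. (x i $ j)\<^sup>2)"

definition norm_matrix :: "(nat \<Rightarrow> real^'p) \<Rightarrow> nat \<Rightarrow> real^'p^'p" where
  "norm_matrix x n = (\<chi> j l. if j = l then col_norm x n j else 0)"

definition lag_corr :: "(nat \<Rightarrow> real^'p) \<Rightarrow> nat \<Rightarrow> 'p \<Rightarrow> 'p \<Rightarrow> nat \<Rightarrow> real" where
  "lag_corr x k j l n =
     (\<Sum>m=1..n - k. x m $ j * x (m + k) $ l / (col_norm x n j * col_norm x n l))"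

definition R_matrix :: "(nat \<Rightarrow> real^'p) \<Rightarrow> nat \<Rightarrow> real^'p^'p" where
  "R_matrix x k = (\<chi> j l. lim (lag_corr x k j l))"

definition design_conditions :: "(nat \<Rightarrow> real^'p) \<Rightarrow> bool" where
  "design_conditions x \<longleftrightarrow>
     (\<forall>j. filterlim (\<lambda>n. col_norm x n j) at_top sequentially) \<and>
     (\<forall>j. (\<lambda>n. (SUP i\<in>{1..n}. \<bar>x i $ j\<bar>) / col_norm x n j) \<longlonglongrightarrow> 0) \<and>
     (\<forall>j l k. convergent (lag_corr x k j l)) \<and>
     posdef (R_matrix x 0)"

text \<open>The two endpoints give the same character, so mass may be moved between $-\pi$ and $\pi$;
  this does not affect integrals of $2\pi$-periodic functions.\<close>

definition spectral_measure_of ::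
  "(nat \<Rightarrow> real^'p) \<Rightarrow> (real set \<Rightarrow> complex^'p^'p) \<Rightarrow> bool" where
  "spectral_measure_of x \<nu> \<longleftrightarrow>
     psd_matrix_measure \<nu> \<and>
     (\<forall>k. (\<chi> j l. complex_of_real (R_matrix x k $ j $ l)) =
          matrix_integral \<nu> (\<lambda>t. cis (real k * t)))"

definition F_matrix :: "(real set \<Rightarrow> complex^'p^'p) \<Rightarrow> complex^'p^'p" where
  "F_matrix \<nu> = (1 / (2 * pi)) *\<^sub>R matrix_integral \<nu> (\<lambda>t. 1)"

definition G_matrix :: "(real \<Rightarrow> complex) \<Rightarrow> (real set \<Rightarrow> complex^'p^'p) \<Rightarrow> complex^'p^'p" where
  "G_matrix f \<nu> = (1 / (2 * pi)) *\<^sub>R matrix_integral \<nu> f"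

definition limit_cov :: "(real \<Rightarrow> complex) \<Rightarrow> (real set \<Rightarrow> complex^'p^'p) \<Rightarrow> complex^'p^'p" where
  "limit_cov f \<nu> = matrix_inv (F_matrix \<nu>) ** G_matrix f \<nu> ** matrix_inv (F_matrix \<nu>)"


section \<open>Estimators\<close>

definition gram :: "(nat \<Rightarrow> real^'p) \<Rightarrow> nat \<Rightarrow> real^'p^'p" where
  "gram x n = (\<chi> j l. \<Sum>i=1..n. x i $ j * x i $ l)"

definition least_squares :: "(nat \<Rightarrow> real^'p) \<Rightarrow> (nat \<Rightarrow> real) \<Rightarrow> nat \<Rightarrow> real^'p" where
  "least_squares x y n = matrix_inv (gram x n) *v (\<chi> j. \<Sum>i=1..n. x i $ j * y i)"

definition residual :: "(nat \<Rightarrow> real^'p) \<Rightarrow> (nat \<Rightarrow> real) \<Rightarrow> nat \<Rightarrow> nat \<Rightarrow> real" where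
  "residual x y n i = y i - x i \<bullet> least_squares x y n"

definition autocov_est :: "(nat \<Rightarrow> real^'p) \<Rightarrow> (nat \<Rightarrow> real) \<Rightarrow> nat \<Rightarrow> int \<Rightarrow> real" where
  "autocov_est x y n k =
     (1 / real n) * (\<Sum>i=1..n - nat \<bar>k\<bar>. residual x y n i * residual x y n (i + nat \<bar>k\<bar>))"

definition Gamma_est ::
  "(real \<Rightarrow> real) \<Rightarrow> real \<Rightarrow> (nat \<Rightarrow> real^'p) \<Rightarrow> (nat \<Rightarrow> real) \<Rightarrow> nat \<Rightarrow> nat \<Rightarrow> nat \<Rightarrow> real" where
  "Gamma_est K h x y n j l = K ((real j - real l) / h) * autocov_est x y n (int j - int l)"

definition cov_est ::
  "(real \<Rightarrow> real) \<Rightarrow> real \<Rightarrow> (nat \<Rightarrow> real^'p) \<Rightarrow> (nat \<Rightarrow> real) \<Rightarrow> nat \<Rightarrow> real^'p^'p" where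
  "cov_est K h x y n =
     norm_matrix x n ** matrix_inv (gram x n) **
     (\<chi> j l. \<Sum>a=1..n. \<Sum>b=1..n. x a $ j * Gamma_est K h x y n a b * x b $ l) **
     matrix_inv (gram x n) ** norm_matrix x n"

definition principal_submatrix :: "('q \<Rightarrow> 'p) \<Rightarrow> real^'p^'p \<Rightarrow> real^'q^'q" where
  "principal_submatrix J A = (\<chi> a b. A $ J a $ J b)"

definition admissible_kernel :: "(real \<Rightarrow> real) \<Rightarrow> bool" where
  "admissible_kernel K \<longleftrightarrow>
     continuous_on UNIV K \<and> (\<forall>u. K u \<ge> 0) \<and> (\<forall>u. K (- u) = K u) \<and> K 0 = 1 \<and>
     compact (closure {u. K u \<noteq> 0}) \<and>
     integrable lborel (\<lambda>s. \<integral>u. complex_of_real (K u) * cis (- s * u) \<partial>lborel)"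


section \<open>Convergence in distribution and limit laws\<close>

definition converges_in_distribution ::
  "'w measure \<Rightarrow> (nat \<Rightarrow> 'w \<Rightarrow> 'b::topological_space) \<Rightarrow> 'b measure \<Rightarrow> bool" where
  "converges_in_distribution M V \<mu> \<longleftrightarrow>
     (\<forall>n. V n \<in> borel_measurable M) \<and>
     (\<forall>g :: 'b \<Rightarrow> real. continuous_on UNIV g \<longrightarrow> bounded (range g) \<longrightarrow>
        (\<lambda>n. \<integral>\<omega>. g (V n \<omega>) \<partial>M) \<longlonglongrightarrow> (\<integral>v. g v \<partial>\<mu>))"

definition standard_gaussian :: "(real^'q) measure" where
  "standard_gaussian = density lborel (\<lambda>z. ennreal (\<Prod>a\<in>UNIV. std_normal_density (z $ a)))"

definition chi_square :: "nat \<Rightarrow> real measure" where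
  "chi_square k = density lborel (\<lambda>t. ennreal (if t > 0 then
     t powr (real k / 2 - 1) * exp (- t / 2) / (2 powr (real k / 2) * Gamma (real k / 2)) else 0))"

end

(* Projective decomposition under Hannan's condition gives one inequality that drives everything:
   linear combinations of the errors have L2 norm at most hannan_sum times the l2 norm of the
   coefficients, and up to a factor delta the errors may be replaced by a finite moving average of
   bounded stationary martingale differences. For these, a triangular central limit theorem follows
   from the bounded products of (1 + i t m_s), and quadratic forms have vanishing variance. The
   quadratic forms built with the kernel transfer back to the errors because the integrable Fourier
   transform of the kernel bounds them, uniformly in the bandwidth, by Toeplitz forms with
   trigonometric weights; in L1 this needs only two moments and no truncation condition on the
   bandwidth. Hence for a fixed design the covariance estimator converges in probability to
   R(0)^-1 Gamma R(0)^-1, where Gamma is the sum over k of gamma(k) R(k), and the characteristic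
   function of the studentized least squares estimator converges to the Gaussian one. Independence
   turns the random design into an average over fixed designs. *)

theory Submission
  imports Defs
begin

section \<open>Square integrable functions\<close>

text \<open>The bandwidth lets the number of sample autocovariances in the estimator grow with n, so
  consistency of each of them does not suffice; the whole quadratic form has to be controlled at
  once. Two facts make this possible. First, a sum over pairs of design points weighted by residual
  autocovariances depends on the pairs only through lags, so the roles can be exchanged: it is also
  a quadratic form in the residuals, whose weights are the kernel times the autocorrelation of a
  deterministic sequence, divided by n. These weights have entries of order 1/n and row sums of
  order h/n, which makes the regression part of the residuals negligible. Second, that
  autocorrelation is a sum over translations of rank one weights. With a cosine in place of the
  kernel the form becomes a sum of squares of linear forms, to which the norm inequality applies;
  the translations produce a factor n that cancels the division by n. In the central limit theorem,
  bounded differences keep the sum of their squares bounded pointwise, so the products are bounded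
  without any stopping time.\<close>

lemmas LINT_sum = Bochner_Integration.integral_sum and Lint_sum = Bochner_Integration.integrable_sum
 and Lint_bound = Bochner_Integration.integrable_bound and LINT_cong = Bochner_Integration.integral_cong
 and Lint_diff = Bochner_Integration.integrable_diff and LINT_diff = Bochner_Integration.integral_diff
 and Lint_add = Bochner_Integration.integrable_add and LINT_add = Bochner_Integration.integral_add

abbreviation (input) seq_tendsto :: "(nat => 'a::topological_space) => 'a => bool" ("((_)/ ----> (_))" [60, 60] 60)
 where "X ----> L == (X \<longlongrightarrow> L) sequentially"

definition L2 :: "'w measure => ('w => real) set" where
 "L2 M = {f. f : borel_measurable M \<and> integrable M (%z. (f z)\<^sup>2)}"

lemma L2_measurable: "f : L2 M ==> f : borel_measurable M"
 and L2_integrable_sq: "f : L2 M ==> integrable M (%z. (f z)\<^sup>2)"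
 by (auto simp: L2_def)

lemma L2_norm_nonneg [simp]: "0 <= L2_norm M f"
 by (simp add: L2_norm_def)

lemma L2_norm_power2: "(L2_norm M f)\<^sup>2 = (LINT z|M. (f z)\<^sup>2)"
 by (simp add: L2_norm_def)

lemma L2_integrable_mult:
 assumes "f : L2 M" "g : L2 M"
 shows "integrable M (%z. f z * g z)"
proof (rule Lint_bound[where f = "%z. (f z)\<^sup>2 + (g z)\<^sup>2"])
 have "\<bar>a * b\<bar> <= \<bar>a\<^sup>2 + b\<^sup>2\<bar>" for a b :: real
 proof -
  have "0 <= (\<bar>a\<bar> - \<bar>b\<bar>)\<^sup>2" "0 <= a\<^sup>2 + b\<^sup>2" "0 <= \<bar>a\<bar> * \<bar>b\<bar>" by simp_all
  then show ?thesis unfolding power2_diff power2_abs abs_mult by linarith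
 qed
 then show "AE z in M. norm (f z * g z) <= norm ((f z)\<^sup>2 + (g z)\<^sup>2)" by simp
qed (use assms in \<open>auto simp: L2_def\<close>)

lemma L2_add: "f : L2 M ==> g : L2 M ==> (%z. f z + g z) : L2 M"
 using L2_integrable_mult[of f M g] by (auto simp: L2_def power2_sum mult.assoc)

lemma L2_diff: "f : L2 M ==> g : L2 M ==> (%z. f z - g z) : L2 M"
 using L2_integrable_mult[of f M g] by (auto simp: L2_def power2_diff mult.assoc)

lemma L2_cmult: "f : L2 M ==> (%z. c * f z) : L2 M"
 by (auto simp: L2_def power_mult_distrib)

lemma L2_zero: "(%_. 0) : L2 M"
 by (auto simp: L2_def)

lemma L2_sum: "(!!i. i : I ==> f i : L2 M) ==> (%z. SUM i:I. f i z) : L2 M"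
 by (induction I rule: infinite_finite_induct) (auto intro: L2_zero L2_add)

lemma L2_const_bound:
 assumes "finite_measure M" "f : borel_measurable M" "!!z. z : space M ==> \<bar>f z\<bar> <= b"
 shows "f : L2 M"
 unfolding L2_def mem_Collect_eq
proof
 show "integrable M (%z. (f z)\<^sup>2)"
  using assms by (intro finite_measure.integrable_const_bound[where B = "b\<^sup>2"])
  (auto intro!: AE_I2 simp: abs_le_square_iff[symmetric] intro: order_trans[OF _ abs_ge_self])
qed fact

lemma L2_integrable:
 assumes "finite_measure M" "f : L2 M"
 shows "integrable M f"
 using L2_integrable_mult[OF assms(2) L2_const_bound[OF assms(1), of "%_. 1" 1]] by simp

lemmas (in finite_measure) L2_int = L2_integrable [OF finite_measure_axioms]

text \<open>Integrates \<open>2 * |u * v| <= r * u^2 + v^2 / r\<close> with \<open>r\<close> the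
  ratio of the two norms. Adding \<open>e\<close> to both norms keeps \<open>r\<close> positive and
  finite when one of them is zero; then \<open>e\<close> tends to 0.\<close>

lemma L2_Cauchy_Schwarz_abs:
 assumes f: "f : L2 M" and g: "g : L2 M"
 shows "(LINT z|M. \<bar>f z * g z\<bar>) <= L2_norm M f * L2_norm M g"
proof -
 let ?a = "L2_norm M f" and ?b = "L2_norm M g"
 have bound: "2 * (LINT z|M. \<bar>f z * g z\<bar>) <= ?a * (?b + e) + ?b * (?a + e)" if e: "e > 0" for e
 proof -
  let ?r = "(?b + e) / (?a + e)"
  have pos: "?a + e > 0" "?b + e > 0" using e by (auto intro: add_nonneg_pos)
  have r: "?r > 0" using pos by simp
  have pw: "2 * \<bar>u * v\<bar> <= u\<^sup>2 * ?r + v\<^sup>2 / ?r" for u v :: real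
  proof -
  have "0 <= (\<bar>u\<bar> * sqrt ?r - \<bar>v\<bar> / sqrt ?r)\<^sup>2" by simp
  also have "... = u\<^sup>2 * ?r + v\<^sup>2 / ?r - 2 * \<bar>u * v\<bar>"
  proof -
  have "sqrt ?r ~= 0" "(sqrt ?r)\<^sup>2 = ?r" using r pos by (auto simp del: real_sqrt_divide)
  then show ?thesis
  by (simp add: power2_diff power_mult_distrib power_divide abs_mult del: real_sqrt_divide)
  qed
  finally show ?thesis by simp
  qed
  have "2 * (LINT z|M. \<bar>f z * g z\<bar>) = (LINT z|M. 2 * \<bar>f z * g z\<bar>)" by simp
  also have "... <= (LINT z|M. (f z)\<^sup>2 * ?r + (g z)\<^sup>2 / ?r)"
  by (rule integral_mono)
  (use pw L2_integrable_mult[OF f g] L2_integrable_sq[OF f] L2_integrable_sq[OF g] in auto)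
  also have "... = ?a\<^sup>2 * ?r + ?b\<^sup>2 / ?r"
  using L2_integrable_sq[OF f] L2_integrable_sq[OF g]
  by (simp add: L2_norm_power2 del: divide_divide_eq_right times_divide_eq_right)
  also have "... <= ?a * (?b + e) + ?b * (?a + e)"
  proof (rule add_mono)
  have "?a\<^sup>2 / (?a + e) <= ?a" "?b\<^sup>2 / (?b + e) <= ?b"
  using pos e by (simp_all add: pos_divide_le_eq power2_eq_square algebra_simps)
  then have "?a\<^sup>2 / (?a + e) * (?b + e) <= ?a * (?b + e)" "?b\<^sup>2 / (?b + e) * (?a + e) <= ?b * (?a + e)"
  using pos mult_right_mono[of "?a\<^sup>2 / (?a + e)" ?a "?b + e"] mult_right_mono[of "?b\<^sup>2 / (?b + e)" ?b "?a + e"]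
  by linarith+
  then show "?a\<^sup>2 * ?r <= ?a * (?b + e)" "?b\<^sup>2 / ?r <= ?b * (?a + e)" by (simp_all only: times_divide_eq_left times_divide_eq_right divide_divide_eq_right)
  qed
  finally show ?thesis .
 qed
 have "((%e. ?a * (?b + e) + ?b * (?a + e)) \<longlongrightarrow> ?a * (?b + 0) + ?b * (?a + 0)) (at_right 0)"
  by (intro tendsto_intros)
 moreover have "\<forall>\<^sub>F e in at_right (0::real). 2 * (LINT z|M. \<bar>f z * g z\<bar>) <= ?a * (?b + e) + ?b * (?a + e)"
  using bound by (auto simp: eventually_at_filter)
 ultimately have "2 * (LINT z|M. \<bar>f z * g z\<bar>) <= ?a * (?b + 0) + ?b * (?a + 0)"
  by (intro tendsto_lowerbound[where F = "at_right (0::real)"]) auto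
 then show ?thesis by (simp add: mult.commute)
qed

lemma L2_Cauchy_Schwarz:
 assumes f: "f : L2 M" and g: "g : L2 M"
 shows "\<bar>(LINT z|M. f z * g z)\<bar> <= L2_norm M f * L2_norm M g"
 using L2_Cauchy_Schwarz_abs[OF assms] integral_abs_bound[of M "%z. f z * g z"] by linarith

lemma L2_norm_cmult: "L2_norm M (%z. c * f z) = \<bar>c\<bar> * L2_norm M f"
 by (simp add: L2_norm_def power_mult_distrib real_sqrt_mult)

lemma L2_norm_add_le:
 assumes f: "f : L2 M" and g: "g : L2 M"
 shows "L2_norm M (%z. f z + g z) <= L2_norm M f + L2_norm M g"
proof (rule power2_le_imp_le)
 have "(L2_norm M (%z. f z + g z))\<^sup>2 = (L2_norm M f)\<^sup>2 + (L2_norm M g)\<^sup>2 + 2 * (LINT z|M. f z * g z)"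
  using L2_integrable_sq[OF f] L2_integrable_sq[OF g] L2_integrable_mult[OF f g]
  by (simp add: L2_norm_power2 power2_sum mult.assoc)
 also have "... <= (L2_norm M f + L2_norm M g)\<^sup>2"
  using L2_Cauchy_Schwarz[OF f g] by (simp add: power2_sum)
 finally show "(L2_norm M (%z. f z + g z))\<^sup>2 <= (L2_norm M f + L2_norm M g)\<^sup>2" .
qed simp

lemma L2_norm_minus_commute: "L2_norm M (%z. f z - g z) = L2_norm M (%z. g z - f z)"
 by (simp add: L2_norm_def power2_commute)


lemma L2_norm_le_add_diff:
 assumes "f : L2 M" "g : L2 M"
 shows "L2_norm M f <= L2_norm M g + L2_norm M (%z. f z - g z)"
 using L2_norm_add_le[OF assms(2) L2_diff[OF assms]] by simp

lemma L2_norm_zero [simp]: "L2_norm M (%_. 0) = 0"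
 by (simp add: L2_norm_def)

lemma L2_norm_sum_le:
 assumes "!!i. i : I ==> f i : L2 M"
 shows "L2_norm M (%z. SUM i:I. f i z) <= (SUM i:I. L2_norm M (f i))"
 using assms
proof (induction I rule: infinite_finite_induct)
 case (insert i I)
 then have "L2_norm M (%z. f i z + (SUM i:I. f i z)) <= L2_norm M (f i) + L2_norm M (%z. SUM i:I. f i z)"
  by (intro L2_norm_add_le L2_sum) auto
 with insert show ?case by fastforce
qed auto

lemma L2_norm_cong_AE:
 assumes "f : borel_measurable M" "g : borel_measurable M" "AE z in M. f z = g z"
 shows "L2_norm M f = L2_norm M g"
proof -
 have "(LINT z|M. (f z)\<^sup>2) = (LINT z|M. (g z)\<^sup>2)"
  using assms by (intro integral_cong_AE) auto
 then show ?thesis by (simp add: L2_norm_def)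
qed

lemma L2_norm_mono:
 assumes "g : L2 M" "f : borel_measurable M" "!!z. z : space M ==> \<bar>f z\<bar> <= \<bar>g z\<bar>"
 shows "f : L2 M" "L2_norm M f <= L2_norm M g"
proof -
 have sq: "(f z)\<^sup>2 <= (g z)\<^sup>2" if "z : space M" for z
  using assms(3)[OF that] by (simp add: abs_le_square_iff)
 show "f : L2 M" unfolding L2_def mem_Collect_eq
  using assms(2) sq by (auto intro!: Lint_bound[OF L2_integrable_sq[OF assms(1)]] AE_I2)
 then show "L2_norm M f <= L2_norm M g"
  using sq assms(1) by (auto simp: L2_norm_def L2_def intro!: integral_mono)
qed

lemma (in prob_space) expectation_abs_le_L2_norm:
 assumes "f : L2 M"
 shows "(LINT z|M. \<bar>f z\<bar>) <= L2_norm M f"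
 using L2_Cauchy_Schwarz_abs[OF assms L2_const_bound[OF finite_measure_axioms, of "%_. 1" 1]]
 by (simp add: L2_norm_def prob_space)

lemma (in prob_space) L2_norm_const: "L2_norm M (%_. c) = \<bar>c\<bar>"
 by (simp add: L2_norm_def prob_space)

text \<open>The geometric rate will make the increments along \<open>r\<close> summable. Partial
  sums of \<open>Suc (N i)\<close> serve as \<open>r\<close> because they increase strictly and stay
  above \<open>N j\<close>.\<close>

lemma subsequence_power_bound:
 fixes d :: "nat => nat => real"
 assumes "!!e. e > 0 ==> EX N. ALL m>=N. ALL n>=N. d m n < e"
 obtains r where "strict_mono r" "!!j m n. m >= r j ==> n >= r j ==> d m n < (1/2) ^ j"
proof -
 have "ALL j. EX N. ALL m>=N. ALL n>=N. d m n < (1/2) ^ j" using assms by simp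
 then obtain N where N: "!!j m n. m >= N j ==> n >= N j ==> d m n < (1/2) ^ j" by metis
 define r where "r j = (SUM i<=j. Suc (N i))" for j
 have "strict_mono r" by (rule strict_monoI_Suc) (simp add: r_def)
 moreover have "N j <= r j" for j
  unfolding r_def by (rule order_trans[OF _ member_le_sum[of j "{..j}" "%i. Suc (N i)"]]) auto
 ultimately show ?thesis using N that by (metis order_trans)
qed

text \<open>The limit is taken pointwise along a subsequence, so that it inherits measurability with
 respect to any sigma-algebra that makes a tail of the sequence measurable.\<close>

lemma (in prob_space) L2_complete:
 assumes Y: "!!n. Y n : L2 M"
  and Cauchy: "!!e. e > 0 ==> EX N. ALL m>=N. ALL n>=N. L2_norm M (%z. Y m z - Y n z) < e"
 obtains r where "strict_mono r" "(%z. lim (%j. Y (r j) z)) : L2 M"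
  "(%n. L2_norm M (%z. Y n z - lim (%j. Y (r j) z))) ----> 0"
proof -
 obtain r where r: "strict_mono r"
  and rd: "!!j m n. m >= r j ==> n >= r j ==> L2_norm M (%z. Y m z - Y n z) < (1/2) ^ j"
  using subsequence_power_bound[OF Cauchy] by blast
 note [measurable] = L2_measurable[OF Y]
 define L where "L z = lim (%j. Y (r j) z)" for z
 have Lm [measurable]: "L : borel_measurable M"
  unfolding L_def by (rule borel_measurable_lim_metric) measurable
 have step: "(\<integral>\<^sup>+z. ennreal \<bar>Y (r (Suc j)) z - Y (r j) z\<bar> \<partial>M) <= ennreal ((1/2) ^ j)" for j
 proof -
  have "(\<integral>\<^sup>+z. ennreal \<bar>Y (r (Suc j)) z - Y (r j) z\<bar> \<partial>M) = ennreal (LINT z|M. \<bar>Y (r (Suc j)) z - Y (r j) z\<bar>)"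
  by (rule nn_integral_eq_integral)
  (intro integrable_abs L2_int L2_diff Y, simp)
  also have "... <= ennreal ((1/2) ^ j)"
  proof (rule ennreal_leI)
  have "(LINT z|M. \<bar>Y (r (Suc j)) z - Y (r j) z\<bar>) <= L2_norm M (%z. Y (r (Suc j)) z - Y (r j) z)"
  by (rule expectation_abs_le_L2_norm) (intro L2_diff Y)
  also have "... <= (1/2) ^ j"
  by (rule less_imp_le, rule rd) (use strict_monoD[OF r, of j "Suc j"] in auto)
  finally show "(LINT z|M. \<bar>Y (r (Suc j)) z - Y (r j) z\<bar>) <= (1/2) ^ j" .
  qed
  finally show ?thesis .
 qed
 have "(\<integral>\<^sup>+z. (\<Sum>j. ennreal \<bar>Y (r (Suc j)) z - Y (r j) z\<bar>) \<partial>M)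
  = (\<Sum>j. \<integral>\<^sup>+z. ennreal \<bar>Y (r (Suc j)) z - Y (r j) z\<bar> \<partial>M)"
  by (rule nn_integral_suminf) measurable
 also have "... <= (\<Sum>j. ennreal ((1/2) ^ j))" by (intro suminf_le step) auto
 also have "... < \<infinity>" by (subst suminf_ennreal2) (auto simp: summable_geometric)
 finally have "(\<integral>\<^sup>+z. (\<Sum>j. ennreal \<bar>Y (r (Suc j)) z - Y (r j) z\<bar>) \<partial>M) ~= \<infinity>" by simp
 \<comment> \<open>A finite expected sum of increments forces almost sure absolute convergence of
   the telescoping series.\<close>
 then have "AE z in M. (\<Sum>j. ennreal \<bar>Y (r (Suc j)) z - Y (r j) z\<bar>) ~= \<infinity>"
  by (intro nn_integral_PInf_AE) auto
 then have conv: "AE z in M. (%j. Y (r j) z) ----> L z"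
 proof eventually_elim
  case (elim z)
  have "summable (%j. \<bar>Y (r (Suc j)) z - Y (r j) z\<bar>)"
  by (rule summable_suminf_not_top) (use elim in auto)
  then have "summable (%j. Y (r (Suc j)) z - Y (r j) z)" by (rule summable_rabs_cancel)
  then have "convergent (%j. Y (r j) z - Y (r 0) z)"
  using sum_lessThan_telescope[of "%j. Y (r j) z"] by (simp add: summable_iff_convergent)
  then have "convergent (%j. Y (r j) z)" by (simp add: convergent_diff_const_right_iff)
  then show ?case unfolding L_def by (simp add: convergent_LIMSEQ_iff)
 qed
 \<comment> \<open>Fatou's lemma along the subsequence transfers the Cauchy bound to the distance
   from the limit and yields square integrability of that distance at the same time.\<close>
 have fatou: "(\<integral>\<^sup>+z. ennreal ((Y n z - L z)\<^sup>2) \<partial>M) <= ennreal (((1/2) ^ i)\<^sup>2)" if n: "n >= r i" for n i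
 proof -
  have "(\<integral>\<^sup>+z. ennreal ((Y n z - L z)\<^sup>2) \<partial>M) = (\<integral>\<^sup>+z. liminf (%j. ennreal ((Y n z - Y (r j) z)\<^sup>2)) \<partial>M)"
  proof (rule nn_integral_cong_AE)
  show "AE z in M. ennreal ((Y n z - L z)\<^sup>2) = liminf (%j. ennreal ((Y n z - Y (r j) z)\<^sup>2))"
  using conv
  proof eventually_elim
  case (elim z)
  then have "(%j. ennreal ((Y n z - Y (r j) z)\<^sup>2)) ----> ennreal ((Y n z - L z)\<^sup>2)"
  by (intro tendsto_intros)
  from lim_imp_Liminf[OF trivial_limit_sequentially this] show ?case by simp
  qed
  qed
  also have "... <= liminf (%j. \<integral>\<^sup>+z. ennreal ((Y n z - Y (r j) z)\<^sup>2) \<partial>M)"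
  by (rule nn_integral_liminf) measurable
  also have "... <= ennreal (((1/2) ^ i)\<^sup>2)"
  proof (rule Liminf_le)
  show "\<forall>\<^sub>F j in sequentially. (\<integral>\<^sup>+z. ennreal ((Y n z - Y (r j) z)\<^sup>2) \<partial>M) <= ennreal (((1/2) ^ i)\<^sup>2)"
  using eventually_ge_at_top[of i]
  proof eventually_elim
  case (elim j)
  have "(\<integral>\<^sup>+z. ennreal ((Y n z - Y (r j) z)\<^sup>2) \<partial>M) = ennreal (LINT z|M. (Y n z - Y (r j) z)\<^sup>2)"
  by (rule nn_integral_eq_integral) (auto intro!: L2_integrable_sq L2_diff Y)
  also have "... = ennreal ((L2_norm M (%z. Y n z - Y (r j) z))\<^sup>2)" by (simp add: L2_norm_power2)
  also have "... <= ennreal (((1/2) ^ i)\<^sup>2)"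
  by (intro ennreal_leI power_mono, rule less_imp_le, rule rd)
  (use n elim strict_mono_less_eq[OF r, of i j] in auto)
  finally show ?case .
  qed
  qed simp
  finally show ?thesis .
 qed
 have diff: "(%z. Y n z - L z) : L2 M" if "n >= r 0" for n
  unfolding L2_def using fatou[OF that]
  by (auto intro!: integrableI_bounded simp: le_less_trans)
 from L2_diff[OF Y[of "r 0"] diff[of "r 0"]] have L: "L : L2 M" by simp
 have rate: "L2_norm M (%z. Y n z - L z) <= (1/2) ^ i" if "n >= r i" for n i
 proof (rule power2_le_imp_le)
  have "ennreal ((L2_norm M (%z. Y n z - L z))\<^sup>2) = (\<integral>\<^sup>+z. ennreal ((Y n z - L z)\<^sup>2) \<partial>M)"
  unfolding L2_norm_power2
  by (rule nn_integral_eq_integral[symmetric]) (auto intro!: L2_integrable_sq L2_diff Y L)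
  also have "... <= ennreal (((1/2) ^ i)\<^sup>2)" by (rule fatou[OF that])
  finally show "(L2_norm M (%z. Y n z - L z))\<^sup>2 <= ((1/2) ^ i)\<^sup>2" by simp
 qed simp
 have "(%n. L2_norm M (%z. Y n z - L z)) ----> 0"
 proof (intro LIMSEQ_I)
  fix e :: real assume "e > 0"
  then obtain i where "(1/2) ^ i < e" using real_arch_pow_inv[of e "1/2"] by auto
  then show "EX no. ALL n>=no. norm (L2_norm M (%z. Y n z - L z) - 0) < e"
  using rate by (intro exI[of _ "r i"]) (auto intro: le_less_trans)
 qed
 with r L show ?thesis using that unfolding L_def by blast
qed

section \<open>The shift and its filtration\<close>

locale stationary_filtration = prob_space M for M :: "'w measure" +
 fixes T :: "'w => 'w" and F0 :: "'w measure"
 assumes T_invertible: "invertible_measure_preserving M T"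
  and F0_subalgebra: "subalgebra M F0"
  and F0_increasing: "sets F0 \<subseteq> sets (vimage_algebra (space M) T F0)"
begin

abbreviation nrm :: "('w => real) => real" where "nrm \<equiv> L2_norm M"

abbreviation "sh \<equiv> iterate M T"
abbreviation "Fi \<equiv> filt M T F0"
abbreviation "CE j \<equiv> real_cond_exp M (Fi j)"

section \<open>Integer iterates of the shift and invariance of integrals\<close>

lemma T_bij: "bij_betw T (space M) (space M)"
 and T_measurable: "T : measurable M M"
 and inv_T_measurable: "inv_into (space M) T : measurable M M"
 and distr_T: "distr M M T = M"
 using T_invertible by (auto simp: invertible_measure_preserving_def)

lemma funpow_measurable: "f : measurable M M ==> f ^^ n : measurable M M"
 proof (induction n)
 case (Suc n)
 then show ?case using measurable_comp[of "f ^^ n" M M f M] by simp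
qed (simp add: id_def)

lemma sh_measurable [measurable]: "sh i : measurable M M"
 unfolding iterate_def by (auto intro!: funpow_measurable T_measurable inv_T_measurable)

lemma sh_in_space: "z : space M ==> sh i z : space M"
 using measurable_space[OF sh_measurable] .

lemma sh_0 [simp]: "sh 0 = (%z. z)"
 by (simp add: iterate_def id_def)

lemma sh_1 [simp]: "sh 1 = T"
 by (simp add: iterate_def)

lemma sh_plus_1: assumes "z : space M" shows "sh (i + 1) z = T (sh i z)"
proof (cases "i >= 0")
 case True
 then show ?thesis by (simp add: iterate_def nat_add_distrib)
next
 case False
 then obtain m where m: "nat (- i) = Suc m" by (cases "nat (- i)") auto
 let ?S = "inv_into (space M) T"
 have sp: "(?S ^^ m) z : space M"
  using measurable_space[OF funpow_measurable[OF inv_T_measurable]] assms by blast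
 have "T (sh i z) = (?S ^^ m) z"
  using False m sp bij_betw_inv_into_right[OF T_bij] by (simp add: iterate_def)
 moreover have "sh (i + 1) z = (?S ^^ m) z"
  using False m by (cases "i = -1") (auto simp: iterate_def nat_diff_distrib' intro!: arg_cong2[where f = "%n. (?S ^^ n)"] fun_cong[of _ _ z])
 ultimately show ?thesis by simp
qed

lemma sh_minus_1: assumes "z : space M" shows "sh (i - 1) z = inv_into (space M) T (sh i z)"
 using sh_plus_1[OF assms, of "i - 1"] bij_betw_inv_into_left[OF T_bij sh_in_space[OF assms]] by simp

lemma sh_add: assumes "z : space M" shows "sh (i + j) z = sh i (sh j z)"
proof (induction i rule: int_induct[where k = 0])
 case (step1 i)
 then show ?case using sh_plus_1[OF assms, of "i + j"] sh_plus_1[OF sh_in_space[OF assms], of i j]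
  by (simp add: algebra_simps)
next
 case (step2 i)
 then show ?case using sh_minus_1[OF assms, of "i + j"] sh_minus_1[OF sh_in_space[OF assms], of i j]
  by (simp add: algebra_simps)
qed simp

lemma distr_sh: "distr M M (sh i) = M"
proof (induction i rule: int_induct[where k = 0])
 case base
 show ?case by (simp add: distr_id2)
next
 case (step1 i)
 have "distr M M (sh (i + 1)) = distr M M (T \<circ> sh i)"
  by (rule distr_cong) (auto simp: sh_plus_1)
 also have "... = distr (distr M M (sh i)) M T"
  by (rule distr_distr[symmetric]) (auto intro: T_measurable)
 finally show ?case using step1 distr_T by simp
next
 case (step2 i)
 let ?S = "inv_into (space M) T"
 have "distr M M (sh (i - 1)) = distr M M (?S \<circ> sh i)"
  by (rule distr_cong) (auto simp: sh_minus_1)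
 also have "... = distr (distr M M (sh i)) M ?S"
  by (rule distr_distr[symmetric]) (auto intro: inv_T_measurable)
 also have "... = distr (distr M M T) M ?S" using step2 distr_T by simp
 also have "... = distr M M (?S \<circ> T)"
  by (rule distr_distr) (auto intro: inv_T_measurable T_measurable)
 also have "... = distr M M (%x. x)"
  by (rule distr_cong) (auto simp: bij_betw_inv_into_left[OF T_bij])
 finally show ?case by (simp add: distr_id2)
qed

lemma integral_sh:
 fixes f :: "'w => 'b::{banach, second_countable_topology}"
 assumes "f : borel_measurable M"
 shows "(LINT z|M. f (sh i z)) = (LINT z|M. f z)"
 using integral_distr[OF sh_measurable assms, of i] by (simp add: distr_sh)

lemma integrable_sh:
 fixes f :: "'w => 'b::{banach, second_countable_topology}"
 assumes "integrable M f"
 shows "integrable M (%z. f (sh i z))"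
 using integrable_distr[OF sh_measurable, of i f] assms by (simp add: distr_sh)


lemma L2_sh: "f : L2 M ==> (%z. f (sh i z)) : L2 M"
 using integrable_sh[of "%z. (f z)\<^sup>2" i] measurable_compose[OF sh_measurable, of f borel i] by (simp add: L2_def)

lemma L2_norm_sh:
 assumes "f : borel_measurable M"
 shows "nrm (%z. f (sh i z)) = nrm f"
 using integral_sh[of "%z. (f z)\<^sup>2" i] assms by (simp add: L2_norm_def)

section \<open>The shifted filtration and its conditional expectations\<close>

lemma space_F0: "space F0 = space M"
 using F0_subalgebra by (simp add: subalgebra_def)

lemma space_Fi [simp]: "space (Fi i) = space M"
 by (simp add: filt_def)

lemma sets_Fi: "sets (Fi i) = {sh i -` A \<inter> space M | A. A : sets F0}"
 unfolding filt_def by (rule sets_vimage_algebra2) (simp add: space_F0 sh_in_space)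


lemma Fi_subalgebra: "subalgebra M (Fi i)"
 unfolding subalgebra_def
proof (intro conjI subsetI)
 fix A assume "A : sets (Fi i)"
 then obtain B where "B : sets F0" "A = sh i -` B \<inter> space M" unfolding sets_Fi by blast
 moreover from this have "B : sets M" using F0_subalgebra unfolding subalgebra_def by blast
 ultimately show "A : sets M" using measurable_sets[OF sh_measurable] by metis
qed simp

lemma Fi_step: "sets (Fi i) \<subseteq> sets (Fi (i + 1))"
proof
 fix A assume "A : sets (Fi i)"
 then obtain B where B: "B : sets F0" "A = sh i -` B \<inter> space M" by (auto simp: sets_Fi)
 then have "B : sets (Fi 1)" using F0_increasing by (auto simp: filt_def)
 then obtain C where C: "C : sets F0" "B = T -` C \<inter> space M" by (auto simp: sets_Fi)
 have "A = sh (i + 1) -` C \<inter> space M" using B C by (auto simp: sh_plus_1 sh_in_space)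
 with C show "A : sets (Fi (i + 1))" by (auto simp: sets_Fi)
qed

lemma Fi_mono: "i <= j ==> sets (Fi i) \<subseteq> sets (Fi j)"
 by (induction j rule: int_ge_induct) (use Fi_step in auto)

lemma Fi_subalgebra_mono: "i <= j ==> subalgebra (Fi j) (Fi i)"
 using Fi_mono by (simp add: subalgebra_def)

lemma measurable_Fi_mono: "f : measurable (Fi i) N ==> i <= j ==> f : measurable (Fi j) N"
 using measurable_from_subalg[OF Fi_subalgebra_mono] .

lemma measurable_Fi: "f : measurable (Fi i) N ==> f : measurable M N"
 using measurable_from_subalg[OF Fi_subalgebra] .

lemma sh_measurable_Fi: "sh i : measurable (Fi (j + i)) (Fi j)"
proof (rule measurableI)
 fix A assume "A : sets (Fi j)"
 then obtain B where B: "B : sets F0" "A = sh j -` B \<inter> space M" by (auto simp: sets_Fi)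
 then have "sh i -` A \<inter> space M = sh (j + i) -` B \<inter> space M" by (auto simp: sh_add sh_in_space)
 then show "sh i -` A \<inter> space (Fi (j + i)) : sets (Fi (j + i))" using B by (auto simp: sets_Fi)
qed (auto simp: sh_in_space)

lemma measurable_sh: "f : measurable (Fi j) N ==> (%z. f (sh i z)) : measurable (Fi (j + i)) N"
 using measurable_compose[OF sh_measurable_Fi] .

lemma Fi_sigma_finite: "sigma_finite_subalgebra M (Fi i)"
 using Fi_subalgebra
 by (intro finite_measure_subalgebra_is_sigma_finite finite_measure_subalgebra.intro finite_measure_axioms finite_measure_subalgebra_axioms.intro)

lemma CE_measurable: "CE j Z : borel_measurable (Fi j)" by simp

lemma CE_measurable_M [measurable]: "CE j Z : borel_measurable M"
 using measurable_Fi[OF CE_measurable] .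

text \<open>Conditional Jensen inequality for the square.\<close>

lemma CE_L2: assumes Z: "Z : L2 M" shows "CE j Z : L2 M" and "nrm (CE j Z) <= nrm Z"
proof -
 interpret S: sigma_finite_subalgebra M "Fi j" by (rule Fi_sigma_finite)
 have Zi: "integrable M Z" by (rule L2_int[OF Z])
 have cv: "convex_on UNIV (%x::real. x\<^sup>2)" by (rule convex_on_realI[where f' = "%x. 2 * x"]) (auto intro!: derivative_eq_intros)
 have i: "integrable M (%z. (CE j Z z)\<^sup>2)"
  by (rule S.integrable_convex_cond_exp[OF Zi, where I = UNIV and q = "%x. x\<^sup>2"])
  (use L2_integrable_sq[OF Z] cv in auto)
 then show L: "CE j Z : L2 M" by (simp add: L2_def)
 have "AE z in M. (CE j Z z)\<^sup>2 <= CE j (%z. (Z z)\<^sup>2) z"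
  by (rule S.real_cond_exp_jensens_inequality(2)[OF Zi, where I = UNIV])
  (use L2_integrable_sq[OF Z] cv in auto)
 then have "(LINT z|M. (CE j Z z)\<^sup>2) <= (LINT z|M. CE j (%z. (Z z)\<^sup>2) z)"
  by (intro integral_mono_AE i S.real_cond_exp_int L2_integrable_sq[OF Z])
 also have "... = (LINT z|M. (Z z)\<^sup>2)" by (intro S.real_cond_exp_int L2_integrable_sq[OF Z])
 finally show "nrm (CE j Z) <= nrm Z" by (simp add: L2_norm_def)
qed

lemma CE_orth:
 assumes "Z : L2 M" "g : L2 M" "g : borel_measurable (Fi j)"
 shows "(LINT z|M. g z * CE j Z z) = (LINT z|M. g z * Z z)"
proof -
 interpret S: sigma_finite_subalgebra M "Fi j" by (rule Fi_sigma_finite)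
 show ?thesis
  by (rule S.real_cond_exp_intg(2)) (use assms L2_integrable_mult in \<open>auto simp: L2_def\<close>)
qed

lemma CE_expectation:
 assumes "Z : L2 M"
 shows "(LINT z|M. CE j Z z) = (LINT z|M. Z z)"
 proof -
 interpret S: sigma_finite_subalgebra M "Fi j" by (rule Fi_sigma_finite)
 show ?thesis by (rule S.real_cond_exp_int(2)) (rule L2_int[OF assms])
qed

text \<open>The shift preserves the measure, and the sets of \<open>Fi (j + i)\<close> are exactly
  the preimages of those of \<open>Fi j\<close>; so integrals over the former become integrals over
  the latter, where the defining property of \<open>CE j Z\<close> applies.\<close>

lemma CE_sh:
 assumes Z: "integrable M Z"
 shows "AE z in M. CE (j + i) (%z. Z (sh i z)) z = CE j Z (sh i z)"
proof -
 interpret S: sigma_finite_subalgebra M "Fi (j + i)" by (rule Fi_sigma_finite)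
 interpret S': sigma_finite_subalgebra M "Fi j" by (rule Fi_sigma_finite)
 have [measurable]: "Z : borel_measurable M" using Z by simp
 show ?thesis
 proof (rule S.real_cond_exp_charact)
  fix A assume "A : sets (Fi (j + i))"
  then obtain B where B: "B : sets F0" "A = sh (j + i) -` B \<inter> space M" by (auto simp: sets_Fi)
  let ?C = "sh j -` B \<inter> space M"
  have C: "?C : sets (Fi j)" using B by (auto simp: sets_Fi)
  then have [measurable]: "?C : sets M" using Fi_subalgebra by (auto simp: subalgebra_def)
  have ind: "indicator A z = (indicator ?C (sh i z) :: real)" if "z : space M" for z
  using that B by (auto simp: indicator_def sh_add sh_in_space)
  have shift: "(\<integral>z\<in>A. f (sh i z) \<partial>M) = (\<integral>z\<in>?C. f z \<partial>M)" if [measurable]: "f : borel_measurable M" for f :: "'w => real"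
  proof -
  have "(\<integral>z\<in>A. f (sh i z) \<partial>M) = (LINT z|M. indicator ?C (sh i z) *\<^sub>R f (sh i z))"
  unfolding set_lebesgue_integral_def by (rule LINT_cong) (simp_all add: ind)
  also have "... = (\<integral>z\<in>?C. f z \<partial>M)"
  unfolding set_lebesgue_integral_def by (rule integral_sh[where f = "%z. indicator ?C z *\<^sub>R f z"]) measurable
  finally show ?thesis .
  qed
  show "(\<integral>z\<in>A. Z (sh i z) \<partial>M) = (\<integral>z\<in>A. CE j Z (sh i z) \<partial>M)"
  using S'.real_cond_exp_intA[OF Z C] by (simp add: shift)
 qed (auto intro!: integrable_sh Z S'.real_cond_exp_int measurable_sh)
qed

lemma CE_mult_nested:
 assumes Z: "Z : L2 M" and "j <= k"
 shows "(LINT z|M. CE j Z z * CE k Z z) = (nrm (CE j Z))\<^sup>2"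
proof -
 have "(LINT z|M. CE j Z z * CE k Z z) = (LINT z|M. CE j Z z * Z z)"
  by (intro CE_orth Z CE_L2 measurable_Fi_mono[OF _ \<open>j <= k\<close>]) simp
 also have "... = (LINT z|M. CE j Z z * CE j Z z)" by (intro CE_orth[symmetric] Z CE_L2) simp
 finally show ?thesis unfolding L2_norm_power2 by (simp add: power2_eq_square)
qed

text \<open>Pythagoras for nested projections. The absolute value covers both orders of
  \<open>j\<close> and \<open>k\<close>, so that increasing and decreasing index sequences can be
  treated together.\<close>

lemma CE_diff_norm:
 assumes Z: "Z : L2 M"
 shows "(nrm (%z. CE j Z z - CE k Z z))\<^sup>2 = \<bar>(nrm (CE j Z))\<^sup>2 - (nrm (CE k Z))\<^sup>2\<bar>"
proof -
 have *: "(nrm (%z. CE k Z z - CE j Z z))\<^sup>2 = (nrm (CE k Z))\<^sup>2 - (nrm (CE j Z))\<^sup>2"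
  if "j <= k" for j k
 proof -
  note [simp] = L2_integrable_sq[OF CE_L2(1)[OF Z]] L2_integrable_mult[OF CE_L2(1)[OF Z] CE_L2(1)[OF Z]]
  have "(nrm (%z. CE k Z z - CE j Z z))\<^sup>2
  = (LINT z|M. ((CE k Z z)\<^sup>2 + (CE j Z z)\<^sup>2) - 2 * (CE j Z z * CE k Z z))"
  by (simp add: L2_norm_power2 power2_diff mult_ac)
  also have "... = (nrm (CE k Z))\<^sup>2 + (nrm (CE j Z))\<^sup>2 - 2 * (nrm (CE j Z))\<^sup>2"
  by (simp add: CE_mult_nested[OF Z that] L2_norm_power2)
  finally show ?thesis by simp
 qed
 have "0 <= (nrm (%z. CE j Z z - CE k Z z))\<^sup>2" by simp
 with *[of j k] *[of k j] show ?thesis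
  by (cases "j <= k") (auto simp: L2_norm_minus_commute[of M "CE j Z"])
qed

section \<open>L2 limits of conditional expectations at both ends of the filtration\<close>

lemma CE_norm_mono:
 assumes Z: "Z : L2 M" and "j <= k"
 shows "(nrm (CE j Z))\<^sup>2 <= (nrm (CE k Z))\<^sup>2"
proof -
 have "(nrm (CE j Z))\<^sup>2 <= nrm (CE j Z) * nrm (CE k Z)"
  using CE_mult_nested[OF assms] L2_Cauchy_Schwarz[OF CE_L2(1)[OF Z] CE_L2(1)[OF Z], of j k] by simp
 then have "nrm (CE j Z) <= nrm (CE k Z)"
  using L2_norm_nonneg[of M "CE j Z"] L2_norm_nonneg[of M "CE k Z"]
  by (cases "nrm (CE j Z) = 0") (auto simp: power2_eq_square)
 then show ?thesis by (simp add: power_mono)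
qed

text \<open>L2 martingale convergence, forward and backward at once: the squared norms are monotone
  and bounded, hence Cauchy, and \<open>CE_diff_norm\<close> turns this into the Cauchy property of
  the sequence itself.\<close>

lemma CE_L2_limit:
 fixes s :: "nat => int"
 assumes Z: "Z : L2 M" and s: "(ALL m. ALL n>=m. s m <= s n) \<or> (ALL m. ALL n>=m. s n <= s m)"
 obtains r where "strict_mono r" "(%z. lim (%j. CE (s (r j)) Z z)) : L2 M"
  "(%n. nrm (%z. CE (s n) Z z - lim (%j. CE (s (r j)) Z z))) ----> 0"
proof -
 let ?a = "%n. (nrm (CE (s n) Z))\<^sup>2"
 have "monoseq ?a"
  using s unfolding monoseq_def by (auto intro: CE_norm_mono[OF Z] simp del: power_mono_iff)
 moreover have "Bseq ?a"
  using CE_L2(2)[OF Z] by (intro BseqI'[where K = "(nrm Z)\<^sup>2"]) (auto intro!: power_mono)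
 ultimately have "Cauchy ?a" using Bseq_monoseq_convergent convergent_Cauchy by blast
 have "EX N. ALL m>=N. ALL n>=N. nrm (%z. CE (s m) Z z - CE (s n) Z z) < e" if "e > 0" for e
 proof -
  obtain N where N: "ALL m>=N. ALL n>=N. \<bar>?a m - ?a n\<bar> < e\<^sup>2"
  using CauchyD[OF \<open>Cauchy ?a\<close>, of "e\<^sup>2"] \<open>e > 0\<close> unfolding real_norm_def by (metis zero_less_power)
  then have "nrm (%z. CE (s m) Z z - CE (s n) Z z) < e" if "m >= N" "n >= N" for m n
  using that \<open>e > 0\<close> by (intro power2_less_imp_less[of _ e]) (auto simp: CE_diff_norm[OF Z])
  then show ?thesis by blast
 qed
 from L2_complete[of "%n. CE (s n) Z", OF CE_L2(1)[OF Z] this] show ?thesis using that by blast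
qed

text \<open>The limit is measurable with respect to the trivial sigma-algebra, hence constant.\<close>

lemma CE_backward_limit:
 assumes trivial: "filt_minus_infinity_trivial M T F0" and Z: "Z : L2 M"
 shows "(%n. nrm (%z. CE (- int n) Z z - (LINT z|M. Z z))) ----> 0"
proof -
 have "(ALL m. ALL n>=m. - int m <= - int n) \<or> (ALL m. ALL n>=m. - int n <= - int m)" by simp
 from CE_L2_limit[OF Z this] obtain r where r: "strict_mono r"
  and L0: "(%z. lim (%j. CE (- int (r j)) Z z)) : L2 M"
  and lim0: "(%n. nrm (%z. CE (- int n) Z z - lim (%j. CE (- int (r j)) Z z))) ----> 0"
  by blast
 define Y where "Y z = lim (%j. CE (- int (r j)) Z z)" for z
 have YL: "Y : L2 M" using L0 by (simp add: Y_def[abs_def])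
 \<comment> \<open>Dropping the first \<open>?m\<close> terms does not change the pointwise limit,
   and all remaining terms are measurable for \<open>Fi i\<close>.\<close>
 have Yi: "Y : borel_measurable (Fi i)" for i
 proof -
  let ?m = "nat (- i)"
  have "Y = (%z. lim (%j. CE (- int (r (j + ?m))) Z z))"
  proof
  fix z
  have "((%j. CE (- int (r j)) Z z) ----> l) = ((%j. CE (- int (r (j + ?m))) Z z) ----> l)" for l
  proof
  assume "(%j. CE (- int (r j)) Z z) ----> l"
  then show "(%j. CE (- int (r (j + ?m))) Z z) ----> l" by (rule LIMSEQ_ignore_initial_segment)
  next
  assume "(%j. CE (- int (r (j + ?m))) Z z) ----> l"
  then show "(%j. CE (- int (r j)) Z z) ----> l" by (rule LIMSEQ_offset)
  qed
  then show "Y z = lim (%j. CE (- int (r (j + ?m))) Z z)" unfolding Y_def lim_def by simp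
  qed
  moreover have "CE (- int (r (j + ?m))) Z : borel_measurable (Fi i)" for j
  proof (rule measurable_Fi_mono[OF CE_measurable])
  show "- int (r (j + ?m)) <= i" using seq_suble[OF r, of "j + ?m"] by linarith
  qed
  ultimately show ?thesis by (simp add: borel_measurable_lim_metric)
 qed
 have prob01: "measure M {z : space M. Y z <= a} = 0 \<or> measure M {z : space M. Y z <= a} = 1" for a
 proof -
  have "{z : space M. Y z <= a} : sets (Fi i)" for i
  using Yi[of i, unfolded borel_measurable_iff_le] by simp
  then show ?thesis using trivial by (auto simp: filt_minus_infinity_trivial_def)
 qed
 note [measurable] = L2_measurable[OF YL] L2_measurable[OF Z]
 define c where "c = (LINT z|M. Y z)"
 have Yint: "integrable M Y" by (rule L2_int[OF YL])
 have "AE z in M. Y z = c"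
 proof -
  let ?P = "%a. measure M {z : space M. Y z <= a}"
  \<comment> \<open>A distribution function with values 0 and 1 only has to jump at the mean:
    otherwise \<open>Y\<close> would lie almost surely above a number larger than its mean, or below
    a smaller one.\<close>
  have up: "AE z in M. Y z <= a" if "a > c" for a
  proof (rule ccontr)
  assume "\<not> (AE z in M. Y z <= a)"
  then have "?P a ~= 1" using prob_eq_1[of "{z : space M. Y z <= a}"] by auto
  then have "?P a = 0" using prob01 by blast
  then have "AE z in M. \<not> Y z <= a" using prob_eq_0[of "{z : space M. Y z <= a}"] by auto
  then have "AE z in M. a <= Y z" by eventually_elim simp
  then have "(LINT z|M. a) <= (LINT z|M. Y z)" by (intro integral_mono_AE Yint) auto
  then show False using that by (simp add: c_def prob_space)
  qed
  have lo: "AE z in M. a <= Y z" if "a < c" for a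
  proof (cases "?P a = 1")
  case True
  then have "AE z in M. Y z <= a" using prob_eq_1[of "{z : space M. Y z <= a}"] by auto
  then have "(LINT z|M. Y z) <= (LINT z|M. a)" by (intro integral_mono_AE Yint) auto
  then show ?thesis using that by (simp add: c_def prob_space)
  next
  case False
  then have "?P a = 0" using prob01 by blast
  then have "AE z in M. \<not> Y z <= a" using prob_eq_0[of "{z : space M. Y z <= a}"] by auto
  then show ?thesis by eventually_elim simp
  qed
  have "AE z in M. ALL n::nat. Y z <= c + 1 / Suc n \<and> c - 1 / Suc n <= Y z"
  unfolding AE_all_countable by (intro allI AE_conjI up lo) auto
  then show ?thesis
  proof eventually_elim
  case (elim z)
  have "(%n. c + 1 / real (Suc n)) ----> c + 0" "(%n. c - 1 / real (Suc n)) ----> c - 0"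
  by (intro tendsto_intros LIMSEQ_inverse_real_of_nat[unfolded inverse_eq_divide])+
  then have "Y z <= c + 0" "c - 0 <= Y z"
  using elim by (auto intro: LIMSEQ_le_const LIMSEQ_le_const2)
  then show ?case by simp
  qed
 qed
 then have lim1: "(%n. nrm (%z. CE (- int n) Z z - c)) ----> 0"
 proof -
  have "nrm (%z. CE (- int n) Z z - Y z) = nrm (%z. CE (- int n) Z z - c)" for n
  using \<open>AE z in M. Y z = c\<close> by (intro L2_norm_cong_AE) auto
  then show ?thesis using lim0 by (simp add: Y_def)
 qed
 have cL: "(%_. c) : L2 M" by (rule L2_const_bound[OF finite_measure_axioms, of _ "\<bar>c\<bar>"]) auto
 \<comment> \<open>Conditioning preserves the mean of \<open>Z\<close>, and L2 convergence carries
   means to the limit, so the constant \<open>c\<close> is that mean.\<close>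
 have "\<bar>(LINT z|M. Z z) - c\<bar> <= nrm (%z. CE (- int n) Z z - c)" for n
 proof -
  have "(LINT z|M. Z z) - c = (LINT z|M. CE (- int n) Z z - c)"
  using L2_int[OF CE_L2(1)[OF Z]] by (simp add: CE_expectation[OF Z] prob_space)
  then have "\<bar>(LINT z|M. Z z) - c\<bar> <= (LINT z|M. \<bar>CE (- int n) Z z - c\<bar>)" by simp
  also have "... <= nrm (%z. CE (- int n) Z z - c)"
  by (intro expectation_abs_le_L2_norm L2_diff CE_L2 Z cL)
  finally show ?thesis .
 qed
 then have "\<bar>(LINT z|M. Z z) - c\<bar> <= 0" by (intro LIMSEQ_le_const[OF lim1]) auto
 with lim1 show ?thesis by simp
qed

lemma Union_Fi_Pow: "(UN i. sets (Fi i)) \<subseteq> Pow (space M)"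
proof
 fix A assume "A : (UN i. sets (Fi i))"
 then obtain i where "A : sets (Fi i)" by blast
 from sets.sets_into_space[OF this] show "A : Pow (space M)" by simp
qed

lemma space_filt_infinity [simp]: "space (filt_infinity M T F0) = space M"
 unfolding filt_infinity_def by (rule space_measure_of) (rule Union_Fi_Pow)

lemma sets_filt_infinity: "sets (filt_infinity M T F0) = sigma_sets (space M) (UN i. sets (Fi i))"
 unfolding filt_infinity_def by (rule sets_measure_of) (rule Union_Fi_Pow)

lemma filt_infinity_subalgebra: "subalgebra M (filt_infinity M T F0)"
proof -
 have "(UN i. sets (Fi i)) \<subseteq> sets M" using Fi_subalgebra by (auto simp: subalgebra_def)
 then have "sigma_sets (space M) (UN i. sets (Fi i)) \<subseteq> sets M" by (rule sets.sigma_sets_subset)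
 then show ?thesis by (simp add: subalgebra_def sets_filt_infinity)
qed

lemma Fi_sub_infinity: "subalgebra (filt_infinity M T F0) (Fi i)"
proof -
 have "sets (Fi i) \<subseteq> sigma_sets (space M) (UN i. sets (Fi i))"
  by (meson UN_upper UNIV_I sigma_sets.Basic subset_iff)
 then show ?thesis by (simp add: subalgebra_def sets_filt_infinity)
qed

text \<open>The L2 limit \<open>Y\<close> and \<open>Z\<close> have equal integrals over every set
  of every \<open>Fi i\<close>. These sets are stable under intersection and generate
  \<open>filt_infinity\<close>, so both are versions of the conditional expectation of
  \<open>Z\<close> given that sigma-algebra.\<close>

lemma CE_forward_limit:
 assumes reg: "Z : borel_measurable (filt_infinity M T F0)" and Z: "Z : L2 M"
 shows "(%n. nrm (%z. CE (int n) Z z - Z z)) ----> 0"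
proof -
 let ?G = "filt_infinity M T F0"
 have "(ALL m. ALL n>=m. int m <= int n) \<or> (ALL m. ALL n>=m. int n <= int m)" by simp
 from CE_L2_limit[OF Z this] obtain r where r: "strict_mono r"
  and L0: "(%z. lim (%j. CE (int (r j)) Z z)) : L2 M"
  and lim0: "(%n. nrm (%z. CE (int n) Z z - lim (%j. CE (int (r j)) Z z))) ----> 0"
  by blast
 define Y where "Y z = lim (%j. CE (int (r j)) Z z)" for z
 have YL: "Y : L2 M" and limY: "(%n. nrm (%z. CE (int n) Z z - Y z)) ----> 0"
  using L0 lim0 by (simp_all add: Y_def[abs_def])
 have YG: "Y : borel_measurable ?G"
  unfolding Y_def
  by (rule borel_measurable_lim_metric) (rule measurable_from_subalg[OF Fi_sub_infinity CE_measurable])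
 note [measurable] = L2_measurable[OF YL] L2_measurable[OF Z]
 have Yint: "integrable M Y" and Zint: "integrable M Z"
  by (rule L2_int, fact)+
 have on_Fi: "(\<integral>z\<in>A. Z z \<partial>M) = (\<integral>z\<in>A. Y z \<partial>M)" if A: "A : sets (Fi i)" for A i
 proof -
  have [measurable]: "A : sets M" using A Fi_subalgebra by (auto simp: subalgebra_def)
  have AL: "indicator A : L2 M" by (rule L2_const_bound[OF finite_measure_axioms, of _ 1]) auto
  have "\<bar>(LINT z|M. indicator A z * (Z z - Y z))\<bar> <= nrm (indicator A) * nrm (%z. CE (int n) Z z - Y z)"
  if n: "n >= nat i" for n
  proof -
  have "indicator A : borel_measurable (Fi (int n))"
  using A Fi_mono[of i "int n"] n nat_le_iff[of i n] by (intro borel_measurable_indicator) auto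
  then have "(LINT z|M. indicator A z * Z z) = (LINT z|M. indicator A z * CE (int n) Z z)"
  by (intro CE_orth[symmetric] Z AL)
  then have "(LINT z|M. indicator A z * (Z z - Y z)) = (LINT z|M. indicator A z * (CE (int n) Z z - Y z))"
  using L2_integrable_mult[OF AL Z] L2_integrable_mult[OF AL YL] L2_integrable_mult[OF AL CE_L2(1)[OF Z]]
  by (simp add: right_diff_distrib)
  then show ?thesis using L2_Cauchy_Schwarz[OF AL L2_diff[OF CE_L2(1)[OF Z] YL]] by simp
  qed
  then have "\<bar>(LINT z|M. indicator A z * (Z z - Y z))\<bar> <= nrm (indicator A) * 0"
  by (intro LIMSEQ_le_const[OF tendsto_mult[OF tendsto_const limY]]) auto
  then have "(LINT z|M. indicator A z * (Z z - Y z)) = 0" by simp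
  then show ?thesis
  using L2_integrable_mult[OF AL Z] L2_integrable_mult[OF AL YL]
  by (simp add: set_lebesgue_integral_def right_diff_distrib)
 qed
 have stable: "Int_stable (UN i. sets (Fi i))"
  proof (rule Int_stableI)
  fix a b assume "a : (UN i. sets (Fi i))" "b : (UN i. sets (Fi i))"
  then obtain i j where "a : sets (Fi i)" "b : sets (Fi j)" by auto
  then have "a : sets (Fi (max i j))" "b : sets (Fi (max i j))"
  using Fi_mono[of i "max i j"] Fi_mono[of j "max i j"] by auto
  then show "a \<inter> b : (UN i. sets (Fi i))" by blast
  qed
  have pow: "(UN i. sets (Fi i)) \<subseteq> Pow (space M)" by (rule Union_Fi_Pow)
 have "(\<integral>z\<in>A. Z z \<partial>M) = (\<integral>z\<in>A. Y z \<partial>M)" if A: "A : sigma_sets (space M) (UN i. sets (Fi i))" for A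
  using stable pow A
 proof (induction rule: sigma_sets_induct_disjoint)
  case (basic A) then show ?case using on_Fi by auto
 next
  case empty then show ?case by (simp add: set_lebesgue_integral_def)
 next
  case (compl A)
  have whole: "(\<integral>z\<in>space M. Z z \<partial>M) = (\<integral>z\<in>space M. Y z \<partial>M)"
  by (rule on_Fi[of _ 0]) (use sets.top[of "Fi 0"] in simp)
  have [measurable]: "A : sets M"
  using compl(1) filt_infinity_subalgebra by (auto simp: subalgebra_def sets_filt_infinity)
  have split: "(\<integral>z\<in>space M - A. f z \<partial>M) = (\<integral>z\<in>space M. f z \<partial>M) - (\<integral>z\<in>A. f z \<partial>M)" if f: "integrable M f" for f :: "'w => real"
  proof -
  have "(\<integral>z\<in>space M. f z \<partial>M) = (\<integral>z\<in>(space M - A) \<union> A. f z \<partial>M)"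
  using sets.sets_into_space[OF \<open>A : sets M\<close>] by (simp add: Un_absorb2)
  also have "... = (\<integral>z\<in>space M - A. f z \<partial>M) + (\<integral>z\<in>A. f z \<partial>M)"
  using f integrable_mult_indicator[of "space M - A" M f] integrable_mult_indicator[of A M f]
  by (intro set_integral_Un) (auto simp: set_integrable_def)
  finally show ?thesis by simp
  qed
  show ?case using compl(2) whole by (simp add: split Zint Yint)
 next
  case (union A)
  have Am: "A i : sets M" for i
  using union(2) filt_infinity_subalgebra by (auto simp: subalgebra_def sets_filt_infinity)
  have split: "(\<integral>z\<in>(UN i. A i). f z \<partial>M) = (\<Sum>i. \<integral>z\<in>A i. f z \<partial>M)" if f: "integrable M f" for f :: "'w => real"
  using Am union(1) f
  by (intro lebesgue_integral_countable_add)
  (auto simp: disjoint_family_on_def set_integrable_def simp del: real_scaleR_def intro!: integrable_mult_indicator)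
  show ?case using union(3) by (simp add: split Zint Yint)
 qed
 then have "(\<integral>z\<in>A. Z z \<partial>M) = (\<integral>z\<in>A. Y z \<partial>M)" if "A : sets ?G" for A
  using that by (simp add: sets_filt_infinity)
 moreover have "sigma_finite_subalgebra M ?G"
  using filt_infinity_subalgebra
  by (intro finite_measure_subalgebra_is_sigma_finite finite_measure_subalgebra.intro finite_measure_axioms finite_measure_subalgebra_axioms.intro)
 ultimately have "AE z in M. real_cond_exp M ?G Z z = Y z" "AE z in M. real_cond_exp M ?G Z z = Z z"
  by (auto intro!: sigma_finite_subalgebra.real_cond_exp_charact sigma_finite_subalgebra.real_cond_exp_F_meas Zint Yint YG reg)
 then have "AE z in M. Y z = Z z" by eventually_elim simp
 then have "nrm (%z. CE (int n) Z z - Y z) = nrm (%z. CE (int n) Z z - Z z)" for n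
  by (intro L2_norm_cong_AE) auto
 then show ?thesis using limY by simp
qed

end

section \<open>Approximation by bounded moving averages of martingale differences\<close>

lemma null_comparison:
 fixes f g :: "'x => real"
 assumes "(g \<longlongrightarrow> 0) F" "!!n. \<bar>f n\<bar> <= g n"
 shows "(f \<longlongrightarrow> 0) F"
 by (rule Lim_null_comparison[OF _ assms(1)]) (simp add: assms(2))

text \<open>The symmetric intervals are cofinal among the finite sets of integers.\<close>

lemma has_sum_int_symmetric:
 fixes f :: "int => 'a::{comm_monoid_add, topological_space}"
 assumes "(f has_sum S) UNIV"
 shows "(%N. SUM k:{- int N..int N}. f k) ----> S"
proof -
 have "filterlim (%N. {- int N..int N}) (finite_subsets_at_top UNIV) sequentially"
  unfolding filterlim_finite_subsets_at_top
 proof (intro allI impI)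
  fix X :: "int set" assume "finite X \<and> X \<subseteq> UNIV"
  then have X: "finite X" by simp
  define N0 where "N0 = nat (Max (insert 0 (abs ` X)))"
  have "X \<subseteq> {- int N..int N}" if "N >= N0" for N
  proof
  fix k assume "k : X"
  then have "\<bar>k\<bar> <= Max (insert 0 (abs ` X))" using X by (intro Max_ge) auto
  also have "... <= int N" using that unfolding N0_def by linarith
  finally show "k : {- int N..int N}" by (simp add: abs_le_iff)
  qed
  then show "\<forall>\<^sub>F N in sequentially. finite {- int N..int N} \<and> X \<subseteq> {- int N..int N} \<and> {- int N..int N} \<subseteq> UNIV"
  unfolding eventually_sequentially by blast
 qed
 from filterlim_compose[OF assms[unfolded has_sum_def] this] show ?thesis .
qed

context stationary_filtration
begin

text \<open>The single function \<open>zt\<close> stands for the stationary sequence of its shifts.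
  That its conditional expectation given \<open>Fi (-1)\<close> vanishes is encoded as orthogonality
  to the past, which is the form used in the calculations and avoids equalities that hold only
  almost everywhere.\<close>

definition mdiff :: "('w => real) => bool" where
 "mdiff zt \<longleftrightarrow> zt : L2 M \<and> zt : borel_measurable (Fi 0) \<and>
  (ALL g. g : L2 M --> g : borel_measurable (Fi (-1)) --> (LINT z|M. zt z * g z) = 0)"

text \<open>Each lag \<open>k\<close> has its own difference sequence. With the projections of the
  errors for \<open>zt\<close>, the summand of lag \<open>k\<close> is the projection of the error
  at time \<open>i\<close> onto the innovation at time \<open>i - k\<close>.\<close>

definition ma :: "nat => (int => 'w => real) => int => 'w => real" where
 "ma m zt i z = (SUM k:{- int m..int m}. zt k (sh (i - k) z))"

lemma mdiff_L2: "mdiff zt ==> zt : L2 M"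
 by (simp add: mdiff_def)

section \<open>Norms of sums of martingale differences\<close>

lemma mdiff_orth:
 assumes "mdiff zt" "g : L2 M" "g : borel_measurable (Fi (s - 1))"
 shows "(LINT z|M. zt (sh s z) * g z) = 0"
proof -
 have [measurable]: "zt : borel_measurable M" "g : borel_measurable M"
  using assms by (auto simp: L2_def mdiff_def)
 have "(LINT z|M. zt (sh s z) * g z) = (LINT z|M. zt (sh s z) * g (sh (- s) (sh s z)))"
  by (rule LINT_cong) (simp_all add: sh_add[symmetric])
 also have "... = (LINT z|M. zt z * g (sh (- s) z))"
  by (rule integral_sh[where f = "%z. zt z * g (sh (- s) z)"]) measurable
 also have "... = 0"
  using assms L2_sh[OF assms(2), of "- s"] measurable_sh[OF assms(3), of "- s"]
  unfolding mdiff_def by simp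
 finally show ?thesis .
qed

lemma mdiff_pair_orth:
 assumes "mdiff zt" "mdiff et" "s ~= t"
 shows "(LINT z|M. zt (sh s z) * et (sh t z)) = 0"
proof -
 have *: "(LINT z|M. zt (sh s z) * et (sh t z)) = 0" if "mdiff zt" "mdiff et" "t < s" for zt et s t
 proof (rule mdiff_orth[OF that(1)])
  show "(%z. et (sh t z)) : L2 M" by (rule L2_sh[OF mdiff_L2[OF that(2)]])
  have "(%z. et (sh t z)) : borel_measurable (Fi (0 + t))"
  using that(2) unfolding mdiff_def by (blast intro: measurable_sh)
  then show "(%z. et (sh t z)) : borel_measurable (Fi (s - 1))"
  by (rule measurable_Fi_mono) (use that(3) in simp)
 qed
 show ?thesis
 proof (cases "t < s")
  case True then show ?thesis by (rule *[OF assms(1,2)])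
 next
  case False
  then have "s < t" using assms(3) by simp
  from *[OF assms(2,1) this] show ?thesis by (simp add: mult.commute)
 qed
qed

lemma mdiff_sum_norm:
 assumes zt: "mdiff zt" and I: "finite I"
 shows "(nrm (%z. SUM s:I. a s * zt (sh s z)))\<^sup>2 = (SUM s:I. (a s)\<^sup>2) * (nrm zt)\<^sup>2"
proof -
 have int: "integrable M (%z. zt (sh s z) * zt (sh t z))" for s t
  by (intro L2_integrable_mult L2_sh mdiff_L2 zt)
 have "(nrm (%z. SUM s:I. a s * zt (sh s z)))\<^sup>2
  = (LINT z|M. (SUM s:I. SUM t:I. (a s * a t) * (zt (sh s z) * zt (sh t z))))"
  unfolding L2_norm_power2 by (simp add: power2_eq_square sum_product mult_ac)
 also have "... = (SUM s:I. SUM t:I. (a s * a t) * (LINT z|M. zt (sh s z) * zt (sh t z)))"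
  by (simp add: int)
 also have "... = (SUM s:I. SUM t:I. if t = s then (a s)\<^sup>2 * (nrm zt)\<^sup>2 else 0)"
 proof (intro sum.cong refl)
  fix s t
  have "(LINT z|M. zt (sh s z) * zt (sh s z)) = (nrm zt)\<^sup>2"
  using L2_norm_power2[of M "%z. zt (sh s z)"] L2_norm_sh[OF L2_measurable[OF mdiff_L2[OF zt]], of s]
  by (simp add: power2_eq_square)
  then show "(a s * a t) * (LINT z|M. zt (sh s z) * zt (sh t z))
  = (if t = s then (a s)\<^sup>2 * (nrm zt)\<^sup>2 else 0)"
  using mdiff_pair_orth[OF zt zt, of s t] by (auto simp: power2_eq_square)
 qed
 also have "... = (SUM s:I. (a s)\<^sup>2) * (nrm zt)\<^sup>2"
  using I by (simp add: sum.delta' sum_distrib_right)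
 finally show ?thesis .
qed

lemma mdiff_shifted_sum_norm:
 assumes zt: "mdiff zt" and I: "finite I"
 shows "nrm (%z. SUM i:I. a i * zt (sh (i - k) z)) = sqrt (SUM i:I. (a i)\<^sup>2) * nrm zt"
proof -
 have inj: "inj_on (%i. i - k) I" by (auto simp: inj_on_def)
 have "(SUM i:I. a i * zt (sh (i - k) z)) = (SUM s:(%i. i - k) ` I. a (s + k) * zt (sh s z))" for z
  by (subst sum.reindex[OF inj]) simp
 moreover have "(SUM i:I. (a i)\<^sup>2) = (SUM s:(%i. i - k) ` I. (a (s + k))\<^sup>2)"
  by (subst sum.reindex[OF inj]) simp
 ultimately have "(nrm (%z. SUM i:I. a i * zt (sh (i - k) z)))\<^sup>2 = (SUM i:I. (a i)\<^sup>2) * (nrm zt)\<^sup>2"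
  using mdiff_sum_norm[OF zt, of "(%i. i - k) ` I" "%s. a (s + k)"] I by simp
 then have "sqrt ((nrm (%z. SUM i:I. a i * zt (sh (i - k) z)))\<^sup>2) = sqrt ((SUM i:I. (a i)\<^sup>2) * (nrm zt)\<^sup>2)"
  by simp
 then show ?thesis by (simp add: real_sqrt_mult)
qed

lemma ma_L2:
 assumes "!!k. zt k : L2 M"
 shows "ma m zt i : L2 M"
 unfolding ma_def[abs_def] by (intro L2_sum L2_sh assms)

lemma mdiff_diff:
 assumes "mdiff zt" "mdiff et"
 shows "mdiff (%z. zt z - et z)"
 unfolding mdiff_def
proof (intro conjI allI impI)
 show "(%z. zt z - et z) : L2 M" using assms by (intro L2_diff mdiff_L2)
 show "(%z. zt z - et z) : borel_measurable (Fi 0)"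
  using assms unfolding mdiff_def by (intro borel_measurable_diff) blast+
 fix g assume g: "g : L2 M" "g : borel_measurable (Fi (- 1))"
 have "integrable M (%z. zt z * g z)" "integrable M (%z. et z * g z)"
  using assms g by (auto intro!: L2_integrable_mult mdiff_L2)
 then show "(LINT z|M. (zt z - et z) * g z) = 0"
  using assms g unfolding mdiff_def by (simp add: left_diff_distrib)
qed

text \<open>Exact orthogonality within each lag, Minkowski's inequality across lags. The constant is
  therefore a partial sum of norms, the very quantity that Hannan's condition makes finite.\<close>

lemma ma_sum_norm:
 assumes zt: "!!k. mdiff (zt k)" and I: "finite I"
 shows "nrm (%z. SUM i:I. a i * ma m zt i z)
  <= (SUM k:{- int m..int m}. nrm (zt k)) * sqrt (SUM i:I. (a i)\<^sup>2)"
proof -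
 have "(SUM i:I. a i * ma m zt i z) = (SUM k:{- int m..int m}. SUM i:I. a i * zt k (sh (i - k) z))" for z
  unfolding ma_def sum_distrib_left by (rule sum.swap)
 then have "nrm (%z. SUM i:I. a i * ma m zt i z)
  = nrm (%z. SUM k:{- int m..int m}. SUM i:I. a i * zt k (sh (i - k) z))" by simp
 also have "... <= (SUM k:{- int m..int m}. nrm (%z. SUM i:I. a i * zt k (sh (i - k) z)))"
  by (intro L2_norm_sum_le L2_sum L2_cmult L2_sh mdiff_L2 zt)
 also have "... = (SUM k:{- int m..int m}. nrm (zt k)) * sqrt (SUM i:I. (a i)\<^sup>2)"
  by (simp add: mdiff_shifted_sum_norm[OF zt I] sum_distrib_left mult.commute)
 finally show ?thesis .
qed

lemma ma_diff: "ma m zt i z - ma m et i z = ma m (%k z. zt k z - et k z) i z"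
 by (simp add: ma_def sum_subtractf)

section \<open>Bounded approximation of martingale differences\<close>

definition trunc :: "real => real => real" where
 "trunc b x = max (- b) (min b x)"

lemma trunc_bound: "0 <= b ==> \<bar>trunc b x\<bar> <= b"
 by (auto simp: trunc_def)

lemma trunc_measurable [measurable]: "trunc b : borel_measurable borel"
 unfolding trunc_def[abs_def] by measurable

lemma trunc_diff_bound: "0 <= b ==> \<bar>x - trunc b x\<bar> <= \<bar>x\<bar>"
 by (auto simp: trunc_def min_def max_def)

lemma trunc_id: "\<bar>x\<bar> <= b ==> trunc b x = x"
 by (auto simp: trunc_def)

lemma trunc_L2_tendsto:
 assumes \<xi>: "\<xi> : L2 M"
 shows "(%n. nrm (%z. \<xi> z - trunc (real n) (\<xi> z))) ----> 0"
proof -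
 note [measurable] = L2_measurable[OF \<xi>]
 have "(%n. (LINT z|M. (\<xi> z - trunc (real n) (\<xi> z))\<^sup>2)) ----> (LINT z|M. 0)"
 proof (rule integral_dominated_convergence[where w = "%z. (\<xi> z)\<^sup>2"])
  show "AE z in M. (%n. (\<xi> z - trunc (real n) (\<xi> z))\<^sup>2) ----> 0"
  proof (rule AE_I2)
  fix z
  obtain N :: nat where "\<bar>\<xi> z\<bar> <= real N" using real_arch_simple by blast
  then have "(\<xi> z - trunc (real n) (\<xi> z))\<^sup>2 = 0" if "n >= N" for n
  using that trunc_id[of "\<xi> z" "real n"] by simp
  then show "(%n. (\<xi> z - trunc (real n) (\<xi> z))\<^sup>2) ----> 0"
  by (intro tendsto_eventually) (auto simp: eventually_sequentially)
  qed
  show "AE z in M. norm ((\<xi> z - trunc (real n) (\<xi> z))\<^sup>2) <= (\<xi> z)\<^sup>2" for n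
  proof (rule AE_I2)
  fix z
  show "norm ((\<xi> z - trunc (real n) (\<xi> z))\<^sup>2) <= (\<xi> z)\<^sup>2"
  using trunc_diff_bound[of "real n" "\<xi> z"] abs_le_square_iff[of "\<xi> z - trunc (real n) (\<xi> z)" "\<xi> z"] by simp
  qed
 qed (use L2_integrable_sq[OF \<xi>] in simp_all)
 then have "(%n. sqrt (LINT z|M. (\<xi> z - trunc (real n) (\<xi> z))\<^sup>2)) ----> sqrt (LINT z|M. 0)"
  by (rule tendsto_real_sqrt)
 then show ?thesis by (simp add: L2_norm_def)
qed

text \<open>Truncation destroys the martingale property; subtracting the conditional expectation of
  the truncated function given the past restores it.\<close>

lemma mdiff_truncation:
 assumes \<xi>: "mdiff \<xi>" and b: "0 <= b"
 obtains zt where "mdiff zt" "!!z. \<bar>zt z\<bar> <= 2 * b"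
  "nrm (%z. \<xi> z - zt z) <= 2 * nrm (%z. \<xi> z - trunc b (\<xi> z))"
proof -
 interpret S: sigma_finite_subalgebra M "Fi (-1)" by (rule Fi_sigma_finite)
 have [measurable]: "\<xi> : borel_measurable M" using mdiff_L2[OF \<xi>] by (rule L2_measurable)
 define t where "t z = trunc b (\<xi> z)" for z
 have tm [measurable]: "t : borel_measurable M" unfolding t_def by measurable
 have tb: "\<bar>t z\<bar> <= b" for z unfolding t_def by (rule trunc_bound[OF b])
 have t: "t : L2 M" using tb by (intro L2_const_bound[OF finite_measure_axioms tm])
 have t0: "t : borel_measurable (Fi 0)"
  unfolding t_def using \<xi> by (intro measurable_compose[OF _ trunc_measurable]) (simp add: mdiff_def)
 have ti: "integrable M t" by (rule L2_int[OF t])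
 let ?E = "CE (-1) t"
 \<comment> \<open>The conditional expectation is bounded by \<open>b\<close> only almost
   everywhere. The outer truncation makes the bound hold everywhere and changes nothing outside a
   null set.\<close>
 define zt where "zt z = t z - trunc b (?E z)" for z
 have "AE z in M. ?E z <= b" using tb by (intro S.real_cond_exp_le_c ti AE_I2) (simp add: abs_le_iff)
 moreover have "AE z in M. ?E z >= - b"
 proof (intro S.real_cond_exp_ge_c ti AE_I2)
  fix z show "- b <= t z" using tb[of z] by linarith
 qed
 ultimately have AE: "AE z in M. zt z = t z - ?E z"
  by eventually_elim (simp add: zt_def trunc_id abs_le_iff)
 have [measurable]: "zt : borel_measurable M" unfolding zt_def by measurable
 have ztb: "\<bar>zt z\<bar> <= 2 * b" for z
  using tb[of z] trunc_bound[OF b, of "?E z"] unfolding zt_def by linarith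
 have ztL: "zt : L2 M" using ztb by (intro L2_const_bound[OF finite_measure_axioms]) auto
 have "mdiff zt"
  unfolding mdiff_def
 proof (intro conjI allI impI ztL)
  have "?E : borel_measurable (Fi 0)" by (rule measurable_Fi_mono[OF CE_measurable]) simp
  then show "zt : borel_measurable (Fi 0)"
  unfolding zt_def using t0 by (intro borel_measurable_diff measurable_compose[OF _ trunc_measurable])
  fix g assume g: "g : L2 M" "g : borel_measurable (Fi (- 1))"
  have [measurable]: "g : borel_measurable M" by (rule L2_measurable[OF g(1)])
  have "(LINT z|M. zt z * g z) = (LINT z|M. g z * t z - g z * ?E z)"
  proof (rule integral_cong_AE)
  show "AE z in M. zt z * g z = g z * t z - g z * ?E z"
  using AE by eventually_elim (simp only: right_diff_distrib mult.commute)
  qed measurable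
  also have "... = (LINT z|M. g z * t z) - (LINT z|M. g z * ?E z)"
  by (intro LINT_diff L2_integrable_mult g t CE_L2)
  also have "... = 0" using CE_orth[OF t g] by simp
  finally show "(LINT z|M. zt z * g z) = 0" .
 qed
 moreover have "nrm (%z. \<xi> z - zt z) <= 2 * nrm (%z. \<xi> z - t z)"
 proof -
  let ?d = "nrm (%z. \<xi> z - t z)"
  have EL: "?E : L2 M" and \<xi>L: "\<xi> : L2 M" by (rule CE_L2[OF t], rule mdiff_L2[OF \<xi>])
  \<comment> \<open>As \<open>\<xi>\<close> is orthogonal to the past, \<open>t\<close> may be
    replaced by \<open>t - \<xi>\<close> in the scalar product with \<open>?E\<close>. So the
    correction is no larger than the truncation error, whence the factor 2.\<close>
  have "(nrm ?E)\<^sup>2 = (LINT z|M. ?E z * t z)"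
  using CE_orth[OF t EL CE_measurable] unfolding L2_norm_power2 by (simp add: power2_eq_square)
  also have "... = (LINT z|M. ?E z * (t z - \<xi> z))"
  proof -
  have "(LINT z|M. \<xi> z * ?E z) = 0" using \<xi> EL CE_measurable unfolding mdiff_def by blast
  then show ?thesis
  using L2_integrable_mult[OF EL t] L2_integrable_mult[OF EL \<xi>L] by (simp add: left_diff_distrib mult.commute)
  qed
  also have "... <= nrm ?E * ?d"
  using L2_Cauchy_Schwarz[OF EL L2_diff[OF t \<xi>L]] L2_norm_minus_commute[of M t \<xi>] by simp
  finally have "nrm ?E <= ?d"
  using L2_norm_nonneg[of M ?E] by (cases "nrm ?E = 0") (auto simp: power2_eq_square)
  have "nrm (%z. \<xi> z - zt z) = nrm (%z. (\<xi> z - t z) + ?E z)"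
  proof (rule L2_norm_cong_AE)
  show "AE z in M. \<xi> z - zt z = (\<xi> z - t z) + ?E z" using AE by eventually_elim simp
  qed measurable
  also have "... <= ?d + nrm ?E" by (intro L2_norm_add_le L2_diff \<xi>L t EL)
  finally show ?thesis using \<open>nrm ?E <= ?d\<close> by simp
 qed
 ultimately show ?thesis using that ztb unfolding t_def by blast
qed

end

locale hannan_process = stationary_filtration M T F0 for M :: "'w measure" and T F0 +
 fixes e0 :: "'w => real"
 assumes e0_L2: "e0 : L2 M"
  and centered: "(LINT z|M. e0 z) = 0"
  and trivial_past: "filt_minus_infinity_trivial M T F0"
  and regular: "e0 : borel_measurable (filt_infinity M T F0)"
  and hannan: "(%i. nrm (proj M T F0 0 (err M T e0 i))) summable_on (UNIV :: int set)"
begin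

abbreviation eps :: "int => 'w => real" where "eps i \<equiv> err M T e0 i"
abbreviation xi :: "int => 'w => real" where "xi k \<equiv> proj M T F0 0 (eps k)"
abbreviation gam :: "int => real" where "gam \<equiv> autocov M T e0"

section \<open>Projective decomposition of the errors\<close>

lemma eps_eq: "eps i = (%z. e0 (sh i z))"
 by (simp add: err_def comp_def)

lemma eps_L2: "eps i : L2 M"
 unfolding eps_eq by (rule L2_sh[OF e0_L2])

lemma eps_measurable [measurable]: "eps i : borel_measurable M"
 by (rule L2_measurable[OF eps_L2])

lemma eps_sh: "z : space M ==> eps i (sh j z) = eps (i + j) z"
 by (simp add: eps_eq sh_add)

lemma xi_eq: "xi k = (%z. CE 0 (eps k) z - CE (-1) (eps k) z)"
 by (simp add: proj_def fun_eq_iff)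

lemma xi_mdiff: "mdiff (xi k)"
 unfolding mdiff_def
proof (intro conjI allI impI)
 show L: "xi k : L2 M" unfolding xi_eq by (intro L2_diff CE_L2 eps_L2)
 have "CE (-1) (eps k) : borel_measurable (Fi 0)" by (rule measurable_Fi_mono[OF CE_measurable]) simp
 then show "xi k : borel_measurable (Fi 0)"
  unfolding xi_eq by (intro borel_measurable_diff CE_measurable)
 fix g assume g: "g : L2 M" "g : borel_measurable (Fi (- 1))"
 have g0: "g : borel_measurable (Fi 0)" by (rule measurable_Fi_mono[OF g(2)]) simp
 have "(LINT z|M. xi k z * g z) = (LINT z|M. g z * CE 0 (eps k) z) - (LINT z|M. g z * CE (-1) (eps k) z)"
  using L2_integrable_mult[OF g(1) CE_L2(1)[OF eps_L2]]
  by (simp add: xi_eq right_diff_distrib mult.commute)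
 also have "... = 0" using CE_orth[OF eps_L2 g(1) g0] CE_orth[OF eps_L2 g] by simp
 finally show "(LINT z|M. xi k z * g z) = 0" .
qed

lemma xi_sh: "AE z in M. xi k (sh s z) = CE s (eps (k + s)) z - CE (s - 1) (eps (k + s)) z"
proof -
 have *: "AE z in M. CE j (eps k) (sh s z) = CE (j + s) (eps (k + s)) z" for j
 proof -
  interpret S: sigma_finite_subalgebra M "Fi (j + s)" by (rule Fi_sigma_finite)
  have "AE z in M. CE (j + s) (%z. eps k (sh s z)) z = CE (j + s) (eps (k + s)) z"
  proof (rule S.real_cond_exp_cong)
  show "AE z in M. eps k (sh s z) = eps (k + s) z" by (rule AE_I2) (rule eps_sh)
  qed measurable
  moreover have "AE z in M. CE (j + s) (%z. eps k (sh s z)) z = CE j (eps k) (sh s z)"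
  by (rule CE_sh[OF L2_int[OF eps_L2]])
  ultimately show ?thesis by eventually_elim simp
 qed
 from *[of 0] *[of "-1"] show ?thesis by eventually_elim (simp add: xi_eq)
qed

text \<open>The summand of lag \<open>k\<close> is a difference of consecutive conditional
  expectations of \<open>e0\<close>, so the sum over symmetric lags telescopes.\<close>

lemma ma_xi_0: "AE z in M. ma N xi 0 z = CE (int N) e0 z - CE (- int (Suc N)) e0 z"
proof -
 have e0: "eps 0 = e0" by (simp add: eps_eq)
 have "AE z in M. ALL k:{- int N..int N}. xi k (sh (- k) z) = CE (- k) e0 z - CE (- k - 1) e0 z"
 proof (rule AE_finite_allI)
  fix k
  show "AE z in M. xi k (sh (- k) z) = CE (- k) e0 z - CE (- k - 1) e0 z"
  using xi_sh[of k "- k"] by (simp add: e0)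
 qed simp
 then show ?thesis
 proof eventually_elim
  case (elim z)
  have tele: "(SUM k:{- int n..int n}. F (- k) - F (- k - 1)) = F (int n) - F (- int (Suc n))" for n and F :: "int => real"
  proof (induction n)
  case (Suc n)
  have "{- int (Suc n)..int (Suc n)} = insert (- int (Suc n)) (insert (int (Suc n)) {- int n..int n})" by auto
  then have "(SUM k:{- int (Suc n)..int (Suc n)}. F (- k) - F (- k - 1))
  = (F (int (Suc n)) - F (int n)) + ((F (- int (Suc n)) - F (- int (Suc (Suc n)))) + (SUM k:{- int n..int n}. F (- k) - F (- k - 1)))"
  by (simp add: algebra_simps)
  then show ?case using Suc by simp
  qed simp
  have "ma N xi 0 z = (SUM k:{- int N..int N}. CE (- k) e0 z - CE (- k - 1) e0 z)"
  unfolding ma_def by (rule sum.cong) (use elim in auto)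
  then show ?case using tele[of "%j. CE j e0 z" N] by simp
 qed
qed

lemma ma_xi_L2: "ma N xi i : L2 M"
 by (intro ma_L2 mdiff_L2 xi_mdiff)

lemma ma_sh: "z : space M ==> ma m zt i (sh j z) = ma m zt (i + j) z"
 unfolding ma_def by (rule sum.cong) (simp_all add: sh_add[symmetric] algebra_simps)

text \<open>Of the two ends of the telescope, the upper one tends to \<open>e0\<close> because
  \<open>e0\<close> is measurable for \<open>filt_infinity\<close>, the lower one to the mean 0
  because the remote past is trivial. Stationarity moves the result to any time
  \<open>i\<close>.\<close>

lemma ma_xi_tendsto: "(%N. nrm (%z. eps i z - ma N xi i z)) ----> 0"
proof -
 have bound: "nrm (%z. eps i z - ma N xi i z)
  <= nrm (%z. CE (int N) e0 z - e0 z) + nrm (%z. CE (- int (Suc N)) e0 z - 0)" for N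
 proof -
  have [measurable]: "ma N xi j : borel_measurable M" for j by (rule L2_measurable[OF ma_xi_L2])
  have [measurable]: "e0 : borel_measurable M" by (rule L2_measurable[OF e0_L2])
  have "nrm (%z. eps i z - ma N xi i z) = nrm (%z. e0 (sh i z) - ma N xi 0 (sh i z))"
  proof (rule L2_norm_cong_AE)
  show "AE z in M. eps i z - ma N xi i z = e0 (sh i z) - ma N xi 0 (sh i z)"
  by (rule AE_I2) (simp add: ma_sh eps_eq)
  qed measurable
  also have "... = nrm (%z. e0 z - ma N xi 0 z)"
  by (rule L2_norm_sh[of "%z. e0 z - ma N xi 0 z"]) measurable
  also have "... = nrm (%z. (e0 z - CE (int N) e0 z) + CE (- int (Suc N)) e0 z)"
  proof (rule L2_norm_cong_AE)
  show "AE z in M. e0 z - ma N xi 0 z = (e0 z - CE (int N) e0 z) + CE (- int (Suc N)) e0 z"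
  using ma_xi_0[of N] by eventually_elim simp
  qed measurable
  also have "... <= nrm (%z. e0 z - CE (int N) e0 z) + nrm (CE (- int (Suc N)) e0)"
  by (intro L2_norm_add_le L2_diff e0_L2 CE_L2)
  finally show ?thesis using L2_norm_minus_commute[of M e0 "CE (int N) e0"] by simp
 qed
 have "(%N. nrm (%z. CE (int N) e0 z - e0 z) + nrm (%z. CE (- int (Suc N)) e0 z - 0)) ----> 0 + 0"
  using CE_backward_limit[OF trivial_past e0_L2] unfolding centered
  by (intro tendsto_add CE_forward_limit regular e0_L2 LIMSEQ_Suc)
 then have lim: "(%N. nrm (%z. CE (int N) e0 z - e0 z) + nrm (%z. CE (- int (Suc N)) e0 z - 0)) ----> 0"
  unfolding add_0_left .
 show ?thesis by (rule null_comparison[OF lim]) (simp only: abs_of_nonneg L2_norm_nonneg bound)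
qed

definition hannan_sum :: real where
 "hannan_sum = (\<Sum>\<^sub>\<infinity>k. nrm (xi k))"

lemma hannan_partial: "(%N. SUM k:{- int N..int N}. nrm (xi k)) ----> hannan_sum"
 unfolding hannan_sum_def by (rule has_sum_int_symmetric[OF has_sum_infsum[OF hannan]])

lemma hannan_partial_le: "finite A ==> (SUM k:A. nrm (xi k)) <= hannan_sum"
 unfolding hannan_sum_def by (rule finite_sum_le_infsum[OF hannan]) simp_all

lemma hannan_sum_nonneg: "0 <= hannan_sum"
 using hannan_partial_le[of "{}"] by simp

lemma sum_eps_ma_tendsto:
 assumes "finite I"
 shows "(%N. nrm (%z. SUM i:I. a i * (eps i z - ma N xi i z))) ----> 0"
proof -
 have "nrm (%z. SUM i:I. a i * (eps i z - ma N xi i z))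
  <= (SUM i:I. \<bar>a i\<bar> * nrm (%z. eps i z - ma N xi i z))" for N
 proof -
  have "nrm (%z. SUM i:I. a i * (eps i z - ma N xi i z))
  <= (SUM i:I. nrm (%z. a i * (eps i z - ma N xi i z)))"
  by (intro L2_norm_sum_le L2_cmult L2_diff eps_L2 ma_xi_L2)
  then show ?thesis by (simp add: L2_norm_cmult)
 qed
 note bound = this
 have "(%N. SUM i:I. \<bar>a i\<bar> * nrm (%z. eps i z - ma N xi i z)) ----> (SUM i:I. \<bar>a i\<bar> * 0)"
  by (intro tendsto_sum tendsto_mult tendsto_const ma_xi_tendsto)
 then have lim: "(%N. SUM i:I. \<bar>a i\<bar> * nrm (%z. eps i z - ma N xi i z)) ----> 0" by simp
 show ?thesis by (rule null_comparison[OF lim]) (simp only: abs_of_nonneg L2_norm_nonneg bound)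
qed

text \<open>The constants in \<open>ma_sum_norm\<close> stay below the full Hannan sum uniformly in
  \<open>N\<close>; for a fixed finite \<open>I\<close> the error of the truncated decomposition
  disappears as \<open>N\<close> grows.\<close>

lemma sum_eps_norm:
 assumes "finite I"
 shows "nrm (%z. SUM i:I. a i * eps i z) <= hannan_sum * sqrt (SUM i:I. (a i)\<^sup>2)"
proof -
 have "nrm (%z. SUM i:I. a i * eps i z)
  <= hannan_sum * sqrt (SUM i:I. (a i)\<^sup>2) + nrm (%z. SUM i:I. a i * (eps i z - ma N xi i z))" for N
 proof -
  have "nrm (%z. SUM i:I. a i * eps i z)
  <= nrm (%z. SUM i:I. a i * ma N xi i z)
  + nrm (%z. (SUM i:I. a i * eps i z) - (SUM i:I. a i * ma N xi i z))"
  by (intro L2_norm_le_add_diff L2_sum L2_cmult eps_L2 ma_xi_L2)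
  moreover have "nrm (%z. SUM i:I. a i * ma N xi i z) <= hannan_sum * sqrt (SUM i:I. (a i)\<^sup>2)"
  by (rule order_trans[OF ma_sum_norm[OF xi_mdiff assms]])
  (intro mult_right_mono hannan_partial_le real_sqrt_ge_zero sum_nonneg, simp_all)
  ultimately show ?thesis by (simp add: sum_subtractf right_diff_distrib)
 qed
 then have "nrm (%z. SUM i:I. a i * eps i z) <= hannan_sum * sqrt (SUM i:I. (a i)\<^sup>2) + 0"
  by (intro LIMSEQ_le_const[OF tendsto_add[OF tendsto_const sum_eps_ma_tendsto[OF assms, of a]]]) blast
 then show ?thesis by simp
qed

text \<open>One half of \<open>dl\<close> pays for the lags beyond \<open>m\<close>, the tail of the
  Hannan series; the other half pays for truncating the differences at the remaining lags. The
  constant in \<open>ma_sum_norm\<close> does not depend on \<open>I\<close>, so the error is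
  uniform in the index set and the coefficients.\<close>

lemma bounded_ma_approximation:
 assumes "dl > 0"
 obtains m zt b where "!!k. mdiff (zt k)" "!!k z. \<bar>zt k z\<bar> <= b" "0 <= b"
  "!!I a. finite I ==>
  nrm (%z. SUM i:I. a i * (eps i z - ma m zt i z)) <= dl * sqrt (SUM i:I. (a i)\<^sup>2)"
proof -
 let ?S = "%N. {- int N..int N}"
 have "\<forall>\<^sub>F N in sequentially. (SUM k:?S N. nrm (xi k)) > hannan_sum - dl / 2"
  using order_tendstoD(1)[OF hannan_partial, of "hannan_sum - dl / 2"] assms by simp
 then obtain m where m: "(SUM k:?S m. nrm (xi k)) > hannan_sum - dl / 2"
  unfolding eventually_sequentially by blast
 let ?t = "%n k. nrm (%z. xi k z - trunc (real n) (xi k z))"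
 have "(%n. SUM k:?S m. 2 * ?t n k) ----> (SUM k:?S m. 2 * 0)"
  by (intro tendsto_sum tendsto_mult tendsto_const trunc_L2_tendsto mdiff_L2 xi_mdiff)
 then have "\<forall>\<^sub>F n in sequentially. (SUM k:?S m. 2 * ?t n k) < dl / 2"
  using assms by (intro order_tendstoD(2)) auto
 then obtain n where n: "(SUM k:?S m. 2 * ?t n k) < dl / 2"
  unfolding eventually_sequentially by blast
 let ?P = "%k zt. mdiff zt \<and> (ALL z. \<bar>zt z\<bar> <= 2 * real n) \<and> nrm (%z. xi k z - zt z) <= 2 * ?t n k"
 have ex: "EX zt. ?P k zt" for k
 proof -
  obtain zt where "mdiff zt" "!!z. \<bar>zt z\<bar> <= 2 * real n" "nrm (%z. xi k z - zt z) <= 2 * ?t n k"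
  using mdiff_truncation[OF xi_mdiff[of k], of "real n"] of_nat_0_le_iff[of n] by blast
  then show ?thesis by blast
 qed
 obtain zt where "ALL k. ?P k (zt k)"
  by (atomize_elim, rule choice, rule allI, rule ex)
 then have zt: "!!k. mdiff (zt k)" "!!k z. \<bar>zt k z\<bar> <= 2 * real n"
  "!!k. nrm (%z. xi k z - zt k z) <= 2 * ?t n k" by simp_all
 have "nrm (%z. SUM i:I. a i * (eps i z - ma m zt i z)) <= dl * sqrt (SUM i:I. (a i)\<^sup>2)"
  if I: "finite I" for I a
 proof -
  \<comment> \<open>Padding with zero beyond \<open>m\<close> allows a comparison, lag by lag, with
    the decomposition of the errors at any larger \<open>N\<close>.\<close>
  define zt' where "zt' k = (if k : ?S m then zt k else (%_. 0))" for k
  have md0: "mdiff (%_. 0)" by (simp add: mdiff_def L2_zero)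
  have zt': "mdiff (zt' k)" for k using zt(1) md0 by (simp add: zt'_def)
  have ma': "ma N zt' i z = ma m zt i z" if "N >= m" for N i z
  proof -
  have "ma N zt' i z = (SUM k:?S m. zt' k (sh (i - k) z))"
  unfolding ma_def using that by (intro sum.mono_neutral_right) (auto simp: zt'_def)
  also have "... = ma m zt i z" unfolding ma_def by (rule sum.cong) (simp_all add: zt'_def)
  finally show ?thesis .
  qed
  have "nrm (%z. SUM i:I. a i * (eps i z - ma m zt i z))
  <= dl * sqrt (SUM i:I. (a i)\<^sup>2) + nrm (%z. SUM i:I. a i * (eps i z - ma N xi i z))" if N: "N >= m" for N
  proof -
  have "(SUM i:I. a i * (eps i z - ma m zt i z))
  = (SUM i:I. a i * ma N (%k z. xi k z - zt' k z) i z) + (SUM i:I. a i * (eps i z - ma N xi i z))" for z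
  unfolding ma_diff[symmetric] ma'[OF N] by (simp add: sum.distrib[symmetric] algebra_simps)
  then have "nrm (%z. SUM i:I. a i * (eps i z - ma m zt i z))
  <= nrm (%z. SUM i:I. a i * ma N (%k z. xi k z - zt' k z) i z)
  + nrm (%z. SUM i:I. a i * (eps i z - ma N xi i z))"
  by (simp only:) (intro L2_norm_add_le L2_sum L2_cmult L2_diff eps_L2 ma_xi_L2 ma_L2 mdiff_L2 mdiff_diff xi_mdiff zt')
  moreover have "nrm (%z. SUM i:I. a i * ma N (%k z. xi k z - zt' k z) i z) <= dl * sqrt (SUM i:I. (a i)\<^sup>2)"
  proof (rule order_trans[OF ma_sum_norm[OF mdiff_diff[OF xi_mdiff zt'] I]], rule mult_right_mono)
  have "(SUM k:?S N. nrm (%z. xi k z - zt' k z))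
  = (SUM k:?S m. nrm (%z. xi k z - zt' k z)) + (SUM k:?S N - ?S m. nrm (%z. xi k z - zt' k z))"
  using N by (subst sum.subset_diff[of "?S m" "?S N"]) auto
  also have "(SUM k:?S m. nrm (%z. xi k z - zt' k z)) <= (SUM k:?S m. 2 * ?t n k)"
  proof (rule sum_mono)
  fix k assume "k : ?S m"
  then show "nrm (%z. xi k z - zt' k z) <= 2 * ?t n k" using zt(3)[of k] by (simp add: zt'_def)
  qed
  also have "(SUM k:?S N - ?S m. nrm (%z. xi k z - zt' k z)) = (SUM k:?S N - ?S m. nrm (xi k))"
  by (rule sum.cong) (auto simp: zt'_def)
  also have "... = (SUM k:?S N. nrm (xi k)) - (SUM k:?S m. nrm (xi k))"
  using N by (intro sum_diff) auto
  also have "... <= dl / 2" using hannan_partial_le[of "?S N"] m by simp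
  finally show "(SUM k:?S N. nrm (%z. xi k z - zt' k z)) <= dl" using n by simp
  qed (simp add: sum_nonneg)
  ultimately show ?thesis by linarith
  qed
  then have "nrm (%z. SUM i:I. a i * (eps i z - ma m zt i z)) <= dl * sqrt (SUM i:I. (a i)\<^sup>2) + 0"
  by (intro LIMSEQ_le_const[OF tendsto_add[OF tendsto_const sum_eps_ma_tendsto[OF I, of a]]]) blast
  then show ?thesis by simp
 qed
 with that[of zt "2 * real n" m] zt(1,2) show ?thesis by simp
qed

lemma bounded_ma_approximation_ex:
 assumes "dl > 0"
 shows "EX m zt b. (ALL k. mdiff (zt k)) \<and> (ALL k z. \<bar>zt k z\<bar> <= b) \<and>
  (ALL I a. finite I --> nrm (%z. SUM i:I. a i * (eps i z - ma m zt i z)) <= dl * sqrt (SUM i:I. (a i)\<^sup>2))"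
  (is "EX m zt b. ?P m zt b")
proof (rule bounded_ma_approximation[OF assms])
 fix m zt b
 assume *: "!!k. mdiff (zt k)" "!!k z. \<bar>zt k z\<bar> <= b"
  "!!I a. finite I ==> nrm (%z. SUM i:I. a i * (eps i z - ma m zt i z)) <= dl * sqrt (SUM i:I. (a i)\<^sup>2)"
 have "?P m zt b" by (intro conjI allI impI *)
 then show ?thesis by (intro exI[of _ m] exI[of _ zt] exI[of _ b])
qed

section \<open>Absolute summability of the autocovariances\<close>

lemma gam_stationary: "(LINT z|M. eps i z * eps j z) = gam (j - i)"
proof -
 have "(LINT z|M. eps i z * eps j z) = (LINT z|M. eps 0 (sh i z) * eps (j - i) (sh i z))"
  by (rule LINT_cong) (simp_all add: eps_sh)
 also have "... = (LINT z|M. eps 0 z * eps (j - i) z)"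
  by (rule integral_sh[where f = "%z. eps 0 z * eps (j - i) z"]) measurable
 finally show ?thesis by (simp add: autocov_def)
qed


lemma gam_ma_tendsto: "(%N. (LINT z|M. ma N xi 0 z * ma N xi k z)) ----> gam k"
proof -
 let ?d = "%N i. nrm (%z. eps i z - ma N xi i z)"
 have bound: "\<bar>(LINT z|M. ma N xi 0 z * ma N xi k z) - gam k\<bar>
  <= ?d N 0 * nrm (eps k) + (nrm (eps 0) + ?d N 0) * ?d N k" for N
 proof -
  have L: "(%z. eps i z - ma N xi i z) : L2 M" for i by (intro L2_diff eps_L2 ma_xi_L2)
  have "gam k - (LINT z|M. ma N xi 0 z * ma N xi k z)
  = (LINT z|M. (eps 0 z - ma N xi 0 z) * eps k z + ma N xi 0 z * (eps k z - ma N xi k z))"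
  unfolding autocov_def
  using L2_integrable_mult[OF eps_L2 eps_L2] L2_integrable_mult[OF ma_xi_L2 ma_xi_L2] L2_integrable_mult[OF ma_xi_L2 eps_L2]
  by (simp add: algebra_simps)
  also have "... = (LINT z|M. (eps 0 z - ma N xi 0 z) * eps k z) + (LINT z|M. ma N xi 0 z * (eps k z - ma N xi k z))"
  by (intro LINT_add L2_integrable_mult L eps_L2 ma_xi_L2)
  finally have "\<bar>gam k - (LINT z|M. ma N xi 0 z * ma N xi k z)\<bar>
  <= ?d N 0 * nrm (eps k) + nrm (ma N xi 0) * ?d N k"
  using L2_Cauchy_Schwarz[OF L[of 0] eps_L2[of k]] L2_Cauchy_Schwarz[OF ma_xi_L2[of N 0] L[of k]] by linarith
  moreover have "nrm (ma N xi 0) <= nrm (eps 0) + ?d N 0"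
  using L2_norm_le_add_diff[OF ma_xi_L2[of N 0] eps_L2[of 0]] L2_norm_minus_commute[of M "ma N xi 0" "eps 0"] by simp
  then have "nrm (ma N xi 0) * ?d N k <= (nrm (eps 0) + ?d N 0) * ?d N k"
  by (intro mult_right_mono) simp_all
  ultimately show ?thesis by (simp add: abs_minus_commute)
 qed
 have "(%N. ?d N 0 * nrm (eps k) + (nrm (eps 0) + ?d N 0) * ?d N k)
  ----> 0 * nrm (eps k) + (nrm (eps 0) + 0) * 0"
  by (intro tendsto_intros ma_xi_tendsto)
 then have lim: "(%N. ?d N 0 * nrm (eps k) + (nrm (eps 0) + ?d N 0) * ?d N k) ----> 0"
  by simp
 have "(%N. (LINT z|M. ma N xi 0 z * ma N xi k z) - gam k) ----> 0"
  by (rule null_comparison[OF lim bound])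
 then show ?thesis by (simp add: LIM_zero_iff)
qed

text \<open>The components of lags \<open>j\<close> and \<open>l\<close> are correlated only at
  distance \<open>k = l - j\<close>. Summing over \<open>k\<close> thus meets each pair of lags at
  most once, and the bound is the square of the sum of norms.\<close>

lemma gam_ma_bound:
 assumes A: "finite A"
 shows "(SUM k:A. \<bar>(LINT z|M. ma N xi 0 z * ma N xi k z)\<bar>) <= hannan_sum\<^sup>2"
proof -
 let ?S = "{- int N..int N}"
 let ?a = "%k. nrm (xi k)"
 have L: "(%z. xi j (sh s z)) : L2 M" for j s by (intro L2_sh mdiff_L2 xi_mdiff)
 have nrm: "nrm (%z. xi j (sh s z)) = ?a j" for j s
  by (rule L2_norm_sh[OF L2_measurable[OF mdiff_L2[OF xi_mdiff]]])
 have inner: "\<bar>(LINT z|M. xi j (sh s z) * xi l (sh (k - l) z))\<bar> <= (if k = l + s then ?a j * ?a l else 0)" for j l k s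
 proof (cases "k = l + s")
  case True
  have "\<bar>(LINT z|M. xi j (sh s z) * xi l (sh (k - l) z))\<bar> <= ?a j * ?a l"
  by (rule order_trans[OF L2_Cauchy_Schwarz[OF L L]]) (simp only: nrm order_refl)
  then show ?thesis unfolding if_P[OF True] .
 next
  case False
  then have "s ~= k - l" by simp
  show ?thesis unfolding mdiff_pair_orth[OF xi_mdiff xi_mdiff \<open>s ~= k - l\<close>] if_not_P[OF False] by simp
 qed
 have "\<bar>(LINT z|M. ma N xi 0 z * ma N xi k z)\<bar> <= (SUM j:?S. SUM l:?S. if k = l + (0 - j) then ?a j * ?a l else 0)" for k
 proof -
  have "(LINT z|M. ma N xi 0 z * ma N xi k z)
  = (LINT z|M. (SUM j:?S. SUM l:?S. xi j (sh (0 - j) z) * xi l (sh (k - l) z)))"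
  unfolding ma_def sum_product ..
  also have "... = (SUM j:?S. SUM l:?S. (LINT z|M. xi j (sh (0 - j) z) * xi l (sh (k - l) z)))"
  by (simp add: L2_integrable_mult[OF L L])
  finally have "\<bar>(LINT z|M. ma N xi 0 z * ma N xi k z)\<bar>
  = \<bar>SUM j:?S. SUM l:?S. (LINT z|M. xi j (sh (0 - j) z) * xi l (sh (k - l) z))\<bar>" by (rule arg_cong)
  also have "... <= (SUM j:?S. \<bar>SUM l:?S. (LINT z|M. xi j (sh (0 - j) z) * xi l (sh (k - l) z))\<bar>)"
  by (rule sum_abs)
  also have "... <= (SUM j:?S. SUM l:?S. \<bar>(LINT z|M. xi j (sh (0 - j) z) * xi l (sh (k - l) z))\<bar>)"
  by (rule sum_mono, rule sum_abs)
  also have "... <= (SUM j:?S. SUM l:?S. if k = l + (0 - j) then ?a j * ?a l else 0)"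
  by (rule sum_mono, rule sum_mono, rule inner)
  finally show ?thesis .
 qed
 then have "(SUM k:A. \<bar>(LINT z|M. ma N xi 0 z * ma N xi k z)\<bar>)
  <= (SUM k:A. SUM j:?S. SUM l:?S. if k = l + (0 - j) then ?a j * ?a l else 0)" by (rule sum_mono)
 also have "... = (SUM j:?S. SUM l:?S. SUM k:A. if k = l + (0 - j) then ?a j * ?a l else 0)"
  by (subst sum.swap, rule sum.cong[OF refl], rule sum.swap)
 also have "... <= (SUM j:?S. SUM l:?S. ?a j * ?a l)"
  using A by (intro sum_mono) (simp add: sum.delta)
 also have "... = (SUM j:?S. ?a j) * (SUM l:?S. ?a l)" by (simp add: sum_product)
 also have "... <= hannan_sum * hannan_sum"
  by (intro mult_mono hannan_partial_le hannan_sum_nonneg sum_nonneg) simp_all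
 finally show ?thesis by (simp add: power2_eq_square)
qed

lemma gam_abs_summable: "(%k. \<bar>gam k\<bar>) summable_on UNIV"
proof (rule nonneg_bdd_above_summable_on)
 have "(SUM k:A. \<bar>gam k\<bar>) <= hannan_sum\<^sup>2" if "finite A" for A
 proof (rule LIMSEQ_le_const2)
  show "(%N. SUM k:A. \<bar>(LINT z|M. ma N xi 0 z * ma N xi k z)\<bar>) ----> (SUM k:A. \<bar>gam k\<bar>)"
  by (intro tendsto_sum tendsto_rabs gam_ma_tendsto)
  show "EX N. ALL n>=N. (SUM k:A. \<bar>(LINT z|M. ma n xi 0 z * ma n xi k z)\<bar>) <= hannan_sum\<^sup>2"
  using gam_ma_bound[OF that] by blast
 qed
 then show "bdd_above (sum (%k. \<bar>gam k\<bar>) ` {F. F \<subseteq> UNIV \<and> finite F})"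
  by (intro bdd_aboveI[where M = "hannan_sum\<^sup>2"]) auto
qed simp

end

section \<open>Weighted laws of large numbers and quadratic forms\<close>

context stationary_filtration
begin

text \<open>Bounded measurable functions are closed under products, square integrable ones are not;
  products of past factors must remain admissible test functions for the martingale
  property.\<close>

definition bm :: "int => ('w => real) => bool" where
 "bm j f \<longleftrightarrow> f : borel_measurable (Fi j) \<and> (EX b. ALL z. \<bar>f z\<bar> <= b)"

lemma bmI: "f : borel_measurable (Fi j) ==> (!!z. \<bar>f z\<bar> <= b) ==> bm j f"
 unfolding bm_def by blast

lemma bm_Fi: "bm j f ==> f : borel_measurable (Fi j)"
 by (simp add: bm_def)

lemma bm_measurable: "bm j f ==> f : borel_measurable M"
 by (rule measurable_Fi) (rule bm_Fi)

lemma bm_L2: assumes "bm j f" shows "f : L2 M"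
proof -
 obtain b where "!!z. \<bar>f z\<bar> <= b" using assms unfolding bm_def by blast
 then show ?thesis by (rule L2_const_bound[OF finite_measure_axioms bm_measurable[OF assms]])
qed

lemma bm_mono: "bm i f ==> i <= j ==> bm j f"
 unfolding bm_def using measurable_Fi_mono[of f i borel j] by blast

lemma bm_sh: assumes "bm j f" shows "bm (j + i) (%z. f (sh i z))"
 using assms measurable_sh[of f j borel i] unfolding bm_def by blast

lemma bm_const: "bm j (%_. c)"
 by (rule bmI[where b = "\<bar>c\<bar>"]) simp_all

lemma bm_add: assumes "bm j f" "bm j g" shows "bm j (%z. f z + g z)"
proof -
 obtain a b where "!!z. \<bar>f z\<bar> <= a" "!!z. \<bar>g z\<bar> <= b" using assms unfolding bm_def by blast
 then have "\<bar>f z + g z\<bar> <= a + b" for z by (meson abs_triangle_ineq add_mono order_trans)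
 then show ?thesis using assms by (intro bmI) (auto simp: bm_def)
qed

lemma bm_mult: assumes "bm j f" "bm j g" shows "bm j (%z. f z * g z)"
proof -
 obtain a b where ab: "!!z. \<bar>f z\<bar> <= a" "!!z. \<bar>g z\<bar> <= b" using assms unfolding bm_def by blast
 then have "\<bar>f z * g z\<bar> <= a * b" for z
  unfolding abs_mult by (intro mult_mono order_trans[OF abs_ge_zero ab(1)] ab abs_ge_zero)
 then show ?thesis using assms by (intro bmI) (auto simp: bm_def)
qed

lemma bm_sum: "(!!i. i : I ==> bm j (f i)) ==> bm j (%z. SUM i:I. f i z)"
proof (induction I rule: infinite_finite_induct)
 case (insert i I)
 then have "bm j (%z. f i z + (SUM i:I. f i z))" by (intro bm_add) simp_all
 then show ?case using insert(1,2) by simp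
qed (simp_all add: bm_const)

lemma mdiff_bm_orth:
 assumes "mdiff zt" "bm (s - 1) g"
 shows "(LINT z|M. zt (sh s z) * g z) = 0"
 by (rule mdiff_orth[OF assms(1) bm_L2[OF assms(2)] bm_Fi[OF assms(2)]])

lemma orthogonal_sum_norm:
 assumes I: "finite I" and D: "!!s. s : I ==> D s : L2 M"
  and orth: "!!s t. s : I ==> t : I ==> s ~= t ==> (LINT z|M. D s z * D t z) = 0"
 shows "(nrm (%z. SUM s:I. D s z))\<^sup>2 = (SUM s:I. (nrm (D s))\<^sup>2)"
proof -
 have "(nrm (%z. SUM s:I. D s z))\<^sup>2 = (LINT z|M. (SUM s:I. SUM t:I. D s z * D t z))"
  unfolding L2_norm_power2 by (simp add: power2_eq_square sum_product)
 also have "... = (SUM s:I. SUM t:I. (LINT z|M. D s z * D t z))"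
  using D by (simp add: L2_integrable_mult)
 also have "... = (SUM s:I. SUM t:I. if t = s then (nrm (D s))\<^sup>2 else 0)"
 proof (intro sum.cong refl)
  fix s t assume st: "s : I" "t : I"
  show "(LINT z|M. D s z * D t z) = (if t = s then (nrm (D s))\<^sup>2 else 0)"
  proof (cases "t = s")
  case True
  then show ?thesis unfolding L2_norm_power2 by (simp add: power2_eq_square)
  next
  case False
  then show ?thesis using orth[OF st] by simp
  qed
 qed
 also have "... = (SUM s:I. (nrm (D s))\<^sup>2)" using I by simp
 finally show ?thesis .
qed

text \<open>The shifted function is measurable for \<open>Fi (- int k)\<close>, so the covariance
  sees only the conditional expectation of \<open>H\<close> given that sigma-algebra, which tends to
  the mean 0.\<close>

lemma covariance_decay:
 assumes trivial: "filt_minus_infinity_trivial M T F0"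
  and H: "H : L2 M" "H : borel_measurable (Fi 0)" "(LINT z|M. H z) = 0"
 shows "(%k. (LINT z|M. H z * H (sh (- int k) z))) ----> 0"
proof (rule null_comparison)
 have "(%k. nrm (%z. CE (- int k) H z - 0)) ----> 0"
  using CE_backward_limit[OF trivial H(1)] unfolding H(3) .
 then have "(%k. nrm H * nrm (%z. CE (- int k) H z - 0)) ----> nrm H * 0"
  by (intro tendsto_mult tendsto_const)
 then show "(%k. nrm H * nrm (CE (- int k) H)) ----> 0" by simp
 fix k
 have L: "(%z. H (sh (- int k) z)) : L2 M" by (rule L2_sh[OF H(1)])
 have "(%z. H (sh (- int k) z)) : borel_measurable (Fi (- int k))"
  using measurable_sh[OF H(2), of "- int k"] by simp
 from CE_orth[OF H(1) L this]
 have "(LINT z|M. H z * H (sh (- int k) z)) = (LINT z|M. H (sh (- int k) z) * CE (- int k) H z)"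
  by (simp add: mult.commute)
 then show "\<bar>(LINT z|M. H z * H (sh (- int k) z))\<bar> <= nrm H * nrm (CE (- int k) H)"
  using L2_Cauchy_Schwarz[OF L CE_L2(1)[OF H(1)], of "- int k"]
  by (simp only: L2_norm_sh[OF L2_measurable[OF H(1)]])
qed

text \<open>Expand the variance. Pairs of indices at distance at least \<open>N\<close> contribute
  at most \<open>e * C^2\<close> by decay of covariances. Each index has fewer than
  \<open>2 * N\<close> nearer partners, so the other pairs contribute a multiple of the sum of
  squared weights, which vanishes for fixed \<open>N\<close>.\<close>

lemma weighted_lln:
 assumes trivial: "filt_minus_infinity_trivial M T F0"
  and H: "H : L2 M" "H : borel_measurable (Fi 0)" "(LINT z|M. H z) = 0"
  and I: "!!n. finite (I n)"
  and C: "!!n. (SUM s:I n. \<bar>a n s\<bar>) <= C"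
  and a2: "(%n::nat. SUM s:I n. (a n s)\<^sup>2) ----> 0"
 shows "(%n. nrm (%z. SUM s:I n. a n s * H (sh s z))) ----> 0"
proof -
 define c where "c k = (LINT z|M. H z * H (sh (- int k) z))" for k
 have c_lim: "c ----> 0" unfolding c_def[abs_def] by (rule covariance_decay[OF trivial H])
 let ?c0 = "(nrm H)\<^sup>2"
 have nH: "nrm (%z. H (sh s z)) = nrm H" for s
  by (rule L2_norm_sh[OF L2_measurable[OF H(1)]])
 have c0: "\<bar>c k\<bar> <= ?c0" for k
  using L2_Cauchy_Schwarz[OF H(1) L2_sh[OF H(1)], of "- int k"] unfolding c_def nH power2_eq_square .
 have [measurable]: "H : borel_measurable M" by (rule L2_measurable[OF H(1)])
 have cov: "(LINT z|M. H (sh s z) * H (sh t z)) = c (nat \<bar>s - t\<bar>)" for s t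
 proof -
  have *: "(LINT z|M. H (sh s z) * H (sh t z)) = c (nat (s - t))" if "t <= s" for s t
  proof -
  have "(LINT z|M. H (sh s z) * H (sh t z)) = (LINT z|M. H (sh s z) * H (sh (t - s) (sh s z)))"
  by (rule LINT_cong) (simp_all add: sh_add[symmetric])
  also have "... = (LINT z|M. H z * H (sh (t - s) z))"
  by (rule integral_sh[where f = "%z. H z * H (sh (t - s) z)"]) measurable
  finally show ?thesis using that by (simp add: c_def)
  qed
  show ?thesis
  proof (cases "t <= s")
  case True then show ?thesis using * by simp
  next
  case False then show ?thesis using *[of s t] by (simp add: mult.commute)
  qed
 qed
 have sq: "(nrm (%z. SUM s:I n. a n s * H (sh s z)))\<^sup>2
  = (SUM s:I n. SUM t:I n. a n s * a n t * c (nat \<bar>s - t\<bar>))" for n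
 proof -
  have int: "integrable M (%z. H (sh s z) * H (sh t z))" for s t
  by (intro L2_integrable_mult L2_sh H)
  have "(nrm (%z. SUM s:I n. a n s * H (sh s z)))\<^sup>2
  = (LINT z|M. (SUM s:I n. SUM t:I n. (a n s * a n t) * (H (sh s z) * H (sh t z))))"
  unfolding L2_norm_power2 by (simp add: power2_eq_square sum_product mult_ac)
  also have "... = (SUM s:I n. SUM t:I n. (a n s * a n t) * (LINT z|M. H (sh s z) * H (sh t z)))"
  by (simp add: int)
  finally show ?thesis unfolding cov .
 qed
 have C0: "0 <= C" by (rule order_trans[OF sum_nonneg C[of 0]]) simp
 have near: "(SUM s:J. SUM t:J. if \<bar>s - t\<bar> < int N then (b s)\<^sup>2 else 0) <= 2 * real N * (SUM s:J. (b s)\<^sup>2)"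
  if "finite J" for J N and b :: "int => real"
 proof -
  have "(SUM t:J. if \<bar>s - t\<bar> < int N then (b s)\<^sup>2 else 0) <= 2 * real N * (b s)\<^sup>2" for s
  proof -
  have "(SUM t:J. if \<bar>s - t\<bar> < int N then (b s)\<^sup>2 else 0) = real (card {t:J. \<bar>s - t\<bar> < int N}) * (b s)\<^sup>2"
  using that by (simp add: sum.inter_filter[symmetric])
  \<comment> \<open>The half-open interval holds one point more than necessary and has exactly
    \<open>2 * N\<close> elements.\<close>
  also have "card {t:J. \<bar>s - t\<bar> < int N} <= card {s - int N<..s + int N}"
  by (rule card_mono) auto
  also have "card {s - int N<..s + int N} = 2 * N" by simp
  finally show ?thesis by (simp add: mult_right_mono)
  qed
  then show ?thesis unfolding sum_distrib_left by (rule sum_mono)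
 qed
 have bound: "(nrm (%z. SUM s:I n. a n s * H (sh s z)))\<^sup>2
  <= e * C\<^sup>2 + ?c0 * (2 * real N) * (SUM s:I n. (a n s)\<^sup>2)"
  if N: "!!k. k >= N ==> \<bar>c k\<bar> <= e" and e: "0 <= e" for n N e
 proof -
  \<comment> \<open>Near pairs use the maximal covariance \<open>?c0\<close> and the arithmetic mean
    of the two squares, written symmetrically in \<open>s\<close> and \<open>t\<close> for the later
    exchange of sums; far pairs use \<open>e\<close>.\<close>
  have pw: "a n s * a n t * c (nat \<bar>s - t\<bar>) <= e * (\<bar>a n s\<bar> * \<bar>a n t\<bar>)
  + ?c0 / 2 * ((if \<bar>s - t\<bar> < int N then (a n s)\<^sup>2 else 0) + (if \<bar>t - s\<bar> < int N then (a n t)\<^sup>2 else 0))" for s t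
  proof -
  have "a n s * a n t * c (nat \<bar>s - t\<bar>) <= \<bar>a n s\<bar> * \<bar>a n t\<bar> * \<bar>c (nat \<bar>s - t\<bar>)\<bar>"
  by (metis abs_ge_self abs_mult)
  also have "... <= e * (\<bar>a n s\<bar> * \<bar>a n t\<bar>)
  + ?c0 / 2 * ((if \<bar>s - t\<bar> < int N then (a n s)\<^sup>2 else 0) + (if \<bar>t - s\<bar> < int N then (a n t)\<^sup>2 else 0))"
  proof (cases "\<bar>s - t\<bar> < int N")
  case True
  have "0 <= (\<bar>a n s\<bar> - \<bar>a n t\<bar>)\<^sup>2" by simp
  then have "\<bar>a n s\<bar> * \<bar>a n t\<bar> <= ((a n s)\<^sup>2 + (a n t)\<^sup>2) / 2" by (simp add: power2_diff)
  then have "\<bar>a n s\<bar> * \<bar>a n t\<bar> * \<bar>c (nat \<bar>s - t\<bar>)\<bar> <= ((a n s)\<^sup>2 + (a n t)\<^sup>2) / 2 * ?c0"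
  by (rule mult_mono) (simp_all add: c0)
  moreover have "0 <= e * (\<bar>a n s\<bar> * \<bar>a n t\<bar>)" using e by simp
  ultimately show ?thesis using True by (simp add: abs_minus_commute mult.commute)
  next
  case False
  then have "\<bar>c (nat \<bar>s - t\<bar>)\<bar> <= e" by (intro N) linarith
  then have "\<bar>a n s\<bar> * \<bar>a n t\<bar> * \<bar>c (nat \<bar>s - t\<bar>)\<bar> <= \<bar>a n s\<bar> * \<bar>a n t\<bar> * e"
  by (rule mult_left_mono) simp
  then show ?thesis using False by (simp add: abs_minus_commute mult.commute)
  qed
  finally show ?thesis .
  qed
  have "(SUM s:I n. SUM t:I n. a n s * a n t * c (nat \<bar>s - t\<bar>))
  <= (SUM s:I n. SUM t:I n. e * (\<bar>a n s\<bar> * \<bar>a n t\<bar>)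
  + ?c0 / 2 * ((if \<bar>s - t\<bar> < int N then (a n s)\<^sup>2 else 0) + (if \<bar>t - s\<bar> < int N then (a n t)\<^sup>2 else 0)))"
  by (rule sum_mono, rule sum_mono, rule pw)
  also have "... = e * ((SUM s:I n. \<bar>a n s\<bar>) * (SUM s:I n. \<bar>a n s\<bar>))
  + ?c0 / 2 * ((SUM s:I n. SUM t:I n. if \<bar>s - t\<bar> < int N then (a n s)\<^sup>2 else 0)
  + (SUM s:I n. SUM t:I n. if \<bar>t - s\<bar> < int N then (a n t)\<^sup>2 else 0))"
  unfolding sum_product by (simp only: sum.distrib sum_distrib_left[symmetric])
  also have "(SUM s:I n. SUM t:I n. if \<bar>t - s\<bar> < int N then (a n t)\<^sup>2 else 0)
  = (SUM s:I n. SUM t:I n. if \<bar>s - t\<bar> < int N then (a n s)\<^sup>2 else 0)" by (rule sum.swap)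
  also have "e * ((SUM s:I n. \<bar>a n s\<bar>) * (SUM s:I n. \<bar>a n s\<bar>))
  + ?c0 / 2 * ((SUM s:I n. SUM t:I n. if \<bar>s - t\<bar> < int N then (a n s)\<^sup>2 else 0)
  + (SUM s:I n. SUM t:I n. if \<bar>s - t\<bar> < int N then (a n s)\<^sup>2 else 0))
  <= e * (C * C) + ?c0 / 2 * (2 * real N * (SUM s:I n. (a n s)\<^sup>2) + 2 * real N * (SUM s:I n. (a n s)\<^sup>2))"
  by (rule add_mono, rule mult_left_mono[OF mult_mono e], rule C, rule C, rule C0, simp add: sum_nonneg,
  rule mult_left_mono, rule add_mono, rule near[OF I], rule near[OF I], simp)
  finally show ?thesis unfolding sq by (simp add: power2_eq_square algebra_simps)
 qed
 have "(%n. (nrm (%z. SUM s:I n. a n s * H (sh s z)))\<^sup>2) ----> 0"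
 proof (rule LIMSEQ_I)
  fix r :: real assume r: "r > 0"
  define e where "e = r / (2 * (C\<^sup>2 + 1))"
  have e: "e > 0" unfolding e_def using r by (simp add: add_nonneg_pos)
  have eC: "e * C\<^sup>2 < r / 2"
  proof -
  have "C\<^sup>2 + 1 > 0" by (simp add: add_nonneg_pos)
  then show ?thesis unfolding e_def using r by (simp add: divide_simps)
  qed
  obtain N where N: "!!k. k >= N ==> \<bar>c k\<bar> <= e"
  using LIMSEQ_D[OF c_lim e] by (auto intro: less_imp_le)
  have "(%n. ?c0 * (2 * real N) * (SUM s:I n. (a n s)\<^sup>2)) ----> ?c0 * (2 * real N) * 0"
  by (intro tendsto_mult tendsto_const a2)
  then have "\<forall>\<^sub>F n in sequentially. ?c0 * (2 * real N) * (SUM s:I n. (a n s)\<^sup>2) < r / 2"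
  using r by (intro order_tendstoD(2)) auto
  then obtain n0 where n0: "!!n. n >= n0 ==> ?c0 * (2 * real N) * (SUM s:I n. (a n s)\<^sup>2) < r / 2"
  unfolding eventually_sequentially by blast
  have "norm ((nrm (%z. SUM s:I n. a n s * H (sh s z)))\<^sup>2 - 0) < r" if "n >= n0" for n
  proof -
  have "(nrm (%z. SUM s:I n. a n s * H (sh s z)))\<^sup>2
  <= e * C\<^sup>2 + ?c0 * (2 * real N) * (SUM s:I n. (a n s)\<^sup>2)"
  by (rule bound[OF N less_imp_le[OF e]])
  then show ?thesis using n0[OF that] eC by simp
  qed
  then show "EX no. ALL n>=no. norm ((nrm (%z. SUM s:I n. a n s * H (sh s z)))\<^sup>2 - 0) < r" by blast
 qed
 then have "(%n. sqrt ((nrm (%z. SUM s:I n. a n s * H (sh s z)))\<^sup>2)) ----> sqrt 0"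
  by (rule tendsto_real_sqrt)
 then show ?thesis by simp
qed

text \<open>The inner sum over \<open>t < s\<close> is measurable for the strict past of
  \<open>s\<close>, so the summands over \<open>s\<close> are orthogonal and centered. One factor
  \<open>b^2\<close> bounds the outer difference, the other the squared norm of
  \<open>et\<close>.\<close>

lemma lower_triangle_norm:
 assumes zt: "mdiff zt" "!!x. \<bar>zt x\<bar> <= b" and et: "mdiff et" "!!x. \<bar>et x\<bar> <= b" and I: "finite I"
 shows "(%x. SUM s:I. SUM t:{t:I. t < s}. a s t * (zt (sh s x) * et (sh t x))) : L2 M" (is "?X : _")
  and "(nrm (%x. SUM s:I. SUM t:{t:I. t < s}. a s t * (zt (sh s x) * et (sh t x))))\<^sup>2
  <= b^4 * (SUM s:I. SUM t:I. (a s t)\<^sup>2)"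
  and "(LINT x|M. (SUM s:I. SUM t:{t:I. t < s}. a s t * (zt (sh s x) * et (sh t x)))) = 0"
proof -
 define A where "A s x = (SUM t:{t:I. t < s}. a s t * et (sh t x))" for s x
 define D where "D s x = zt (sh s x) * A s x" for s x
 have X: "(SUM s:I. SUM t:{t:I. t < s}. a s t * (zt (sh s x) * et (sh t x))) = (SUM s:I. D s x)" for x
  unfolding D_def A_def sum_distrib_left by (simp add: mult_ac)
 have b0: "0 <= b" using order_trans[OF abs_ge_zero zt(2)] .
 have z: "bm s (%x. zt (sh s x))" and e: "bm s (%x. et (sh s x))" for s
  using bm_sh[of 0 zt s] bm_sh[of 0 et s] zt et unfolding bm_def mdiff_def by auto
 have A: "bm (s - 1) (A s)" for s
  unfolding A_def by (intro bm_sum bm_mult bm_const) (auto intro: bm_mono[OF e])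
 have D: "bm s (D s)" for s
  unfolding D_def by (intro bm_mult z bm_mono[OF A]) simp
 have orth: "(LINT x|M. D s x * D t x) = 0" if "s ~= t" for s t
 proof -
  have *: "(LINT x|M. D s x * D t x) = 0" if "t < s" for s t
  proof -
  have "bm (s - 1) (%x. A s x * D t x)"
  using that by (intro bm_mult A bm_mono[OF D]) simp
  from mdiff_bm_orth[OF zt(1) this] show ?thesis unfolding D_def by (simp add: mult.assoc)
  qed
  show ?thesis
  proof (cases "t < s")
  case True then show ?thesis by (rule *)
  next
  case False
  then have "s < t" using that by simp
  from *[OF this] show ?thesis by (simp add: mult.commute)
  qed
 qed
 have DL: "D s : L2 M" for s by (rule bm_L2[OF D])
 show "?X : L2 M" unfolding X by (intro L2_sum DL)
 have "(LINT x|M. D s x) = 0" for s unfolding D_def by (rule mdiff_bm_orth[OF zt(1) A])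
 then show "(LINT x|M. (SUM s:I. SUM t:{t:I. t < s}. a s t * (zt (sh s x) * et (sh t x)))) = 0"
  unfolding X by (simp add: L2_int[OF DL])
 have "(nrm (%x. SUM s:I. D s x))\<^sup>2 = (SUM s:I. (nrm (D s))\<^sup>2)"
  by (rule orthogonal_sum_norm[OF I DL orth])
 also have "... <= (SUM s:I. b^4 * (SUM t:I. (a s t)\<^sup>2))"
 proof (rule sum_mono)
  fix s
  have "nrm (D s) <= nrm (%x. b * A s x)"
  proof (rule L2_norm_mono(2)[OF L2_cmult[OF bm_L2[OF A]] bm_measurable[OF D]])
  fix x show "\<bar>D s x\<bar> <= \<bar>b * A s x\<bar>"
  unfolding D_def abs_mult using zt(2)[of "sh s x"] b0 by (intro mult_right_mono) auto
  qed
  then have "(nrm (D s))\<^sup>2 <= (nrm (%x. b * A s x))\<^sup>2" by (rule power_mono) simp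
  also have "... = b\<^sup>2 * (nrm (A s))\<^sup>2" by (simp add: L2_norm_cmult power_mult_distrib)
  also have "(nrm (A s))\<^sup>2 = (SUM t:{t:I. t < s}. (a s t)\<^sup>2) * (nrm et)\<^sup>2"
  unfolding A_def using I by (intro mdiff_sum_norm[OF et(1)]) simp
  also have "... <= (SUM t:I. (a s t)\<^sup>2) * b\<^sup>2"
  proof (rule mult_mono)
  show "(SUM t:{t:I. t < s}. (a s t)\<^sup>2) <= (SUM t:I. (a s t)\<^sup>2)"
  using I by (intro sum_mono2) auto
  have "nrm et <= nrm (%_. b)"
  by (rule L2_norm_mono(2)[OF L2_const_bound[OF finite_measure_axioms, of _ b] L2_measurable[OF mdiff_L2[OF et(1)]]])
  (use et(2) b0 in simp_all)
  then show "(nrm et)\<^sup>2 <= b\<^sup>2"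
  using b0 by (intro power_mono) (simp_all add: L2_norm_const)
  qed (simp_all add: sum_nonneg)
  finally have "(nrm (D s))\<^sup>2 <= b\<^sup>2 * ((SUM t:I. (a s t)\<^sup>2) * b\<^sup>2)" by (simp add: mult_left_mono)
  also have "... = b^4 * (SUM t:I. (a s t)\<^sup>2)" by (simp add: power4_eq_xxxx power2_eq_square algebra_simps)
  finally show "(nrm (D s))\<^sup>2 <= b^4 * (SUM t:I. (a s t)\<^sup>2)" .
 qed
 also have "... = b^4 * (SUM s:I. SUM t:I. (a s t)\<^sup>2)" by (simp add: sum_distrib_left)
 finally show "(nrm (%x. SUM s:I. SUM t:{t:I. t < s}. a s t * (zt (sh s x) * et (sh t x))))\<^sup>2
  <= b^4 * (SUM s:I. SUM t:I. (a s t)\<^sup>2)" unfolding X .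
qed

lemma mdiff_product_bm:
 assumes zt: "mdiff zt" "!!z. \<bar>zt z\<bar> <= b" and et: "mdiff et" "!!z. \<bar>et z\<bar> <= b"
 shows "bm 0 (%z. zt z * et z)"
 using assms unfolding mdiff_def by (intro bm_mult) (auto intro: bmI)

text \<open>Below the diagonal the form is a martingale sum; above it, it is one with
  \<open>zt\<close> and \<open>et\<close> exchanged; both need only a vanishing sum of squared
  weights. The diagonal is a weighted sum of the stationary sequence of products
  \<open>zt * et\<close>, where \<open>weighted_lln\<close> uses the bound \<open>C\<close>.\<close>

lemma mdiff_quadratic_form:
 fixes a :: "nat => int => int => real"
 assumes trivial: "filt_minus_infinity_trivial M T F0"
  and zt: "mdiff zt" "!!z. \<bar>zt z\<bar> <= b" and et: "mdiff et" "!!z. \<bar>et z\<bar> <= b"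
  and I: "!!n. finite (I n)"
  and C: "!!n. (SUM s:I n. \<bar>a n s s\<bar>) <= C"
  and a2: "(%n. SUM s:I n. SUM t:I n. (a n s t)\<^sup>2) ----> 0"
 defines "X n z \<equiv> SUM s:I n. SUM t:I n. a n s t * (zt (sh s z) * et (sh t z))"
 shows "X n : L2 M" and "(%n. nrm (%z. X n z - (LINT z|M. X n z))) ----> 0"
proof -
 define L where "L n z = (SUM s:I n. SUM t:{t:I n. t < s}. a n s t * (zt (sh s z) * et (sh t z)))" for n z
 define U where "U n z = (SUM s:I n. SUM t:{t:I n. t < s}. a n t s * (et (sh s z) * zt (sh t z)))" for n z
 define m where "m = (LINT z|M. zt z * et z)"
 define H where "H z = zt z * et z - m" for z
 define G where "G n z = (SUM s:I n. a n s s * H (sh s z))" for n z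
 define q where "q n = (SUM s:I n. a n s s) * m" for n
 have P: "bm 0 (%z. zt z * et z)" by (rule mdiff_product_bm[OF zt et])
 have Hb: "bm 0 H" unfolding H_def using bm_add[OF P bm_const[of 0 "- m"]] by simp
 have H0: "(LINT z|M. H z) = 0"
  unfolding H_def m_def using L2_int[OF bm_L2[OF P]] by (simp add: prob_space)
 have split: "X n z = L n z + U n z + (G n z + q n)" for n z
 proof -
  let ?f = "%s t. a n s t * (zt (sh s z) * et (sh t z))"
  have "(SUM t:I n. ?f s t) = (SUM t:{t:I n. t < s}. ?f s t) + ((SUM t:{t:I n. s < t}. ?f s t) + ?f s s)"
  if "s : I n" for s
  proof -
  have "I n = {t:I n. t < s} \<union> ({t:I n. s < t} \<union> {s})" using that by auto
  then have "(SUM t:I n. ?f s t) = (SUM t:{t:I n. t < s} \<union> ({t:I n. s < t} \<union> {s}). ?f s t)" by simp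
  also have "... = (SUM t:{t:I n. t < s}. ?f s t) + ((SUM t:{t:I n. s < t}. ?f s t) + (SUM t:{s}. ?f s t))"
  using I by (subst sum.union_disjoint, simp, simp, force, subst sum.union_disjoint) auto
  finally show ?thesis by simp
  qed
  then have "X n z = (SUM s:I n. (SUM t:{t:I n. t < s}. ?f s t) + ((SUM t:{t:I n. s < t}. ?f s t) + ?f s s))"
  unfolding X_def by (intro sum.cong) simp_all
  also have "... = L n z + ((SUM s:I n. SUM t:{t:I n. s < t}. ?f s t) + (SUM s:I n. ?f s s))"
  unfolding L_def sum.distrib ..
  also have "(SUM s:I n. SUM t:{t:I n. s < t}. ?f s t) = U n z"
  unfolding U_def using I by (subst sum.swap_restrict) (simp_all add: mult_ac)
  also have "(SUM s:I n. ?f s s) = G n z + q n"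
  unfolding G_def q_def H_def by (simp add: right_diff_distrib sum_subtractf sum_distrib_right)
  finally show ?thesis by (simp add: add.assoc)
 qed
 have LL: "L n : L2 M" and L0: "(LINT z|M. L n z) = 0" and UL: "U n : L2 M" and U0: "(LINT z|M. U n z) = 0" for n
  unfolding L_def[abs_def] U_def[abs_def]
  using lower_triangle_norm(1,3)[OF zt et I, where a = "a n"] lower_triangle_norm(1,3)[OF et zt I, where a = "%s t. a n t s"] by auto
 have GL: "G n : L2 M" for n unfolding G_def[abs_def] by (intro L2_sum L2_cmult L2_sh bm_L2[OF Hb])
 have qL: "(%_. q n) : L2 M" for n by (rule bm_L2[OF bm_const])
 show "X n : L2 M" for n
 proof -
  have "X n = (%z. L n z + U n z + (G n z + q n))" using split by (rule ext)
  then show ?thesis by (simp only:) (intro L2_add LL UL GL qL)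
 qed
 have G0: "(LINT z|M. G n z) = 0" for n
 proof -
  have "(LINT z|M. H (sh s z)) = 0" for s using integral_sh[OF bm_measurable[OF Hb], of s] H0 by simp
  then show ?thesis
  unfolding G_def using L2_int[OF L2_sh[OF bm_L2[OF Hb]]] by simp
 qed
 have EX: "(LINT z|M. X n z) = q n" for n
  unfolding split using L2_int[OF LL] L2_int[OF UL]
  L2_int[OF GL] by (simp add: L0 U0 G0 prob_space)
 have bound: "nrm (%z. X n z - (LINT z|M. X n z)) <= nrm (L n) + nrm (U n) + nrm (G n)" for n
 proof -
  have "nrm (%z. X n z - (LINT z|M. X n z)) = nrm (%z. (L n z + U n z) + G n z)"
  unfolding EX by (simp add: split add.assoc)
  also have "... <= nrm (%z. L n z + U n z) + nrm (G n)"
  by (intro L2_norm_add_le L2_add LL UL GL)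
  also have "... <= nrm (L n) + nrm (U n) + nrm (G n)"
  by (intro add_right_mono L2_norm_add_le LL UL)
  finally show ?thesis .
 qed
 have tri: "(%n. nrm (V n)) ----> 0"
  if V: "!!n. (nrm (V n))\<^sup>2 <= b^4 * (SUM s:I n. SUM t:I n. (a n s t)\<^sup>2)" for V
 proof -
  have "(%n. sqrt (b^4 * (SUM s:I n. SUM t:I n. (a n s t)\<^sup>2))) ----> sqrt (b^4 * 0)"
  by (intro tendsto_real_sqrt tendsto_mult tendsto_const a2)
  then have lim: "(%n. sqrt (b^4 * (SUM s:I n. SUM t:I n. (a n s t)\<^sup>2))) ----> 0" by simp
  show ?thesis
  proof (rule null_comparison[OF lim])
  fix n show "\<bar>nrm (V n)\<bar> <= sqrt (b^4 * (SUM s:I n. SUM t:I n. (a n s t)\<^sup>2))"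
  using V[of n] by (simp add: real_le_rsqrt)
  qed
 qed
 have Ll: "(%n. nrm (L n)) ----> 0"
  by (rule tri, unfold L_def[abs_def]) (rule lower_triangle_norm(2)[OF zt et I])
 have Ul: "(%n. nrm (U n)) ----> 0"
 proof (rule tri)
  fix n
  have "(SUM s:I n. SUM t:I n. (a n t s)\<^sup>2) = (SUM s:I n. SUM t:I n. (a n s t)\<^sup>2)" by (rule sum.swap)
  then show "(nrm (U n))\<^sup>2 <= b^4 * (SUM s:I n. SUM t:I n. (a n s t)\<^sup>2)"
  using lower_triangle_norm(2)[OF et zt I, of "%s t. a n t s" n] unfolding U_def[abs_def] by simp
 qed
 have diag: "(%n. SUM s:I n. (a n s s)\<^sup>2) ----> 0"
 proof (rule null_comparison[OF a2])
  fix n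
  have "(SUM s:I n. (a n s s)\<^sup>2) <= (SUM s:I n. SUM t:I n. (a n s t)\<^sup>2)"
  proof (rule sum_mono)
  fix s assume "s : I n"
  then show "(a n s s)\<^sup>2 <= (SUM t:I n. (a n s t)\<^sup>2)"
  using I by (intro member_le_sum[of s "I n" "%t. (a n s t)\<^sup>2"]) simp_all
  qed
  then show "\<bar>SUM s:I n. (a n s s)\<^sup>2\<bar> <= (SUM s:I n. SUM t:I n. (a n s t)\<^sup>2)" by (simp add: sum_nonneg)
 qed
 have Gl: "(%n. nrm (G n)) ----> 0"
  unfolding G_def[abs_def] by (rule weighted_lln[OF trivial bm_L2[OF Hb] bm_Fi[OF Hb] H0 I C diag])
 have "(%n. nrm (L n) + nrm (U n) + nrm (G n)) ----> 0 + 0 + 0"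
  by (intro tendsto_add Ll Ul Gl)
 then have lim: "(%n. nrm (L n) + nrm (U n) + nrm (G n)) ----> 0" by simp
 show "(%n. nrm (%z. X n z - (LINT z|M. X n z))) ----> 0"
  by (rule null_comparison[OF lim]) (simp only: abs_of_nonneg L2_norm_nonneg bound)
qed

text \<open>Expanding both moving averages and shifting each index by its lag leaves one form for
  every pair of lags. The window widened by \<open>m\<close> at both ends contains all shifted
  indices, and the weights vanish outside the original window, so nothing is added.\<close>

lemma ma_quadratic_form:
 fixes a :: "nat => int => int => real"
 assumes trivial: "filt_minus_infinity_trivial M T F0"
  and zt: "!!k. mdiff (zt k)" "!!k z. \<bar>zt k z\<bar> <= b"
  and supp: "!!n s t. a n s t ~= 0 ==> s : {1..int n} \<and> t : {1..int n}"
  and C: "!!n k l. (SUM s:{1 - int m..int n + int m}. \<bar>a n (s + k) (s + l)\<bar>) <= C"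
  and a2: "(%n. SUM s:{1..int n}. SUM t:{1..int n}. (a n s t)\<^sup>2) ----> 0"
 defines "X n z \<equiv> SUM s:{1..int n}. SUM t:{1..int n}. a n s t * (ma m zt s z * ma m zt t z)"
 shows "(%n. nrm (%z. X n z - (LINT z|M. X n z))) ----> 0"
proof -
 let ?S = "{- int m..int m}"
 let ?I = "%n. {1 - int m..int n + int m}"
 define Y where "Y k l n z = (SUM s:?I n. SUM t:?I n. a n (s + k) (t + l) * (zt k (sh s z) * zt l (sh t z)))" for k l n z
 have shift: "(SUM s:{1..int n}. f s) = (SUM s:?I n. f (s + k))"
  if k: "k : ?S" and f: "!!s. f s ~= 0 ==> s : {1..int n}" for f :: "int => real" and k n
 proof -
  have "(SUM s:?I n. f (s + k)) = (SUM s:(%s. s + k) ` ?I n. f s)"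
  by (subst sum.reindex) (auto simp: inj_on_def)
  also have "... = (SUM s:{1..int n}. f s)"
  proof (rule sum.mono_neutral_right)
  show "{1..int n} \<subseteq> (%s. s + k) ` ?I n"
  proof
  fix s assume "s : {1..int n}"
  then have "s - k : ?I n" using k by auto
  then show "s : (%s. s + k) ` ?I n" by force
  qed
  show "ALL i:(%s. s + k) ` ?I n - {1..int n}. f i = 0" using f by blast
  qed simp
  finally show ?thesis ..
 qed
 have XY: "X n z = (SUM k:?S. SUM l:?S. Y k l n z)" for n z
 proof -
  let ?g = "%k l s t. a n s t * (zt k (sh (s - k) z) * zt l (sh (t - l) z))"
  have "X n z = (SUM s:{1..int n}. SUM t:{1..int n}. SUM k:?S. SUM l:?S. ?g k l s t)"
  unfolding X_def ma_def sum_product unfolding sum_distrib_left ..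
  also have "... = (SUM s:{1..int n}. SUM k:?S. SUM t:{1..int n}. SUM l:?S. ?g k l s t)"
  by (rule sum.cong[OF refl], rule sum.swap)
  also have "... = (SUM k:?S. SUM s:{1..int n}. SUM t:{1..int n}. SUM l:?S. ?g k l s t)" by (rule sum.swap)
  also have "... = (SUM k:?S. SUM s:{1..int n}. SUM l:?S. SUM t:{1..int n}. ?g k l s t)"
  by (rule sum.cong[OF refl], rule sum.cong[OF refl], rule sum.swap)
  also have "... = (SUM k:?S. SUM l:?S. SUM s:{1..int n}. SUM t:{1..int n}. ?g k l s t)"
  by (rule sum.cong[OF refl], rule sum.swap)
  also have "... = (SUM k:?S. SUM l:?S. Y k l n z)"
  proof (intro sum.cong refl)
  fix k l assume kl: "k : ?S" "l : ?S"
  have inner: "(SUM t:{1..int n}. ?g k l s t) = (SUM t:?I n. ?g k l s (t + l))" for s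
  proof (rule shift[OF kl(2)])
  fix t assume "?g k l s t ~= 0"
  then have "a n s t ~= 0" by auto
  then show "t : {1..int n}" using supp by blast
  qed
  have "(SUM s:{1..int n}. SUM t:?I n. ?g k l s (t + l)) = (SUM s:?I n. SUM t:?I n. ?g k l (s + k) (t + l))"
  proof (rule shift[OF kl(1)])
  fix s assume "(SUM t:?I n. ?g k l s (t + l)) ~= 0"
  then obtain t where "?g k l s (t + l) ~= 0" by (meson sum.not_neutral_contains_not_neutral)
  then have "a n s (t + l) ~= 0" by auto
  then show "s : {1..int n}" using supp by blast
  qed
  then show "(SUM s:{1..int n}. SUM t:{1..int n}. ?g k l s t) = Y k l n z" unfolding inner Y_def by simp
  qed
  finally show ?thesis .
 qed
 have Y: "Y k l n : L2 M" "(%n. nrm (%z. Y k l n z - (LINT z|M. Y k l n z))) ----> 0"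
  if kl: "k : ?S" "l : ?S" for k l n
 proof -
  have sq: "(SUM s:?I n. SUM t:?I n. (a n (s + k) (t + l))\<^sup>2) = (SUM s:{1..int n}. SUM t:{1..int n}. (a n s t)\<^sup>2)" for n
  proof -
  have inner: "(SUM t:{1..int n}. (a n s t)\<^sup>2) = (SUM t:?I n. (a n s (t + l))\<^sup>2)" for s
  proof (rule shift[OF kl(2)])
  fix t assume "(a n s t)\<^sup>2 ~= 0"
  then have "a n s t ~= 0" by auto
  then show "t : {1..int n}" using supp by blast
  qed
  have "(SUM s:{1..int n}. SUM t:?I n. (a n s (t + l))\<^sup>2) = (SUM s:?I n. SUM t:?I n. (a n (s + k) (t + l))\<^sup>2)"
  proof (rule shift[OF kl(1)])
  fix s assume "(SUM t:?I n. (a n s (t + l))\<^sup>2) ~= 0"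
  then obtain t where "(a n s (t + l))\<^sup>2 ~= 0" by (meson sum.not_neutral_contains_not_neutral)
  then have "a n s (t + l) ~= 0" by auto
  then show "s : {1..int n}" using supp by blast
  qed
  then show ?thesis unfolding inner by simp
  qed
  have a2': "(%n. SUM s:?I n. SUM t:?I n. (a n (s + k) (t + l))\<^sup>2) ----> 0" unfolding sq by (rule a2)
  note res = mdiff_quadratic_form[where I = ?I and a = "%n s t. a n (s + k) (t + l)",
  OF trivial zt(1)[of k] zt(2) zt(1)[of l] zt(2) finite_atLeastAtMost_int C a2']
  show "Y k l n : L2 M" unfolding Y_def[abs_def] by (rule res(1))
  show "(%n. nrm (%z. Y k l n z - (LINT z|M. Y k l n z))) ----> 0"
  unfolding Y_def[abs_def] by (rule res(2))
 qed
 have EX: "(LINT z|M. X n z) = (SUM k:?S. SUM l:?S. (LINT z|M. Y k l n z))" for n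
 proof -
  have Yi: "integrable M (Y k l n)" if "k : ?S" "l : ?S" for k l
  by (rule L2_int[OF Y(1)[OF that]])
  have "(LINT z|M. X n z) = (SUM k:?S. (LINT z|M. (SUM l:?S. Y k l n z)))"
  unfolding XY by (rule LINT_sum, rule Lint_sum, rule Yi)
  also have "... = (SUM k:?S. SUM l:?S. (LINT z|M. Y k l n z))"
  by (rule sum.cong[OF refl], rule LINT_sum, rule Yi)
  finally show ?thesis .
 qed
 have bound: "nrm (%z. X n z - (LINT z|M. X n z))
  <= (SUM k:?S. SUM l:?S. nrm (%z. Y k l n z - (LINT z|M. Y k l n z)))" for n
 proof -
  have L: "(%z. Y k l n z - (LINT z|M. Y k l n z)) : L2 M" if "k : ?S" "l : ?S" for k l
  by (intro L2_diff Y(1)[OF that] bm_L2[OF bm_const])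
  have "nrm (%z. X n z - (LINT z|M. X n z))
  = nrm (%z. SUM k:?S. SUM l:?S. Y k l n z - (LINT z|M. Y k l n z))"
  unfolding EX unfolding XY sum_subtractf ..
  also have "... <= (SUM k:?S. nrm (%z. SUM l:?S. Y k l n z - (LINT z|M. Y k l n z)))"
  by (rule L2_norm_sum_le, rule L2_sum, rule L)
  also have "... <= (SUM k:?S. SUM l:?S. nrm (%z. Y k l n z - (LINT z|M. Y k l n z)))"
  by (rule sum_mono, rule L2_norm_sum_le, rule L)
  finally show ?thesis .
 qed
 have "(%n. SUM k:?S. SUM l:?S. nrm (%z. Y k l n z - (LINT z|M. Y k l n z))) ----> (SUM k:?S. SUM l:?S. 0)"
  by (rule tendsto_sum, rule tendsto_sum, rule Y(2))
 then have lim: "(%n. SUM k:?S. SUM l:?S. nrm (%z. Y k l n z - (LINT z|M. Y k l n z))) ----> 0" by simp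
 show ?thesis by (rule null_comparison[OF lim]) (simp only: abs_of_nonneg L2_norm_nonneg bound)
qed

end

section \<open>The central limit theorem for weighted sums\<close>

text \<open>By \<open>1 + x^2 <= exp (x^2)\<close>. Factors of modulus at most 1 are what allows a
  difference of products to be bounded by the sum of the differences of the factors.\<close>

lemma norm_gaussian_factor_le_1: "norm ((1 + \<i> * complex_of_real x) * exp (- (complex_of_real x)\<^sup>2 / 2)) <= 1"
proof -
 have "(cmod (1 + \<i> * complex_of_real x))\<^sup>2 = 1 + x\<^sup>2" by (simp add: cmod_power2)
 also have "... <= exp (x\<^sup>2)" by (rule exp_ge_add_one_self)
 also have "... = (exp (x\<^sup>2 / 2))\<^sup>2" by (simp add: exp_double[symmetric])
 finally have "cmod (1 + \<i> * complex_of_real x) <= exp (x\<^sup>2 / 2)" by (rule power2_le_imp_le) simp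
 then have "cmod (1 + \<i> * complex_of_real x) * exp (- x\<^sup>2 / 2) <= exp (x\<^sup>2 / 2) * exp (- x\<^sup>2 / 2)"
  by (rule mult_right_mono) simp
 also have "... = 1" by (simp add: exp_add[symmetric])
 finally show ?thesis by (simp add: norm_mult)
qed

text \<open>McLeish's expansion in difference form: both terms agree up to second order. For
  \<open>|x| > 1\<close> the trivial bound 2 suffices; for \<open>|x| <= 1\<close> the Taylor
  remainder gives 1/6 and the Gaussian factor at most 1.\<close>

lemma iexp_gaussian_factor:
 "norm (iexp x - (1 + \<i> * complex_of_real x) * exp (- (complex_of_real x)\<^sup>2 / 2)) <= 2 * \<bar>x\<bar>^3"
proof (cases "\<bar>x\<bar> <= 1")
 case False
 have "norm (iexp x - (1 + \<i> * complex_of_real x) * exp (- (complex_of_real x)\<^sup>2 / 2)) <= 1 + 1"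
  by (rule order_trans[OF norm_triangle_ineq4]) (intro add_mono norm_gaussian_factor_le_1, simp)
 moreover have "1 <= \<bar>x\<bar>^3" using False by (intro one_le_power) simp
 ultimately show ?thesis by linarith
next
 case True
 define y where "y = x\<^sup>2 / 2"
 have y0: "0 <= y" by (simp add: y_def)
 \<comment> \<open>\<open>r\<close> is the second-order remainder of the exponential, with
   \<open>0 <= r <= y^2\<close>; the upper bound comes from
   \<open>exp (- y) <= 1 / (1 + y)\<close>.\<close>
 define r where "r = exp (- y) - (1 - y)"
 have r0: "0 <= r" unfolding r_def using exp_ge_add_one_self[of "- y"] by simp
 have "exp (- y) <= 1 / (1 + y)"
  using exp_ge_add_one_self[of y] y0 by (simp add: exp_minus divide_simps)
 also have "... <= 1 - y + y\<^sup>2"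
 proof -
  have "1 <= (1 - y + y\<^sup>2) * (1 + y)" using y0 by (simp add: algebra_simps power2_eq_square)
  then show ?thesis using y0 by (simp add: divide_le_eq)
 qed
 finally have r1: "r <= y\<^sup>2" unfolding r_def by simp
 have "cmod (iexp x - (SUM k<=2. (\<i> * complex_of_real x)^k / fact k)) <= \<bar>x\<bar>^Suc 2 / fact (Suc 2)" by (rule iexp_approx1)
 moreover have "(SUM k<=2. (\<i> * complex_of_real x)^k / fact k) = 1 + \<i> * complex_of_real x - complex_of_real y"
 proof -
  have "{..2::nat} = {0, 1, 2}" by auto
  then show ?thesis by (simp add: y_def power_mult_distrib)
 qed
 ultimately have a1: "cmod (iexp x - (1 + \<i> * complex_of_real x - complex_of_real y)) <= \<bar>x\<bar>^3 / 6"
  by (simp add: fact_numeral numeral_3_eq_3)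
 have e: "exp (- (complex_of_real x)\<^sup>2 / 2) = complex_of_real (1 - y + r)"
 proof -
  have "- (complex_of_real x)\<^sup>2 / 2 = complex_of_real (- y)" by (simp add: y_def)
  then show ?thesis by (simp only: exp_of_real) (simp add: r_def)
 qed
 have "(1 + \<i> * complex_of_real x - complex_of_real y) - (1 + \<i> * complex_of_real x) * exp (- (complex_of_real x)\<^sup>2 / 2)
  = \<i> * complex_of_real (x * y) - (1 + \<i> * complex_of_real x) * complex_of_real r"
  unfolding e by (simp add: algebra_simps)
 also have "cmod ... <= \<bar>x\<bar> * y + (1 + \<bar>x\<bar>) * r"
 proof -
  have "cmod (1 + \<i> * complex_of_real x) <= 1 + \<bar>x\<bar>"
  by (rule order_trans[OF norm_triangle_ineq]) (simp add: norm_mult)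
  then have "cmod ((1 + \<i> * complex_of_real x) * complex_of_real r) <= (1 + \<bar>x\<bar>) * r"
  using r0 by (simp add: norm_mult mult_right_mono)
  moreover have "cmod (\<i> * complex_of_real (x * y)) = \<bar>x\<bar> * y" using y0 by (simp add: norm_mult abs_mult)
  ultimately show ?thesis
  using norm_triangle_ineq4[of "\<i> * complex_of_real (x * y)" "(1 + \<i> * complex_of_real x) * complex_of_real r"] by linarith
 qed
 also have "... <= \<bar>x\<bar>^3 / 2 + \<bar>x\<bar>^3 / 2"
 proof (rule add_mono)
  have x3: "\<bar>x\<bar>^3 = \<bar>x\<bar> * x\<^sup>2" by (simp add: power3_eq_cube power2_eq_square)
  show "\<bar>x\<bar> * y <= \<bar>x\<bar>^3 / 2" unfolding y_def x3 by simp
  have "(1 + \<bar>x\<bar>) * r <= 2 * y\<^sup>2" using True r0 r1 by (intro mult_mono) simp_all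
  also have "2 * y\<^sup>2 = \<bar>x\<bar>^3 / 2 * \<bar>x\<bar>"
  unfolding x3 y_def by (simp add: power2_eq_square)
  also have "... <= \<bar>x\<bar>^3 / 2 * 1" using True by (intro mult_left_mono) simp_all
  finally show "(1 + \<bar>x\<bar>) * r <= \<bar>x\<bar>^3 / 2" by simp
 qed
 finally have a2: "cmod ((1 + \<i> * complex_of_real x - complex_of_real y) - (1 + \<i> * complex_of_real x) * exp (- (complex_of_real x)\<^sup>2 / 2)) <= \<bar>x\<bar>^3" by simp
 have "cmod (iexp x - (1 + \<i> * complex_of_real x) * exp (- (complex_of_real x)\<^sup>2 / 2)) <= \<bar>x\<bar>^3 / 6 + \<bar>x\<bar>^3"
  using norm_triangle_mono[OF a1 a2] by simp
 then show ?thesis using zero_le_power[of "\<bar>x\<bar>" 3] by linarith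
qed

lemma exp_neg_lipschitz:
 fixes a b c :: real
 assumes "0 <= a" "0 <= b" "0 <= c"
 shows "\<bar>exp (- c * a) - exp (- c * b)\<bar> <= c * \<bar>a - b\<bar>"
proof -
 have *: "exp (- c * a) - exp (- c * b) <= c * \<bar>a - b\<bar>" if "0 <= a" "0 <= b" for a b
 proof -
  have "exp (- c * a) - exp (- c * b) = exp (- c * a) * (1 - exp (- (c * (b - a))))"
  by (simp add: exp_add[symmetric] algebra_simps)
  also have "... <= exp (- c * a) * (c * \<bar>a - b\<bar>)"
  proof (rule mult_left_mono)
  have "1 - exp (- (c * (b - a))) <= c * (b - a)" using exp_ge_add_one_self[of "- (c * (b - a))"] by simp
  also have "... <= c * \<bar>a - b\<bar>" using assms(3) by (intro mult_left_mono) simp_all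
  finally show "1 - exp (- (c * (b - a))) <= c * \<bar>a - b\<bar>" .
  qed simp
  also have "... <= 1 * (c * \<bar>a - b\<bar>)" using that assms(3) by (intro mult_right_mono) simp_all
  finally show ?thesis by simp
 qed
 from *[OF assms(1,2)] *[OF assms(2,1)] show ?thesis by (simp add: abs_le_iff abs_minus_commute)
qed

text \<open>The widened window contains every translate by at most \<open>m\<close>, so the new
  range of summation is the same for all \<open>k\<close>.\<close>

lemma sum_shift_support:
 fixes f :: "int => 'b::comm_monoid_add"
 assumes k: "k : {- int m..int m}" and f: "!!s. f s ~= 0 ==> s : {1..int n}"
 shows "(SUM s:{1..int n}. f s) = (SUM s:{1 - int m..int n + int m}. f (s + k))"
proof -
 let ?I = "{1 - int m..int n + int m}"
 have "(SUM s:?I. f (s + k)) = (SUM s:(%s. s + k) ` ?I. f s)"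
  by (subst sum.reindex) (auto simp: inj_on_def)
 also have "... = (SUM s:{1..int n}. f s)"
 proof (rule sum.mono_neutral_right)
  show "{1..int n} \<subseteq> (%s. s + k) ` ?I"
  proof
  fix s assume "s : {1..int n}"
  then have "s - k : ?I" using k by auto
  then show "s : (%s. s + k) ` ?I" by force
  qed
  show "ALL i:(%s. s + k) ` ?I - {1..int n}. f i = 0" using f by blast
 qed simp
 finally show ?thesis ..
qed

context stationary_filtration
begin

text \<open>Multiplying by a further factor adds a term orthogonal to the past product, so the
  expectation stays 1. The induction runs over real and imaginary parts because \<open>bm\<close>
  and the orthogonality concern real functions; the product starts at \<open>lo\<close> so that its
  length can be the induction variable.\<close>

lemma martingale_product_expectation:
 fixes D :: "int => 'w => real" and t :: real and lo :: int
 assumes D: "!!s. bm s (D s)" and orth: "!!s g. bm (s - 1) g ==> (LINT z|M. D s z * g z) = 0"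
 defines "P L z \<equiv> PROD j<L. 1 + \<i> * complex_of_real (t * D (lo + int j) z)"
 shows "bm (lo + int L - 1) (%z. Re (P L z))" "bm (lo + int L - 1) (%z. Im (P L z))"
  "(LINT z|M. P L z) = 1"
proof -
 have "bm (lo + int L - 1) (%z. Re (P L z)) \<and> bm (lo + int L - 1) (%z. Im (P L z))
  \<and> (LINT z|M. Re (P L z)) = 1 \<and> (LINT z|M. Im (P L z)) = 0"
 proof (induction L)
  case 0
  show ?case by (simp add: P_def bm_const prob_space)
 next
  case (Suc L)
  let ?s = "lo + int L"
  have ReP: "bm (?s - 1) (%z. Re (P L z))" and ImP: "bm (?s - 1) (%z. Im (P L z))"
  and R1: "(LINT z|M. Re (P L z)) = 1" and I0: "(LINT z|M. Im (P L z)) = 0"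
  using Suc by simp_all
  have re: "Re (P (Suc L) z) = Re (P L z) + (- t) * (D ?s z * Im (P L z))"
  and im: "Im (P (Suc L) z) = Im (P L z) + t * (D ?s z * Re (P L z))" for z
  by (simp_all add: P_def algebra_simps)
  have bR: "bm ?s (%z. D ?s z * Re (P L z))" and bI: "bm ?s (%z. D ?s z * Im (P L z))"
  by (rule bm_mult[OF D bm_mono[OF ReP]], simp, rule bm_mult[OF D bm_mono[OF ImP]], simp)
  have bm1: "bm ?s (%z. Re (P (Suc L) z))" unfolding re
  by (rule bm_add[OF bm_mono[OF ReP] bm_mult[OF bm_const bI]]) simp
  have bm2: "bm ?s (%z. Im (P (Suc L) z))" unfolding im
  by (rule bm_add[OF bm_mono[OF ImP] bm_mult[OF bm_const bR]]) simp
  note int = L2_int[OF bm_L2]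
  have i1: "(LINT z|M. Re (P (Suc L) z)) = 1" unfolding re
  using int[OF ReP] int[OF bI] R1 orth[OF ImP] by simp
  have i2: "(LINT z|M. Im (P (Suc L) z)) = 0" unfolding im
  using int[OF ImP] int[OF bR] I0 orth[OF ReP] by simp
  have "lo + int (Suc L) - 1 = ?s" by simp
  then show ?case using bm1 bm2 i1 i2 by simp
 qed
 then show R: "bm (lo + int L - 1) (%z. Re (P L z))" and I: "bm (lo + int L - 1) (%z. Im (P L z))"
  and "(LINT z|M. P L z) = 1"
 proof -
  assume a: "bm (lo + int L - 1) (%z. Re (P L z)) \<and> bm (lo + int L - 1) (%z. Im (P L z))
  \<and> (LINT z|M. Re (P L z)) = 1 \<and> (LINT z|M. Im (P L z)) = 0"
  then show "bm (lo + int L - 1) (%z. Re (P L z))" "bm (lo + int L - 1) (%z. Im (P L z))" by simp_all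
  have "integrable M (%z. complex_of_real (Re (P L z)) + \<i> * complex_of_real (Im (P L z)))"
  using a by (intro Lint_add integrable_mult_right integrable_of_real
  L2_int[OF bm_L2]) blast+
  then have "integrable M (P L)" by (simp add: complex_eq[symmetric])
  then show "(LINT z|M. P L z) = 1" using a by (intro complex_eqI) simp_all
 qed
qed

text \<open>Grouping by the time \<open>s\<close> of the innovation instead of the time
  \<open>i\<close> of the observation gives martingale differences \<open>D n s\<close>. The
  character of their sum is close to the product \<open>P n\<close> times a Gaussian factor in the
  sum of squares \<open>V n\<close>; \<open>V n\<close> concentrates at its mean, which is the
  variance, and \<open>P n\<close> has mean 1. The conclusion is a difference because the variances
  need not converge here.\<close>

lemma bounded_ma_clt:
 fixes w :: "nat => int => real" and m :: nat and t :: real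
 assumes trivial: "filt_minus_infinity_trivial M T F0"
  and zt: "!!k. mdiff (zt k)" "!!k y. \<bar>zt k y\<bar> <= b"
  and supp: "!!n i. w n i ~= 0 ==> i : {1..int n}"
  and C: "!!n. (SUM i:{1..int n}. (w n i)\<^sup>2) <= C"
  and et: "!!n i. \<bar>w n i\<bar> <= et n" "et ----> 0"
 defines "S n y \<equiv> SUM i:{1..int n}. w n i * ma m zt i y"
 shows "(%n. (LINT y|M. iexp (t * S n y)) - exp (- (t\<^sup>2 / 2) * (nrm (S n))\<^sup>2)) ----> 0"
proof -
 let ?K = "{- int m..int m}"
 let ?I = "%n. {1 - int m..int n + int m}"
 define D where "D n s y = (SUM k:?K. w n (s + k) * zt k (sh s y))" for n s y
 define V where "V n y = (SUM s:?I n. (D n s y)\<^sup>2)" for n y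
 have b0: "0 <= b" using order_trans[OF abs_ge_zero zt(2)] .
 have et0: "0 <= et n" for n using order_trans[OF abs_ge_zero et(1)] .
 have z: "bm s (%y. zt k (sh s y))" for s k
 proof -
  have "bm 0 (zt k)" by (rule bmI[OF _ zt(2)]) (use zt(1)[of k] in \<open>simp add: mdiff_def\<close>)
  from bm_sh[OF this, of s] show ?thesis by simp
 qed
 have Dbm: "bm s (D n s)" for n s unfolding D_def[abs_def] by (intro bm_sum bm_mult bm_const z)
 have Dorth: "(LINT y|M. D n s y * g y) = 0" if g: "bm (s - 1) g" for n s g
 proof -
  have i: "integrable M (%y. w n (s + k) * (zt k (sh s y) * g y))" for k
  by (intro integrable_mult_right L2_integrable_mult bm_L2[OF z] bm_L2[OF g])
  have "(LINT y|M. D n s y * g y) = (LINT y|M. (SUM k:?K. w n (s + k) * (zt k (sh s y) * g y)))"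
  unfolding D_def sum_distrib_right by (simp only: mult.assoc)
  also have "... = (SUM k:?K. (LINT y|M. w n (s + k) * (zt k (sh s y) * g y)))"
  by (rule LINT_sum) (rule i)
  also have "... = 0" by (simp add: mdiff_bm_orth[OF zt(1) g])
  finally show ?thesis .
 qed
 have SD: "S n y = (SUM s:?I n. D n s y)" for n y
 proof -
  have "S n y = (SUM k:?K. SUM i:{1..int n}. w n i * zt k (sh (i - k) y))"
  unfolding S_def ma_def sum_distrib_left by (rule sum.swap)
  also have "... = (SUM k:?K. SUM s:?I n. w n (s + k) * zt k (sh s y))"
  proof (rule sum.cong[OF refl])
  fix k assume k: "k : ?K"
  have "(SUM i:{1..int n}. w n i * zt k (sh (i - k) y)) = (SUM s:?I n. w n (s + k) * zt k (sh (s + k - k) y))"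
  proof (rule sum_shift_support[OF k])
  fix s assume "w n s * zt k (sh (s - k) y) ~= 0"
  then have "w n s ~= 0" by auto
  then show "s : {1..int n}" by (rule supp)
  qed
  then show "(SUM i:{1..int n}. w n i * zt k (sh (i - k) y)) = (SUM s:?I n. w n (s + k) * zt k (sh s y))" by simp
  qed
  also have "... = (SUM s:?I n. D n s y)" unfolding D_def by (rule sum.swap)
  finally show ?thesis .
 qed
 have wk: "(SUM s:?I n. (w n (s + k))\<^sup>2) <= C" if k: "k : ?K" for n k
 proof -
  have "(SUM i:{1..int n}. (w n i)\<^sup>2) = (SUM s:?I n. (w n (s + k))\<^sup>2)"
  proof (rule sum_shift_support[OF k])
  fix s assume "(w n s)\<^sup>2 ~= 0"
  then have "w n s ~= 0" by auto
  then show "s : {1..int n}" by (rule supp)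
  qed
  then show ?thesis using C[of n] by simp
 qed
 have DL: "D n s : L2 M" for n s by (rule bm_L2[OF Dbm])
 have SL: "S n : L2 M" for n
 proof -
  have "S n = (%y. SUM s:?I n. D n s y)" using SD by (rule ext)
  then show ?thesis by (simp only:) (intro L2_sum DL)
 qed
 have EV: "(LINT y|M. V n y) = (nrm (S n))\<^sup>2" for n
 proof -
  have orth: "(LINT y|M. D n s y * D n u y) = 0" if "s ~= u" for s u
  proof (cases "u < s")
  case True
  show ?thesis by (rule Dorth, rule bm_mono[OF Dbm]) (use True in simp)
  next
  case False
  then have "s < u" using that by simp
  have "(LINT y|M. D n u y * D n s y) = 0" by (rule Dorth, rule bm_mono[OF Dbm]) (use \<open>s < u\<close> in simp)
  then show ?thesis by (simp only: mult.commute)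
  qed
  have "(nrm (%y. SUM s:?I n. D n s y))\<^sup>2 = (SUM s:?I n. (nrm (D n s))\<^sup>2)"
  by (rule orthogonal_sum_norm[OF _ DL orth]) simp
  moreover have "S n = (%y. SUM s:?I n. D n s y)" using SD by (rule ext)
  moreover have "(LINT y|M. V n y) = (SUM s:?I n. (nrm (D n s))\<^sup>2)"
  unfolding V_def L2_norm_power2 by (rule LINT_sum) (rule L2_integrable_sq[OF DL])
  ultimately show ?thesis by simp
 qed
 \<comment> \<open>One factor \<open>card ?K\<close> comes from the Cauchy-Schwarz inequality inside
   the square of \<open>D n s\<close>, the other from summing over the lags.\<close>
 define Cv where "Cv = real (card ?K) * (real (card ?K) * (b\<^sup>2 * C))"
 have VCv: "V n y <= Cv" for n y
 proof -
  have "V n y <= (SUM s:?I n. SUM k:?K. real (card ?K) * (b\<^sup>2 * (w n (s + k))\<^sup>2))"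
  unfolding V_def
  proof (rule sum_mono)
  fix s
  have "(D n s y)\<^sup>2 <= (SUM k:?K. (w n (s + k) * zt k (sh s y))\<^sup>2) * real (card ?K)"
  unfolding D_def by (rule sum_squared_le_sum_of_squares) 
  also have "... <= (SUM k:?K. b\<^sup>2 * (w n (s + k))\<^sup>2) * real (card ?K)"
  proof (rule mult_right_mono[OF sum_mono])
  fix k
  have "(zt k (sh s y))\<^sup>2 <= b\<^sup>2" using zt(2)[of k "sh s y"] b0 by (simp add: abs_le_square_iff[symmetric])
  then show "(w n (s + k) * zt k (sh s y))\<^sup>2 <= b\<^sup>2 * (w n (s + k))\<^sup>2"
  unfolding power_mult_distrib by (subst mult.commute) (rule mult_right_mono, simp_all)
  qed simp
  finally show "(D n s y)\<^sup>2 <= (SUM k:?K. real (card ?K) * (b\<^sup>2 * (w n (s + k))\<^sup>2))"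
  by (simp only: sum_distrib_left[symmetric] mult.commute)
  qed
  also have "... = (SUM k:?K. real (card ?K) * (b\<^sup>2 * (SUM s:?I n. (w n (s + k))\<^sup>2)))"
  unfolding sum_distrib_left by (rule sum.swap)
  also have "... <= (SUM k:?K. real (card ?K) * (b\<^sup>2 * C))"
  by (intro sum_mono mult_left_mono wk) simp_all
  also have "... = Cv" unfolding Cv_def by simp
  finally show ?thesis .
 qed
 have V0: "0 <= V n y" for n y unfolding V_def by (intro sum_nonneg) simp
 have Cv0: "0 <= Cv" using order_trans[OF V0 VCv] .
 define \<theta> where "\<theta> n = real (card ?K) * (et n * b)" for n
 have Db: "\<bar>D n s y\<bar> <= \<theta> n" for n s y
 proof -
  have "\<bar>D n s y\<bar> <= (SUM k:?K. \<bar>w n (s + k) * zt k (sh s y)\<bar>)" unfolding D_def by (rule sum_abs)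
  also have "... <= (SUM k:?K. et n * b)"
  unfolding abs_mult by (intro sum_mono mult_mono et(1) zt(2) et0 abs_ge_zero)
  finally show ?thesis unfolding \<theta>_def by simp
 qed
 have \<theta>lim: "\<theta> ----> 0"
 proof -
  have "(%n. real (card ?K) * (et n * b)) ----> real (card ?K) * (0 * b)" by (intro tendsto_intros et(2))
  then show ?thesis unfolding \<theta>_def[abs_def] by simp
 qed
 have VL: "V n : L2 M" for n
  unfolding V_def[abs_def] power2_eq_square
  by (rule L2_sum, rule bm_L2, rule bm_mult[OF Dbm Dbm])
 \<comment> \<open>For each pair of lags, \<open>V n\<close> contains a quadratic form with diagonal
   weights \<open>w n (s + k) * w n (s + l)\<close>; their squares sum to at most
   \<open>(et n)^2 * C\<close>.\<close>
 have Vlln: "(%n. nrm (%y. V n y - (LINT y|M. V n y))) ----> 0"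
 proof -
  define a where "a k l n s u = (if s = u then w n (s + k) * w n (s + l) else 0)" for k l n and s u :: int
  define X where "X k l n y = (SUM s:?I n. SUM u:?I n. a k l n s u * (zt k (sh s y) * zt l (sh u y)))" for k l n y
  have X: "X k l n : L2 M" "(%n. nrm (%y. X k l n y - (LINT y|M. X k l n y))) ----> 0"
  if kl: "k : ?K" "l : ?K" for k l n
  proof -
  have c1: "(SUM s:?I n. \<bar>a k l n s s\<bar>) <= C" for n
  proof -
  have "(SUM s:?I n. \<bar>a k l n s s\<bar>) <= (SUM s:?I n. (w n (s + k))\<^sup>2 / 2 + (w n (s + l))\<^sup>2 / 2)"
  proof (rule sum_mono)
  fix s
  have "0 <= (\<bar>w n (s + k)\<bar> - \<bar>w n (s + l)\<bar>)\<^sup>2" by simp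
  then show "\<bar>a k l n s s\<bar> <= (w n (s + k))\<^sup>2 / 2 + (w n (s + l))\<^sup>2 / 2"
  by (simp add: a_def abs_mult power2_diff)
  qed
  also have "... = (SUM s:?I n. (w n (s + k))\<^sup>2) / 2 + (SUM s:?I n. (w n (s + l))\<^sup>2) / 2"
  by (simp add: sum.distrib sum_divide_distrib)
  finally show ?thesis using wk[OF kl(1), of n] wk[OF kl(2), of n] by linarith
  qed
  have c2: "(%n. SUM s:?I n. SUM u:?I n. (a k l n s u)\<^sup>2) ----> 0"
  proof (rule null_comparison)
  have "(%n. (et n)\<^sup>2 * C) ----> 0\<^sup>2 * C" by (intro tendsto_intros et(2))
  then show "(%n. (et n)\<^sup>2 * C) ----> 0" by simp
  fix n
  have "(SUM s:?I n. SUM u:?I n. (a k l n s u)\<^sup>2) = (SUM s:?I n. (w n (s + k) * w n (s + l))\<^sup>2)"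
  proof (rule sum.cong[OF refl])
  fix s assume s: "s : ?I n"
  have "(SUM u:?I n. (a k l n s u)\<^sup>2) = (SUM u:?I n. if s = u then (w n (s + k) * w n (s + l))\<^sup>2 else 0)"
  by (rule sum.cong) (simp_all add: a_def)
  then show "(SUM u:?I n. (a k l n s u)\<^sup>2) = (w n (s + k) * w n (s + l))\<^sup>2" using s by simp
  qed
  also have "... <= (SUM s:?I n. (et n)\<^sup>2 * (w n (s + l))\<^sup>2)"
  unfolding power_mult_distrib
  by (intro sum_mono mult_right_mono) (simp_all add: abs_le_square_iff[symmetric] et(1) abs_of_nonneg[OF et0])
  also have "... <= (et n)\<^sup>2 * C"
  unfolding sum_distrib_left[symmetric] by (intro mult_left_mono wk kl) simp
  finally show "\<bar>SUM s:?I n. SUM u:?I n. (a k l n s u)\<^sup>2\<bar> <= (et n)\<^sup>2 * C"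
  by (subst abs_of_nonneg) (simp_all add: sum_nonneg)
  qed
  note res = mdiff_quadratic_form[where I = ?I and a = "a k l", OF trivial zt(1)[of k] zt(2) zt(1)[of l] zt(2)
  finite_atLeastAtMost_int c1 c2]
  show "X k l n : L2 M" unfolding X_def[abs_def] by (rule res(1))
  show "(%n. nrm (%y. X k l n y - (LINT y|M. X k l n y))) ----> 0" unfolding X_def[abs_def] by (rule res(2))
  qed
  have VX: "V n y = (SUM k:?K. SUM l:?K. X k l n y)" for n y
  proof -
  let ?g = "%k l s. (w n (s + k) * w n (s + l)) * (zt k (sh s y) * zt l (sh s y))"
  have "V n y = (SUM s:?I n. SUM k:?K. SUM l:?K. ?g k l s)"
  unfolding V_def D_def power2_eq_square sum_product by (simp only: mult_ac)
  also have "... = (SUM k:?K. SUM s:?I n. SUM l:?K. ?g k l s)" by (rule sum.swap)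
  also have "... = (SUM k:?K. SUM l:?K. SUM s:?I n. ?g k l s)" by (rule sum.cong[OF refl], rule sum.swap)
  also have "... = (SUM k:?K. SUM l:?K. X k l n y)"
  proof (intro sum.cong refl)
  fix k l
  show "(SUM s:?I n. ?g k l s) = X k l n y"
  unfolding X_def
  proof (rule sum.cong[OF refl])
  fix s assume s: "s : ?I n"
  have "(SUM u:?I n. a k l n s u * (zt k (sh s y) * zt l (sh u y))) = (SUM u:?I n. if s = u then ?g k l s else 0)"
  by (rule sum.cong) (simp_all add: a_def)
  then show "?g k l s = (SUM u:?I n. a k l n s u * (zt k (sh s y) * zt l (sh u y)))" using s by simp
  qed
  qed
  finally show ?thesis .
  qed
  have bound: "nrm (%y. V n y - (LINT y|M. V n y))
  <= (SUM k:?K. SUM l:?K. nrm (%y. X k l n y - (LINT y|M. X k l n y)))" for n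
  proof -
  have Xi: "integrable M (X k l n)" if "k : ?K" "l : ?K" for k l
  by (rule L2_int[OF X(1)[OF that]])
  have e1: "(LINT y|M. V n y) = (SUM k:?K. (LINT y|M. (SUM l:?K. X k l n y)))"
  unfolding VX by (rule LINT_sum, rule Lint_sum, rule Xi)
  have e2: "(SUM k:?K. (LINT y|M. (SUM l:?K. X k l n y))) = (SUM k:?K. SUM l:?K. (LINT y|M. X k l n y))"
  by (rule sum.cong[OF refl], rule LINT_sum, rule Xi)
  have L: "(%y. X k l n y - (LINT y|M. X k l n y)) : L2 M" if "k : ?K" "l : ?K" for k l
  by (intro L2_diff X(1)[OF that] bm_L2[OF bm_const])
  have "nrm (%y. V n y - (LINT y|M. V n y))
  = nrm (%y. SUM k:?K. SUM l:?K. X k l n y - (LINT y|M. X k l n y))"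
  unfolding e1 e2 unfolding VX sum_subtractf ..
  also have "... <= (SUM k:?K. nrm (%y. SUM l:?K. X k l n y - (LINT y|M. X k l n y)))"
  by (rule L2_norm_sum_le, rule L2_sum, rule L)
  also have "... <= (SUM k:?K. SUM l:?K. nrm (%y. X k l n y - (LINT y|M. X k l n y)))"
  by (rule sum_mono, rule L2_norm_sum_le, rule L)
  finally show ?thesis .
  qed
  have "(%n. SUM k:?K. SUM l:?K. nrm (%y. X k l n y - (LINT y|M. X k l n y))) ----> (SUM k:?K. SUM l:?K. 0)"
  by (rule tendsto_sum, rule tendsto_sum, rule X(2))
  then have lim: "(%n. SUM k:?K. SUM l:?K. nrm (%y. X k l n y - (LINT y|M. X k l n y))) ----> 0" by simp
  show ?thesis by (rule null_comparison[OF lim]) (simp only: abs_of_nonneg L2_norm_nonneg bound)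
 qed
 define v where "v n = (LINT y|M. V n y)" for n
 have v0: "0 <= v n" for n unfolding v_def by (rule Bochner_Integration.integral_nonneg) (rule V0)
 define P where "P n y = (PROD s:?I n. 1 + \<i> * complex_of_real (t * D n s y))" for n y
 have Preindex: "P n y = (PROD j<nat (int n + 2 * int m). 1 + \<i> * complex_of_real (t * D n (1 - int m + int j) y))" for n y
 proof -
  have "bij_betw (%j. 1 - int m + int j) {..<nat (int n + 2 * int m)} (?I n)"
  by (rule bij_betwI[where g = "%s. nat (s - (1 - int m))"]) auto
  from prod.reindex_bij_betw[OF this, of "%s. 1 + \<i> * complex_of_real (t * D n s y)"]
  show ?thesis unfolding P_def by (rule sym)
 qed
 have Pint: "(LINT y|M. P n y) = 1" for n
  unfolding Preindex by (rule martingale_product_expectation(3)[OF Dbm Dorth])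
 have Dm [measurable]: "D n s : borel_measurable M" for n s by (rule bm_measurable[OF Dbm])
 have Pm [measurable]: "P n : borel_measurable M" for n unfolding P_def[abs_def] by measurable
 have Vm [measurable]: "V n : borel_measurable M" for n by (rule L2_measurable[OF VL])
 have Sm [measurable]: "S n : borel_measurable M" for n by (rule L2_measurable[OF SL])
 have Pbound: "cmod (P n y) <= exp (t\<^sup>2 / 2 * Cv)" for n y
 proof -
  have "cmod (P n y) = (PROD s:?I n. cmod (1 + \<i> * complex_of_real (t * D n s y)))"
  unfolding P_def by (simp add: prod_norm)
  also have "... <= (PROD s:?I n. exp (t\<^sup>2 / 2 * (D n s y)\<^sup>2))"
  proof (rule prod_mono, intro conjI norm_ge_zero)
  fix s
  let ?x = "t * D n s y"
  have "(cmod (1 + \<i> * complex_of_real ?x))\<^sup>2 = 1 + ?x\<^sup>2" by (simp add: cmod_power2 del: of_real_mult)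
  also have "... <= exp (?x\<^sup>2)" by (rule exp_ge_add_one_self)
  also have "... = (exp (t\<^sup>2 / 2 * (D n s y)\<^sup>2))\<^sup>2" by (simp add: exp_double[symmetric] power_mult_distrib)
  finally show "cmod (1 + \<i> * complex_of_real ?x) <= exp (t\<^sup>2 / 2 * (D n s y)\<^sup>2)" by (rule power2_le_imp_le) simp
  qed
  also have "... = exp (t\<^sup>2 / 2 * V n y)" unfolding V_def by (simp add: exp_sum sum_distrib_left)
  also have "... <= exp (t\<^sup>2 / 2 * Cv)" by (simp add: mult_left_mono VCv)
  finally show ?thesis .
 qed
 \<comment> \<open>The cubic errors sum to at most a multiple of the largest difference
   \<open>\<theta> n\<close> times the sum of squares, so only \<open>\<theta> n\<close> has to
   vanish.\<close>
 have step1: "cmod (iexp (t * S n y) - P n y * complex_of_real (exp (- (t\<^sup>2 / 2) * V n y))) <= 2 * \<bar>t\<bar>^3 * (\<theta> n * Cv)" for n y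
 proof -
  let ?x = "%s. t * D n s y"
  let ?z = "%s. (1 + \<i> * complex_of_real (?x s)) * exp (- (complex_of_real (?x s))\<^sup>2 / 2)"
  have e1: "iexp (t * S n y) = (PROD s:?I n. iexp (?x s))"
  unfolding SD by (simp add: exp_sum sum_distrib_left)
  have e2: "P n y * complex_of_real (exp (- (t\<^sup>2 / 2) * V n y)) = (PROD s:?I n. ?z s)"
  proof -
  have "complex_of_real (exp (- (t\<^sup>2 / 2) * V n y)) = (PROD s:?I n. exp (- (complex_of_real (?x s))\<^sup>2 / 2))"
  unfolding V_def by (simp add: exp_of_real[symmetric] exp_sum[symmetric] sum_distrib_left power_mult_distrib sum_negf)
  then show ?thesis unfolding P_def prod.distrib by simp
  qed
  have "cmod ((PROD s:?I n. iexp (?x s)) - (PROD s:?I n. ?z s)) <= (SUM s:?I n. cmod (iexp (?x s) - ?z s))"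
  by (rule norm_prod_diff) (simp, rule norm_gaussian_factor_le_1)
  also have "... <= (SUM s:?I n. 2 * \<bar>?x s\<bar>^3)" by (rule sum_mono) (rule iexp_gaussian_factor)
  also have "... <= (SUM s:?I n. 2 * \<bar>t\<bar>^3 * (\<theta> n * (D n s y)\<^sup>2))"
  proof (rule sum_mono)
  fix s
  have "\<bar>D n s y\<bar>^3 = \<bar>D n s y\<bar> * (D n s y)\<^sup>2" by (simp add: power3_eq_cube power2_eq_square)
  also have "... <= \<theta> n * (D n s y)\<^sup>2" by (rule mult_right_mono[OF Db]) simp
  finally have "2 * \<bar>t\<bar>^3 * \<bar>D n s y\<bar>^3 <= 2 * \<bar>t\<bar>^3 * (\<theta> n * (D n s y)\<^sup>2)" by (rule mult_left_mono) simp
  then show "2 * \<bar>?x s\<bar>^3 <= 2 * \<bar>t\<bar>^3 * (\<theta> n * (D n s y)\<^sup>2)" by (simp add: abs_mult power_mult_distrib)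
  qed
  also have "... = 2 * \<bar>t\<bar>^3 * (\<theta> n * V n y)" unfolding V_def by (simp add: sum_distrib_left)
  also have "... <= 2 * \<bar>t\<bar>^3 * (\<theta> n * Cv)"
  using order_trans[OF abs_ge_zero Db[of n]] by (intro mult_left_mono VCv) simp_all
  finally show ?thesis unfolding e1 e2 .
 qed
 have total: "cmod ((LINT y|M. iexp (t * S n y)) - exp (- (t\<^sup>2 / 2) * v n))
  <= 2 * \<bar>t\<bar>^3 * (\<theta> n * Cv) + exp (t\<^sup>2 / 2 * Cv) * (t\<^sup>2 / 2 * nrm (%y. V n y - v n))" for n
 proof -
  let ?E = "%u. complex_of_real (exp (- (t\<^sup>2 / 2) * u))"
  have E1: "exp (- (t\<^sup>2 / 2) * u) <= 1" if "0 <= u" for u :: real using that by simp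
  have bP: "cmod (P n y * ?E u) <= exp (t\<^sup>2 / 2 * Cv)" if "0 <= u" for u y
  using mult_mono[OF Pbound E1[OF that], of n y] by (simp add: norm_mult)
  have i1: "integrable M (%y. iexp (t * S n y))"
  by (rule integrable_const_bound[where B = 1]) (simp_all del: of_real_mult)
  have i2: "integrable M (%y. P n y * ?E (V n y))"
  by (rule integrable_const_bound[where B = "exp (t\<^sup>2 / 2 * Cv)"], rule AE_I2, rule bP[OF V0]) measurable
  have i3: "integrable M (%y. P n y * ?E (v n))"
  by (rule integrable_const_bound[where B = "exp (t\<^sup>2 / 2 * Cv)"], rule AE_I2, rule bP[OF v0]) measurable
  have E3: "(LINT y|M. P n y * ?E (v n)) = ?E (v n)" by (simp only: integral_mult_left_zero Pint mult_1)
  have "(LINT y|M. iexp (t * S n y)) - ?E (v n)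
  = (LINT y|M. iexp (t * S n y) - P n y * ?E (V n y)) + (LINT y|M. P n y * ?E (V n y) - P n y * ?E (v n))"
  using i1 i2 i3 E3 by (simp only: LINT_diff) simp
  then have split: "cmod ((LINT y|M. iexp (t * S n y)) - ?E (v n))
  <= cmod (LINT y|M. iexp (t * S n y) - P n y * ?E (V n y))
  + cmod (LINT y|M. P n y * ?E (V n y) - P n y * ?E (v n))"
  by (simp only: norm_triangle_ineq)
  have n1: "cmod (LINT y|M. iexp (t * S n y) - P n y * ?E (V n y)) <= 2 * \<bar>t\<bar>^3 * (\<theta> n * Cv)"
  proof -
  have "cmod (LINT y|M. iexp (t * S n y) - P n y * ?E (V n y)) <= (LINT y|M. cmod (iexp (t * S n y) - P n y * ?E (V n y)))"
  by (rule integral_norm_bound)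
  also have "... <= (LINT y|M. 2 * \<bar>t\<bar>^3 * (\<theta> n * Cv))"
  by (rule integral_mono[OF integrable_norm[OF Lint_diff[OF i1 i2]] _ step1]) simp
  finally show ?thesis by (simp add: prob_space)
  qed
  have n2: "cmod (LINT y|M. P n y * ?E (V n y) - P n y * ?E (v n))
  <= exp (t\<^sup>2 / 2 * Cv) * (t\<^sup>2 / 2 * nrm (%y. V n y - v n))"
  proof -
  have VvL: "(%y. V n y - v n) : L2 M" by (intro L2_diff VL bm_L2[OF bm_const])
  have iV: "integrable M (%y. \<bar>V n y - v n\<bar>)" by (rule integrable_abs[OF L2_int[OF VvL]])
  have "cmod (LINT y|M. P n y * ?E (V n y) - P n y * ?E (v n)) <= (LINT y|M. cmod (P n y * ?E (V n y) - P n y * ?E (v n)))"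
  by (rule integral_norm_bound)
  also have "... <= (LINT y|M. exp (t\<^sup>2 / 2 * Cv) * (t\<^sup>2 / 2 * \<bar>V n y - v n\<bar>))"
  proof (rule integral_mono[OF integrable_norm[OF Lint_diff[OF i2 i3]]])
  fix y
  have "cmod (P n y * ?E (V n y) - P n y * ?E (v n)) = cmod (P n y) * \<bar>exp (- (t\<^sup>2 / 2) * V n y) - exp (- (t\<^sup>2 / 2) * v n)\<bar>"
  unfolding right_diff_distrib[symmetric] norm_mult of_real_diff[symmetric] norm_of_real ..
  also have "... <= exp (t\<^sup>2 / 2 * Cv) * (t\<^sup>2 / 2 * \<bar>V n y - v n\<bar>)"
  by (intro mult_mono Pbound exp_neg_lipschitz V0 v0) simp_all
  finally show "cmod (P n y * ?E (V n y) - P n y * ?E (v n)) <= exp (t\<^sup>2 / 2 * Cv) * (t\<^sup>2 / 2 * \<bar>V n y - v n\<bar>)" .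
  qed (use iV in simp)
  also have "... = exp (t\<^sup>2 / 2 * Cv) * (t\<^sup>2 / 2 * (LINT y|M. \<bar>V n y - v n\<bar>))" by simp
  also have "... <= exp (t\<^sup>2 / 2 * Cv) * (t\<^sup>2 / 2 * nrm (%y. V n y - v n))"
  by (intro mult_left_mono expectation_abs_le_L2_norm VvL) simp_all
  finally show ?thesis .
  qed
  have "cmod ((LINT y|M. iexp (t * S n y)) - ?E (v n))
  <= 2 * \<bar>t\<bar>^3 * (\<theta> n * Cv) + exp (t\<^sup>2 / 2 * Cv) * (t\<^sup>2 / 2 * nrm (%y. V n y - v n))"
  using split n1 n2 by linarith
  then show ?thesis by (simp add: exp_of_real)
 qed
 have "(%n. 2 * \<bar>t\<bar>^3 * (\<theta> n * Cv) + exp (t\<^sup>2 / 2 * Cv) * (t\<^sup>2 / 2 * nrm (%y. V n y - v n)))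
  ----> 2 * \<bar>t\<bar>^3 * (0 * Cv) + exp (t\<^sup>2 / 2 * Cv) * (t\<^sup>2 / 2 * 0)"
  unfolding v_def by (intro tendsto_add tendsto_mult tendsto_const \<theta>lim Vlln)
 then have lim: "(%n. 2 * \<bar>t\<bar>^3 * (\<theta> n * Cv) + exp (t\<^sup>2 / 2 * Cv) * (t\<^sup>2 / 2 * nrm (%y. V n y - v n))) ----> 0" by simp
 have "(%n. (LINT y|M. iexp (t * S n y)) - exp (- (t\<^sup>2 / 2) * v n)) ----> 0"
  by (rule Lim_null_comparison[OF always_eventually[OF allI[OF total]] lim])
 then show ?thesis unfolding v_def EV by (simp add: exp_of_real)
qed

end

context hannan_process
begin

section \<open>Transfer of the central limit theorem to the errors\<close>

lemma eps_sum_L2: "(%z. SUM i:I. a i * eps i z) : L2 M"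
 by (intro L2_sum L2_cmult eps_L2)

lemma iexp_diff_norm: "cmod (iexp x - iexp y) <= \<bar>x - y\<bar>"
proof -
 have "iexp x - iexp y = iexp y * (iexp (x - y) - 1)"
  by (simp add: right_diff_distrib exp_add[symmetric] of_real_diff algebra_simps)
 then have "cmod (iexp x - iexp y) = cmod (iexp (x - y) - 1)" by (simp only: norm_mult norm_exp_i_times mult_1)
 also have "... <= \<bar>x - y\<bar>" using iexp_approx1[of "x - y" 0] by simp
 finally show ?thesis .
qed

lemma expectation_iexp_diff:
 assumes X: "X : L2 M" and Y: "Y : L2 M"
 shows "cmod ((LINT z|M. iexp (t * X z)) - (LINT z|M. iexp (t * Y z))) <= \<bar>t\<bar> * nrm (%z. X z - Y z)"
proof -
 have i: "integrable M (%z. iexp (t * Z z))" if "Z : L2 M" for Z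
 proof (rule integrable_const_bound[where B = 1])
  note [measurable] = L2_measurable[OF that]
  show "(%z. iexp (t * Z z)) : borel_measurable M" by measurable
 qed (simp del: of_real_mult)
 have XY: "(%z. X z - Y z) : L2 M" by (rule L2_diff[OF X Y])
 have "cmod ((LINT z|M. iexp (t * X z)) - (LINT z|M. iexp (t * Y z))) = cmod (LINT z|M. iexp (t * X z) - iexp (t * Y z))"
  using i[OF X] i[OF Y] by (simp only: LINT_diff)
 also have "... <= (LINT z|M. cmod (iexp (t * X z) - iexp (t * Y z)))" by (rule integral_norm_bound)
 also have "... <= (LINT z|M. \<bar>t\<bar> * \<bar>X z - Y z\<bar>)"
 proof (rule integral_mono[OF integrable_norm[OF Lint_diff[OF i[OF X] i[OF Y]]]])
  show "integrable M (%z. \<bar>t\<bar> * \<bar>X z - Y z\<bar>)"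
  by (intro integrable_mult_right integrable_abs L2_int[OF XY])
  fix z show "cmod (iexp (t * X z) - iexp (t * Y z)) <= \<bar>t\<bar> * \<bar>X z - Y z\<bar>"
  using iexp_diff_norm[of "t * X z" "t * Y z"] unfolding right_diff_distrib[symmetric] abs_mult .
 qed
 also have "... = \<bar>t\<bar> * (LINT z|M. \<bar>X z - Y z\<bar>)" by simp
 also have "... <= \<bar>t\<bar> * nrm (%z. X z - Y z)" by (intro mult_left_mono expectation_abs_le_L2_norm XY) simp
 finally show ?thesis .
qed

text \<open>The norm inequality makes the error of replacing the errors by a bounded moving average
  uniform in n, for the characteristic function and for the variance alike; so \<open>dl\<close> can
  be fixed before n grows.\<close>

theorem weighted_clt:
 fixes w :: "nat => int => real"
 assumes supp: "!!n i. w n i ~= 0 ==> i : {1..int n}"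
  and C: "!!n. (SUM i:{1..int n}. (w n i)\<^sup>2) <= C"
  and et: "!!n i. \<bar>w n i\<bar> <= et n" "et ----> 0"
  and var: "(%n. (nrm (%z. SUM i:{1..int n}. w n i * eps i z))\<^sup>2) ----> \<sigma>2"
 shows "(%n. (LINT z|M. iexp (t * (SUM i:{1..int n}. w n i * eps i z)))) ----> exp (- (t\<^sup>2 / 2) * \<sigma>2)"
proof -
 define S where "S n z = (SUM i:{1..int n}. w n i * eps i z)" for n z
 have SL: "S n : L2 M" for n unfolding S_def[abs_def] by (rule eps_sum_L2)
 have C0: "0 <= C" by (rule order_trans[OF sum_nonneg C[of 0]]) simp
 have Sn: "nrm (S n) <= hannan_sum * sqrt C" for n
  unfolding S_def[abs_def]
  by (rule order_trans[OF sum_eps_norm]) (simp, intro mult_left_mono real_sqrt_le_mono C hannan_sum_nonneg)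
 have "(%n. (LINT z|M. iexp (t * S n z)) - exp (- (t\<^sup>2 / 2) * (nrm (S n))\<^sup>2)) ----> 0"
 proof (rule LIMSEQ_I)
  fix r :: real assume r: "r > 0"
  \<comment> \<open>\<open>dl * B\<close> collects the replacement errors: the first summand for the
    characteristic function, the second for the difference of the two variances in the Gaussian
    exponent.\<close>
  define B where "B = \<bar>t\<bar> * sqrt C + t\<^sup>2 / 2 * (sqrt C * (2 * (hannan_sum * sqrt C) + sqrt C))"
  have B0: "0 <= B" unfolding B_def using C0 hannan_sum_nonneg by simp
  define dl where "dl = min 1 (r / (2 * (B + 1)))"
  have dl: "dl > 0" "dl <= 1" unfolding dl_def using r B0 by simp_all
  have dlB: "dl * B < r / 2"
  proof -
  have "dl * B <= r / (2 * (B + 1)) * B" unfolding dl_def using B0 by (intro mult_right_mono) simp_all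
  also have "... < r / 2" using r B0 by (simp add: divide_simps)
  finally show ?thesis .
  qed
  from bounded_ma_approximation_ex[OF dl(1)]
  obtain m zt b where P: "(ALL k. mdiff (zt k)) \<and> (ALL k z. \<bar>zt k z\<bar> <= b) \<and> 
  (ALL I a. finite I --> nrm (%z. SUM i:I. a i * (eps i z - ma m zt i z)) <= dl * sqrt (SUM i:I. (a i)\<^sup>2))"
  by (elim exE)
  have zt: "mdiff (zt k)" "\<bar>zt k z\<bar> <= b" for k z using P by blast+
  have approx: "finite I ==> nrm (%z. SUM i:I. a i * (eps i z - ma m zt i z)) <= dl * sqrt (SUM i:I. (a i)\<^sup>2)" for I a
  using P by blast
  define R where "R n z = (SUM i:{1..int n}. w n i * ma m zt i z)" for n z
  have RL: "R n : L2 M" for n unfolding R_def[abs_def] by (intro L2_sum L2_cmult ma_L2 mdiff_L2 zt)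
  have diff: "nrm (%z. S n z - R n z) <= dl * sqrt C" for n
  proof -
  have "(%z. S n z - R n z) = (%z. SUM i:{1..int n}. w n i * (eps i z - ma m zt i z))"
  unfolding S_def R_def by (simp add: right_diff_distrib sum_subtractf)
  then show ?thesis
  using approx[of "{1..int n}" "w n"] mult_left_mono[OF real_sqrt_le_mono[OF C[of n]] less_imp_le[OF dl(1)]] by simp
  qed
  have clt: "(%n. (LINT z|M. iexp (t * R n z)) - exp (- (t\<^sup>2 / 2) * (nrm (R n))\<^sup>2)) ----> 0"
  using bounded_ma_clt[OF trivial_past zt(1,2) supp C et, where m = m and t = t] unfolding R_def[abs_def] .
  obtain n0 where n0: "!!n. n >= n0 ==> cmod ((LINT z|M. iexp (t * R n z)) - exp (- (t\<^sup>2 / 2) * (nrm (R n))\<^sup>2)) < r / 2"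
  using LIMSEQ_D[OF clt, of "r / 2"] r by auto
  have "cmod ((LINT z|M. iexp (t * S n z)) - exp (- (t\<^sup>2 / 2) * (nrm (S n))\<^sup>2)) < r" if n: "n >= n0" for n
  proof -
  let ?s = "nrm (S n)" and ?r = "nrm (R n)"
  have d1: "cmod ((LINT z|M. iexp (t * S n z)) - (LINT z|M. iexp (t * R n z))) <= \<bar>t\<bar> * (dl * sqrt C)"
  by (rule order_trans[OF expectation_iexp_diff[OF SL RL]]) (intro mult_left_mono diff abs_ge_zero)
  have d2: "\<bar>?s - ?r\<bar> <= dl * sqrt C"
  using L2_norm_le_add_diff[OF SL RL, of n n] L2_norm_le_add_diff[OF RL SL, of n n] diff[of n]
  L2_norm_minus_commute[of M "R n" "S n"] by linarith
  have "dl * sqrt C <= sqrt C" using dl(2) C0 by (simp add: mult_left_le_one_le less_imp_le[OF dl(1)])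
  then have sr: "?s + ?r <= 2 * (hannan_sum * sqrt C) + sqrt C" using Sn[of n] d2 by linarith
  have d3: "\<bar>?s\<^sup>2 - ?r\<^sup>2\<bar> <= dl * (sqrt C * (2 * (hannan_sum * sqrt C) + sqrt C))"
  proof -
  have "\<bar>?s\<^sup>2 - ?r\<^sup>2\<bar> = \<bar>?s - ?r\<bar> * (?s + ?r)"
  proof -
  have "?s\<^sup>2 - ?r\<^sup>2 = (?s - ?r) * (?s + ?r)" by (simp add: power2_eq_square algebra_simps)
  then show ?thesis by (simp add: abs_mult)
  qed
  also have "... <= (dl * sqrt C) * (2 * (hannan_sum * sqrt C) + sqrt C)"
  by (intro mult_mono d2 sr) (use dl(1) C0 in simp_all)
  finally show ?thesis by (simp only: mult.assoc)
  qed
  have d4: "\<bar>exp (- (t\<^sup>2 / 2) * ?s\<^sup>2) - exp (- (t\<^sup>2 / 2) * ?r\<^sup>2)\<bar> <= t\<^sup>2 / 2 * (dl * (sqrt C * (2 * (hannan_sum * sqrt C) + sqrt C)))"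
  by (rule order_trans[OF exp_neg_lipschitz]) (simp_all add: mult_left_mono d3)
  have d5: "cmod (complex_of_real (exp (- (t\<^sup>2 / 2) * ?s\<^sup>2)) - complex_of_real (exp (- (t\<^sup>2 / 2) * ?r\<^sup>2)))
  <= t\<^sup>2 / 2 * (dl * (sqrt C * (2 * (hannan_sum * sqrt C) + sqrt C)))"
  unfolding of_real_diff[symmetric] norm_of_real by (rule d4)
  let ?A = "(LINT z|M. iexp (t * S n z))" and ?B = "(LINT z|M. iexp (t * R n z))"
  let ?a = "complex_of_real (exp (- (t\<^sup>2 / 2) * ?s\<^sup>2))" and ?b = "complex_of_real (exp (- (t\<^sup>2 / 2) * ?r\<^sup>2))"
  have tri: "cmod (P + (Q - R)) <= cmod P + (cmod Q + cmod R)" for P Q R :: complex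
  by (rule order_trans[OF norm_triangle_ineq add_left_mono[OF norm_triangle_ineq4]])
  have "?A - ?a = (?A - ?B) + ((?B - ?b) - (?a - ?b))" by simp
  then have "cmod (?A - ?a) <= cmod (?A - ?B) + (cmod (?B - ?b) + cmod (?a - ?b))"
  using tri[of "?A - ?B" "?B - ?b" "?a - ?b"] by (simp only:)
  moreover have "cmod (?B - ?b) < r / 2" using n0[OF n] by (simp add: exp_of_real)
  moreover have "\<bar>t\<bar> * (dl * sqrt C) + t\<^sup>2 / 2 * (dl * (sqrt C * (2 * (hannan_sum * sqrt C) + sqrt C))) = dl * B"
  unfolding B_def by (simp add: algebra_simps)
  ultimately have "cmod (?A - ?a) < r" using d1 d5 dlB by linarith
  then show ?thesis by (simp add: exp_of_real)
  qed
  then show "EX no. ALL n>=no. cmod ((LINT z|M. iexp (t * S n z)) - exp (- (t\<^sup>2 / 2) * (nrm (S n))\<^sup>2) - 0) < r"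
  by auto
 qed
 moreover have "(%n. complex_of_real (exp (- (t\<^sup>2 / 2) * (nrm (S n))\<^sup>2))) ----> complex_of_real (exp (- (t\<^sup>2 / 2) * \<sigma>2))"
  using var unfolding S_def[abs_def] by (intro tendsto_of_real tendsto_exp tendsto_mult tendsto_const)
 ultimately have "(%n. ((LINT z|M. iexp (t * S n z)) - exp (- (t\<^sup>2 / 2) * (nrm (S n))\<^sup>2))
  + complex_of_real (exp (- (t\<^sup>2 / 2) * (nrm (S n))\<^sup>2))) ----> 0 + complex_of_real (exp (- (t\<^sup>2 / 2) * \<sigma>2))"
  by (rule tendsto_add)
 then show ?thesis unfolding S_def by simp
qed

end

section \<open>Kernels with integrable Fourier transform\<close>

lemma admissible_kernel_bounds:
 assumes "admissible_kernel K"
 obtains B L where "0 <= B" "0 <= L" "!!u. \<bar>K u\<bar> <= B" "!!u. \<bar>u\<bar> > L ==> K u = 0"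
proof -
 have cont: "continuous_on UNIV K" and cpt: "compact (closure {u. K u ~= 0})"
  using assms by (auto simp: admissible_kernel_def)
 have "EX L0. ALL u:closure {u. K u ~= 0}. norm u <= L0" using compact_imp_bounded[OF cpt] unfolding bounded_iff .
 then obtain L0 where L0: "ALL u:closure {u. K u ~= 0}. norm u <= L0" ..
 define L where "L = max L0 0"
 have zero: "K u = 0" if "\<bar>u\<bar> > L" for u
 proof (rule ccontr)
  assume "K u ~= 0"
  then have "u : closure {u. K u ~= 0}" by (intro subsetD[OF closure_subset]) simp
  from bspec[OF L0 this] have "norm u <= L0" .
  then show False using that unfolding L_def by simp
 qed
 have "compact (K ` {-L..L})" by (rule compact_continuous_image[OF continuous_on_subset[OF cont]]) simp_all
 from compact_imp_bounded[OF this] obtain B0 where "ALL y:K ` {-L..L}. norm y <= B0" unfolding bounded_iff ..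
 then have B0: "\<bar>K u\<bar> <= B0" if "u : {-L..L}" for u using that by simp
 have "\<bar>K u\<bar> <= max B0 0" for u
 proof (cases "\<bar>u\<bar> > L")
  case True then show ?thesis using zero by simp
 next
  case False
  then have "u : {-L..L}" by auto
  from B0[OF this] show ?thesis by simp
 qed
 with zero show ?thesis using that[of "max B0 0" L] unfolding L_def by auto
qed

text \<open>The Gaussian density is, up to a constant, its own Fourier transform; this form lets it
  be exchanged for a cosine integral.\<close>

lemma std_normal_density_cos:
 "std_normal_density w = (1 / sqrt (2 * pi)) * (LINT t|lborel. std_normal_density t * cos (w * t))"
proof -
 have "char std_normal_distribution w = (LINT t|lborel. std_normal_density t *\<^sub>R iexp (w * t))"
  unfolding char_def by (rule integral_density) auto
 moreover have "integrable lborel (%t. std_normal_density t *\<^sub>R iexp (w * t))"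
  by (rule Lint_bound[OF integrable_normal_density[of 1 0]]) auto
 then have "Re (LINT t|lborel. std_normal_density t *\<^sub>R iexp (w * t)) = (LINT t|lborel. std_normal_density t * cos (w * t))"
  by (subst integral_Re[symmetric]) (simp_all add: Re_exp)
 moreover have "Re (char std_normal_distribution w) = exp (- (w\<^sup>2) / 2)"
  unfolding char_std_normal_distribution by (simp only: Re_complex_of_real)
 ultimately have "(LINT t|lborel. std_normal_density t * cos (w * t)) = exp (- (w\<^sup>2) / 2)" by (simp only:)
 then show ?thesis unfolding std_normal_density_def by simp
qed

context
 fixes K :: "real => real"
 assumes K: "admissible_kernel K"
begin

lemma kernel_measurable [measurable]: "K : borel_measurable borel"
 using K unfolding admissible_kernel_def by (intro borel_measurable_continuous_onI) blast

lemma kernel_integrable: "integrable lborel K"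
proof -
 obtain B L where B: "0 <= B" "0 <= L" "!!u. \<bar>K u\<bar> <= B" "!!u. \<bar>u\<bar> > L ==> K u = 0"
  using admissible_kernel_bounds[OF K] by blast
 show ?thesis
 proof (rule Lint_bound[where f = "%u. B * indicator {-L..L} u"])
  show "integrable lborel (%u. B * indicator {-L..L} u :: real)"
  by (intro integrable_mult_right integrable_real_indicator) (simp_all add: B(2) emeasure_lborel_Icc_eq)
  show "AE u in lborel. norm (K u) <= norm (B * indicator {-L..L} u)"
  proof (rule AE_I2)
  fix u show "norm (K u) <= norm (B * indicator {-L..L} u)"
  using B(1) B(3)[of u] B(4)[of u] by (cases "\<bar>u\<bar> > L") (auto simp: indicator_def)
  qed
 qed simp
qed

text \<open>The Fourier transform of \<open>K\<close>, which is real since \<open>K\<close> is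
  even.\<close>

definition cos_transform :: "real => real" where
 "cos_transform v = (LINT u|lborel. K u * cos (v * u))"

lemma kernel_cos_integrable: "integrable lborel (%u. K u * f u)"
 if "f : borel_measurable borel" "!!u. \<bar>f u\<bar> <= 1" for f
proof (rule Lint_bound[OF kernel_integrable])
 show "AE u in lborel. norm (K u * f u) <= norm (K u)"
  using that(2) by (intro AE_I2) (simp add: abs_mult mult_left_le)
qed (use that(1) in measurable)

lemma cos_transform_integrable: "integrable lborel cos_transform"
proof -
 have "Re (LINT u|lborel. complex_of_real (K u) * cis (- s * u)) = cos_transform s" for s
 proof -
  have "integrable lborel (%u. complex_of_real (K u) * cis (- s * u))"
  proof (rule Lint_bound[OF kernel_integrable])
  have "(%u. cis (- s * u)) : borel_measurable borel"
  by (intro borel_measurable_continuous_onI continuous_intros)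
  then show "(%u. complex_of_real (K u) * cis (- s * u)) : borel_measurable lborel" by simp
  qed (simp add: norm_mult)
  then show ?thesis unfolding cos_transform_def by (subst integral_Re[symmetric]) simp_all
 qed
 moreover have "integrable lborel (%s. Re (LINT u|lborel. complex_of_real (K u) * cis (- s * u)))"
  using K unfolding admissible_kernel_def by (intro integrable_Re) blast
 ultimately show ?thesis by simp
qed

lemma kernel_sin_zero: "(LINT u|lborel. K u * sin (v * u)) = 0"
proof -
 have even: "K (- u) = K u" for u using K by (simp add: admissible_kernel_def)
 have "(LINT u|lborel. K u * sin (v * u)) = (LINT u|lborel. K (0 + (- 1) * u) * sin (v * (0 + (- 1) * u)))"
  using lborel_integral_real_affine[of "- 1" "%u. K u * sin (v * u)" 0] by simp
 also have "... = (LINT u|lborel. - (K u * sin (v * u)))" by (simp add: even)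
 also have "... = - (LINT u|lborel. K u * sin (v * u))" by (rule Bochner_Integration.integral_minus)
 finally show ?thesis by simp
qed

lemma kernel_shifted_cos: "(LINT y|lborel. K y * cos (v * (y - x))) = cos_transform v * cos (v * x)"
proof -
 have "(LINT y|lborel. K y * cos (v * (y - x)))
  = (LINT y|lborel. K y * cos (v * y) * cos (v * x) + K y * sin (v * y) * sin (v * x))"
  by (rule LINT_cong) (simp_all add: right_diff_distrib cos_diff algebra_simps)
 also have "... = (LINT y|lborel. K y * cos (v * y) * cos (v * x)) + (LINT y|lborel. K y * sin (v * y) * sin (v * x))"
  by (intro LINT_add integrable_mult_left kernel_cos_integrable) simp_all
 also have "... = cos_transform v * cos (v * x)"
  by (simp only: integral_mult_left_zero kernel_sin_zero cos_transform_def mult_zero_left add_0_right)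
 finally show ?thesis .
qed

text \<open>\<open>K\<close> averaged over Gaussian noise of standard deviation \<open>s\<close>.
  The regularization gives an absolutely convergent inversion formula and is removed by continuity
  of \<open>K\<close>.\<close>

definition smoothed_kernel :: "real => real => real" where
 "smoothed_kernel s x = (LINT z|lborel. K (x + s * z) * std_normal_density z)"

text \<open>Fourier inversion by Fubini: writing the Gaussian weight as a cosine integral leaves an
  integrand dominated by \<open>|K y|\<close> times the Gaussian density.\<close>

lemma smoothed_kernel_eq:
 assumes s: "s > 0"
 shows "smoothed_kernel s x
  = (1 / (s * sqrt (2 * pi))) * (LINT t|lborel. std_normal_density t * (cos_transform (t / s) * cos ((t / s) * x)))"
proof -
 let ?c = "1 / sqrt (2 * pi)"
 have aff: "(LINT y|lborel. K y * std_normal_density ((y - x) / s)) = s * smoothed_kernel s x"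
  using lborel_integral_real_affine[of s "%y. K y * std_normal_density ((y - x) / s)" x] s
  by (simp add: smoothed_kernel_def)
 let ?g = "%y t. K y * (std_normal_density t * cos ((y - x) / s * t))"
 have int: "integrable (lborel \<Otimes>\<^sub>M lborel) (%(y, t). ?g y t)"
 proof (rule Lint_bound[where f = "%(y, t). K y * std_normal_density t"])
  show "integrable (lborel \<Otimes>\<^sub>M lborel) (%(y, t). K y * std_normal_density t)"
  proof (rule lborel_pair.Fubini_integrable)
  show "(%(y, t). K y * std_normal_density t) : borel_measurable (lborel \<Otimes>\<^sub>M lborel)" by measurable
  have "(LINT t|lborel. norm (case (y, t) of (y, t) => K y * std_normal_density t)) = \<bar>K y\<bar>" for y
  by (simp add: abs_mult integral_normal_density)
  then show "integrable lborel (%y. (LINT t|lborel. norm (case (y, t) of (y, t) => K y * std_normal_density t)))"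
  by (simp only:) (rule integrable_abs[OF kernel_integrable])
  show "AE y in lborel. integrable lborel (%t. case (y, t) of (y, t) => K y * std_normal_density t)"
  by (rule AE_I2) (simp add: integrable_normal_density)
  qed
  show "(%(y, t). ?g y t) : borel_measurable (lborel \<Otimes>\<^sub>M lborel)" by measurable
  show "AE p in lborel \<Otimes>\<^sub>M lborel. norm (case p of (y, t) => ?g y t) <= norm (case p of (y, t) => K y * std_normal_density t)"
  proof (rule AE_I2)
  fix p :: "real \<times> real"
  show "norm (case p of (y, t) => ?g y t) <= norm (case p of (y, t) => K y * std_normal_density t)"
  by (cases p) (simp add: abs_mult mult_left_le mult_left_mono)
  qed
 qed
 have "s * smoothed_kernel s x = (LINT y|lborel. K y * (?c * (LINT t|lborel. std_normal_density t * cos ((y - x) / s * t))))"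
  unfolding aff[symmetric] by (subst std_normal_density_cos) (rule refl)
 also have "... = (LINT y|lborel. ?c * (LINT t|lborel. ?g y t))"
 proof (rule arg_cong[of _ _ "integral\<^sup>L lborel"], rule ext)
  fix y
  have "(LINT t|lborel. ?g y t) = K y * (LINT t|lborel. std_normal_density t * cos ((y - x) / s * t))"
  by (rule integral_mult_right_zero)
  then show "K y * (?c * (LINT t|lborel. std_normal_density t * cos ((y - x) / s * t))) = ?c * (LINT t|lborel. ?g y t)"
  by (simp only: mult.left_commute)
 qed
 also have "... = ?c * (LINT y|lborel. (LINT t|lborel. ?g y t))" by (rule integral_mult_right_zero)
 finally have e1: "s * smoothed_kernel s x = ?c * (LINT y|lborel. (LINT t|lborel. ?g y t))" .
 have e2: "(LINT y|lborel. (LINT t|lborel. ?g y t)) = (LINT t|lborel. (LINT y|lborel. ?g y t))"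
  by (rule lborel_pair.Fubini_integral[OF int, symmetric])
 have e3: "(LINT y|lborel. ?g y t) = std_normal_density t * (cos_transform (t / s) * cos ((t / s) * x))" for t
 proof -
  have "(LINT y|lborel. ?g y t) = (LINT y|lborel. std_normal_density t * (K y * cos ((t / s) * (y - x))))"
  by (rule LINT_cong) (simp_all add: mult_ac)
  also have "... = std_normal_density t * (LINT y|lborel. K y * cos ((t / s) * (y - x)))" by (rule integral_mult_right_zero)
  finally show ?thesis unfolding kernel_shifted_cos .
 qed
 have "s * smoothed_kernel s x = ?c * (LINT t|lborel. std_normal_density t * (cos_transform (t / s) * cos ((t / s) * x)))"
  unfolding e1 e2 e3 ..
 then have "(s * smoothed_kernel s x) / s = (?c * (LINT t|lborel. std_normal_density t * (cos_transform (t / s) * cos ((t / s) * x)))) / s"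
  by (rule arg_cong)
 then show ?thesis using s by simp
qed

lemma smoothed_kernel_tendsto: "(%n. smoothed_kernel (1 / real (Suc n)) x) ----> K x"
proof -
 obtain B L where B: "0 <= B" "0 <= L" "!!u. \<bar>K u\<bar> <= B" "!!u. \<bar>u\<bar> > L ==> K u = 0"
  using admissible_kernel_bounds[OF K] by blast
 have cont: "isCont K y" for y
  using K by (simp add: admissible_kernel_def continuous_on_eq_continuous_at)
 have "(%n. smoothed_kernel (1 / real (Suc n)) x) ----> (LINT z|lborel. K x * std_normal_density z)"
  unfolding smoothed_kernel_def
 proof (rule integral_dominated_convergence[where w = "%z. B * std_normal_density z"])
  show "AE z in lborel. (%n. K (x + 1 / real (Suc n) * z) * std_normal_density z) ----> K x * std_normal_density z"
  proof (rule AE_I2)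
  fix z
  have "(%n. x + 1 / real (Suc n) * z) ----> x + 0 * z"
  by (intro tendsto_intros LIMSEQ_inverse_real_of_nat[unfolded inverse_eq_divide])
  then have "(%n. K (x + 1 / real (Suc n) * z)) ----> K x"
  by (intro isCont_tendsto_compose[OF cont]) simp
  then show "(%n. K (x + 1 / real (Suc n) * z) * std_normal_density z) ----> K x * std_normal_density z"
  by (intro tendsto_mult tendsto_const)
  qed
  show "AE z in lborel. norm (K (x + 1 / real (Suc n) * z) * std_normal_density z) <= B * std_normal_density z" for n
  using B(3) by (intro AE_I2) (simp add: abs_mult mult_right_mono)
  show "integrable lborel (%z. B * std_normal_density z)" by (intro integrable_mult_right integrable_normal_density) simp
 qed measurable
 then show ?thesis by (simp add: integral_normal_density)
qed

text \<open>Only the bound by trigonometric Toeplitz sums is needed from the integrability of the Fourier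
 transform; it does not depend on the bandwidth.\<close>

lemma kernel_toeplitz_bound:
 fixes a :: "int => int => real"
 assumes B: "!!\<theta>. \<bar>SUM s:I. SUM t:I. a s t * cos (\<theta> * of_int (s - t))\<bar> <= B"
 shows "\<bar>SUM s:I. SUM t:I. a s t * K (of_int (s - t) / h)\<bar> <= (LINT v|lborel. \<bar>cos_transform v\<bar>) * B"
proof -
 let ?A = "(LINT v|lborel. \<bar>cos_transform v\<bar>)"
 have B0: "0 <= B" using order_trans[OF abs_ge_zero B] .
 have bound: "\<bar>SUM s:I. SUM t:I. a s t * smoothed_kernel e (of_int (s - t) / h)\<bar> <= ?A * B" if e: "e > 0" for e
 proof -
  let ?c = "1 / (e * sqrt (2 * pi))"
  let ?G = "%x v. std_normal_density v * (cos_transform (v / e) * cos ((v / e) * x))"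
  have ct: "integrable lborel (%v. cos_transform (v / e))"
  using lborel_integrable_real_affine[OF cos_transform_integrable, of "1 / e" 0] e by simp
  have [measurable]: "(%v. cos_transform (v / e)) : borel_measurable borel" using ct by simp
  have gi: "integrable lborel (?G x)" for x
  proof (rule Lint_bound[OF integrable_mult_right[OF ct, of "1 / sqrt (2 * pi)"]])
  show "AE v in lborel. norm (?G x v) <= norm (1 / sqrt (2 * pi) * cos_transform (v / e))"
  proof (rule AE_I2)
  fix v
  have "std_normal_density v <= 1 / sqrt (2 * pi)" by (simp add: std_normal_density_def divide_right_mono)
  then show "norm (?G x v) <= norm (1 / sqrt (2 * pi) * cos_transform (v / e))"
  unfolding real_norm_def abs_mult
  by (intro mult_mono) (simp_all add: mult_left_le)
  qed
  qed measurable
  have "(SUM s:I. SUM t:I. a s t * smoothed_kernel e (of_int (s - t) / h))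
  = (SUM s:I. SUM t:I. (LINT v|lborel. ?c * (a s t * ?G (of_int (s - t) / h) v)))"
  proof (intro sum.cong refl)
  fix s t
  have "(LINT v|lborel. ?c * (a s t * ?G (of_int (s - t) / h) v)) = ?c * (a s t * (LINT v|lborel. ?G (of_int (s - t) / h) v))"
  unfolding integral_mult_right_zero ..
  then show "a s t * smoothed_kernel e (of_int (s - t) / h) = (LINT v|lborel. ?c * (a s t * ?G (of_int (s - t) / h) v))"
  unfolding smoothed_kernel_eq[OF e] by (simp only: mult.left_commute)
  qed
  also have "... = (LINT v|lborel. (SUM s:I. SUM t:I. ?c * (a s t * ?G (of_int (s - t) / h) v)))"
  proof -
  have i: "integrable lborel (%v. ?c * (a s t * ?G (of_int (s - t) / h) v))" for s t
  by (intro integrable_mult_right gi)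
  have "(LINT v|lborel. (SUM s:I. SUM t:I. ?c * (a s t * ?G (of_int (s - t) / h) v)))
  = (SUM s:I. (LINT v|lborel. (SUM t:I. ?c * (a s t * ?G (of_int (s - t) / h) v))))"
  by (rule LINT_sum, rule Lint_sum, rule i)
  also have "... = (SUM s:I. SUM t:I. (LINT v|lborel. ?c * (a s t * ?G (of_int (s - t) / h) v)))"
  by (rule sum.cong[OF refl], rule LINT_sum, rule i)
  finally show ?thesis by (rule sym)
  qed
  finally have eq: "(SUM s:I. SUM t:I. a s t * smoothed_kernel e (of_int (s - t) / h))
  = (LINT v|lborel. (SUM s:I. SUM t:I. ?c * (a s t * ?G (of_int (s - t) / h) v)))" .
  have pw: "\<bar>SUM s:I. SUM t:I. ?c * (a s t * ?G (of_int (s - t) / h) v)\<bar> <= (1 / e) * \<bar>cos_transform (v / e)\<bar> * B" for v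
  proof -
  have "(SUM s:I. SUM t:I. ?c * (a s t * ?G (of_int (s - t) / h) v))
  = (?c * std_normal_density v * cos_transform (v / e)) * (SUM s:I. SUM t:I. a s t * cos ((v / (e * h)) * of_int (s - t)))"
  unfolding sum_distrib_left by (intro sum.cong refl) (simp add: mult_ac)
  then have "\<bar>SUM s:I. SUM t:I. ?c * (a s t * ?G (of_int (s - t) / h) v)\<bar>
  = (?c * std_normal_density v) * \<bar>cos_transform (v / e)\<bar> * \<bar>SUM s:I. SUM t:I. a s t * cos ((v / (e * h)) * of_int (s - t))\<bar>"
  using e by (simp only: abs_mult) simp
  also have "... <= (1 / e) * \<bar>cos_transform (v / e)\<bar> * B"
  proof (rule mult_mono[OF mult_right_mono B])
  have "std_normal_density v <= 1 / sqrt (2 * pi)" by (simp add: std_normal_density_def divide_right_mono)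
  \<comment> \<open>A crude bound, chosen to cancel the square root in \<open>?c\<close>; any
    constant independent of \<open>e\<close> and \<open>h\<close> would do.\<close>
  also have "... <= sqrt (2 * pi)"
  using pi_gt3 by (simp add: divide_le_eq)
  finally have "std_normal_density v <= sqrt (2 * pi)" .
  then have "?c * std_normal_density v <= ?c * sqrt (2 * pi)" using e by (intro mult_left_mono) simp_all
  then show "?c * std_normal_density v <= 1 / e" by simp
  qed (use e B0 in simp_all)
  finally show ?thesis .
  qed
  have "\<bar>(LINT v|lborel. (SUM s:I. SUM t:I. ?c * (a s t * ?G (of_int (s - t) / h) v)))\<bar>
  <= (LINT v|lborel. \<bar>SUM s:I. SUM t:I. ?c * (a s t * ?G (of_int (s - t) / h) v)\<bar>)" by (rule integral_abs_bound)
  also have "... <= (LINT v|lborel. (1 / e) * \<bar>cos_transform (v / e)\<bar> * B)"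
  proof (rule integral_mono[OF _ _ pw])
  show "integrable lborel (%v. \<bar>SUM s:I. SUM t:I. ?c * (a s t * ?G (of_int (s - t) / h) v)\<bar>)"
  by (intro integrable_abs Lint_sum integrable_mult_right gi)
  show "integrable lborel (%v. (1 / e) * \<bar>cos_transform (v / e)\<bar> * B)"
  by (intro integrable_mult_left integrable_mult_right integrable_abs ct)
  qed
  also have "... = (1 / e) * (LINT v|lborel. \<bar>cos_transform (v / e)\<bar>) * B"
  by (simp only: integral_mult_left_zero integral_mult_right_zero)
  finally have fin: "\<bar>(LINT v|lborel. (SUM s:I. SUM t:I. ?c * (a s t * ?G (of_int (s - t) / h) v)))\<bar>
  <= (1 / e) * (LINT v|lborel. \<bar>cos_transform (v / e)\<bar>) * B" .
  \<comment> \<open>The substitution absorbs the factor \<open>1 / e\<close>, so the bound does not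
    deteriorate as the smoothing is removed.\<close>
  have A: "(1 / e) * (LINT v|lborel. \<bar>cos_transform (v / e)\<bar>) = ?A"
  using lborel_integral_real_affine[of "1 / e" "%v. \<bar>cos_transform v\<bar>" 0] e by simp
  show ?thesis using fin unfolding eq A .
 qed
 have "(%n. \<bar>SUM s:I. SUM t:I. a s t * smoothed_kernel (1 / real (Suc n)) (of_int (s - t) / h)\<bar>)
  ----> \<bar>SUM s:I. SUM t:I. a s t * K (of_int (s - t) / h)\<bar>"
  by (intro tendsto_rabs tendsto_sum tendsto_mult tendsto_const smoothed_kernel_tendsto)
 then show ?thesis by (rule LIMSEQ_le_const2) (use bound in auto)
qed

end

section \<open>Positive definite matrices and their square roots\<close>

lemma symmetric_inner:
 fixes A :: "real^'n^'n"
 assumes "transpose A = A"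
 shows "x \<bullet> (A *v y) = (A *v x) \<bullet> y"
 by (metis assms dot_lmul_matrix vector_transpose_matrix)

lemma continuous_on_quadratic_form: "continuous_on S (%v. v \<bullet> ((A :: real^'n^'n) *v v))"
 by (rule continuous_on_inner[OF continuous_on_id linear_continuous_on[OF matrix_vector_mul_bounded_linear]])

text \<open>A maximizer \<open>v\<close> of the quadratic form on the unit sphere of
  \<open>S\<close> is an eigenvector: the residual \<open>w\<close> lies in \<open>S\<close> by
  invariance, and a nonzero \<open>w\<close> would be a direction of increase.\<close>

lemma symmetric_eigenvector_in_subspace:
 fixes A :: "real^'n^'n"
 assumes sym: "transpose A = A" and S: "subspace S" "S ~= {0}"
  and inv: "!!v. v : S ==> A *v v : S"
 obtains v l where "v : S" "norm v = 1" "A *v v = l *\<^sub>R v"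
proof -
 let ?f = "%v. v \<bullet> (A *v v)"
 have cpt: "compact (S \<inter> sphere 0 1)"
  by (rule closed_Int_compact[OF closed_subspace[OF S(1)] compact_sphere])
 obtain u where u: "u : S" "u ~= 0" using S subspace_0 by blast
 then have "(1 / norm u) *\<^sub>R u : S \<inter> sphere 0 1" using S(1) by (auto intro: subspace_scale)
 then have ne: "S \<inter> sphere 0 1 ~= {}" by blast
 have "continuous_on (S \<inter> sphere 0 1) ?f"
  by (rule continuous_on_quadratic_form)
 from continuous_attains_sup[OF cpt ne this] obtain v where v: "v : S" "norm v = 1"
  and max: "!!y. y : S ==> norm y = 1 ==> ?f y <= ?f v" by auto
 let ?l = "?f v"
 have bound: "?f y <= ?l * (y \<bullet> y)" if "y : S" for y
 proof (cases "y = 0")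
  case False
  let ?z = "(1 / norm y) *\<^sub>R y"
  have "?f ?z <= ?l" using False that S(1) by (intro max) (auto intro: subspace_scale)
  moreover have "?f ?z = ?f y / (y \<bullet> y)"
  by (simp add: matrix_vector_mult_scaleR power2_norm_eq_inner[symmetric] power2_eq_square)
  ultimately have "?f y / (y \<bullet> y) <= ?l" by (simp only:)
  moreover have "y \<bullet> y > 0" using False by simp
  ultimately show ?thesis by (simp only: pos_divide_le_eq)
 qed simp
 define w where "w = A *v v - ?l *\<^sub>R v"
 have w: "w : S" unfolding w_def using inv[OF v(1)] v(1) S(1) by (intro subspace_diff subspace_scale)
 have vv: "v \<bullet> v = 1" using v(2) by (simp add: dot_square_norm)
 have wAv: "w \<bullet> (A *v v) - ?l * (v \<bullet> w) = w \<bullet> w"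
  unfolding w_def by (simp add: inner_diff_left inner_diff_right inner_commute algebra_simps)
 \<comment> \<open>Moving from \<open>v\<close> in the direction \<open>w\<close> gains
   \<open>2 * t * (w \<bullet> w)\<close> to first order, while maximality allows only a gain of
   order \<open>t^2\<close>.\<close>
 have key: "2 * (w \<bullet> w) <= t * (?l * (w \<bullet> w) - ?f w)" if "t > 0" for t
 proof -
  have "?f (v + t *\<^sub>R w) <= ?l * ((v + t *\<^sub>R w) \<bullet> (v + t *\<^sub>R w))"
  using w v(1) S(1) by (intro bound subspace_add subspace_scale)
  moreover have "?f (v + t *\<^sub>R w) = ?l + 2 * t * (w \<bullet> (A *v v)) + t * t * ?f w"
  using symmetric_inner[OF sym, of v w]
  by (simp only: matrix_vector_right_distrib matrix_vector_mult_scaleR inner_add_left inner_add_right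
  inner_scaleR_left inner_scaleR_right inner_commute[of "A *v v"]) (simp add: algebra_simps)
  moreover have "(v + t *\<^sub>R w) \<bullet> (v + t *\<^sub>R w) = 1 + 2 * t * (v \<bullet> w) + t * t * (w \<bullet> w)"
  by (simp only: inner_add_left inner_add_right inner_scaleR_left inner_scaleR_right
  inner_commute[of w v] vv) (simp only: algebra_simps)
  ultimately have "?l + 2 * t * (w \<bullet> (A *v v)) + t * t * ?f w <= ?l * (1 + 2 * t * (v \<bullet> w) + t * t * (w \<bullet> w))"
  by simp
  then have "t * (2 * (w \<bullet> (A *v v) - ?l * (v \<bullet> w))) <= t * (t * (?l * (w \<bullet> w) - ?f w))"
  by (simp add: algebra_simps)
  then show ?thesis using that wAv by simp
 qed
 have "w \<bullet> w <= 0"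
 proof -
  have "((%t. t * (?l * (w \<bullet> w) - ?f w)) \<longlongrightarrow> 0 * (?l * (w \<bullet> w) - ?f w)) (at_right 0)"
  by (intro tendsto_intros)
  moreover have "\<forall>\<^sub>F t in at_right 0. 2 * (w \<bullet> w) <= t * (?l * (w \<bullet> w) - ?f w)"
  using key by (auto simp: eventually_at_filter)
  ultimately have "2 * (w \<bullet> w) <= 0 * (?l * (w \<bullet> w) - ?f w)"
  by (rule tendsto_lowerbound) simp
  then show ?thesis by simp
 qed
 then have "w = 0" by (metis inner_ge_zero inner_eq_zero_iff order_antisym)
 then show ?thesis using that[OF v(1,2)] by (simp add: w_def)
qed

text \<open>Take an orthonormal family of eigenvectors of maximal size. Its orthogonal complement is
  invariant, and if it were nonzero it would contain a further eigenvector.\<close>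

lemma symmetric_orthonormal_eigenbasis:
 fixes A :: "real^'n^'n"
 assumes sym: "transpose A = A"
 obtains B l where "finite B" "pairwise orthogonal B" "!!v. v : B ==> norm v = 1"
  "span B = UNIV" "!!v. v : B ==> A *v v = l v *\<^sub>R v"
proof -
 define P where "P B \<longleftrightarrow> pairwise orthogonal B \<and> (ALL v:B. norm v = 1 \<and> (EX l. A *v v = l *\<^sub>R v))" for B
 have fin: "finite B \<and> card B <= DIM(real^'n)" if "P B" for B
  using that by (intro independent_bound pairwise_orthogonal_independent) (auto simp: P_def)
 have "P {}" by (simp add: P_def)
 then obtain B where B: "P B" and max: "!!B'. P B' ==> card B' <= card B"
  using ex_has_greatest_nat[of P "{}" card "Suc (DIM(real^'n))"] fin by (metis le_imp_less_Suc)
 have "span B = UNIV"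
 proof (rule ccontr)
  assume "span B ~= UNIV"
  then have "dim B < DIM(real^'n)"
  by (metis dim_eq_full dim_subset_UNIV order_neq_le_trans)
  then obtain x where x: "x ~= 0" "!!y. y : span B ==> orthogonal x y"
  using orthogonal_to_subspace_exists by blast
  let ?S = "{y. ALL b:B. b \<bullet> y = 0}"
  have sub: "subspace ?S" by (auto simp: subspace_def inner_add_right)
  have "x : ?S" using x(2) span_base by (auto simp: orthogonal_def inner_commute)
  then have ne: "?S ~= {0}" using x(1) by blast
  have inv: "A *v y : ?S" if "y : ?S" for y
  proof -
  have "b \<bullet> (A *v y) = 0" if b: "b : B" for b
  proof -
  obtain l where "A *v b = l *\<^sub>R b" using B b by (auto simp: P_def)
  then show ?thesis using \<open>y : ?S\<close> b by (simp add: symmetric_inner[OF sym])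
  qed
  then show ?thesis by simp
  qed
  obtain v l where v: "v : ?S" "norm v = 1" "A *v v = l *\<^sub>R v"
  by (rule symmetric_eigenvector_in_subspace[OF sym sub ne inv])
  have "v ~: B"
  proof
  assume "v : B"
  with v(1) have "v \<bullet> v = 0" by blast
  with v(2) show False by simp
  qed
  moreover have "P (insert v B)"
  using B v unfolding P_def by (auto simp: pairwise_insert orthogonal_def inner_commute)
  ultimately show False using max[of "insert v B"] fin[OF B] by simp
 qed
 moreover obtain l where "!!v. v : B ==> A *v v = l v *\<^sub>R v" using B unfolding P_def by metis
 ultimately show ?thesis using that fin[OF B] B unfolding P_def by blast
qed

lemma orthonormal_expansion_norm:
 fixes B :: "(real^'n) set"
 assumes "finite B" "pairwise orthogonal B" "!!v. v : B ==> norm v = 1"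
 shows "(norm (SUM v:B. c v *\<^sub>R v))\<^sup>2 = (SUM v:B. (c v)\<^sup>2)"
proof -
 have "(norm (SUM v:B. c v *\<^sub>R v))\<^sup>2 = (SUM v:B. (norm (c v *\<^sub>R v))\<^sup>2)"
  using assms(1,2) by (intro norm_sum_Pythagorean) (auto simp: pairwise_def orthogonal_def)
 then show ?thesis using assms(3) by (simp add: power_mult_distrib)
qed

text \<open>In an eigenbasis the coordinates are multiplied by the eigenvalues. This reduces an
  operator norm estimate to a scalar one at a single eigenvector.\<close>

lemma symmetric_norm_bound:
 fixes A :: "real^'n^'n"
 assumes sym: "transpose A = A" and "0 <= K"
  and bound: "!!v l. norm v = 1 ==> A *v v = l *\<^sub>R v ==> \<bar>l\<bar> <= K"
 shows "norm (A *v x) <= K * norm x"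
proof -
 obtain B l where B: "finite B" "pairwise orthogonal B" "!!v. v : B ==> norm v = 1"
  "span B = UNIV" "!!v. v : B ==> A *v v = l v *\<^sub>R v"
  using symmetric_orthonormal_eigenbasis[OF sym] by blast
 have x: "x = (SUM v:B. (x \<bullet> v) *\<^sub>R v)"
  using orthonormal_basis_expand[OF B(2,3), of x] B(1,4) by simp
 then have "A *v x = A *v (SUM v:B. (x \<bullet> v) *\<^sub>R v)" by simp
 also have "... = (SUM v:B. (x \<bullet> v) *\<^sub>R (A *v v))"
  by (simp add: linear_sum[OF matrix_vector_mul_linear] matrix_vector_mult_scaleR)
 also have "... = (SUM v:B. ((x \<bullet> v) * l v) *\<^sub>R v)" by (intro sum.cong) (auto simp: B(5))
 finally have "(norm (A *v x))\<^sup>2 = (SUM v:B. ((x \<bullet> v) * l v)\<^sup>2)"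
  using orthonormal_expansion_norm[OF B(1,2,3)] by simp
 also have "... <= (SUM v:B. (x \<bullet> v)\<^sup>2 * K\<^sup>2)"
 proof (rule sum_mono)
  fix v assume "v : B"
  then have "\<bar>l v\<bar> <= K" using bound B by blast
  then have "(l v)\<^sup>2 <= K\<^sup>2" using \<open>0 <= K\<close> by (simp add: abs_le_square_iff[symmetric])
  then show "((x \<bullet> v) * l v)\<^sup>2 <= (x \<bullet> v)\<^sup>2 * K\<^sup>2" by (simp add: power_mult_distrib mult_left_mono)
 qed
 also have "... = (norm x)\<^sup>2 * K\<^sup>2"
  using orthonormal_expansion_norm[OF B(1,2,3), of "%v. x \<bullet> v"] x by (simp add: sum_distrib_right)
 finally have "(norm (A *v x))\<^sup>2 <= (K * norm x)\<^sup>2" by (simp add: power_mult_distrib mult.commute)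
 then show ?thesis by (rule power2_le_imp_le) (use \<open>0 <= K\<close> in simp)
qed

lemma posdef_coercive:
 fixes A :: "real^'n^'n"
 assumes "posdef A"
 obtains c where "c > 0" "!!v. c * (norm v)\<^sup>2 <= v \<bullet> (A *v v)"
proof -
 let ?f = "%v. v \<bullet> (A *v v)"
 have "continuous_on (sphere 0 1) ?f"
  by (rule continuous_on_quadratic_form)
 moreover have "sphere (0 :: real^'n) 1 ~= {}" by simp
 ultimately obtain u where u: "norm u = 1" and min: "!!v. norm v = 1 ==> ?f u <= ?f v"
  using continuous_attains_inf[OF compact_sphere, of 0 1 ?f] by auto
 have "u ~= 0" using u by auto
 then have "?f u > 0" using assms by (simp add: posdef_def)
 moreover have "?f u * (norm v)\<^sup>2 <= ?f v" for v
 proof (cases "v = 0")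
  case False
  let ?z = "(1 / norm v) *\<^sub>R v"
  have "?f u <= ?f ?z" using False by (intro min) simp
  moreover have "?f ?z = ?f v / (norm v)\<^sup>2"
  by (simp add: matrix_vector_mult_scaleR power2_eq_square)
  ultimately have "?f u <= ?f v / (norm v)\<^sup>2" by (simp only:)
  moreover have "(norm v)\<^sup>2 > 0" using False by simp
  ultimately show ?thesis by (simp only: pos_le_divide_eq)
 qed simp
 ultimately show ?thesis using that by blast
qed


section \<open>Inverses and square roots of matrices\<close>

lemma posdef_invertible:
 fixes A :: "real^'n^'n"
 assumes "posdef A"
 shows "invertible A"
proof -
 have "x = 0" if "A *v x = 0" for x
  using assms that unfolding posdef_def by (metis inner_zero_right less_irrefl)
 then show ?thesis by (simp add: invertible_left_inverse matrix_left_invertible_ker)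
qed

lemma matrix_inv_mult:
 fixes A :: "'a::field^'n^'n"
 assumes "invertible A"
 shows "A ** matrix_inv A = mat 1" "matrix_inv A ** A = mat 1"
 using someI_ex[OF assms[unfolded invertible_def]] unfolding matrix_inv_def by auto

lemma matrix_inv_unique_left:
 fixes A B :: "'a::field^'n^'n"
 assumes "B ** A = mat 1"
 shows "matrix_inv A = B"
proof -
 have inv: "invertible A" using assms invertible_left_inverse by blast
 have "B = B ** (A ** matrix_inv A)" by (simp add: matrix_inv_mult[OF inv])
 also have "... = (B ** A) ** matrix_inv A" by (simp only: matrix_mul_assoc)
 also have "... = matrix_inv A" using assms by simp
 finally show ?thesis by simp
qed

lemma matrix_inv_transpose:
 fixes A :: "'a::field^'n^'n"
 assumes "invertible A"
 shows "matrix_inv (transpose A) = transpose (matrix_inv A)"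
 by (rule matrix_inv_unique_left) (metis assms matrix_inv_mult(1) matrix_transpose_mul transpose_mat)

text \<open>The eigenvector equation turns $X = B - C$ in $BX + XC = B^2 - C^2$ into a scalar.\<close>

lemma posdef_square_root_diff:
 fixes B C :: "real^'n^'n"
 assumes B: "posdef B" and C: "posdef C" and c: "c > 0" "!!v. c * (norm v)\<^sup>2 <= v \<bullet> (C *v v)"
  and K: "!!v. \<bar>v \<bullet> ((B ** B - C ** C) *v v)\<bar> <= K * (norm v)\<^sup>2"
 shows "norm ((B - C) *v x) <= (K / c) * norm x"
proof (rule symmetric_norm_bound)
 let ?X = "B - C"
 have tB: "transpose B = B" and tC: "transpose C = C" using B C by (auto simp: posdef_def)
 then show "transpose ?X = ?X" by (simp add: transpose_def vec_eq_iff)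
 \<comment> \<open>Any nonzero vector in the hypothesis on \<open>K\<close> shows that
   \<open>K\<close> is nonnegative; a basis vector serves.\<close>
 have "0 <= K * (norm (axis undefined 1 :: real^'n))\<^sup>2" using K[of "axis undefined 1"] by linarith
 then have "0 <= K" by simp
 then show "0 <= K / c" using c(1) by simp
 fix v l assume v: "norm v = 1" "?X *v v = l *\<^sub>R v"
 have id: "B ** B - C ** C = B ** ?X + ?X ** C"
  by (simp add: matrix_matrix_mult_def vec_eq_iff sum_subtractf sum.distrib[symmetric] algebra_simps)
 have sX: "v \<bullet> (?X *v w) = l * (v \<bullet> w)" for w
 proof -
  have "transpose ?X = ?X" using tB tC by (simp add: transpose_def vec_eq_iff)
  then have "v \<bullet> (?X *v w) = (?X *v v) \<bullet> w" by (rule symmetric_inner)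
  then show ?thesis using v(2) by simp
 qed
 have "v \<bullet> ((B ** B - C ** C) *v v) = v \<bullet> (B *v (?X *v v)) + v \<bullet> (?X *v (C *v v))"
  unfolding id by (simp only: matrix_vector_mult_add_rdistrib matrix_vector_mul_assoc inner_add_right)
 also have "... = l * (v \<bullet> (B *v v) + v \<bullet> (C *v v))"
  unfolding sX v(2) matrix_vector_mult_scaleR inner_scaleR_right by (simp only: distrib_left)
 finally have "\<bar>l\<bar> * \<bar>v \<bullet> (B *v v) + v \<bullet> (C *v v)\<bar> <= K"
  using K[of v] v(1) by (simp add: abs_mult)
 moreover have "v \<bullet> (B *v v) > 0" using B v(1) unfolding posdef_def by (metis norm_zero zero_neq_one)
 moreover have "v \<bullet> (C *v v) >= c" using c(2)[of v] v(1) by simp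
 ultimately have "\<bar>l\<bar> * c <= K"
  by (smt (verit) c(1) mult_left_mono abs_ge_zero)
 then show "\<bar>l\<bar> <= K / c" using c(1) by (simp add: le_divide_eq)
qed

text \<open>The estimate of \<open>posdef_square_root_diff\<close> with
  \<open>K = 0\<close>.\<close>

lemma posdef_square_root_unique:
 fixes B C :: "real^'n^'n"
 assumes B: "posdef B" and C: "posdef C" and eq: "B ** B = C ** C"
 shows "B = C"
proof -
 obtain c where c: "c > 0" "!!v. c * (norm v)\<^sup>2 <= v \<bullet> (C *v v)" using posdef_coercive[OF C] by blast
 have "norm ((B - C) *v x) <= (0 / c) * norm x" for x
  using posdef_square_root_diff[OF B C c, of 0 x] by (simp add: eq)
 then have "(B - C) *v x = 0" for x using c(1) by simp
 then have "B *v x = C *v x" for x by (simp add: matrix_vector_mult_diff_rdistrib)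
 then show ?thesis by (simp add: matrix_eq)
qed

lemma posdef_square_root_exists:
 fixes A :: "real^'n^'n"
 assumes A: "posdef A"
 obtains B where "posdef B" "B ** B = A"
proof -
 have sym: "transpose A = A" using A by (simp add: posdef_def)
 obtain E l where E: "finite E" "pairwise orthogonal E" "!!v. v : E ==> norm v = 1"
  "span E = UNIV" "!!v. v : E ==> A *v v = l v *\<^sub>R v"
  using symmetric_orthonormal_eigenbasis[OF sym] by blast
 have expand: "(SUM v:E. (x \<bullet> v) *\<^sub>R v) = x" for x
  using orthonormal_basis_expand[OF E(2,3), of x] E(1,4) by simp
 have lpos: "l v > 0" if "v : E" for v
 proof -
  have "v ~= 0" using E(3)[OF that] by auto
  then have "v \<bullet> (A *v v) > 0" using A by (simp add: posdef_def)
  then show ?thesis using E(3,5)[OF that] by (simp add: dot_square_norm)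
 qed
 \<comment> \<open>The spectral sum of \<open>sqrt (l v)\<close> times the orthogonal projection
   onto \<open>v\<close>, written in coordinates.\<close>
 define B :: "real^'n^'n" where "B = (\<chi> i j. SUM v:E. sqrt (l v) * (v $ i * v $ j))"
 have Bx: "B *v x = (SUM v:E. (sqrt (l v) * (x \<bullet> v)) *\<^sub>R v)" for x
 proof -
  have "(B *v x) $ i = (SUM v:E. (sqrt (l v) * (x \<bullet> v)) *\<^sub>R v) $ i" for i
  proof -
  have "(B *v x) $ i = (SUM j:UNIV. SUM v:E. sqrt (l v) * v $ i * (x $ j * v $ j))"
  by (simp add: B_def matrix_vector_mult_def sum_distrib_right sum_distrib_left mult_ac)
  also have "... = (SUM v:E. SUM j:UNIV. sqrt (l v) * v $ i * (x $ j * v $ j))" by (rule sum.swap)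
  also have "... = (SUM v:E. (sqrt (l v) * (x \<bullet> v)) * v $ i)"
  by (simp add: inner_vec_def sum_distrib_left sum_distrib_right mult_ac)
  finally show ?thesis by simp
  qed
  then show ?thesis by (simp add: vec_eq_iff)
 qed
 have Bv: "B *v v = sqrt (l v) *\<^sub>R v" if v: "v : E" for v
 proof -
  have "B *v v = (SUM u:E. if u = v then sqrt (l v) *\<^sub>R v else 0)"
  unfolding Bx
  proof (rule sum.cong[OF refl])
  fix u assume u: "u : E"
  have "v \<bullet> u = 0" if "u ~= v" using E(2) u v that by (auto simp: pairwise_def orthogonal_def)
  moreover have "v \<bullet> v = 1" using E(3)[OF v] by (simp add: dot_square_norm)
  ultimately show "(sqrt (l u) * (v \<bullet> u)) *\<^sub>R u = (if u = v then sqrt (l v) *\<^sub>R v else 0)" by auto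
  qed
  also have "... = sqrt (l v) *\<^sub>R v" using E(1) v by simp
  finally show ?thesis .
 qed
 have "(B ** B) *v v = A *v v" if "v : E" for v
  using Bv[OF that] E(5)[OF that] lpos[OF that]
  by (simp add: matrix_vector_mul_assoc[symmetric] matrix_vector_mult_scaleR)
 then have "(B ** B) *v x = A *v x" for x
  by (rule linear_eq_on_span[OF matrix_vector_mul_linear matrix_vector_mul_linear, of E]) (simp_all add: E(4))
 then have "B ** B = A" by (simp add: matrix_eq)
 moreover have "posdef B"
  unfolding posdef_def
 proof (intro conjI allI impI)
  show "transpose B = B" by (simp add: transpose_def B_def vec_eq_iff mult_ac)
  fix x :: "real^'n" assume "x ~= 0"
  have "x \<bullet> (B *v x) = (SUM v:E. sqrt (l v) * (x \<bullet> v)\<^sup>2)"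
  by (simp add: Bx inner_sum_right power2_eq_square mult_ac)
  moreover have "EX v:E. x \<bullet> v ~= 0"
  proof (rule ccontr)
  assume "\<not> ?thesis"
  then have "(SUM v:E. (x \<bullet> v) *\<^sub>R v) = 0" by (intro sum.neutral) auto
  then show False using expand \<open>x ~= 0\<close> by simp
  qed
  then have "(SUM v:E. sqrt (l v) * (x \<bullet> v)\<^sup>2) > 0"
  using lpos E(1) by (auto intro!: sum_pos2 simp: less_imp_le)
  ultimately show "x \<bullet> (B *v x) > 0" by simp
 qed
 ultimately show ?thesis using that by blast
qed

definition sqrt_matrix :: "real^'n^'n => real^'n^'n" where
 "sqrt_matrix A = (THE B. posdef B \<and> B ** B = A)"

lemma sqrt_matrix:
 assumes "posdef A"
 shows "posdef (sqrt_matrix A)" "sqrt_matrix A ** sqrt_matrix A = A"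
proof -
 have "\<exists>!B. posdef B \<and> B ** B = A"
  using posdef_square_root_exists[OF assms] posdef_square_root_unique by metis
 from theI'[OF this] show "posdef (sqrt_matrix A)" "sqrt_matrix A ** sqrt_matrix A = A"
  by (simp_all add: sqrt_matrix_def)
qed

lemma inv_sqrt_eq: "inv_sqrt A = matrix_inv (sqrt_matrix A)"
 by (simp add: inv_sqrt_def sqrt_matrix_def)

lemma inv_sqrt:
 assumes "posdef A"
 shows "transpose (inv_sqrt A) = inv_sqrt A" "inv_sqrt A ** A ** inv_sqrt A = mat 1"
proof -
 let ?B = "sqrt_matrix A"
 note B = sqrt_matrix[OF assms]
 have inv: "invertible ?B" by (rule posdef_invertible[OF B(1)])
 have "transpose ?B = ?B" using B(1) by (simp add: posdef_def)
 then show "transpose (inv_sqrt A) = inv_sqrt A"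
  unfolding inv_sqrt_eq using matrix_inv_transpose[OF inv] by simp
 have "inv_sqrt A ** A ** inv_sqrt A = (matrix_inv ?B ** ?B) ** (?B ** matrix_inv ?B)"
  unfolding inv_sqrt_eq by (subst B(2)[symmetric]) (simp only: matrix_mul_assoc)
 then show "inv_sqrt A ** A ** inv_sqrt A = mat 1" by (simp add: matrix_inv_mult[OF inv])
qed

lemma quadratic_form_bound:
 fixes D :: "real^'n^'n"
 shows "\<bar>v \<bullet> (D *v v)\<bar> <= (SUM i:UNIV. SUM j:UNIV. \<bar>D $ i $ j\<bar>) * (norm v)\<^sup>2"
proof -
 have "v \<bullet> (D *v v) = (SUM i:UNIV. SUM j:UNIV. D $ i $ j * (v $ i * v $ j))"
  by (simp add: inner_vec_def matrix_vector_mult_def sum_distrib_left mult_ac)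
 also have "\<bar>...\<bar> <= (SUM i:UNIV. \<bar>SUM j:UNIV. D $ i $ j * (v $ i * v $ j)\<bar>)" by (rule sum_abs)
 also have "... <= (SUM i:UNIV. SUM j:UNIV. \<bar>D $ i $ j * (v $ i * v $ j)\<bar>)" by (intro sum_mono sum_abs)
 also have "... <= (SUM i:UNIV. SUM j:UNIV. \<bar>D $ i $ j\<bar> * (norm v * norm v))"
  unfolding abs_mult by (intro sum_mono mult_left_mono mult_mono component_le_norm_cart) simp_all
 finally show ?thesis by (simp add: sum_distrib_right power2_eq_square)
qed

lemma tendsto_det:
 fixes f :: "'x => real^'n^'n"
 assumes "(f \<longlongrightarrow> A) F"
 shows "((%x. det (f x)) \<longlongrightarrow> det A) F"
 unfolding det_def by (intro tendsto_intros assms)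

text \<open>Cramer's rule. As quotients of determinants the entries of the inverse are visibly
  continuous and measurable in the matrix.\<close>

lemma matrix_inv_entry:
 fixes A :: "'a::field^'n^'n"
 assumes "det A ~= 0"
 shows "matrix_inv A $ k $ j = det (\<chi> i m. if m = k then axis j 1 $ i else A $ i $ m) / det A"
proof -
 have inv: "invertible A" using assms by (simp add: invertible_det_nz)
 have "A *v (matrix_inv A *v axis j 1) = axis j 1"
  by (simp add: matrix_vector_mul_assoc matrix_inv_mult[OF inv])
 then have "matrix_inv A *v axis j 1 = (\<chi> k. det (\<chi> i m. if m = k then axis j 1 $ i else A $ i $ m) / det A)"
  using cramer[OF assms] by blast
 moreover have "(matrix_inv A *v axis j 1) $ k = matrix_inv A $ k $ j"
  by (simp add: matrix_vector_mult_def axis_def if_distrib cong: if_cong)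
 ultimately show ?thesis by simp
qed

lemma tendsto_matrix_inv:
 fixes f :: "'x => real^'n^'n"
 assumes f: "(f \<longlongrightarrow> A) F" and A: "invertible A"
 shows "((%x. matrix_inv (f x)) \<longlongrightarrow> matrix_inv A) F"
proof (intro vec_tendstoI)
 fix k j
 have dA: "det A ~= 0" using A by (simp add: invertible_det_nz)
 have "\<forall>\<^sub>F x in F. det (f x) ~= 0"
  using tendsto_det[OF f] dA by (rule tendsto_imp_eventually_ne)
 then have ev: "\<forall>\<^sub>F x in F. det (\<chi> i m. if m = k then axis j 1 $ i else f x $ i $ m) / det (f x) = matrix_inv (f x) $ k $ j"
  by eventually_elim (simp add: matrix_inv_entry)
 have "((%x. det (\<chi> i m. if m = k then axis j 1 $ i else f x $ i $ m) / det (f x))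
  \<longlongrightarrow> det (\<chi> i m. if m = k then axis j 1 $ i else A $ i $ m) / det A) F"
 proof (intro tendsto_divide tendsto_det f dA tendsto_vec_lambda)
  fix i m show "((%x. if m = k then axis j 1 $ i else f x $ i $ m) \<longlongrightarrow> (if m = k then axis j 1 $ i else A $ i $ m)) F"
  using f by (auto intro!: tendsto_intros)
 qed
 then show "((%x. matrix_inv (f x) $ k $ j) \<longlongrightarrow> matrix_inv A $ k $ j) F"
  unfolding matrix_inv_entry[OF dA] using ev by (rule Lim_transform_eventually)
qed

text \<open>The Lipschitz estimate for the square root involves only the coercivity constant of the
  limit \<open>A\<close>, so the approximating matrices need no uniform lower bound.\<close>

lemma tendsto_inv_sqrt:
 fixes f :: "'x => real^'n^'n"
 assumes f: "(f \<longlongrightarrow> A) F" and A: "posdef A" and pd: "\<forall>\<^sub>F x in F. posdef (f x)"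
 shows "((%x. inv_sqrt (f x)) \<longlongrightarrow> inv_sqrt A) F"
 unfolding inv_sqrt_eq
proof (rule tendsto_matrix_inv)
 show "invertible (sqrt_matrix A)" by (rule posdef_invertible[OF sqrt_matrix(1)[OF A]])
 obtain c where c: "c > 0" "!!v. c * (norm v)\<^sup>2 <= v \<bullet> (sqrt_matrix A *v v)"
  using posdef_coercive[OF sqrt_matrix(1)[OF A]] by blast
 let ?K = "%x. (SUM i:UNIV. SUM j:UNIV. \<bar>(f x - A) $ i $ j\<bar>) / c"
 have "(?K \<longlongrightarrow> (SUM i:(UNIV::'n set). SUM j:(UNIV::'n set). \<bar>(A - A) $ i $ j\<bar>) / c) F"
  using c(1) by (intro tendsto_intros f) auto
 then have K0: "(?K \<longlongrightarrow> 0) F" by simp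
 have bound: "\<forall>\<^sub>F x in F. \<bar>(sqrt_matrix (f x) - sqrt_matrix A) $ i $ j\<bar> <= ?K x" for i j
  using pd
 proof eventually_elim
  case (elim x)
  let ?X = "sqrt_matrix (f x) - sqrt_matrix A"
  have "norm (?X *v axis j 1) <= ?K x * norm (axis j 1 :: real^'n)"
  by (rule posdef_square_root_diff[OF sqrt_matrix(1)[OF elim] sqrt_matrix(1)[OF A] c])
  (simp only: sqrt_matrix(2)[OF elim] sqrt_matrix(2)[OF A] quadratic_form_bound)
  moreover have "(?X *v axis j 1) $ i = ?X $ i $ j"
  by (simp add: matrix_vector_mult_def axis_def if_distrib cong: if_cong)
  ultimately show ?case using component_le_norm_cart[of "?X *v axis j 1" i] by (simp add: norm_axis_1)
 qed
 show "((%x. sqrt_matrix (f x)) \<longlongrightarrow> sqrt_matrix A) F"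
 proof (intro vec_tendstoI)
  fix i j
  have "((%x. (sqrt_matrix (f x) - sqrt_matrix A) $ i $ j) \<longlongrightarrow> 0) F"
  by (rule tendsto_rabs_zero_cancel, rule tendsto_sandwich[OF _ bound tendsto_const K0]) simp
  then show "((%x. sqrt_matrix (f x) $ i $ j) \<longlongrightarrow> sqrt_matrix A $ i $ j) F"
  by (simp add: LIM_zero_iff)
 qed
qed

lemma continuous_on_inv_sqrt: "continuous_on {A :: real^'n^'n. posdef A} inv_sqrt"
 unfolding continuous_on_def
 by (auto intro!: tendsto_inv_sqrt tendsto_ident_at simp: eventually_at_filter)

lemma posdef_near:
 fixes A B :: "real^'n^'n"
 assumes c: "!!v. c * (norm v)\<^sup>2 <= v \<bullet> (A *v v)" and B: "transpose B = B"
  and near: "(SUM i:UNIV. SUM j:UNIV. \<bar>(B - A) $ i $ j\<bar>) < c"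
 shows "posdef B"
 unfolding posdef_def
proof (intro conjI allI impI)
 fix v :: "real^'n" assume "v ~= 0"
 let ?s = "SUM i:UNIV. SUM j:UNIV. \<bar>(B - A) $ i $ j\<bar>"
 have "v \<bullet> (B *v v) = v \<bullet> (A *v v) + v \<bullet> ((B - A) *v v)"
  by (simp add: matrix_vector_mult_diff_rdistrib inner_diff_right)
 moreover have "\<bar>v \<bullet> ((B - A) *v v)\<bar> <= ?s * (norm v)\<^sup>2" by (rule quadratic_form_bound)
 moreover have "?s * (norm v)\<^sup>2 < c * (norm v)\<^sup>2" using near \<open>v ~= 0\<close> by simp
 ultimately show "v \<bullet> (B *v v) > 0" using c[of v] by linarith
qed fact

section \<open>Measurability of matrix operations\<close>

lemma borel_measurable_vec_lambda:
 fixes f :: "'x => ('a::euclidean_space)^'n"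
 assumes "!!i. (%x. f x $ i) : borel_measurable M"
 shows "f : borel_measurable M"
proof -
 have "(%x. SUM i:UNIV. axis i (f x $ i)) : borel_measurable M"
 proof (rule borel_measurable_sum)
  fix i :: 'n
  have "continuous_on UNIV (%c :: 'a. if j = i then c else 0)" for j by (cases "j = i") auto
  then have "continuous_on UNIV (axis i :: 'a => 'a^'n)"
  unfolding axis_def by (rule continuous_on_vec_lambda)
  then have "(axis i :: 'a => 'a^'n) : borel_measurable borel"
  by (rule borel_measurable_continuous_onI)
  from measurable_compose[OF assms this] show "(%x. axis i (f x $ i)) : borel_measurable M" .
 qed
 moreover have "(SUM i:UNIV. axis i (f x $ i)) = f x" for x
  by (simp add: vec_eq_iff axis_def if_distrib cong: if_cong)
 ultimately show ?thesis by simp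
qed

lemma borel_measurable_vec_nth [measurable (raw)]:
 fixes f :: "'x => ('a::euclidean_space)^'n"
 assumes "f : borel_measurable M"
 shows "(%x. f x $ i) : borel_measurable M"
 by (rule measurable_compose[OF assms], rule borel_measurable_continuous_onI, rule linear_continuous_on,
  rule bounded_linear_vec_nth)

lemma borel_measurable_det:
 fixes f :: "'x => real^'n^'n"
 assumes [measurable]: "f : borel_measurable M"
 shows "(%x. det (f x)) : borel_measurable M"
 unfolding det_def by measurable

text \<open>On the singular matrices \<^const>\<open>matrix_inv\<close> is the choice from an empty predicate, hence
 constant.\<close>

lemma borel_measurable_matrix_inv:
 fixes f :: "'x => real^'n^'n"
 assumes [measurable]: "f : borel_measurable M"
 shows "(%x. matrix_inv (f x)) : borel_measurable M"
proof (rule borel_measurable_vec_lambda, rule borel_measurable_vec_lambda)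
 fix k j
 have sing: "matrix_inv A = (SOME B :: real^'n^'n. False)" if "det A = 0" for A :: "real^'n^'n"
 proof -
  have "\<not> invertible A" using that by (simp add: invertible_det_nz)
  then have "(%B. A ** B = mat 1 \<and> B ** A = mat 1) = (%_. False)" unfolding invertible_def by blast
  then show ?thesis unfolding matrix_inv_def by simp
 qed
 have eq: "matrix_inv (f x) $ k $ j = (if det (f x) = 0 then (SOME B :: real^'n^'n. False) $ k $ j
  else det (\<chi> i m. if m = k then axis j 1 $ i else f x $ i $ m) / det (f x))" for x
  by (simp add: sing matrix_inv_entry)
 have [measurable]: "(%x. det (f x)) : borel_measurable M"
  by (rule borel_measurable_det) measurable
 have [measurable]: "(%x. det (\<chi> i m. if m = k then axis j 1 $ i else f x $ i $ m)) : borel_measurable M"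
 proof (rule borel_measurable_det, rule borel_measurable_vec_lambda, rule borel_measurable_vec_lambda)
  fix i m
  show "(%x. (\<chi> i m. if m = k then axis j 1 $ i else f x $ i $ m) $ i $ m) : borel_measurable M"
  by (cases "m = k") simp_all
 qed
 show "(%x. matrix_inv (f x) $ k $ j) : borel_measurable M" unfolding eq by measurable
qed

lemma borel_measurable_mult_vec:
 fixes f :: "'x => real^'n^'m"
 assumes [measurable]: "f : borel_measurable M" "g : borel_measurable M"
 shows "(%x. f x *v g x) : borel_measurable M"
 by (rule borel_measurable_vec_lambda) (simp add: matrix_vector_mult_def)

lemma borel_measurable_matrix_mult:
 fixes f :: "'x => real^'n^'m" and g :: "'x => real^'k^'n"
 assumes [measurable]: "f : borel_measurable M" "g : borel_measurable M"
 shows "(%x. f x ** g x) : borel_measurable M"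
 by (rule borel_measurable_vec_lambda, rule borel_measurable_vec_lambda) (simp add: matrix_matrix_mult_def)

text \<open>A closed condition, symmetry, intersected with an open one: the form attains a positive
  minimum on the unit sphere, which small perturbations of the matrix cannot cancel.\<close>

lemma posdef_sets: "{A :: real^'n^'n. posdef A} : sets borel"
proof -
 let ?sym = "{A :: real^'n^'n. transpose A = A}"
 let ?pd = "{A :: real^'n^'n. ALL v. v ~= 0 --> v \<bullet> (A *v v) > 0}"
 have "closed ?sym"
 proof -
  have "?sym = {A. ALL i j. A $ j $ i = A $ i $ j}" by (simp add: transpose_def vec_eq_iff)
  moreover have "closed {A :: real^'n^'n. ALL i j. A $ j $ i = A $ i $ j}"
  by (rule closed_Collect_all, rule closed_Collect_all, rule closed_Collect_eq) (auto intro!: continuous_intros)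
  ultimately show ?thesis by simp
 qed
 moreover have "open ?pd"
 proof (subst open_subopen, rule ballI)
  fix A assume A: "A : ?pd"
  have cont: "continuous_on (sphere 0 1) (%v. v \<bullet> (A *v v))"
  by (rule continuous_on_quadratic_form)
  obtain u :: "real^'n" where u: "norm u = 1" "!!v. norm v = 1 ==> u \<bullet> (A *v u) <= v \<bullet> (A *v v)"
  using continuous_attains_inf[OF compact_sphere _ cont] by auto
  let ?c = "u \<bullet> (A *v u)"
  have "u ~= 0" using u(1) by auto
  then have c: "?c > 0" using A by simp
  have "((%B. SUM i:UNIV. SUM j:UNIV. \<bar>(B - A) $ i $ j\<bar>) \<longlongrightarrow> (SUM i:(UNIV::'n set). SUM j:(UNIV::'n set). \<bar>(A - A) $ i $ j\<bar>)) (nhds A)"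
  by (intro tendsto_intros filterlim_ident)
  then have "\<forall>\<^sub>F B in nhds A. (SUM i:UNIV. SUM j:UNIV. \<bar>(B - A) $ i $ j\<bar>) < ?c"
  using c by (intro order_tendstoD) auto
  then have "\<forall>\<^sub>F B in nhds A. B : ?pd"
  proof eventually_elim
  case (elim B)
  have "w \<bullet> (B *v w) > 0" if w: "norm w = 1" for w
  proof -
  have "w \<bullet> (B *v w) = w \<bullet> (A *v w) + w \<bullet> ((B - A) *v w)"
  by (simp add: matrix_vector_mult_diff_rdistrib inner_diff_right)
  then show ?thesis using quadratic_form_bound[of w "B - A"] u(2)[OF w] elim w by simp
  qed
  note unit = this
  have "v \<bullet> (B *v v) > 0" if "v ~= 0" for v
  proof -
  have "((1 / norm v) *\<^sub>R v) \<bullet> (B *v ((1 / norm v) *\<^sub>R v)) > 0" using that by (intro unit) simp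
  then show ?thesis using that by (simp add: matrix_vector_mult_scaleR zero_less_divide_iff)
  qed
  then show ?case by simp
  qed
  then show "EX T. open T \<and> A : T \<and> T \<subseteq> ?pd" unfolding eventually_nhds by blast
 qed
 moreover have "{A :: real^'n^'n. posdef A} = ?sym \<inter> ?pd" by (auto simp: posdef_def)
 ultimately show ?thesis by auto
qed

lemma borel_measurable_inv_sqrt:
 "(%A :: real^'n^'n. if posdef A then inv_sqrt A else 0) : borel_measurable borel"
 using borel_measurable_continuous_on_if[OF posdef_sets continuous_on_inv_sqrt, of "%_. 0"] by simp

section \<open>Levy's continuity theorem for the standard Gaussian law\<close>

definition gauss_density :: "real^'q => real" where
 "gauss_density z = (PROD a:UNIV. std_normal_density (z $ a))"

text \<open>A Gaussian kernel of width \<open>s\<close> without the normalizing power of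
  \<open>s\<close>, which therefore appears explicitly in the convolution formulas.\<close>

abbreviation gk :: "real => real^'q => real^'q => real" where
 "gk s y v \<equiv> gauss_density ((1 / s) *\<^sub>R (y - v))"

lemma Basis_cart: "(Basis :: (real^'q) set) = range (%a. axis a 1)"
 by (auto simp: Basis_vec_def)

lemma inj_axis_1: "inj (%a. axis a (1::real) :: real^'q)"
 by (auto simp: inj_on_def axis_eq_axis)

text \<open>Lebesgue measure on \<open>real^'q\<close> is the image of a product measure indexed by
  basis vectors rather than by coordinates; \<open>F\<close> renames the factors
  accordingly.\<close>

lemma lborel_product_integral:
 fixes f :: "'q::finite => real => complex"
 assumes f: "!!a. integrable lborel (f a)"
 shows "integrable lborel (%z :: real^'q. PROD a:UNIV. f a (z $ a))"
  and "(\<integral>z. (PROD a:UNIV. f a (z $ a)) \<partial>(lborel :: (real^'q) measure)) = (PROD a:UNIV. (LINT t|lborel. f a t))"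
proof -
 let ?B = "Basis :: (real^'q) set"
 let ?T = "%x. SUM b:?B. x b *\<^sub>R b"
 interpret product_sigma_finite "%_ :: real^'q. lborel :: real measure" ..
 define F where "F b = f (THE a. b = axis a 1)" for b :: "real^'q"
 have F: "F (axis a 1) = f a" for a
  unfolding F_def by (rule arg_cong[where f = f]) (auto simp: axis_eq_axis)
 have comp: "?T x $ a = x (axis a 1)" for x and a :: 'q
 proof -
  have "?T x $ a = (SUM c:UNIV. x (axis c 1) * (axis c 1 :: real^'q) $ a)"
  unfolding Basis_cart by (simp add: sum.reindex[OF inj_axis_1])
  also have "... = x (axis a 1)"
  by (simp add: axis_def if_distrib cong: if_cong)
  finally show ?thesis .
 qed
 have prod: "(PROD a:UNIV. f a (?T x $ a)) = (PROD b:?B. F b (x b))" for x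
  unfolding comp unfolding Basis_cart by (simp add: prod.reindex[OF inj_axis_1] F)
 have Fi: "integrable lborel (F b)" if "b : ?B" for b
  using that f unfolding Basis_cart by (auto simp: F)
 have Tm [measurable]: "?T : borel_measurable (\<Pi>\<^sub>M b\<in>?B. lborel)"
 proof (intro borel_measurable_sum borel_measurable_scaleR borel_measurable_const)
  fix b :: "real^'q" assume "b : ?B"
  from measurable_component_singleton[OF this, of "%_. lborel :: real measure"]
  show "(%x. x b :: real) : borel_measurable (\<Pi>\<^sub>M b\<in>?B. lborel)" by (simp only: measurable_lborel1)
 qed
 have [measurable]: "f a : borel_measurable borel" for a using f[of a] by simp
 have vn: "(%z :: real^'q. z $ a) : borel_measurable borel" for a
  by (intro borel_measurable_continuous_onI linear_continuous_on bounded_linear_vec_nth)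
 have gm: "(%z :: real^'q. PROD a:UNIV. f a (z $ a)) : borel_measurable borel"
  by (intro borel_measurable_prod measurable_compose[OF vn]) measurable
 show "integrable lborel (%z :: real^'q. PROD a:UNIV. f a (z $ a))"
  unfolding lborel_eq[where 'a = "real^'q"]
 proof (rule iffD2[OF integrable_distr_eq[OF Tm gm]])
  show "integrable (\<Pi>\<^sub>M b\<in>?B. lborel) (%x. PROD a:UNIV. f a (?T x $ a))"
  unfolding prod by (rule product_integrable_prod[OF finite_Basis Fi])
 qed
 have "(\<integral>z. (PROD a:UNIV. f a (z $ a)) \<partial>(lborel :: (real^'q) measure))
  = (\<integral>x. (PROD a:UNIV. f a (?T x $ a)) \<partial>(\<Pi>\<^sub>M b\<in>?B. lborel))"
  unfolding lborel_eq[where 'a = "real^'q"] by (rule integral_distr[OF Tm gm])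
 also have "... = (PROD b:?B. integral\<^sup>L lborel (F b))"
  unfolding prod by (rule product_integral_prod[OF finite_Basis Fi])
 also have "... = (PROD a:UNIV. (LINT t|lborel. f a t))"
  unfolding Basis_cart by (simp add: prod.reindex[OF inj_axis_1] F)
 finally show "(\<integral>z. (PROD a:UNIV. f a (z $ a)) \<partial>(lborel :: (real^'q) measure)) = (PROD a:UNIV. (LINT t|lborel. f a t))" .
qed

lemma gauss_density_measurable [measurable]: "(gauss_density :: real^'q => real) : borel_measurable borel"
proof -
 have "(%z :: real^'q. z $ a) : borel_measurable borel" for a
  by (intro borel_measurable_continuous_onI linear_continuous_on bounded_linear_vec_nth)
 from measurable_compose[OF this borel_measurable_normal_density]
 show ?thesis unfolding gauss_density_def[abs_def] by (intro borel_measurable_prod)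
qed

lemma gauss_density_nonneg: "0 <= gauss_density z"
 unfolding gauss_density_def by (intro prod_nonneg) simp

lemma std_normal_fourier:
 "integrable lborel (%t. complex_of_real (std_normal_density t) * iexp (u * t))"
 "(LINT t|lborel. complex_of_real (std_normal_density t) * iexp (u * t)) = exp (- u\<^sup>2 / 2)"
proof -
 have "integrable lborel (%t. complex_of_real (std_normal_density t))"
  by (intro integrable_of_real integrable_normal_density) simp
 then show "integrable lborel (%t. complex_of_real (std_normal_density t) * iexp (u * t))"
  by (rule Lint_bound) (auto simp: norm_mult)
 have "char std_normal_distribution u = (LINT t|lborel. std_normal_density t *\<^sub>R iexp (u * t))"
  unfolding char_def by (rule integral_density) auto
 then show "(LINT t|lborel. complex_of_real (std_normal_density t) * iexp (u * t)) = exp (- u\<^sup>2 / 2)"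
  unfolding char_std_normal_distribution by (simp add: scaleR_conv_of_real)
qed

lemma gauss_fourier:
 fixes u :: "real^'q"
 shows "integrable lborel (%z. complex_of_real (gauss_density z) * iexp (u \<bullet> z))"
  and "(LINT z|lborel. complex_of_real (gauss_density z) * iexp (u \<bullet> z)) = exp (- (norm u)\<^sup>2 / 2)"
proof -
 have eq: "complex_of_real (gauss_density z) * iexp (u \<bullet> z)
  = (PROD a:UNIV. complex_of_real (std_normal_density (z $ a)) * iexp (u $ a * z $ a))" for z
  by (simp add: gauss_density_def inner_vec_def prod.distrib sum_distrib_left exp_sum)
 show "integrable lborel (%z. complex_of_real (gauss_density z) * iexp (u \<bullet> z))"
  unfolding eq by (rule lborel_product_integral(1)) (rule std_normal_fourier)
 have "(LINT z|lborel. complex_of_real (gauss_density z) * iexp (u \<bullet> z))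
  = (PROD a:UNIV. (LINT t|lborel. complex_of_real (std_normal_density t) * iexp (u $ a * t)))"
  unfolding eq by (rule lborel_product_integral(2)) (rule std_normal_fourier)
 also have "... = (PROD a:UNIV. complex_of_real (exp (- (u $ a)\<^sup>2 / 2)))"
  unfolding std_normal_fourier(2) ..
 also have "... = complex_of_real (exp (SUM a:UNIV. - (u $ a)\<^sup>2 / 2))" by (simp add: exp_sum)
 also have "(SUM a:UNIV. - (u $ a)\<^sup>2 / 2) = - (norm u)\<^sup>2 / 2"
  by (simp add: norm_vec_def L2_set_def sum_nonneg sum_negf sum_divide_distrib[symmetric])
 finally show "(LINT z|lborel. complex_of_real (gauss_density z) * iexp (u \<bullet> z)) = exp (- (norm u)\<^sup>2 / 2)" .
qed

lemma gauss_density_integrable: "integrable lborel (gauss_density :: real^'q => real)"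
 and gauss_density_integral: "(\<integral>z. gauss_density z \<partial>(lborel :: (real^'q) measure)) = 1"
proof -
 have c: "integrable lborel (%z :: real^'q. complex_of_real (gauss_density z))"
  "(\<integral>z. complex_of_real (gauss_density z) \<partial>(lborel :: (real^'q) measure)) = 1"
  using gauss_fourier[of "0 :: real^'q"] by simp_all
 have "integrable lborel (%z :: real^'q. Re (complex_of_real (gauss_density z)))" using integrable_Re[OF c(1)] .
 then show i: "integrable lborel (gauss_density :: real^'q => real)" by simp
 have "complex_of_real (\<integral>z. gauss_density z \<partial>(lborel :: (real^'q) measure)) = 1"
  using c(2) by (simp add: integral_complex_of_real)
 then show "(\<integral>z. gauss_density z \<partial>(lborel :: (real^'q) measure)) = 1"
  using of_real_eq_1_iff by blast
qed

lemma gauss_density_norm: "gauss_density z = (1 / sqrt (2 * pi)) ^ CARD('q) * exp (- (norm z)\<^sup>2 / 2)"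
 for z :: "real^'q"
proof -
 have "gauss_density z = (PROD a:UNIV. (1 / sqrt (2 * pi)) * exp (- (z $ a)\<^sup>2 / 2))"
  by (simp only: gauss_density_def std_normal_density_def)
 also have "... = (1 / sqrt (2 * pi)) ^ CARD('q) * exp (SUM a:UNIV. - (z $ a)\<^sup>2 / 2)"
  by (simp only: prod.distrib prod_constant exp_sum[OF finite])
 also have "(SUM a:UNIV. - (z $ a)\<^sup>2 / 2) = - (norm z)\<^sup>2 / 2"
  by (simp add: norm_vec_def L2_set_def sum_nonneg sum_negf sum_divide_distrib[symmetric])
 finally show ?thesis .
qed

lemma standard_gaussian_prob: "prob_space (standard_gaussian :: (real^'q) measure)"
proof (rule prob_spaceI)
 have "emeasure (standard_gaussian :: (real^'q) measure) (space standard_gaussian)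
  = (\<integral>\<^sup>+z. ennreal (gauss_density z) \<partial>(lborel :: (real^'q) measure))"
  unfolding standard_gaussian_def gauss_density_def[symmetric] by (simp add: emeasure_density)
 also have "... = ennreal (\<integral>z. gauss_density z \<partial>(lborel :: (real^'q) measure))"
  by (rule nn_integral_eq_integral[OF gauss_density_integrable]) (simp add: gauss_density_nonneg)
 finally show "emeasure (standard_gaussian :: (real^'q) measure) (space standard_gaussian) = 1"
  by (simp add: gauss_density_integral)
qed

lemma sets_standard_gaussian [measurable_cong]: "sets standard_gaussian = sets borel"
 and space_standard_gaussian [simp]: "space standard_gaussian = UNIV"
 by (simp_all add: standard_gaussian_def)

lemma standard_gaussian_integral:
 fixes f :: "real^'q => 'b::{banach, second_countable_topology}"
 assumes "f : borel_measurable borel"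
 shows "(\<integral>z. f z \<partial>standard_gaussian) = (LINT z|lborel. gauss_density z *\<^sub>R f z)"
 unfolding standard_gaussian_def gauss_density_def[symmetric]
 by (rule integral_density) (use assms in \<open>simp_all add: gauss_density_nonneg\<close>)

lemma standard_gaussian_char:
 fixes u :: "real^'q"
 shows "(\<integral>z. iexp (u \<bullet> z) \<partial>standard_gaussian) = exp (- (norm u)\<^sup>2 / 2)"
proof -
 have "(%z :: real^'q. iexp (u \<bullet> z)) : borel_measurable borel" by measurable
 then show ?thesis
  using gauss_fourier(2)[of u] by (simp add: standard_gaussian_integral scaleR_conv_of_real)
qed

text \<open>Fourier inversion for the Gaussian kernel: smoothing the law of $V$ with it only involves
 the characteristic function of $V$.\<close>

lemma (in prob_space) expectation_gauss_kernel:
 fixes V :: "'a => real^'q"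
 assumes [measurable]: "V : borel_measurable M"
 shows "complex_of_real (LINT v|M. gk s y (V v))
  = (1 / sqrt (2 * pi)) ^ CARD('q) *
  (LINT z|lborel. complex_of_real (gauss_density z) * iexp ((z \<bullet> y) / s) * (LINT v|M. iexp ((- (1/s) *\<^sub>R z) \<bullet> V v)))"
proof -
 let ?c = "(1 / sqrt (2 * pi)) ^ CARD('q)"
 have point: "complex_of_real (gauss_density x) = ?c * (LINT z|lborel. complex_of_real (gauss_density z) * iexp (x \<bullet> z))" for x :: "real^'q"
  unfolding gauss_fourier(2) by (subst gauss_density_norm) simp
 interpret P: pair_sigma_finite M "lborel :: (real^'q) measure" ..
 let ?g = "%v z. complex_of_real (gauss_density z) * iexp (((1/s) *\<^sub>R (y - V v)) \<bullet> z)"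
 have m: "(%(v, z). ?g v z) : borel_measurable (M \<Otimes>\<^sub>M lborel)" by measurable
 have int: "integrable (M \<Otimes>\<^sub>M lborel) (%(v, z). ?g v z)"
 proof (rule P.Fubini_integrable[OF m])
  have "(LINT z|lborel. norm (case (v, z) of (v, z) => ?g v z)) = 1" for v
  using gauss_density_integral by (simp add: norm_mult abs_of_nonneg[OF gauss_density_nonneg])
  then show "integrable M (%v. (LINT z|lborel. norm (case (v, z) of (v, z) => ?g v z)))" by simp
  show "AE v in M. integrable lborel (%z. case (v, z) of (v, z) => ?g v z)"
  by (rule AE_I2) (simp only: split_conv gauss_fourier(1))
 qed
 have A: "complex_of_real (LINT v|M. gk s y (V v)) = ?c * (LINT v|M. (LINT z|lborel. ?g v z))"
 proof -
  have "complex_of_real (LINT v|M. gk s y (V v))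
  = (LINT v|M. complex_of_real (gk s y (V v)))"
  by (rule integral_complex_of_real[symmetric])
  also have "(%v. complex_of_real (gk s y (V v))) = (%v. ?c * (LINT z|lborel. ?g v z))"
  by (rule ext) (rule point)
  finally show ?thesis unfolding integral_mult_right_zero .
 qed
 have B: "(LINT v|M. (LINT z|lborel. ?g v z)) = (LINT z|lborel. (LINT v|M. ?g v z))"
  by (rule P.Fubini_integral[OF int, symmetric])
 have C: "(LINT v|M. ?g v z) = complex_of_real (gauss_density z) * iexp ((z \<bullet> y) / s) * (LINT v|M. iexp ((- (1/s) *\<^sub>R z) \<bullet> V v))" for z
 proof -
  have g: "?g v z = (complex_of_real (gauss_density z) * iexp ((z \<bullet> y) / s)) * iexp ((- (1/s) *\<^sub>R z) \<bullet> V v)" for v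
  proof -
  have "((1/s) *\<^sub>R (y - V v)) \<bullet> z = (z \<bullet> y) / s + (- (1/s) *\<^sub>R z) \<bullet> V v"
  unfolding inner_scaleR_left inner_diff_left inner_commute[of z y] inner_commute[of z "V v"]
  by (simp add: diff_divide_distrib)
  then have "iexp (((1/s) *\<^sub>R (y - V v)) \<bullet> z) = iexp ((z \<bullet> y) / s) * iexp ((- (1/s) *\<^sub>R z) \<bullet> V v)"
  by (simp only: of_real_add distrib_left exp_add)
  then show ?thesis by (simp only: mult.assoc)
  qed
  show ?thesis unfolding g integral_mult_right_zero ..
 qed
 show ?thesis unfolding A B unfolding C ..
qed

lemma gauss_kernel_convolution:
 fixes g :: "real^'q => real"
 assumes [measurable]: "g : borel_measurable borel" and s: "s > 0"
 shows "(LINT y|lborel. g y * gk s y v)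
  = s ^ CARD('q) * (LINT z|lborel. g (v + s *\<^sub>R z) * gauss_density z)"
proof -
 have "(LINT y|lborel. g y * gk s y v)
  = (\<integral>y. g y * gk s y v \<partial>density (distr lborel borel (%x. v + s *\<^sub>R x)) (%_. ennreal (s ^ CARD('q))))"
  using lborel_affine[of s v] s by (simp add: ennreal_power)
 also have "... = (\<integral>y. s ^ CARD('q) *\<^sub>R (g y * gk s y v) \<partial>distr lborel borel (%x. v + s *\<^sub>R x))"
  by (rule integral_density) (use s in simp_all)
 also have "... = (LINT z|lborel. s ^ CARD('q) *\<^sub>R (g (v + s *\<^sub>R z) * gauss_density ((1/s) *\<^sub>R ((v + s *\<^sub>R z) - v))))"
  by (rule integral_distr) simp_all
 finally show ?thesis using s by simp
qed

text \<open>Fubini moves the smoothing from the test function to the law of \<open>V\<close>, so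
  that only expectations of Gaussian kernels, hence characteristic functions, remain. Integrability
  of \<open>g\<close> over the whole space is what makes this possible.\<close>

lemma (in prob_space) gauss_smoothing:
 fixes V :: "'a => real^'q" and g :: "real^'q => real"
 assumes [measurable]: "V : borel_measurable M" and g: "g : borel_measurable borel" "integrable lborel g" and s: "s > 0"
 shows "s ^ CARD('q) * (LINT q|M. (LINT z|lborel. g (V q + s *\<^sub>R z) * gauss_density z))
  = (LINT y|lborel. g y * (LINT q|M. gk s y (V q)))"
proof -
 note [measurable] = g(1)
 interpret P: pair_sigma_finite M "lborel :: (real^'q) measure" ..
 let ?c = "(1 / sqrt (2 * pi)) ^ CARD('q)"
 have gd: "gauss_density x <= ?c" for x :: "real^'q"
  unfolding gauss_density_norm by (simp add: mult_left_le)
 have m: "(%(q, y). g y * gk s y (V q)) : borel_measurable (M \<Otimes>\<^sub>M lborel)" by measurable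
 have ig: "integrable lborel (%y. g y * gk s y v)" for v
 proof (rule Lint_bound[where f = "%y. ?c * g y"])
  show "AE y in lborel. norm (g y * gk s y v) <= norm (?c * g y)"
  proof (rule AE_I2)
  fix y show "norm (g y * gk s y v) <= norm (?c * g y)"
  using gd[of "(1/s) *\<^sub>R (y - v)"] gauss_density_nonneg[of "(1/s) *\<^sub>R (y - v)"]
  unfolding real_norm_def abs_mult by (subst mult.commute) (intro mult_right_mono, simp_all)
  qed
 qed (use g in simp_all)
 have int: "integrable (M \<Otimes>\<^sub>M lborel) (%(q, y). g y * gk s y (V q))"
 proof (rule P.Fubini_integrable[OF m])
  show "AE q in M. integrable lborel (%y. case (q, y) of (q, y) => g y * gk s y (V q))"
  using ig by simp
  show "integrable M (%q. (LINT y|lborel. norm (case (q, y) of (q, y) => g y * gk s y (V q))))"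
  proof (rule integrable_const_bound[where B = "?c * (LINT y|lborel. \<bar>g y\<bar>)"])
  show "AE q in M. norm (LINT y|lborel. norm (case (q, y) of (q, y) => g y * gk s y (V q))) <= ?c * (LINT y|lborel. \<bar>g y\<bar>)"
  proof (rule AE_I2)
  fix q
  have "(LINT y|lborel. norm (g y * gk s y (V q))) <= (LINT y|lborel. ?c * \<bar>g y\<bar>)"
  proof (rule integral_mono)
  fix y show "norm (g y * gk s y (V q)) <= ?c * \<bar>g y\<bar>"
  using gd[of "(1/s) *\<^sub>R (y - V q)"] gauss_density_nonneg[of "(1/s) *\<^sub>R (y - V q)"]
  unfolding real_norm_def abs_mult by (subst mult.commute) (intro mult_right_mono, simp_all)
  qed (intro integrable_norm ig, use g in simp)
  then show "norm (LINT y|lborel. norm (case (q, y) of (q, y) => g y * gk s y (V q))) <= ?c * (LINT y|lborel. \<bar>g y\<bar>)"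
  by (simp add: abs_of_nonneg)
  qed
  qed measurable
 qed
 have "s ^ CARD('q) * (LINT q|M. (LINT z|lborel. g (V q + s *\<^sub>R z) * gauss_density z))
  = (LINT q|M. (LINT y|lborel. g y * gk s y (V q)))"
  by (simp add: gauss_kernel_convolution[OF g(1) s])
 also have "... = (LINT y|lborel. (LINT q|M. g y * gk s y (V q)))"
  by (rule P.Fubini_integral[OF int, symmetric])
 finally show ?thesis by simp
qed

lemma gauss_tail:
 "(%n. (LINT z|lborel. indicator {z :: real^'q. real n <= norm z} z * gauss_density z)) ----> 0"
proof -
 have "(%n. (LINT z|lborel. indicator {z :: real^'q. real n <= norm z} z * gauss_density z)) ----> (\<integral>z. 0 \<partial>(lborel :: (real^'q) measure))"
 proof (rule integral_dominated_convergence[where w = gauss_density])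
  show "AE z in lborel. (%n. indicator {z :: real^'q. real n <= norm z} z * gauss_density z) ----> 0"
  proof (rule AE_I2)
  fix z :: "real^'q"
  obtain N :: nat where "norm z < real N" using reals_Archimedean2 by blast
  then have "indicator {z :: real^'q. real n <= norm z} z * gauss_density z = 0" if "n >= N" for n
  using that by (simp add: indicator_def)
  then show "(%n. indicator {z :: real^'q. real n <= norm z} z * gauss_density z) ----> 0"
  by (intro tendsto_eventually) (auto simp: eventually_sequentially)
  qed
  show "AE z in lborel. norm (indicator {z :: real^'q. real n <= norm z} z * gauss_density z) <= gauss_density z" for n
  by (rule AE_I2) (simp add: indicator_def abs_of_nonneg[OF gauss_density_nonneg] gauss_density_nonneg)
 qed (simp_all add: gauss_density_integrable)
 then show ?thesis by simp
qed

lemma gauss_smoothing_uniform: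
 fixes g :: "real^'q => real"
 assumes uc: "uniformly_continuous_on UNIV g" and B: "!!v. \<bar>g v\<bar> <= B" and e: "e > 0"
 obtains s where "s > 0" "!!v. \<bar>(LINT z|lborel. g (v + s *\<^sub>R z) * gauss_density z) - g v\<bar> <= e"
proof -
 have [measurable]: "g : borel_measurable borel"
  by (intro borel_measurable_continuous_onI uniformly_continuous_imp_continuous uc)
 obtain d where d: "d > 0" "!!x y. dist y x < d ==> dist (g y) (g x) < e / 2"
  using uc e unfolding uniformly_continuous_on_def by (metis UNIV_I half_gt_zero)
 let ?t = "%n. (LINT z|lborel. indicator {z :: real^'q. real n <= norm z} z * gauss_density z)"
 have "(%n. 2 * B * ?t n) ----> 2 * B * 0" by (intro tendsto_mult tendsto_const gauss_tail)
 then have "\<forall>\<^sub>F n in sequentially. 2 * B * ?t n < e / 2" using e by (intro order_tendstoD(2)) auto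
 then obtain n where n: "2 * B * ?t (Suc n) < e / 2"
  unfolding eventually_sequentially by (meson Suc_n_not_le_n nat_le_linear)
 \<comment> \<open>A noise vector of norm below \<open>Suc n\<close> displaces the argument by less
   than \<open>d\<close>; larger ones are covered by the tail bound.\<close>
 let ?s = "d / real (Suc n)"
 have s: "?s > 0" using d by simp
 have "\<bar>(LINT z|lborel. g (v + ?s *\<^sub>R z) * gauss_density z) - g v\<bar> <= e" for v
 proof -
  have gi: "integrable lborel (%z. f z * gauss_density z)" if "f : borel_measurable borel" "!!z. \<bar>f z\<bar> <= C" for f :: "real^'q => real" and C
  proof (rule Lint_bound[where f = "%z. C * gauss_density z"])
  show "AE z in lborel. norm (f z * gauss_density z) <= norm (C * gauss_density z)"
  using order_trans[OF that(2) abs_ge_self]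
  by (intro AE_I2) (simp add: abs_mult mult_right_mono)
  qed (use that(1) in \<open>simp_all add: gauss_density_integrable\<close>)
  have i1: "integrable lborel (%z. g (v + ?s *\<^sub>R z) * gauss_density z)" by (rule gi[OF _ B]) measurable
  have i2: "integrable lborel (%z. g v * gauss_density z)" by (intro integrable_mult_right gauss_density_integrable)
  have i3: "integrable lborel (%z. indicator {z :: real^'q. real (Suc n) <= norm z} z * gauss_density z)"
  by (rule gi[where C = 1]) (auto simp: indicator_def)
  have "(LINT z|lborel. g (v + ?s *\<^sub>R z) * gauss_density z) - g v
  = (LINT z|lborel. g (v + ?s *\<^sub>R z) * gauss_density z - g v * gauss_density z)"
  using i1 i2 by (simp add: gauss_density_integral gauss_density_integrable)
  also have "\<bar>...\<bar> <= (LINT z|lborel. \<bar>g (v + ?s *\<^sub>R z) * gauss_density z - g v * gauss_density z\<bar>)"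
  by (rule integral_abs_bound)
  also have "... <= (LINT z|lborel. e / 2 * gauss_density z + 2 * B * (indicator {z :: real^'q. real (Suc n) <= norm z} z * gauss_density z))"
  proof (rule integral_mono)
  fix z :: "real^'q"
  have *: "\<bar>g (v + ?s *\<^sub>R z) - g v\<bar> <= e / 2 + 2 * B * indicator {z :: real^'q. real (Suc n) <= norm z} z"
  proof (cases "real (Suc n) <= norm z")
  case True
  then show ?thesis using B[of "v + ?s *\<^sub>R z"] B[of v] e by simp
  next
  case False
  then have "dist (v + ?s *\<^sub>R z) v < d" using d(1) by (simp add: dist_norm divide_simps mult.commute)
  from d(2)[OF this] show ?thesis using False by (simp add: dist_real_def)
  qed
  have "\<bar>g (v + ?s *\<^sub>R z) * gauss_density z - g v * gauss_density z\<bar> = \<bar>g (v + ?s *\<^sub>R z) - g v\<bar> * gauss_density z"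
  unfolding left_diff_distrib[symmetric] abs_mult abs_of_nonneg[OF gauss_density_nonneg] ..
  also have "... <= (e / 2 + 2 * B * indicator {z :: real^'q. real (Suc n) <= norm z} z) * gauss_density z"
  by (rule mult_right_mono[OF * gauss_density_nonneg])
  finally show "\<bar>g (v + ?s *\<^sub>R z) * gauss_density z - g v * gauss_density z\<bar>
  <= e / 2 * gauss_density z + 2 * B * (indicator {z :: real^'q. real (Suc n) <= norm z} z * gauss_density z)"
  by (simp only: distrib_right mult.assoc)
  qed (intro integrable_abs Lint_diff i1 i2, intro Lint_add integrable_mult_right i3 gauss_density_integrable)
  also have "... = e / 2 + 2 * B * ?t (Suc n)"
  using i3 gauss_density_integrable[where 'q = 'q] by (simp add: gauss_density_integral del: of_nat_Suc)
  finally show ?thesis using n by linarith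
 qed
 with s show ?thesis using that by blast
qed

lemma compact_support_uniformly_continuous:
 fixes g :: "real^'q => real"
 assumes cont: "continuous_on UNIV g" and supp: "!!v. norm v > R ==> g v = 0"
 shows "uniformly_continuous_on UNIV g"
proof -
 have uc: "uniformly_continuous_on (cball 0 (R + 1)) g"
  by (rule compact_uniformly_continuous[OF continuous_on_subset[OF cont] compact_cball]) simp
 show ?thesis
  unfolding uniformly_continuous_on_def
 proof (intro allI impI)
  fix e :: real assume e: "e > 0"
  obtain d where d: "d > 0" "!!x y. x : cball 0 (R + 1) ==> y : cball 0 (R + 1) ==> dist y x < d ==> dist (g y) (g x) < e"
  using uc e unfolding uniformly_continuous_on_def by blast
  have "dist (g y) (g x) < e" if xy: "dist y x < min d 1" for x y
  proof (cases "norm x <= R \<or> norm y <= R")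
  case True
  have "norm x <= norm y + dist y x" "norm y <= norm x + dist y x"
  using norm_triangle_ineq2[of x y] norm_triangle_ineq2[of y x] by (simp_all add: dist_norm norm_minus_commute)
  then have "x : cball 0 (R + 1)" "y : cball 0 (R + 1)" using True xy by (auto simp: dist_norm)
  then show ?thesis using d(2) xy by simp
  next
  case False
  then show ?thesis using supp[of x] supp[of y] e by simp
  qed
  then show "EX d>0. ALL x:UNIV. ALL x':UNIV. dist x' x < d --> dist (g x') (g x) < e"
  using d(1) by (intro exI[of _ "min d 1"]) simp
 qed
qed

text \<open>Kernel expectations converge by the inversion formula and dominated convergence, hence
  so do expectations of the smoothed \<open>g\<close>. Uniform continuity makes the smoothing error
  small for all laws at once.\<close>

lemma (in prob_space) levy_compact_support:
 fixes V :: "nat => 'a => real^'q" and g :: "real^'q => real"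
 assumes V: "!!n. V n : borel_measurable M"
  and char: "!!u. (%n. (LINT q|M. iexp (u \<bullet> V n q))) ----> exp (- (norm u)\<^sup>2 / 2)"
  and cont: "continuous_on UNIV g" and supp: "!!v. norm v > R ==> g v = 0"
 shows "(%n. (LINT q|M. g (V n q))) ----> (\<integral>v. g v \<partial>standard_gaussian)"
proof -
 note [measurable] = V
 have gm [measurable]: "g : borel_measurable borel" by (rule borel_measurable_continuous_onI[OF cont])
 have uc: "uniformly_continuous_on UNIV g" by (rule compact_support_uniformly_continuous[OF cont supp])
 have "compact (g ` cball 0 R)" by (rule compact_continuous_image[OF continuous_on_subset[OF cont] compact_cball]) simp
 then have "EX B0. ALL v:cball 0 R. \<bar>g v\<bar> <= B0"
  using compact_imp_bounded[of "g ` cball 0 R"] unfolding bounded_iff by auto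
 then obtain B0 where B0: "!!v. v : cball 0 R ==> \<bar>g v\<bar> <= B0" by blast
 define B where "B = max B0 0"
 have B: "\<bar>g v\<bar> <= B" for v
  using B0[of v] supp[of v] unfolding B_def by (cases "norm v <= R") auto
 have ig: "integrable lborel g"
 proof (rule Lint_bound[where f = "%v. B * indicator (cball 0 R) v"])
  have "emeasure lborel (cball (0 :: real^'q) R) < \<infinity>" by (rule emeasure_bounded_finite) simp
  then show "integrable lborel (%v. B * indicator (cball (0 :: real^'q) R) v)"
  by (intro integrable_mult_right integrable_real_indicator) simp_all
  show "AE v in lborel. norm (g v) <= norm (B * indicator (cball (0 :: real^'q) R) v)"
  proof (rule AE_I2)
  fix v :: "real^'q"
  show "norm (g v) <= norm (B * indicator (cball 0 R) v)"
  using B[of v] supp[of v] by (cases "norm v <= R") (simp_all add: indicator_def B_def)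
  qed
 qed simp
 interpret N: prob_space "standard_gaussian :: (real^'q) measure" by (rule standard_gaussian_prob)
 let ?id = "%v :: real^'q. v"
 have idm: "?id : borel_measurable standard_gaussian" by measurable
 let ?c = "(1 / sqrt (2 * pi)) ^ CARD('q)"
 have gd: "gauss_density x <= ?c" for x :: "real^'q"
  unfolding gauss_density_norm by (simp add: mult_left_le)
 have smooth: "(%n. (LINT q|M. (LINT z|lborel. g (V n q + s *\<^sub>R z) * gauss_density z)))
  ----> (\<integral>v. (LINT z|lborel. g (v + s *\<^sub>R z) * gauss_density z) \<partial>standard_gaussian)" if s: "s > 0" for s
 proof -
  have kern: "(%n. (LINT q|M. gk s y (V n q)))
  ----> (\<integral>v. gk s y v \<partial>standard_gaussian)" for y
  proof -
  have "(%n. (LINT z|lborel. complex_of_real (gauss_density z) * iexp ((z \<bullet> y) / s) * (LINT q|M. iexp ((- (1/s) *\<^sub>R z) \<bullet> V n q))))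
  ----> (\<integral>z. complex_of_real (gauss_density z) * iexp ((z \<bullet> y) / s) * (\<integral>v. iexp ((- (1/s) *\<^sub>R z) \<bullet> v) \<partial>standard_gaussian) \<partial>lborel)"
  proof (rule integral_dominated_convergence[where w = gauss_density])
  show "AE z in lborel. (%n. complex_of_real (gauss_density z) * iexp ((z \<bullet> y) / s) * (LINT q|M. iexp ((- (1/s) *\<^sub>R z) \<bullet> V n q)))
  ----> complex_of_real (gauss_density z) * iexp ((z \<bullet> y) / s) * (\<integral>v. iexp ((- (1/s) *\<^sub>R z) \<bullet> v) \<partial>standard_gaussian)"
  unfolding standard_gaussian_char by (intro AE_I2 tendsto_mult tendsto_const char)
  show "AE z in lborel. norm (complex_of_real (gauss_density z) * iexp ((z \<bullet> y) / s) * (LINT q|M. iexp ((- (1/s) *\<^sub>R z) \<bullet> V n q))) <= gauss_density z" for n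
  proof (rule AE_I2)
  fix z :: "real^'q"
  have "norm (LINT q|M. iexp ((- (1/s) *\<^sub>R z) \<bullet> V n q)) <= (LINT q|M. norm (iexp ((- (1/s) *\<^sub>R z) \<bullet> V n q)))"
  by (rule integral_norm_bound)
  also have "... = 1" by (simp only: norm_exp_i_times) (simp add: prob_space)
  finally have le1: "norm (LINT q|M. iexp ((- (1/s) *\<^sub>R z) \<bullet> V n q)) <= 1" .
  have "norm (complex_of_real (gauss_density z) * iexp ((z \<bullet> y) / s)) = gauss_density z"
  by (simp only: norm_mult norm_exp_i_times norm_of_real abs_of_nonneg[OF gauss_density_nonneg] mult_1_right)
  then show "norm (complex_of_real (gauss_density z) * iexp ((z \<bullet> y) / s) * (LINT q|M. iexp ((- (1/s) *\<^sub>R z) \<bullet> V n q))) <= gauss_density z"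
  using mult_left_le[OF le1 gauss_density_nonneg[of z]] by (simp only: norm_mult[of "_ * _"])
  qed
  show "integrable lborel (gauss_density :: real^'q => real)" by (rule gauss_density_integrable)
  qed measurable
  then have "(%n. ?c * (LINT z|lborel. complex_of_real (gauss_density z) * iexp ((z \<bullet> y) / s) * (LINT q|M. iexp ((- (1/s) *\<^sub>R z) \<bullet> V n q))))
  ----> ?c * (\<integral>z. complex_of_real (gauss_density z) * iexp ((z \<bullet> y) / s) * (\<integral>v. iexp ((- (1/s) *\<^sub>R z) \<bullet> v) \<partial>standard_gaussian) \<partial>lborel)"
  by (intro tendsto_mult tendsto_const)
  then have "(%n. complex_of_real (LINT q|M. gk s y (V n q)))
  ----> complex_of_real (\<integral>v. gk s y v \<partial>standard_gaussian)"
  unfolding expectation_gauss_kernel[OF V] N.expectation_gauss_kernel[OF idm] .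
  then show ?thesis unfolding tendsto_of_real_iff .
  qed
  have "(%n. (LINT y|lborel. g y * (LINT q|M. gk s y (V n q))))
  ----> (\<integral>y. g y * (\<integral>v. gk s y v \<partial>standard_gaussian) \<partial>lborel)"
  proof (rule integral_dominated_convergence[where w = "%y. \<bar>g y\<bar> * ?c"])
  show "AE y in lborel. (%n. g y * (LINT q|M. gk s y (V n q)))
  ----> g y * (\<integral>v. gk s y v \<partial>standard_gaussian)"
  by (intro AE_I2 tendsto_mult tendsto_const kern)
  show "AE y in lborel. norm (g y * (LINT q|M. gk s y (V n q))) <= \<bar>g y\<bar> * ?c" for n
  proof (rule AE_I2)
  fix y
  have i: "integrable M (%q. gk s y (V n q))"
  by (rule integrable_const_bound[where B = ?c])
  (auto intro!: AE_I2 simp: abs_of_nonneg[OF gauss_density_nonneg] gd)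
  have "(LINT q|M. gk s y (V n q)) <= (LINT q|M. ?c)"
  by (rule integral_mono[OF i]) (simp_all add: gd)
  moreover have "0 <= (LINT q|M. gk s y (V n q))"
  by (rule Bochner_Integration.integral_nonneg) (rule gauss_density_nonneg)
  ultimately show "norm (g y * (LINT q|M. gk s y (V n q))) <= \<bar>g y\<bar> * ?c"
  unfolding real_norm_def abs_mult by (intro mult_left_mono) (simp_all add: prob_space)
  qed
  show "integrable lborel (%y. \<bar>g y\<bar> * ?c)" by (intro integrable_mult_left integrable_abs ig)
  qed measurable
  then have "(%n. s ^ CARD('q) * (LINT q|M. (LINT z|lborel. g (V n q + s *\<^sub>R z) * gauss_density z)))
  ----> s ^ CARD('q) * (\<integral>v. (LINT z|lborel. g (v + s *\<^sub>R z) * gauss_density z) \<partial>standard_gaussian)"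
  unfolding gauss_smoothing[OF V gm ig s] N.gauss_smoothing[OF idm gm ig s] .
  note lim = tendsto_mult[OF tendsto_const[of "1 / s ^ CARD('q)"] this]
  have "(1 / s ^ CARD('q)) * (s ^ CARD('q) * t) = t" for t using s by simp
  with lim show ?thesis by (simp only:)
 qed
 show ?thesis
 proof (rule LIMSEQ_I)
  fix r :: real assume "r > 0"
  then have r4: "r / 4 > 0" by simp
  obtain s where s: "s > 0" "!!v. \<bar>(LINT z|lborel. g (v + s *\<^sub>R z) * gauss_density z) - g v\<bar> <= r / 4"
  using gauss_smoothing_uniform[OF uc B r4] by blast
  define h where "h v = (LINT z|lborel. g (v + s *\<^sub>R z) * gauss_density z)" for v
  have hm [measurable]: "h : borel_measurable borel" unfolding h_def by measurable
  have hg: "\<bar>h v - g v\<bar> <= r / 4" for v using s(2) unfolding h_def .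
  have hB: "\<bar>h v\<bar> <= B + r / 4" for v using hg[of v] B[of v] by linarith
  \<comment> \<open>Stated for an arbitrary probability space, since it is needed for
    \<open>M\<close> and for the Gaussian law itself.\<close>
  have diff: "\<bar>(\<integral>q. h (X q) \<partial>Q) - (\<integral>q. g (X q) \<partial>Q)\<bar> <= r / 4"
  if Q: "prob_space Q" and X: "X : borel_measurable Q" for Q :: "'z measure" and X
  proof -
  interpret Q: prob_space Q by (rule Q)
  note [measurable] = X
  have i: "integrable Q (%q. h (X q))" "integrable Q (%q. g (X q))"
  by (rule Q.integrable_const_bound[where B = "B + r / 4"], simp add: hB, measurable)
  (rule Q.integrable_const_bound[where B = B], simp add: B, measurable)
  have "\<bar>(\<integral>q. h (X q) \<partial>Q) - (\<integral>q. g (X q) \<partial>Q)\<bar> = \<bar>\<integral>q. h (X q) - g (X q) \<partial>Q\<bar>" using i by simp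
  also have "... <= (\<integral>q. \<bar>h (X q) - g (X q)\<bar> \<partial>Q)" by (rule integral_abs_bound)
  also have "... <= (\<integral>q. r / 4 \<partial>Q)" by (rule integral_mono) (use i hg in simp_all)
  finally show ?thesis by (simp add: Q.prob_space)
  qed
  obtain n0 where n0: "!!n. n >= n0 ==> \<bar>(LINT q|M. h (V n q)) - (\<integral>v. h v \<partial>standard_gaussian)\<bar> < r / 4"
  using LIMSEQ_D[OF smooth[OF s(1)] r4] unfolding h_def real_norm_def by blast
  have "norm ((LINT q|M. g (V n q)) - (\<integral>v. g v \<partial>standard_gaussian)) < r" if "n >= n0" for n
  using n0[OF that] diff[OF prob_space_axioms V[of n]] diff[OF N.prob_space_axioms idm] \<open>r > 0\<close>
  unfolding real_norm_def by linarith
  then show "EX no. ALL n>=no. norm ((LINT q|M. g (V n q)) - (\<integral>v. g v \<partial>standard_gaussian)) < r" by blast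
 qed
qed

text \<open>Tightness needs no separate argument: the compactly supported case applies to the
  cut-off function \<open>ct L\<close> itself, whose expectations converge to a number near 1. This
  bounds the mass on which \<open>g\<close> and \<open>g * ct L\<close> differ.\<close>

theorem (in prob_space) levy_continuity_gaussian:
 fixes V :: "nat => 'a => real^'q"
 assumes V: "!!n. V n : borel_measurable M"
  and char: "!!u. (%n. (LINT z|M. iexp (u \<bullet> V n z))) ----> exp (- (norm u)\<^sup>2 / 2)"
 shows "converges_in_distribution M V standard_gaussian"
 unfolding converges_in_distribution_def
proof (intro conjI allI impI V)
 fix g :: "real^'q => real"
 assume cont: "continuous_on UNIV g" and bd: "bounded (range g)"
 note [measurable] = V
 have gm [measurable]: "g : borel_measurable borel" by (rule borel_measurable_continuous_onI[OF cont])
 have "EX B. ALL v. \<bar>g v\<bar> <= B" using bd unfolding bounded_iff by auto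
 then obtain B where B: "!!v. \<bar>g v\<bar> <= B" by blast
 have B0: "0 <= B" using order_trans[OF abs_ge_zero B] .
 interpret N: prob_space "standard_gaussian :: (real^'q) measure" by (rule standard_gaussian_prob)
 have idm: "(%v :: real^'q. v) : borel_measurable standard_gaussian" by measurable
 define ct where "ct L v = max 0 (min 1 (real L + 1 - norm v))" for L :: nat and v :: "real^'q"
 have ctc: "continuous_on UNIV (ct L)" for L unfolding ct_def by (intro continuous_intros)
 have ctm [measurable]: "ct L : borel_measurable borel" for L by (rule borel_measurable_continuous_onI[OF ctc])
 have ct0: "0 <= ct L v" "ct L v <= 1" for L v by (simp_all add: ct_def)
 have cts: "ct L v = 0" if "norm v > real L + 1" for L v using that by (simp add: ct_def)
 have "(%L. \<integral>v. ct L v \<partial>standard_gaussian) ----> (\<integral>v. 1 \<partial>(standard_gaussian :: (real^'q) measure))"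
 proof (rule integral_dominated_convergence[where w = "%_. 1"])
  show "AE v in standard_gaussian. (%L. ct L v) ----> 1"
  proof (rule AE_I2)
  fix v :: "real^'q"
  obtain L0 :: nat where "norm v <= real L0" using real_arch_simple by blast
  then have "ct L v = 1" if "L >= L0" for L using that by (simp add: ct_def)
  then show "(%L. ct L v) ----> 1" by (intro tendsto_eventually) (auto simp: eventually_sequentially)
  qed
  show "AE v in standard_gaussian. norm (ct L v) <= 1" for L using ct0 by (intro AE_I2) simp
 qed (simp_all, measurable)
 then have ctlim: "(%L. \<integral>v. ct L v \<partial>standard_gaussian) ----> 1" using N.prob_space by simp
 show "(%n. (LINT z|M. g (V n z))) ----> (\<integral>v. g v \<partial>standard_gaussian)"
 proof (rule LIMSEQ_I)
  fix r :: real assume r: "r > 0"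
  define e where "e = r / (4 * (B + 1))"
  have e: "e > 0" "B * e < r / 4"
  proof -
  show "e > 0" unfolding e_def using r B0 by simp
  have "(B + 1) * e = r / 4" unfolding e_def using B0 by (simp add: field_simps)
  then show "B * e < r / 4" using \<open>e > 0\<close> by (simp add: distrib_right)
  qed
  obtain L where "\<bar>(\<integral>v. ct L v \<partial>standard_gaussian) - 1\<bar> < e / 2"
  using LIMSEQ_D[OF ctlim, of "e / 2"] e(1) by auto
  then have L: "1 - (\<integral>v. ct L v \<partial>standard_gaussian) < e / 2" by linarith
  have c1: "(%n. (LINT z|M. ct L (V n z))) ----> (\<integral>v. ct L v \<partial>standard_gaussian)"
  by (rule levy_compact_support[OF V char ctc cts])
  have c2: "(%n. (LINT z|M. g (V n z) * ct L (V n z))) ----> (\<integral>v. g v * ct L v \<partial>standard_gaussian)"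
  by (rule levy_compact_support[OF V char continuous_on_mult[OF cont ctc], of "real L + 1"]) (simp add: cts)
  obtain n1 where n1: "!!n. n >= n1 ==> \<bar>(LINT z|M. ct L (V n z)) - (\<integral>v. ct L v \<partial>standard_gaussian)\<bar> < e / 2"
  using LIMSEQ_D[OF c1, of "e / 2"] e(1) by auto
  obtain n2 where n2: "!!n. n >= n2 ==> \<bar>(LINT z|M. g (V n z) * ct L (V n z)) - (\<integral>v. g v * ct L v \<partial>standard_gaussian)\<bar> < r / 4"
  using LIMSEQ_D[OF c2, of "r / 4"] r by auto
  have cut: "\<bar>(\<integral>z. g (X z) \<partial>Q) - (\<integral>z. g (X z) * ct L (X z) \<partial>Q)\<bar> <= B * (1 - (\<integral>z. ct L (X z) \<partial>Q))"
  if Q: "prob_space Q" and X: "X : borel_measurable Q" for Q :: "'z measure" and X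
  proof -
  interpret Q: prob_space Q by (rule Q)
  note [measurable] = X
  have ig: "integrable Q (%z. g (X z))"
  by (rule Q.integrable_const_bound[where B = B], simp add: B, measurable)
  have ic: "integrable Q (%z. ct L (X z))"
  by (rule Q.integrable_const_bound[where B = 1], simp add: ct0, measurable)
  have igc: "integrable Q (%z. g (X z) * ct L (X z))"
  proof (rule Q.integrable_const_bound[where B = B])
  show "AE z in Q. norm (g (X z) * ct L (X z)) <= B"
  proof (rule AE_I2)
  fix z show "norm (g (X z) * ct L (X z)) <= B"
  using mult_mono[OF B[of "X z"] ct0(2)[of L "X z"] B0 ct0(1)] by (simp add: abs_mult abs_of_nonneg[OF ct0(1)])
  qed
  qed measurable
  have "\<bar>(\<integral>z. g (X z) \<partial>Q) - (\<integral>z. g (X z) * ct L (X z) \<partial>Q)\<bar> = \<bar>\<integral>z. g (X z) - g (X z) * ct L (X z) \<partial>Q\<bar>"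
  using ig igc by simp
  also have "... <= (\<integral>z. \<bar>g (X z) - g (X z) * ct L (X z)\<bar> \<partial>Q)" by (rule integral_abs_bound)
  also have "... <= (\<integral>z. B * (1 - ct L (X z)) \<partial>Q)"
  proof (rule integral_mono)
  fix z
  have "\<bar>g (X z) - g (X z) * ct L (X z)\<bar> = \<bar>g (X z)\<bar> * (1 - ct L (X z))"
  using ct0(2)[of L "X z"] by (simp add: abs_mult right_diff_distrib[of "g (X z)" 1, symmetric, simplified])
  also have "... <= B * (1 - ct L (X z))" using B ct0(2) by (intro mult_right_mono) simp_all
  finally show "\<bar>g (X z) - g (X z) * ct L (X z)\<bar> <= B * (1 - ct L (X z))" .
  qed (use ig igc ic in simp_all)
  also have "... = B * (1 - (\<integral>z. ct L (X z) \<partial>Q))" using ic by (simp add: Q.prob_space)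
  finally show ?thesis .
  qed
  have "norm ((LINT z|M. g (V n z)) - (\<integral>v. g v \<partial>standard_gaussian)) < r" if "n >= max n1 n2" for n
  proof -
  have "\<bar>(LINT z|M. ct L (V n z)) - (\<integral>v. ct L v \<partial>standard_gaussian)\<bar> < e / 2"
  using that by (intro n1) simp
  then have "1 - (LINT z|M. ct L (V n z)) <= e" using L by linarith
  then have "B * (1 - (LINT z|M. ct L (V n z))) <= B * e" using B0 by (rule mult_left_mono)
  moreover have "1 - (\<integral>v. ct L v \<partial>standard_gaussian) <= e" using L e(1) by linarith
  then have "B * (1 - (\<integral>v. ct L v \<partial>standard_gaussian)) <= B * e" using B0 by (rule mult_left_mono)
  moreover have "\<bar>(LINT z|M. g (V n z) * ct L (V n z)) - (\<integral>v. g v * ct L v \<partial>standard_gaussian)\<bar> < r / 4"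
  using that by (intro n2) simp
  ultimately show ?thesis
  using cut[OF prob_space_axioms V[of n]] cut[OF N.prob_space_axioms idm] e(2) unfolding real_norm_def by linarith
  qed
  then show "EX no. ALL n>=no. norm ((LINT z|M. g (V n z)) - (\<integral>v. g v \<partial>standard_gaussian)) < r" by blast
 qed
qed

section \<open>The chi-square law\<close>

text \<open>Both measures agree on half-lines: the set where the squared norm is at most
  \<open>t\<close> is a ball of radius \<open>sqrt t\<close>, whose volume is the integral of the
  density up to \<open>t\<close>.\<close>

lemma norm_square_lborel:
 "distr (lborel :: (real^'q) measure) borel (%z. (norm z)\<^sup>2)
  = density lborel (%t. ennreal (indicator {0..} t * (unit_ball_vol (real CARD('q)) * (real CARD('q) / 2) * t powr (real CARD('q) / 2 - 1))))"
 (is "?A = ?B")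
proof (rule measure_eqI_generator_eq[where E = "range (%t :: real. {..t})" and \<Omega> = UNIV and A = "%i. {..real i}"])
 let ?q = "real CARD('q)"
 let ?c = "unit_ball_vol ?q * (?q / 2)"
 let ?f = "%t. ?c * t powr (?q / 2 - 1)"
 have q: "?q > 0" by simp
 have c0: "0 <= ?c" by simp
 have eB: "emeasure ?B {..t} = (if 0 <= t then ennreal (unit_ball_vol ?q * t powr (?q / 2)) else 0)" for t :: real
 proof -
  have "emeasure ?B {..t} = (\<integral>\<^sup>+x. ennreal (indicator {0..} x * ?f x) * indicator {..t} x \<partial>lborel)"
  by (rule emeasure_density) simp_all
  also have "... = (\<integral>\<^sup>+x. ennreal (indicator {0..t} x * ?f x) \<partial>lborel)"
  by (rule nn_integral_cong) (simp add: indicator_def)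
  also have "... = (if 0 <= t then ennreal (unit_ball_vol ?q * t powr (?q / 2)) else 0)"
  proof (cases "0 <= t")
  case True
  have "((%x. x powr (?q / 2 - 1)) has_integral t powr (?q / 2 - 1 + 1) / (?q / 2 - 1 + 1)) {0..t}"
  using q True by (intro has_integral_powr_from_0) simp_all
  then have "((%x. ?c * x powr (?q / 2 - 1)) has_integral ?c * (t powr (?q / 2 - 1 + 1) / (?q / 2 - 1 + 1))) {0..t}"
  by (rule has_integral_mult_right)
  moreover have "?c * (t powr (?q / 2 - 1 + 1) / (?q / 2 - 1 + 1)) = unit_ball_vol ?q * t powr (?q / 2)"
  by simp
  ultimately have hi: "(?f has_integral unit_ball_vol ?q * t powr (?q / 2)) {0..t}" by simp
  have "(\<integral>\<^sup>+x. ennreal (indicator {0..t} x * ?f x) \<partial>lborel) = ennreal (unit_ball_vol ?q * t powr (?q / 2))"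
  by (rule nn_integral_has_integral_lebesgue[OF _ hi]) simp
  then show ?thesis using True by simp
  next
  case False
  then show ?thesis by simp
  qed
  finally show ?thesis .
 qed
 have eA: "emeasure ?A {..t} = (if 0 <= t then ennreal (unit_ball_vol ?q * t powr (?q / 2)) else 0)" for t :: real
 proof -
  have "emeasure ?A {..t} = emeasure lborel {z :: real^'q. (norm z)\<^sup>2 <= t}"
  by (subst emeasure_distr) (simp_all add: vimage_def)
  also have "... = (if 0 <= t then ennreal (unit_ball_vol ?q * t powr (?q / 2)) else 0)"
  proof (cases "0 <= t")
  case True
  have "(norm z)\<^sup>2 <= t \<longleftrightarrow> norm z <= sqrt t" for z :: "real^'q"
  using True real_le_rsqrt[of "norm z" t] power_mono[of "norm z" "sqrt t" 2] by auto
  then have "{z :: real^'q. (norm z)\<^sup>2 <= t} = cball 0 (sqrt t)" by (simp add: set_eq_iff)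
  then have "emeasure lborel {z :: real^'q. (norm z)\<^sup>2 <= t} = ennreal (unit_ball_vol ?q * sqrt t ^ CARD('q))"
  using emeasure_cball[of "sqrt t" "0 :: real^'q"] True by simp
  also have "sqrt t ^ CARD('q) = t powr (?q / 2)"
  proof (cases "t = 0")
  case False
  then have "sqrt t ^ CARD('q) = (t powr (1/2)) powr ?q"
  using True by (simp add: powr_half_sqrt powr_realpow)
  then show ?thesis by (simp add: powr_powr)
  qed simp
  finally show ?thesis using True by simp
  next
  case False
  then have "\<not> (norm z)\<^sup>2 <= t" for z :: "real^'q" using zero_le_power2[of "norm z"] by linarith
  then show ?thesis using False by simp
  qed
  finally show ?thesis .
 qed
 show "Int_stable (range (%t :: real. {..t}))"
 proof (rule Int_stableI)
  fix a b :: "real set" assume "a : range (%t. {..t})" "b : range (%t. {..t})"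
  then obtain s t where "a = {..s}" "b = {..t}" by blast
  then have "a \<inter> b = {..min s t}" by auto
  then show "a \<inter> b : range (%t. {..t})" by blast
 qed
 show "!!X. X : range (%t :: real. {..t}) ==> emeasure ?A X = emeasure ?B X"
  using eA eB by (auto simp del: emeasure_density)
 show "sets ?A = sigma_sets UNIV (range (%t :: real. {..t}))" "sets ?B = sigma_sets UNIV (range (%t :: real. {..t}))"
  by (simp_all add: borel_eq_atMost)
 show "range (%i. {..real i}) \<subseteq> range (%t :: real. {..t})" by blast
 show "(UN i. {..real i}) = UNIV"
 proof (rule set_eqI, rule iffI)
  fix x :: real
  obtain n :: nat where "x <= real n" using real_arch_simple by blast
  then show "x : (UN i. {..real i})" by blast
 qed simp
 show "!!i. emeasure ?A {..real i} ~= \<infinity>" unfolding eA by simp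
qed simp

text \<open>The Gaussian density depends on the squared norm only and so passes to the image of
  Lebesgue measure. The unit ball volume and the functional equation of Gamma at
  \<open>?q / 2\<close> produce the normalizing constant.\<close>

lemma standard_gaussian_norm_square:
 "distr (standard_gaussian :: (real^'q) measure) borel (%z. (norm z)\<^sup>2) = chi_square CARD('q)"
proof -
 let ?q = "real CARD('q)"
 let ?g = "%t. ennreal ((1 / sqrt (2 * pi)) ^ CARD('q) * exp (- t / 2))"
 let ?f = "%t. ennreal (indicator {0..} t * (unit_ball_vol ?q * (?q / 2) * t powr (?q / 2 - 1)))"
 have sg: "standard_gaussian = density (lborel :: (real^'q) measure) (%z. ?g ((norm z)\<^sup>2))"
  unfolding standard_gaussian_def gauss_density_def[symmetric] gauss_density_norm by simp
 have "distr (standard_gaussian :: (real^'q) measure) borel (%z. (norm z)\<^sup>2)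
  = density (distr (lborel :: (real^'q) measure) borel (%z. (norm z)\<^sup>2)) ?g"
  unfolding sg by (rule density_distr[symmetric]) simp_all
 also have "... = density (density lborel ?f) ?g" unfolding norm_square_lborel ..
 also have "... = density lborel (%t. ?f t * ?g t)"
  by (rule density_density_eq) simp_all
 also have "... = chi_square CARD('q)"
  unfolding chi_square_def
 proof (rule density_cong)
  show "AE t in lborel. ?f t * ?g t = ennreal (if t > 0 then
  t powr (?q / 2 - 1) * exp (- t / 2) / (2 powr (?q / 2) * Gamma (?q / 2)) else 0)"
  using AE_lborel_singleton[of 0]
  proof eventually_elim
  case (elim t)
  have const: "(1 / sqrt (2 * pi)) ^ CARD('q) * (unit_ball_vol ?q * (?q / 2)) = 1 / (2 powr (?q / 2) * Gamma (?q / 2))"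
  proof -
  have "sqrt (2 * pi) ^ CARD('q) = (2 * pi) powr (?q / 2)"
  proof -
  have "sqrt (2 * pi) ^ CARD('q) = ((2 * pi) powr (1/2)) powr ?q" by (simp add: powr_half_sqrt powr_realpow)
  then show ?thesis by (simp add: powr_powr)
  qed
  also have "... = 2 powr (?q / 2) * pi powr (?q / 2)" by (rule powr_mult)
  finally have s: "(1 / sqrt (2 * pi)) ^ CARD('q) = 1 / (2 powr (?q / 2) * pi powr (?q / 2))"
  by (simp only: power_one_over)
  have "Gamma (?q / 2 + 1) = (?q / 2) * Gamma (?q / 2)" by (rule Gamma_plus1, rule notI, drule nonpos_Ints_nonpos) simp
  moreover have "Gamma (?q / 2) > 0" by (rule Gamma_real_pos) simp
  ultimately have "unit_ball_vol ?q * (?q / 2) = pi powr (?q / 2) / Gamma (?q / 2)"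
  unfolding unit_ball_vol_def by simp
  then show ?thesis unfolding s by simp
  qed
  show ?case
  proof (cases "t > 0")
  case True
  have "?f t * ?g t = ennreal (((1 / sqrt (2 * pi)) ^ CARD('q) * (unit_ball_vol ?q * (?q / 2))) * (t powr (?q / 2 - 1) * exp (- t / 2)))"
  using True by (subst ennreal_mult[symmetric]) (simp_all add: mult_ac)
  then show ?thesis unfolding const using True by simp
  next
  case False
  then show ?thesis using elim by simp
  qed
  qed
 qed simp_all
 finally show ?thesis .
qed

text \<open>Continuous mapping by the squared norm.\<close>

theorem (in prob_space) chi_square_limit:
 fixes Z :: "nat => 'a => real^'q"
 assumes conv: "converges_in_distribution M Z standard_gaussian"
  and X: "!!n v. X n v = (SUM a:UNIV. (Z n v $ a)\<^sup>2)"
 shows "weak_conv_m (%n. distr M borel (X n)) (chi_square CARD('q))"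
proof -
 have [measurable]: "Z n : borel_measurable M" for n using conv by (simp add: converges_in_distribution_def)
 have Xn: "X n = (%v. (norm (Z n v))\<^sup>2)" for n
  using X by (simp add: fun_eq_iff norm_vec_def L2_set_def sum_nonneg)
 have [measurable]: "X n : borel_measurable M" for n unfolding Xn by measurable
 interpret N: prob_space "standard_gaussian :: (real^'q) measure" by (rule standard_gaussian_prob)
 have sq: "(%z :: real^'q. (norm z)\<^sup>2) : borel_measurable standard_gaussian" by measurable
 show ?thesis
 proof (rule integral_bdd_continuous_conv_imp_weak_conv)
  show "real_distribution (distr M borel (X n))" for n by (rule real_distribution_distr) measurable
  show "real_distribution (chi_square CARD('q))"
  unfolding standard_gaussian_norm_square[symmetric] by (rule N.real_distribution_distr) (rule sq)
  fix f :: "real => real" assume f: "!!x. isCont f x" "!!x. \<bar>f x\<bar> <= 1"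
  have fc: "continuous_on UNIV f" using f(1) by (simp add: continuous_at_imp_continuous_on)
  have fm [measurable]: "f : borel_measurable borel" by (rule borel_measurable_continuous_onI[OF fc])
  have "(%n. (LINT v|M. f ((norm (Z n v))\<^sup>2))) ----> (\<integral>z. f ((norm z)\<^sup>2) \<partial>(standard_gaussian :: (real^'q) measure))"
  proof -
  have "continuous_on UNIV (%z :: real^'q. f ((norm z)\<^sup>2))"
  by (intro continuous_on_compose2[OF fc] continuous_intros) simp
  moreover have "bounded (range (%z :: real^'q. f ((norm z)\<^sup>2)))"
  using f(2) unfolding bounded_iff by auto
  ultimately show ?thesis using conv unfolding converges_in_distribution_def by blast
  qed
  moreover have "integral\<^sup>L (chi_square CARD('q)) f = (\<integral>z. f ((norm z)\<^sup>2) \<partial>(standard_gaussian :: (real^'q) measure))"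
  unfolding standard_gaussian_norm_square[symmetric] by (rule integral_distr[OF sq fm])
  moreover have "integral\<^sup>L (distr M borel (X n)) f = (LINT v|M. f ((norm (Z n v))\<^sup>2))" for n
  by (subst integral_distr) (simp_all add: Xn)
  ultimately show "(%n. integral\<^sup>L (distr M borel (X n)) f) ----> integral\<^sup>L (chi_square CARD('q)) f" by simp
 qed
qed

section \<open>Lag sums and kernel quadratic forms\<close>

text \<open>Unnormalized autocorrelation at an integer lag. It is applied to sequences that vanish
  off \<open>{1..int n}\<close>, so the range of \<open>i + k\<close> needs no condition.\<close>

definition lagsum :: "nat => (int => real) => int => real" where
 "lagsum n u k = (SUM i:{1..int n}. u i * u (i + k))"

lemma sum_shift_le:
 fixes f :: "int => real"
 assumes "finite I" "!!i. 0 <= f i" "!!i. f i ~= 0 ==> i : {1..int n}"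
 shows "(SUM i:I. f (i + k)) <= (SUM i:{1..int n}. f i)"
proof -
 have "(SUM i:I. f (i + k)) = (SUM i:(%i. i + k) ` I. f i)"
  by (subst sum.reindex) (auto simp: inj_on_def)
 also have "... = (SUM i:((%i. i + k) ` I) \<inter> {1..int n}. f i)"
  using assms(1,3) by (intro sum.mono_neutral_right) auto
 also have "... <= (SUM i:{1..int n}. f i)" using assms(2) by (intro sum_mono2) auto
 finally show ?thesis .
qed

context
 fixes n :: nat and u :: "int => real"
 assumes supp: "!!i. u i ~= 0 ==> i : {1..int n}"
begin

lemma lag_double_sum:
 "(SUM s:{1..int n}. SUM t:{1..int n}. \<phi> (t - s) * (u s * u t)) = (SUM k:{- int n..int n}. \<phi> k * lagsum n u k)"
proof -
 have "(SUM t:{1..int n}. \<phi> (t - s) * (u s * u t)) = (SUM k:{- int n..int n}. \<phi> k * (u s * u (s + k)))"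
  if s: "s : {1..int n}" for s
 proof -
  have "(SUM k:{- int n..int n}. \<phi> k * (u s * u (s + k))) = (SUM t:(%k. s + k) ` {- int n..int n}. \<phi> (t - s) * (u s * u t))"
  by (subst sum.reindex) (auto simp: inj_on_def)
  also have "(%k. s + k) ` {- int n..int n} = {s - int n..s + int n}"
  by (simp add: image_add_atLeastAtMost)
  also have "(SUM t:{s - int n..s + int n}. \<phi> (t - s) * (u s * u t)) = (SUM t:{1..int n}. \<phi> (t - s) * (u s * u t))"
  proof (rule sum.mono_neutral_right)
  show "ALL t:{s - int n..s + int n} - {1..int n}. \<phi> (t - s) * (u s * u t) = 0" using supp by auto
  qed (use s in auto)
  finally show ?thesis by (rule sym)
 qed
 then have "(SUM s:{1..int n}. SUM t:{1..int n}. \<phi> (t - s) * (u s * u t))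
  = (SUM s:{1..int n}. SUM k:{- int n..int n}. \<phi> k * (u s * u (s + k)))" by (rule sum.cong[OF refl])
 also have "... = (SUM k:{- int n..int n}. SUM s:{1..int n}. \<phi> k * (u s * u (s + k)))" by (rule sum.swap)
 finally show ?thesis unfolding lagsum_def sum_distrib_left .
qed

lemma lagsum_even: "lagsum n u (- k) = lagsum n u k"
proof -
 let ?m = "nat \<bar>k\<bar>"
 have "lagsum n u (- k) = (SUM s:{1 - int ?m..int n + int ?m}. u (s + k) * u (s + k + - k))"
  unfolding lagsum_def by (rule sum_shift_support) (use supp in auto)
 also have "... = (SUM s:{1..int n}. u (s + k) * u (s + k + - k))"
 proof (rule sum.mono_neutral_right)
  show "ALL i:{1 - int ?m..int n + int ?m} - {1..int n}. u (i + k) * u (i + k + - k) = 0" using supp by auto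
 qed auto
 finally show ?thesis unfolding lagsum_def by (simp add: mult.commute)
qed

lemma lagsum_bound: "\<bar>lagsum n u k\<bar> <= (SUM i:{1..int n}. (u i)\<^sup>2)"
proof -
 have "\<bar>lagsum n u k\<bar> <= (SUM i:{1..int n}. \<bar>u i * u (i + k)\<bar>)" unfolding lagsum_def by (rule sum_abs)
 also have "... <= (SUM i:{1..int n}. ((u i)\<^sup>2 + (u (i + k))\<^sup>2) / 2)"
 proof (rule sum_mono)
  fix i
  have "0 <= (\<bar>u i\<bar> - \<bar>u (i + k)\<bar>)\<^sup>2" by simp
  then show "\<bar>u i * u (i + k)\<bar> <= ((u i)\<^sup>2 + (u (i + k))\<^sup>2) / 2" by (simp add: power2_diff abs_mult)
 qed
 also have "... = ((SUM i:{1..int n}. (u i)\<^sup>2) + (SUM i:{1..int n}. (u (i + k))\<^sup>2)) / 2"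
  by (simp add: sum.distrib sum_divide_distrib[symmetric])
 also have "... <= (SUM i:{1..int n}. (u i)\<^sup>2)"
  using sum_shift_le[of "{1..int n}" "%i. (u i)\<^sup>2" n k] supp by simp
 finally show ?thesis .
qed

text \<open>Exhibits the autocorrelation, as a function of the pair \<open>(s, t)\<close>, as a sum
  over translations \<open>c\<close> of rank one weights. This is the positive definiteness by which
  trigonometric Toeplitz forms split into squares.\<close>

lemma lagsum_convolution:
 assumes s: "s : {1..int n}" and t: "t : {1..int n}"
 shows "lagsum n u (s - t) = (SUM c:{- int n..int n}. u (c + s) * u (c + t))"
proof -
 have "(SUM c:{- int n..int n}. u (c + s) * u (c + t)) = (SUM i:(%c. c + t) ` {- int n..int n}. u i * u (i + (s - t)))"
  by (subst sum.reindex) (auto simp: inj_on_def algebra_simps)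
 also have "(%c. c + t) ` {- int n..int n} = {t - int n..t + int n}"
  by (simp add: image_add_atLeastAtMost' add.commute)
 also have "(SUM i:{t - int n..t + int n}. u i * u (i + (s - t))) = lagsum n u (s - t)"
  unfolding lagsum_def
 proof (rule sum.mono_neutral_right)
  show "ALL i:{t - int n..t + int n} - {1..int n}. u i * u (i + (s - t)) = 0"
  proof
  fix i assume "i : {t - int n..t + int n} - {1..int n}"
  then have "u i = 0" using supp[of i] by blast
  then show "u i * u (i + (s - t)) = 0" by simp
  qed
 qed (use t in auto)
 finally show ?thesis by (rule sym)
qed

end

text \<open>\<open>u\<close> is a deterministic combination of the design columns and enters only
  through its autocorrelation; the random sequence is the argument of the quadratic form.\<close>

definition kweight :: "(real => real) => real => nat => (int => real) => int => int => real" where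
 "kweight K h n u s t = (if s : {1..int n} \<and> t : {1..int n}
  then K (of_int (s - t) / h) * lagsum n u (s - t) / real n else 0)"

definition kform :: "(real => real) => real => nat => (int => real) => (int => real) => real" where
 "kform K h n u X = (SUM s:{1..int n}. SUM t:{1..int n}. kweight K h n u s t * (X s * X t))"

lemma kweight_supp: "kweight K h n u s t ~= 0 ==> s : {1..int n} \<and> t : {1..int n}"
 by (simp add: kweight_def split: if_splits)

text \<open>The quadratic form depends on the pairs \<open>(s, t)\<close> only through the lag, so
  it is a sum symmetric in the autocorrelations of \<open>u\<close> and of \<open>X\<close>. Read
  the other way, it is the form in the design weighted by residual autocovariances.\<close>

lemma kform_eq_lag:
 assumes supp: "!!i. u i ~= 0 ==> i : {1..int n}" "!!i. X i ~= 0 ==> i : {1..int n}"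
  and even: "!!v. K (- v) = K v"
 shows "kform K h n u X = (SUM k:{- int n..int n}. K (of_int k / h) * lagsum n u k / real n * lagsum n X k)"
proof -
 have ev: "K (of_int (s - t) / h) * lagsum n u (s - t) = K (of_int (t - s) / h) * lagsum n u (t - s)" for s t
  using lagsum_even[where k = "s - t", OF supp(1)] even[of "of_int (s - t) / h"] by (simp add: minus_divide_left)
 have "kform K h n u X = (SUM s:{1..int n}. SUM t:{1..int n}. (%k. K (of_int k / h) * lagsum n u k / real n) (t - s) * (X s * X t))"
  unfolding kform_def by (intro sum.cong refl) (simp add: kweight_def ev del: of_int_diff)
 also have "... = (SUM k:{- int n..int n}. K (of_int k / h) * lagsum n u k / real n * lagsum n X k)"
  by (rule lag_double_sum[OF supp(2)])
 finally show ?thesis .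
qed

lemma card_lags: "0 <= b ==> real (card {k:I. \<bar>of_int k :: real\<bar> <= b}) <= 2 * b + 1"
proof -
 assume b: "0 <= b"
 have "{k:I. \<bar>of_int k :: real\<bar> <= b} \<subseteq> {- \<lfloor>b\<rfloor>..\<lfloor>b\<rfloor>}" by (auto simp: le_floor_iff abs_le_iff minus_le_iff)
 then have "card {k:I. \<bar>of_int k :: real\<bar> <= b} <= card {- \<lfloor>b\<rfloor>..\<lfloor>b\<rfloor>}" by (intro card_mono) auto
 also have "real ... = 2 * of_int \<lfloor>b\<rfloor> + 1" using b by simp
 also have "... <= 2 * b + 1" by simp
 finally show ?thesis by simp
qed

context
 fixes K :: "real => real" and B L h :: real and n :: nat and u :: "int => real" and C :: real
 assumes B: "0 <= B" "0 <= L" "!!v. \<bar>K v\<bar> <= B" "!!v. \<bar>v\<bar> > L ==> K v = 0" and even: "!!v. K (- v) = K v"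
  and h: "0 < h" and supp: "!!i. u i ~= 0 ==> i : {1..int n}" and C: "(SUM i:{1..int n}. (u i)\<^sup>2) <= C"
begin

lemma kweight_bound: "\<bar>kweight K h n u s t\<bar> <= B * C / real n"
proof -
 have C0: "0 <= C" by (rule order_trans[OF sum_nonneg C]) simp
 have "\<bar>K (of_int (s - t) / h) * lagsum n u (s - t)\<bar> <= B * C"
  unfolding abs_mult by (intro mult_mono B order_trans[OF lagsum_bound C] supp) simp_all
 then have "\<bar>K (of_int (s - t) / h) * lagsum n u (s - t)\<bar> / real n <= B * C / real n" by (rule divide_right_mono) simp
 then show ?thesis using B(1) C0 by (simp add: kweight_def)
qed

text \<open>The compact support of \<open>K\<close> leaves at most \<open>2 * (L * h) + 1\<close>
  entries in a row, each of order 1/n.\<close>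

lemma kweight_row: "(SUM t:{1..int n}. \<bar>kweight K h n u s t\<bar>) <= (2 * (L * h) + 1) * (B * C / real n)"
proof -
 have C0: "0 <= C" by (rule order_trans[OF sum_nonneg C]) simp
 have "(SUM t:{1..int n}. \<bar>kweight K h n u s t\<bar>) = (SUM t:{t:{1..int n}. \<bar>of_int (s - t) :: real\<bar> <= L * h}. \<bar>kweight K h n u s t\<bar>)"
 proof (rule sum.mono_neutral_right)
  show "ALL t:{1..int n} - {t:{1..int n}. \<bar>of_int (s - t) :: real\<bar> <= L * h}. \<bar>kweight K h n u s t\<bar> = 0"
  proof
  fix t assume "t : {1..int n} - {t:{1..int n}. \<bar>of_int (s - t) :: real\<bar> <= L * h}"
  then have "\<not> \<bar>of_int (s - t) :: real\<bar> <= L * h" by blast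
  then have "\<bar>of_int (s - t) / h\<bar> > L" using h by (simp add: abs_divide less_divide_eq not_le)
  from B(4)[OF this] show "\<bar>kweight K h n u s t\<bar> = 0" by (simp add: kweight_def)
  qed
 qed auto
 also have "... <= real (card {t:{1..int n}. \<bar>of_int (s - t) :: real\<bar> <= L * h}) * (B * C / real n)"
  by (rule sum_bounded_above) (rule kweight_bound)
 also have "... <= (2 * (L * h) + 1) * (B * C / real n)"
 proof (rule mult_right_mono)
  have "(%t. s - t) ` {t:{1..int n}. \<bar>of_int (s - t) :: real\<bar> <= L * h} \<subseteq> {k:{s - int n..s}. \<bar>of_int k :: real\<bar> <= L * h}" by auto
  moreover have "inj_on (%t. s - t) {t:{1..int n}. \<bar>of_int (s - t) :: real\<bar> <= L * h}" by (auto simp: inj_on_def)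
  ultimately have "card {t:{1..int n}. \<bar>of_int (s - t) :: real\<bar> <= L * h} <= card {k:{s - int n..s}. \<bar>of_int k :: real\<bar> <= L * h}"
  by (intro card_inj_on_le[of "%t. s - t"] finite_subset[of "{k:{s - int n..s}. \<bar>of_int k :: real\<bar> <= L * h}" "{s - int n..s}"]) auto
  then have "real (card {t:{1..int n}. \<bar>of_int (s - t) :: real\<bar> <= L * h}) <= real (card {k:{s - int n..s}. \<bar>of_int k :: real\<bar> <= L * h})" by simp
  also have "... <= 2 * (L * h) + 1" by (rule card_lags) (use B(2) h in simp)
  finally show "real (card {t:{1..int n}. \<bar>of_int (s - t) :: real\<bar> <= L * h}) <= 2 * (L * h) + 1" .
 qed (use B(1) C0 in simp)
 finally show ?thesis .
qed

end

text \<open>Schur's test: row sums control the squares of \<open>x\<close>, column sums those of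
  \<open>y\<close>, after bounding each product by the mean of the two squares.\<close>

lemma schur_bound:
 fixes a :: "'i => 'i => real"
 assumes "!!s. s : I ==> (SUM t:I. \<bar>a s t\<bar>) <= A" "!!t. t : I ==> (SUM s:I. \<bar>a s t\<bar>) <= A"
 shows "\<bar>SUM s:I. SUM t:I. a s t * (x s * y t)\<bar> <= A * ((SUM s:I. (x s)\<^sup>2) + (SUM t:I. (y t)\<^sup>2)) / 2"
proof -
 have "\<bar>SUM s:I. SUM t:I. a s t * (x s * y t)\<bar> <= (SUM s:I. \<bar>SUM t:I. a s t * (x s * y t)\<bar>)" by (rule sum_abs)
 also have "... <= (SUM s:I. SUM t:I. (\<bar>a s t\<bar> * (x s)\<^sup>2 + \<bar>a s t\<bar> * (y t)\<^sup>2) / 2)"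
 proof (rule sum_mono)
  fix s
  have "\<bar>SUM t:I. a s t * (x s * y t)\<bar> <= (SUM t:I. \<bar>a s t * (x s * y t)\<bar>)" by (rule sum_abs)
  also have "... <= (SUM t:I. (\<bar>a s t\<bar> * (x s)\<^sup>2 + \<bar>a s t\<bar> * (y t)\<^sup>2) / 2)"
  proof (rule sum_mono)
  fix t
  have "0 <= \<bar>a s t\<bar> * (\<bar>x s\<bar> - \<bar>y t\<bar>)\<^sup>2" by simp
  then show "\<bar>a s t * (x s * y t)\<bar> <= (\<bar>a s t\<bar> * (x s)\<^sup>2 + \<bar>a s t\<bar> * (y t)\<^sup>2) / 2"
  by (simp add: power2_diff abs_mult algebra_simps)
  qed
  finally show "\<bar>SUM t:I. a s t * (x s * y t)\<bar> <= (SUM t:I. (\<bar>a s t\<bar> * (x s)\<^sup>2 + \<bar>a s t\<bar> * (y t)\<^sup>2) / 2)" .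
 qed
 also have "... = ((SUM s:I. SUM t:I. \<bar>a s t\<bar> * (x s)\<^sup>2) + (SUM s:I. SUM t:I. \<bar>a s t\<bar> * (y t)\<^sup>2)) / 2"
  by (simp only: sum_divide_distrib[symmetric] sum.distrib)
 finally have *: "\<bar>SUM s:I. SUM t:I. a s t * (x s * y t)\<bar>
  <= ((SUM s:I. SUM t:I. \<bar>a s t\<bar> * (x s)\<^sup>2) + (SUM s:I. SUM t:I. \<bar>a s t\<bar> * (y t)\<^sup>2)) / 2" .
 have 1: "(SUM s:I. SUM t:I. \<bar>a s t\<bar> * (x s)\<^sup>2) <= A * (SUM s:I. (x s)\<^sup>2)"
  unfolding sum_distrib_left sum_distrib_right[symmetric] by (intro sum_mono mult_right_mono assms(1)) simp_all
 have 2: "(SUM s:I. SUM t:I. \<bar>a s t\<bar> * (y t)\<^sup>2) <= A * (SUM t:I. (y t)\<^sup>2)"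
 proof -
  have "(SUM s:I. SUM t:I. \<bar>a s t\<bar> * (y t)\<^sup>2) = (SUM t:I. (SUM s:I. \<bar>a s t\<bar>) * (y t)\<^sup>2)"
  unfolding sum_distrib_right by (rule sum.swap)
  also have "... <= (SUM t:I. A * (y t)\<^sup>2)" by (intro sum_mono mult_right_mono assms(2)) simp_all
  finally show ?thesis by (simp add: sum_distrib_left)
 qed
 show ?thesis using * 1 2 by (simp add: distrib_left)
qed

text \<open>The bilinear bound is applied to the image \<open>?b\<close> of \<open>y\<close> paired
  with \<open>A * y\<close>; half of the square sum of \<open>?b\<close> is then absorbed on the
  left.\<close>

lemma schur_square_bound:
 fixes a :: "'i => 'i => real"
 assumes A: "0 < A" "!!s. s : I ==> (SUM t:I. \<bar>a s t\<bar>) <= A" "!!t. t : I ==> (SUM s:I. \<bar>a s t\<bar>) <= A"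
 shows "(SUM s:I. (SUM t:I. a s t * y t)\<^sup>2) <= A\<^sup>2 * (SUM t:I. (y t)\<^sup>2)"
proof -
 let ?b = "%s. SUM t:I. a s t * y t"
 let ?S = "SUM s:I. (?b s)\<^sup>2" and ?Y = "SUM t:I. (A * y t)\<^sup>2"
 have "A * ?S = (SUM s:I. SUM t:I. a s t * (?b s * (A * y t)))"
  unfolding power2_eq_square sum_distrib_left sum_distrib_right by (intro sum.cong refl) (simp add: mult_ac)
 then have "A * ?S <= A * (?S + ?Y) / 2" using schur_bound[OF A(2,3), where x = ?b and y = "%t. A * y t"] by linarith
 then have "A * ?S <= A * ?Y" by (simp add: distrib_left)
 then have "?S <= ?Y" using A(1) by simp
 then show ?thesis by (simp add: power_mult_distrib sum_distrib_left)
qed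

context prob_space
begin

text \<open>Testing the difference against its sign turns the expected absolute value into a Toeplitz sum in
 the kernel, so that only trigonometric weights remain; for those the form splits into squares of
 linear forms.\<close>

lemma kernel_form_difference:
 assumes K: "admissible_kernel K" and supp: "!!i. u i ~= 0 ==> i : {1..int n}"
  and X: "!!i. X i : L2 M" and Y: "!!i. Y i : L2 M" and pos: "0 <= \<Lambda>" "0 <= dl"
  and nX: "!!a. L2_norm M (%z. SUM i:{1..int n}. a i * X i z) <= \<Lambda> * sqrt (SUM i:{1..int n}. (a i)\<^sup>2)"
  and nD: "!!a. L2_norm M (%z. SUM i:{1..int n}. a i * (X i z - Y i z)) <= dl * sqrt (SUM i:{1..int n}. (a i)\<^sup>2)"
 shows "(LINT z|M. \<bar>kform K h n u (%i. X i z) - kform K h n u (%i. Y i z)\<bar>)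
  <= (LINT v|lborel. \<bar>cos_transform K v\<bar>) * (dl * (2 * \<Lambda> + dl) * (SUM i:{1..int n}. (u i)\<^sup>2))"
proof -
 let ?I = "{1..int n}" and ?R = "{- int n..int n}" and ?C = "SUM i:{1..int n}. (u i)\<^sup>2"
 define D where "D z = kform K h n u (%i. X i z) - kform K h n u (%i. Y i z)" for z
 note [measurable] = L2_measurable[OF X] L2_measurable[OF Y]
 have [measurable]: "D : borel_measurable M" unfolding D_def[abs_def] kform_def by measurable
 define y where "y z = sgn (D z)" for z
 have [measurable]: "y : borel_measurable M" unfolding y_def[abs_def] by measurable
 have y1: "\<bar>y z\<bar> <= 1" for z by (simp add: y_def sgn_if)
 define q where "q s t = (LINT z|M. y z * (X s z * X t z - Y s z * Y t z))" for s t
 have yint: "integrable M (%z. y z * f z)" if "integrable M f" for f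
 proof (rule Lint_bound[OF that])
  have [measurable]: "f : borel_measurable M" using that by simp
  show "(%z. y z * f z) : borel_measurable M" by measurable
  show "AE z in M. norm (y z * f z) <= norm (f z)"
  using y1 by (intro AE_I2) (simp add: abs_mult mult_left_le_one_le)
 qed
 have qi: "integrable M (%z. y z * (X s z * X t z - Y s z * Y t z))" for s t
  by (intro yint Lint_diff L2_integrable_mult X Y)
 have qsum: "(LINT z|M. (SUM s:?I. SUM t:?I. b s t * (y z * (X s z * X t z - Y s z * Y t z)))) = (SUM s:?I. SUM t:?I. b s t * q s t)" for b
 proof -
  have i: "integrable M (%z. b s t * (y z * (X s z * X t z - Y s z * Y t z)))" for s t
  by (rule integrable_mult_right[OF qi])
  have "(LINT z|M. (SUM s:?I. SUM t:?I. b s t * (y z * (X s z * X t z - Y s z * Y t z))))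
  = (SUM s:?I. (LINT z|M. (SUM t:?I. b s t * (y z * (X s z * X t z - Y s z * Y t z)))))"
  by (rule LINT_sum, rule Lint_sum, rule i)
  also have "... = (SUM s:?I. SUM t:?I. (LINT z|M. b s t * (y z * (X s z * X t z - Y s z * Y t z))))"
  by (rule sum.cong[OF refl], rule LINT_sum, rule i)
  finally show ?thesis unfolding q_def integral_mult_right_zero .
 qed
 have Dy: "\<bar>D z\<bar> = (SUM s:?I. SUM t:?I. kweight K h n u s t * (y z * (X s z * X t z - Y s z * Y t z)))" for z
 proof -
  have "\<bar>D z\<bar> = y z * D z" by (simp add: y_def sgn_if)
  also have "... = (SUM s:?I. SUM t:?I. kweight K h n u s t * (y z * (X s z * X t z - Y s z * Y t z)))"
  unfolding D_def kform_def sum_subtractf[symmetric] sum_distrib_left by (intro sum.cong refl) (simp add: algebra_simps)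
  finally show ?thesis .
 qed
 \<comment> \<open>\<open>G f\<close> is the expected difference, tested against the sign
   \<open>y\<close>, between the squares of the linear forms with coefficients \<open>f\<close> in
   \<open>X\<close> and in \<open>Y\<close>.\<close>
 define G where "G f = (SUM s:?I. SUM t:?I. (f s * f t) * q s t)" for f :: "int => real"
 have Gb: "\<bar>G f\<bar> <= dl * (2 * \<Lambda> + dl) * (SUM s:?I. (f s)\<^sup>2)" for f
 proof -
  define P where "P z = (SUM s:?I. f s * X s z)" for z
  define Q where "Q z = (SUM s:?I. f s * (X s z - Y s z))" for z
  have PL: "P : L2 M" unfolding P_def[abs_def] by (intro L2_sum L2_cmult X)
  have QL: "Q : L2 M" unfolding Q_def[abs_def] by (intro L2_sum L2_cmult L2_diff X Y)
  have SL: "(%z. 2 * P z - Q z) : L2 M" by (intro L2_diff L2_cmult PL QL)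
  have yQ: "(%z. y z * Q z) : L2 M" "L2_norm M (%z. y z * Q z) <= L2_norm M Q"
  using y1 L2_measurable[OF QL] by (auto intro!: L2_norm_mono[OF QL] simp: abs_mult mult_left_le_one_le)
  \<comment> \<open>With \<open>P\<close> and \<open>Q\<close> the linear forms in \<open>X\<close>
    and in \<open>X - Y\<close>, the difference of squares is
    \<open>P^2 - (P - Q)^2 = Q * (2 * P - Q)\<close>, whose first factor has norm of order
    \<open>dl\<close>.\<close>
  have e: "(SUM s:?I. SUM t:?I. (f s * f t) * (y z * (X s z * X t z - Y s z * Y t z))) = (y z * Q z) * (2 * P z - Q z)" for z
  proof -
  have Y': "(SUM s:?I. f s * Y s z) = P z - Q z" unfolding P_def Q_def by (simp add: right_diff_distrib sum_subtractf)
  have "(SUM s:?I. SUM t:?I. (f s * f t) * (y z * (X s z * X t z - Y s z * Y t z)))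
  = (SUM s:?I. SUM t:?I. y z * ((f s * X s z) * (f t * X t z)) - y z * ((f s * Y s z) * (f t * Y t z)))"
  by (intro sum.cong refl) (simp add: algebra_simps)
  also have "... = y z * (P z * P z) - y z * ((SUM s:?I. f s * Y s z) * (SUM s:?I. f s * Y s z))"
  unfolding P_def sum_subtractf sum_distrib_left[symmetric] sum_product ..
  finally have "(SUM s:?I. SUM t:?I. (f s * f t) * (y z * (X s z * X t z - Y s z * Y t z)))
  = y z * (P z * P z) - y z * ((SUM s:?I. f s * Y s z) * (SUM s:?I. f s * Y s z))" .
  then show ?thesis unfolding Y' by (simp add: algebra_simps)
  qed
  have "G f = (LINT z|M. (y z * Q z) * (2 * P z - Q z))" unfolding G_def qsum[symmetric] e ..
  then have "\<bar>G f\<bar> <= L2_norm M (%z. y z * Q z) * L2_norm M (%z. 2 * P z - Q z)"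
  using L2_Cauchy_Schwarz[OF yQ(1) SL] by simp
  also have "... <= (dl * sqrt (SUM s:?I. (f s)\<^sup>2)) * ((2 * \<Lambda> + dl) * sqrt (SUM s:?I. (f s)\<^sup>2))"
  proof (rule mult_mono)
  show "L2_norm M (%z. y z * Q z) <= dl * sqrt (SUM s:?I. (f s)\<^sup>2)"
  using yQ(2) nD[of f] unfolding Q_def[abs_def] by linarith
  have "L2_norm M (%z. 2 * P z - Q z) <= L2_norm M (%z. 2 * P z) + L2_norm M (%z. (2 * P z - Q z) - 2 * P z)"
  by (rule L2_norm_le_add_diff[OF SL L2_cmult[OF PL]])
  also have "(%z. (2 * P z - Q z) - 2 * P z) = (%z. (- 1) * Q z)" by simp
  finally have "L2_norm M (%z. 2 * P z - Q z) <= 2 * L2_norm M P + L2_norm M Q"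
  unfolding L2_norm_cmult by simp
  then show "L2_norm M (%z. 2 * P z - Q z) <= (2 * \<Lambda> + dl) * sqrt (SUM s:?I. (f s)\<^sup>2)"
  using nX[of f] nD[of f] unfolding P_def[abs_def] Q_def[abs_def] by (simp add: algebra_simps)
  qed (use pos in \<open>simp_all add: sum_nonneg\<close>)
  also have "... = dl * (2 * \<Lambda> + dl) * (sqrt (SUM s:?I. (f s)\<^sup>2) * sqrt (SUM s:?I. (f s)\<^sup>2))" by (simp only: mult_ac)
  finally show ?thesis by (simp add: sum_nonneg)
 qed
 have toep: "\<bar>SUM s:?I. SUM t:?I. (lagsum n u (s - t) / real n * q s t) * cos (\<theta> * of_int (s - t))\<bar> <= dl * (2 * \<Lambda> + dl) * ?C" for \<theta>
 proof -
  \<comment> \<open>The addition theorem for the cosine and the translates in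
    \<open>lagsum_convolution\<close> split the weight into products of a function of
    \<open>s\<close> and the same function of \<open>t\<close>.\<close>
  let ?c = "%c s. u (s + c) * cos (\<theta> * of_int s)" and ?s = "%c s. u (s + c) * sin (\<theta> * of_int s)"
  have split: "lagsum n u (s - t) * q s t * cos (\<theta> * of_int (s - t))
  = (SUM c:?R. (?c c s * ?c c t) * q s t + (?s c s * ?s c t) * q s t)" if "s : ?I" "t : ?I" for s t
  proof -
  have lc: "lagsum n u (s - t) = (SUM c:?R. u (c + s) * u (c + t))"
  by (rule lagsum_convolution[OF supp that])
  show ?thesis unfolding lc sum_distrib_right
  by (intro sum.cong refl) (simp add: of_int_diff right_diff_distrib cos_diff algebra_simps)
  qed
  have "(SUM s:?I. SUM t:?I. lagsum n u (s - t) * q s t * cos (\<theta> * of_int (s - t)))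
  = (SUM s:?I. SUM t:?I. SUM c:?R. (?c c s * ?c c t) * q s t + (?s c s * ?s c t) * q s t)"
  by (intro sum.cong refl split)
  also have "... = (SUM s:?I. SUM c:?R. SUM t:?I. (?c c s * ?c c t) * q s t + (?s c s * ?s c t) * q s t)"
  by (intro sum.cong refl sum.swap)
  also have "... = (SUM c:?R. SUM s:?I. SUM t:?I. (?c c s * ?c c t) * q s t + (?s c s * ?s c t) * q s t)" by (rule sum.swap)
  also have "... = (SUM c:?R. G (?c c) + G (?s c))" unfolding G_def by (simp only: sum.distrib)
  finally have "\<bar>SUM s:?I. SUM t:?I. lagsum n u (s - t) * q s t * cos (\<theta> * of_int (s - t))\<bar> <= (SUM c:?R. \<bar>G (?c c) + G (?s c)\<bar>)"
  by (simp only: sum_abs)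
  also have "... <= (SUM c:?R. dl * (2 * \<Lambda> + dl) * (SUM s:?I. (u (s + c))\<^sup>2))"
  proof (rule sum_mono)
  fix c
  have "(SUM s:?I. (?c c s)\<^sup>2) + (SUM s:?I. (?s c s)\<^sup>2) = (SUM s:?I. (u (s + c))\<^sup>2)"
  unfolding sum.distrib[symmetric] power_mult_distrib distrib_left[symmetric] by simp
  then have "dl * (2 * \<Lambda> + dl) * (SUM s:?I. (?c c s)\<^sup>2) + dl * (2 * \<Lambda> + dl) * (SUM s:?I. (?s c s)\<^sup>2) = dl * (2 * \<Lambda> + dl) * (SUM s:?I. (u (s + c))\<^sup>2)"
  by (simp only: distrib_left[symmetric])
  then show "\<bar>G (?c c) + G (?s c)\<bar> <= dl * (2 * \<Lambda> + dl) * (SUM s:?I. (u (s + c))\<^sup>2)"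
  using Gb[of "?c c"] Gb[of "?s c"] by linarith
  qed
  also have "... = dl * (2 * \<Lambda> + dl) * (SUM s:?I. SUM c:?R. (u (c + s))\<^sup>2)"
  unfolding sum_distrib_left[symmetric] by (subst sum.swap) (simp only: add.commute)
  \<comment> \<open>For each \<open>s\<close> the translations sweep at most the whole square sum of
    \<open>u\<close>. The resulting factor \<open>n\<close> cancels the division by \<open>n\<close>
    in the weights.\<close>
  also have "... <= dl * (2 * \<Lambda> + dl) * (SUM s:?I. ?C)"
  using pos supp by (intro mult_left_mono sum_mono sum_shift_le[where f = "%i. (u i)\<^sup>2"]) auto
  finally have *: "\<bar>SUM s:?I. SUM t:?I. lagsum n u (s - t) * q s t * cos (\<theta> * of_int (s - t))\<bar> <= real n * (dl * (2 * \<Lambda> + dl) * ?C)"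
  by (simp add: mult_ac)
  have "(SUM s:?I. SUM t:?I. (lagsum n u (s - t) / real n * q s t) * cos (\<theta> * of_int (s - t)))
  = (SUM s:?I. SUM t:?I. lagsum n u (s - t) * q s t * cos (\<theta> * of_int (s - t))) / real n"
  by (simp add: sum_divide_distrib)
  with * show ?thesis using pos by (cases "n = 0") (simp_all add: divide_le_eq mult_ac)
 qed
 have "(LINT z|M. \<bar>D z\<bar>) = (SUM s:?I. SUM t:?I. kweight K h n u s t * q s t)" unfolding Dy qsum ..
 also have "... = (SUM s:?I. SUM t:?I. (lagsum n u (s - t) / real n * q s t) * K (of_int (s - t) / h))"
  by (intro sum.cong refl) (simp add: kweight_def)
 also have "... <= (LINT v|lborel. \<bar>cos_transform K v\<bar>) * (dl * (2 * \<Lambda> + dl) * ?C)"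
  using kernel_toeplitz_bound[OF K toep, of h] by linarith
 finally show ?thesis unfolding D_def .
qed

end

section \<open>Kernel quadratic forms of the errors and of the residuals\<close>

text \<open>Dominated convergence for the counting measure on the integers, the terms outside the
  growing window being set to zero.\<close>

lemma dominated_int_sum:
 fixes f :: "nat => int => real"
 assumes G: "G summable_on UNIV" and bound: "!!n k. \<bar>f n k\<bar> <= G k" and lim: "!!k. (%n. f n k) ----> F k"
 shows "(%n. SUM k:{- int n..int n}. f n k) ----> (\<Sum>\<^sub>\<infinity>k. F k)"
proof -
 have FG: "\<bar>F k\<bar> <= G k" for k
  by (rule LIMSEQ_le_const2[OF tendsto_rabs[OF lim]]) (use bound in auto)
 have G0: "0 <= G k" for k using FG[of k] by linarith
 have iG: "integrable (count_space UNIV) G"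
  using G G0 unfolding Infinite_Set_Sum.abs_summable_on_def[symmetric] abs_summable_equivalent[symmetric]
  by (simp add: abs_of_nonneg)
 have iF: "integrable (count_space UNIV) F"
  by (rule Lint_bound[OF iG]) (use FG in \<open>auto intro!: order_trans[OF FG abs_ge_self]\<close>)
 have "(%n. \<integral>k. (if k : {- int n..int n} then f n k else 0) \<partial>count_space UNIV) ----> (\<integral>k. F k \<partial>count_space UNIV)"
 proof (rule integral_dominated_convergence[OF _ _ iG])
  show "AE k in count_space UNIV. (%n. if k : {- int n..int n} then f n k else 0) ----> F k"
  proof (rule AE_I2)
  fix k
  have "\<forall>\<^sub>F n in sequentially. (if k : {- int n..int n} then f n k else 0) = f n k"
  using eventually_ge_at_top[of "nat \<bar>k\<bar>"] by eventually_elim auto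
  then show "(%n. if k : {- int n..int n} then f n k else 0) ----> F k"
  using lim[of k] by (simp only: tendsto_cong)
  qed
  show "AE k in count_space UNIV. norm (if k : {- int n..int n} then f n k else 0) <= G k" for n
  using bound G0 by (intro AE_I2) simp
 qed simp_all
 moreover have "(\<integral>k. (if k : {- int n..int n} then f n k else 0) \<partial>count_space UNIV) = (SUM k:{- int n..int n}. f n k)" for n
 proof -
  have "(\<integral>k. (if k : {- int n..int n} then f n k else 0) \<partial>count_space UNIV)
  = (SUM k | k : UNIV \<and> (if k : {- int n..int n} then f n k else 0) ~= 0. (if k : {- int n..int n} then f n k else 0))"
  by (rule lebesgue_integral_count_space_finite_support) (auto intro: finite_subset[of _ "{- int n..int n}"] split: if_splits)
  also have "... = (SUM k:{- int n..int n}. (if k : {- int n..int n} then f n k else 0))"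
  by (rule sum.mono_neutral_left) (auto split: if_splits)
  also have "... = (SUM k:{- int n..int n}. f n k)" by (rule sum.cong) auto
  finally show ?thesis .
 qed
 moreover have "(\<integral>k. F k \<partial>count_space UNIV) = (\<Sum>\<^sub>\<infinity>k. F k)"
  using infsetsum_infsum[of F UNIV] iF by (simp add: infsetsum_def Infinite_Set_Sum.abs_summable_on_def)
 ultimately show ?thesis by simp
qed

text \<open>For \<open>n >= |k|\<close> there are \<open>n - |k|\<close> indices \<open>i\<close>
  with both \<open>i\<close> and \<open>i + k\<close> in the window: these are the Fejer
  weights.\<close>

lemma lagsum_interval:
 "(%n. lagsum n (%i. if i : {1..int n} then 1 else 0) k / real n) ----> 1"
proof (rule tendsto_sandwich)
 let ?u = "%n i. if i : {1..int n} then 1 else (0::real)"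
 show "\<forall>\<^sub>F n in sequentially. 1 - \<bar>of_int k\<bar> / real n <= lagsum n (?u n) k / real n"
  using eventually_ge_at_top[of "max 1 (nat \<bar>k\<bar>)"]
 proof eventually_elim
  case (elim n)
  have "real n - \<bar>of_int k\<bar> <= lagsum n (?u n) k"
  proof -
  have "lagsum n (?u n) k = (SUM i:{i:{1..int n}. i + k : {1..int n}}. 1)"
  unfolding lagsum_def by (rule sum.mono_neutral_cong_right) auto
  also have "{i:{1..int n}. i + k : {1..int n}} = {max 1 (1 - k)..min (int n) (int n - k)}" by auto
  also have "(SUM i:{max 1 (1 - k)..min (int n) (int n - k)}. 1) = real (nat (min (int n) (int n - k) - max 1 (1 - k) + 1))" by simp
  also have "... >= of_int (min (int n) (int n - k) - max 1 (1 - k) + 1)" by (simp add: of_nat_nat max_def)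
  also have "min (int n) (int n - k) - max 1 (1 - k) + 1 = int n - \<bar>k\<bar>" by (simp add: min_def max_def)
  finally show ?thesis by simp
  qed
  from divide_right_mono[OF this, of "real n"] show ?case using elim by (simp add: diff_divide_distrib)
 qed
 show "\<forall>\<^sub>F n in sequentially. lagsum n (?u n) k / real n <= 1"
  using eventually_ge_at_top[of 1]
 proof eventually_elim
  case (elim n)
  have "lagsum n (?u n) k <= (SUM i:{1..int n}. (?u n i)\<^sup>2)"
  by (rule order_trans[OF abs_ge_self lagsum_bound]) (simp split: if_splits)
  also have "... = real n" by simp
  finally show ?case using elim by (simp add: divide_le_eq)
 qed
 have "(%n. 1 - \<bar>of_int k\<bar> / real n) ----> 1 - 0" by (intro tendsto_diff tendsto_const lim_const_over_n)
 then show "(%n. 1 - \<bar>of_int k\<bar> / real n) ----> 1" by simp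
qed simp

context hannan_process
begin

lemma quadratic_form_expectation:
 "(LINT z|M. (SUM s:I. SUM t:I. a s t * (eps s z * eps t z))) = (SUM s:I. SUM t:I. a s t * gam (t - s))"
proof -
 have i: "integrable M (%z. a s t * (eps s z * eps t z))" for s t
  by (intro integrable_mult_right L2_integrable_mult eps_L2)
 have "(LINT z|M. (SUM s:I. SUM t:I. a s t * (eps s z * eps t z))) = (SUM s:I. (LINT z|M. (SUM t:I. a s t * (eps s z * eps t z))))"
  by (rule LINT_sum, rule Lint_sum, rule i)
 also have "... = (SUM s:I. SUM t:I. (LINT z|M. a s t * (eps s z * eps t z)))"
  by (rule sum.cong[OF refl], rule LINT_sum, rule i)
 finally show ?thesis unfolding integral_mult_right_zero gam_stationary .
qed

lemma weighted_sum_variance: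
 assumes "!!i. u i ~= 0 ==> i : {1..int n}"
 shows "(nrm (%z. SUM i:{1..int n}. u i * eps i z))\<^sup>2 = (SUM k:{- int n..int n}. gam k * lagsum n u k)"
proof -
 have e: "(SUM i:{1..int n}. u i * eps i z)\<^sup>2 = (SUM s:{1..int n}. SUM t:{1..int n}. (u s * u t) * (eps s z * eps t z))" for z
  unfolding power2_eq_square sum_product by (intro sum.cong refl) (simp only: mult_ac)
 have "(nrm (%z. SUM i:{1..int n}. u i * eps i z))\<^sup>2
  = (LINT z|M. (SUM s:{1..int n}. SUM t:{1..int n}. (u s * u t) * (eps s z * eps t z)))"
  unfolding L2_norm_power2 e ..
 also have "... = (SUM s:{1..int n}. SUM t:{1..int n}. gam (t - s) * (u s * u t))"
  unfolding quadratic_form_expectation by (intro sum.cong refl) (simp only: mult_ac)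
 also have "... = (SUM k:{- int n..int n}. gam k * lagsum n u k)" by (rule lag_double_sum[OF assms])
 finally show ?thesis .
qed

lemma kform_integrable: "(!!i. X i : L2 M) ==> integrable M (%z. kform K c n u (%i. X i z))"
 unfolding kform_def by (intro Lint_sum integrable_mult_right L2_integrable_mult)

context
 fixes K :: "real => real" and h :: "nat => real" and w :: "nat => int => real" and C :: real and \<rho> :: "int => real"
 assumes K: "admissible_kernel K"
  and h: "!!n. n >= 1 ==> 0 < h n" "filterlim h at_top sequentially" "(%n. h n / real n) ----> 0"
  and supp: "!!n i. w n i ~= 0 ==> i : {1..int n}" and C: "!!n. (SUM i:{1..int n}. (w n i)\<^sup>2) <= C"
  and \<rho>: "!!k. (%n. lagsum n (w n) k) ----> \<rho> k"
begin

lemma C_nonneg: "0 <= C" by (rule order_trans[OF sum_nonneg C[of 0]]) simp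

lemma lagsum_w_bound: "\<bar>lagsum n (w n) k\<bar> <= C"
 by (rule order_trans[OF lagsum_bound C]) (rule supp)

lemma weighted_sum_variance_limit:
 "(%n. (nrm (%z. SUM i:{1..int n}. w n i * eps i z))\<^sup>2) ----> (\<Sum>\<^sub>\<infinity>k. gam k * \<rho> k)"
proof -
 have eq: "(nrm (%z. SUM i:{1..int n}. w n i * eps i z))\<^sup>2 = (SUM k:{- int n..int n}. gam k * lagsum n (w n) k)" for n
  by (rule weighted_sum_variance[OF supp])
 show ?thesis unfolding eq
proof (rule dominated_int_sum)
 show "(%k. \<bar>gam k\<bar> * C) summable_on UNIV" by (rule summable_on_cmult_left[OF gam_abs_summable])
 show "\<bar>gam k * lagsum n (w n) k\<bar> <= \<bar>gam k\<bar> * C" for n k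
  unfolding abs_mult by (intro mult_left_mono lagsum_w_bound abs_ge_zero)
 show "(%n. gam k * lagsum n (w n) k) ----> gam k * \<rho> k" for k by (intro tendsto_mult tendsto_const \<rho>)
qed
qed

lemma kernel_even: "K (- v) = K v" using K by (simp add: admissible_kernel_def)

text \<open>At a fixed lag the kernel factor tends to \<open>K 0 = 1\<close> because
  \<open>h n\<close> tends to infinity, the autocorrelation to \<open>\<rho> k\<close>, and the
  Fejer weight to 1; summability of the autocovariances dominates.\<close>

lemma kform_mean_limit:
 "(%n. (LINT z|M. kform K (h n) n (w n) (%i. eps i z))) ----> (\<Sum>\<^sub>\<infinity>k. gam k * \<rho> k)"
proof -
 obtain B L where B: "0 <= B" "0 <= L" "!!v. \<bar>K v\<bar> <= B" "!!v. \<bar>v\<bar> > L ==> K v = 0"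
  using admissible_kernel_bounds[OF K] by blast
 \<comment> \<open>The indicator of the window writes the sum over pairs as a lag sum of the form
   required by \<open>lag_double_sum\<close>.\<close>
 let ?u = "%n i. if i : {1..int n} then 1 else (0::real)"
 let ?f = "%n k. K (of_int k / h n) * lagsum n (w n) k * gam k * (lagsum n (?u n) k / real n)"
 have eq: "(LINT z|M. kform K (h n) n (w n) (%i. eps i z)) = (SUM k:{- int n..int n}. ?f n k)" for n
 proof -
  have ev: "K (of_int (s - t) / h n) * lagsum n (w n) (s - t) = K (of_int (t - s) / h n) * lagsum n (w n) (t - s)" for s t
  using lagsum_even[where k = "s - t", OF supp] kernel_even[of "of_int (s - t) / h n"] by (simp add: minus_divide_left)
  have "(LINT z|M. kform K (h n) n (w n) (%i. eps i z))
  = (SUM s:{1..int n}. SUM t:{1..int n}. (%k. K (of_int k / h n) * lagsum n (w n) k / real n * gam k) (t - s) * (?u n s * ?u n t))"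
  unfolding kform_def quadratic_form_expectation
  by (intro sum.cong refl) (simp add: kweight_def ev del: of_int_diff)
  also have "... = (SUM k:{- int n..int n}. K (of_int k / h n) * lagsum n (w n) k / real n * gam k * lagsum n (?u n) k)"
  by (rule lag_double_sum) (simp split: if_splits)
  finally show ?thesis by (simp add: mult_ac)
 qed
 show ?thesis unfolding eq
 proof (rule dominated_int_sum)
  show "(%k. \<bar>gam k\<bar> * (B * C)) summable_on UNIV" by (rule summable_on_cmult_left[OF gam_abs_summable])
  show "\<bar>?f n k\<bar> <= \<bar>gam k\<bar> * (B * C)" for n k
  proof -
  have "\<bar>lagsum n (?u n) k\<bar> <= (SUM i:{1..int n}. (?u n i)\<^sup>2)" by (rule lagsum_bound) (simp split: if_splits)
  also have "... = real n" by simp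
  finally have "\<bar>lagsum n (?u n) k / real n\<bar> <= 1" by (simp add: abs_divide divide_le_eq)
  moreover have "\<bar>K (of_int k / h n) * lagsum n (w n) k * gam k\<bar> <= B * C * \<bar>gam k\<bar>"
  unfolding abs_mult using B(1) C_nonneg by (intro mult_mono B(3) lagsum_w_bound) simp_all
  ultimately have "\<bar>K (of_int k / h n) * lagsum n (w n) k * gam k\<bar> * \<bar>lagsum n (?u n) k / real n\<bar> <= B * C * \<bar>gam k\<bar> * 1"
  using B(1) C_nonneg by (intro mult_mono) simp_all
  then show ?thesis by (simp only: abs_mult mult_1_right mult.commute mult.left_commute)
  qed
  fix k
  have "(%n. of_int k / h n) ----> 0"
  by (rule real_tendsto_divide_at_top[OF tendsto_const h(2)])
  moreover have "isCont K 0" using K by (simp add: admissible_kernel_def continuous_on_eq_continuous_at)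
  ultimately have "(%n. K (of_int k / h n)) ----> K 0" by (rule isCont_tendsto_compose[rotated])
  then have "(%n. ?f n k) ----> K 0 * \<rho> k * gam k * 1"
  by (rule tendsto_mult[OF tendsto_mult[OF tendsto_mult[OF _ \<rho>] tendsto_const] lagsum_interval])
  then show "(%n. ?f n k) ----> gam k * \<rho> k" using K by (simp add: admissible_kernel_def mult.commute)
 qed
qed

lemma kweight_bounds:
 "EX B L. 0 <= B \<and> 0 <= L \<and> (ALL n s t. \<bar>kweight K (h n) n (w n) s t\<bar> <= B * C / real n) \<and>
  (ALL n>=1. ALL s. (SUM t:{1..int n}. \<bar>kweight K (h n) n (w n) s t\<bar>) <= (2 * (L * h n) + 1) * (B * C / real n))"
proof -
 obtain B L where B: "0 <= B" "0 <= L" "!!v. \<bar>K v\<bar> <= B" "!!v. \<bar>v\<bar> > L ==> K v = 0"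
  using admissible_kernel_bounds[OF K] by blast
 have row: "(SUM t:{1..int n}. \<bar>kweight K (h n) n (w n) s t\<bar>) <= (2 * (L * h n) + 1) * (B * C / real n)" if n: "n >= 1" for n s
  by (rule kweight_row[where K = K]) (rule B kernel_even C h(1)[OF n] supp | assumption)+
 have bd: "\<bar>kweight K (h n) n (w n) s t\<bar> <= B * C / real n" for n s t
 proof (cases "n = 0")
  case True then show ?thesis by (simp add: kweight_def)
 next
  case False
  then have n: "n >= 1" by simp
  show ?thesis by (rule kweight_bound[where K = K and L = L]) (rule B kernel_even C h(1)[OF n] supp | assumption)+
 qed
 show ?thesis by (intro exI[of _ B] exI[of _ L] conjI allI impI B(1,2) row bd)
qed

lemma kweight_sym: "kweight K (h n) n (w n) s t = kweight K (h n) n (w n) t s"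
proof -
 have "lagsum n (w n) (s - t) = lagsum n (w n) (t - s)"
  using lagsum_even[where k = "s - t", OF supp] by simp
 moreover have "K (of_int (s - t) / h n) = K (of_int (t - s) / h n)"
  using kernel_even[of "of_int (s - t) / h n"] by (simp add: minus_divide_left)
 ultimately show ?thesis by (simp add: kweight_def)
qed

text \<open>A row sum times the largest entry, summed over n rows, bounds the sum of squared weights
  by a multiple of \<open>h n / real n + 1 / real n\<close>; here \<open>h n / real n\<close>
  tending to 0 enters. The diagonals stay bounded because each entry is of order 1/n.\<close>

lemma kform_ma_variance:
 fixes m :: nat
 assumes zt: "!!k. mdiff (zt k)" "!!k z. \<bar>zt k z\<bar> <= b"
 defines "X n z \<equiv> kform K (h n) n (w n) (%i. ma m zt i z)"
 shows "X n : L2 M" "(%n. (LINT z|M. \<bar>X n z - (LINT z|M. X n z)\<bar>)) ----> 0"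
proof -
 obtain B L where BL: "0 <= B \<and> 0 <= L \<and> (ALL n s t. \<bar>kweight K (h n) n (w n) s t\<bar> <= B * C / real n) \<and>
  (ALL n>=1. ALL s. (SUM t:{1..int n}. \<bar>kweight K (h n) n (w n) s t\<bar>) <= (2 * (L * h n) + 1) * (B * C / real n))"
  using kweight_bounds by (elim exE)
 have B: "0 <= B" "0 <= L" using BL by simp_all
 have kb: "\<bar>kweight K (h n) n (w n) s t\<bar> <= B * C / real n" for n s t using BL by blast
 have krow: "(SUM t:{1..int n}. \<bar>kweight K (h n) n (w n) s t\<bar>) <= (2 * (L * h n) + 1) * (B * C / real n)" if "n >= 1" for n s
  using BL that by blast
 have mab: "\<bar>ma m zt i z\<bar> <= (SUM k:{- int m..int m}. b)" for i z
  unfolding ma_def by (rule order_trans[OF sum_abs sum_mono]) (rule zt(2))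
 have maL: "ma m zt i : L2 M" for i by (intro ma_L2 mdiff_L2 zt(1))
 have prod: "(%z. ma m zt s z * ma m zt t z) : L2 M" for s t
 proof (rule L2_const_bound[OF finite_measure_axioms])
  note [measurable] = L2_measurable[OF maL]
  show "(%z. ma m zt s z * ma m zt t z) : borel_measurable M" by measurable
  show "\<bar>ma m zt s z * ma m zt t z\<bar> <= (SUM k:{- int m..int m}. b) * (SUM k:{- int m..int m}. b)" for z
  unfolding abs_mult by (rule mult_mono[OF mab mab order_trans[OF abs_ge_zero mab] abs_ge_zero])
 qed
 show XL: "X n : L2 M" for n unfolding X_def kform_def by (intro L2_sum L2_cmult prod)
 have "(%n. nrm (%z. X n z - (LINT z|M. X n z))) ----> 0"
  unfolding X_def kform_def
 proof (rule ma_quadratic_form[OF trivial_past zt])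
  show "kweight K (h n) n (w n) s t ~= 0 ==> s : {1..int n} \<and> t : {1..int n}" for n s t by (rule kweight_supp)
  show "(SUM s:{1 - int m..int n + int m}. \<bar>kweight K (h n) n (w n) (s + k) (s + l)\<bar>) <= B * C" for n k l
  proof -
  let ?f = "%i. if i : {1..int n} then B * C / real n else 0"
  have "(SUM s:{1 - int m..int n + int m}. \<bar>kweight K (h n) n (w n) (s + k) (s + l)\<bar>) <= (SUM s:{1 - int m..int n + int m}. ?f (s + k))"
  proof (rule sum_mono)
  fix s
  show "\<bar>kweight K (h n) n (w n) (s + k) (s + l)\<bar> <= ?f (s + k)"
  proof (cases "s + k : {1..int n}")
  case True
  show ?thesis unfolding if_P[OF True] by (rule kb)
  next
  case False
  then have "kweight K (h n) n (w n) (s + k) (s + l) = 0"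
  using kweight_supp[of K "h n" n "w n" "s + k" "s + l"] by blast
  then show ?thesis unfolding if_not_P[OF False] by simp
  qed
  qed
  also have "... <= (SUM i:{1..int n}. ?f i)" using B(1) C_nonneg by (intro sum_shift_le) (auto split: if_splits)
  also have "... <= B * C" using B(1) C_nonneg by simp
  finally show ?thesis .
  qed
  show "(%n. SUM s:{1..int n}. SUM t:{1..int n}. (kweight K (h n) n (w n) s t)\<^sup>2) ----> 0"
  proof (rule null_comparison)
  have "(%n. (2 * (L * (h n / real n)) + 1 / real n) * (B * C)\<^sup>2) ----> (2 * (L * 0) + 0) * (B * C)\<^sup>2"
  by (intro tendsto_mult tendsto_add tendsto_const h(3) lim_const_over_n)
  then show "(%n. (2 * (L * (h n / real n)) + 1 / real n) * (B * C)\<^sup>2) ----> 0" by simp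
  fix n
  show "\<bar>SUM s:{1..int n}. SUM t:{1..int n}. (kweight K (h n) n (w n) s t)\<^sup>2\<bar> <= (2 * (L * (h n / real n)) + 1 / real n) * (B * C)\<^sup>2"
  proof (cases "n = 0")
  case False
  then have n: "n >= 1" by simp
  have "(SUM t:{1..int n}. (kweight K (h n) n (w n) s t)\<^sup>2) <= (2 * (L * h n) + 1) * (B * C / real n) * (B * C / real n)" for s
  proof -
  have "(SUM t:{1..int n}. (kweight K (h n) n (w n) s t)\<^sup>2) <= (SUM t:{1..int n}. \<bar>kweight K (h n) n (w n) s t\<bar> * (B * C / real n))"
  proof (rule sum_mono)
  fix t
  show "(kweight K (h n) n (w n) s t)\<^sup>2 <= \<bar>kweight K (h n) n (w n) s t\<bar> * (B * C / real n)"
  using mult_left_mono[OF kb[of n s t] abs_ge_zero[of "kweight K (h n) n (w n) s t"]] by (simp add: power2_eq_square)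
  qed
  also have "... = (SUM t:{1..int n}. \<bar>kweight K (h n) n (w n) s t\<bar>) * (B * C / real n)" by (rule sum_distrib_right[symmetric])
  also have "... <= (2 * (L * h n) + 1) * (B * C / real n) * (B * C / real n)"
  using B(1) C_nonneg by (intro mult_right_mono krow[OF n]) simp
  finally show ?thesis .
  qed
  then have "(SUM s:{1..int n}. SUM t:{1..int n}. (kweight K (h n) n (w n) s t)\<^sup>2)
  <= (SUM s:{1..int n}. (2 * (L * h n) + 1) * (B * C / real n) * (B * C / real n))" by (intro sum_mono)
  also have "... = (2 * (L * (h n / real n)) + 1 / real n) * (B * C)\<^sup>2" using n by (simp add: field_simps power2_eq_square)
  finally show ?thesis by (simp add: sum_nonneg)
  qed simp
  qed
 qed
 then show "(%n. (LINT z|M. \<bar>X n z - (LINT z|M. X n z)\<bar>)) ----> 0"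
 proof (rule null_comparison)
  fix n
  have "(%z. X n z - (LINT z|M. X n z)) : L2 M"
  by (intro L2_diff XL L2_const_bound[OF finite_measure_axioms]) auto
  from expectation_abs_le_L2_norm[OF this]
  show "\<bar>(LINT z|M. \<bar>X n z - (LINT z|M. X n z)\<bar>)\<bar> <= nrm (%z. X n z - (LINT z|M. X n z))" by simp
 qed
qed

text \<open>\<open>kernel_form_difference\<close> replaces the errors by a bounded moving average in
  L1, uniformly in n and the bandwidth, where the variance vanishes. The mean is computed for the
  errors themselves, so the moving average leaves no trace in the limit.\<close>

theorem kform_limit:
 "(%n. (LINT z|M. \<bar>kform K (h n) n (w n) (%i. eps i z) - (\<Sum>\<^sub>\<infinity>k. gam k * \<rho> k)\<bar>)) ----> 0"
proof (rule LIMSEQ_I)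
 fix r :: real assume r: "r > 0"
 let ?A = "(LINT v|lborel. \<bar>cos_transform K v\<bar>)" and ?\<sigma> = "\<Sum>\<^sub>\<infinity>k. gam k * \<rho> k"
 define Q where "Q n z = kform K (h n) n (w n) (%i. eps i z)" for n z
 define c where "c = ?A * ((2 * hannan_sum + 1) * C)"
 have A0: "0 <= ?A" by (rule integral_nonneg_AE) simp
 have c0: "0 <= c" unfolding c_def using A0 C_nonneg hannan_sum_nonneg by simp
 \<comment> \<open>The error \<open>dl * c\<close> enters twice, through the form and through its
   mean, so it is kept below \<open>r / 4\<close>. The minimum with 1 allows
   \<open>2 * hannan_sum + dl\<close> to be bounded by \<open>2 * hannan_sum + 1\<close>.\<close>
 define dl where "dl = min 1 (r / (8 * (c + 1)))"
 have dl: "dl > 0" "dl <= 1" unfolding dl_def using r c0 by simp_all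
 have dlc: "dl * c < r / 8 + r / 8"
 proof -
  have "dl * c <= r / (8 * (c + 1)) * c" unfolding dl_def using c0 by (intro mult_right_mono) simp_all
  also have "... <= r / 8" using r c0 by (simp add: divide_simps)
  finally show ?thesis using r by simp
 qed
 from bounded_ma_approximation_ex[OF dl(1)]
 obtain m zt b where P: "(ALL k. mdiff (zt k)) \<and> (ALL k z. \<bar>zt k z\<bar> <= b) \<and>
  (ALL I a. finite I --> nrm (%z. SUM i:I. a i * (eps i z - ma m zt i z)) <= dl * sqrt (SUM i:I. (a i)\<^sup>2))"
  by (elim exE)
 have zt: "mdiff (zt k)" "\<bar>zt k z\<bar> <= b" for k z using P by blast+
 have approx: "finite I ==> nrm (%z. SUM i:I. a i * (eps i z - ma m zt i z)) <= dl * sqrt (SUM i:I. (a i)\<^sup>2)" for I a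
  using P by blast
 define X where "X n z = kform K (h n) n (w n) (%i. ma m zt i z)" for n z
 have XL: "X n : L2 M" for n unfolding X_def[abs_def] by (rule kform_ma_variance(1)[OF zt])
 have Xv: "(%n. (LINT z|M. \<bar>X n z - (LINT z|M. X n z)\<bar>)) ----> 0"
  unfolding X_def by (rule kform_ma_variance(2)[OF zt])
 have iX: "integrable M (X n)" for n by (rule L2_int[OF XL])
 have iQ: "integrable M (Q n)" for n unfolding Q_def[abs_def] by (rule kform_integrable[OF eps_L2])
 have d: "(LINT z|M. \<bar>Q n z - X n z\<bar>) <= dl * c" for n
 proof -
  have "(LINT z|M. \<bar>Q n z - X n z\<bar>) <= ?A * (dl * (2 * hannan_sum + dl) * (SUM i:{1..int n}. (w n i)\<^sup>2))"
  unfolding Q_def X_def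
  by (rule kernel_form_difference[OF K supp eps_L2 ma_L2[OF mdiff_L2[OF zt(1)]] hannan_sum_nonneg less_imp_le[OF dl(1)]])
  (assumption | rule sum_eps_norm approx finite_atLeastAtMost_int)+
  also have "... <= ?A * (dl * (2 * hannan_sum + 1) * C)"
  using dl hannan_sum_nonneg by (intro mult_left_mono mult_mono C A0) (simp_all add: sum_nonneg)
  finally show ?thesis unfolding c_def by (simp only: mult_ac)
 qed
 have "\<forall>\<^sub>F n in sequentially. (LINT z|M. \<bar>X n z - (LINT z|M. X n z)\<bar>) < r / 4"
  using order_tendstoD(2)[OF Xv, of "r / 4"] r by simp
 moreover have "\<forall>\<^sub>F n in sequentially. dist (LINT z|M. Q n z) ?\<sigma> < r / 4"
  using tendstoD[OF kform_mean_limit, of "r / 4"] r unfolding Q_def by simp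
 ultimately have "\<forall>\<^sub>F n in sequentially. norm ((LINT z|M. \<bar>Q n z - ?\<sigma>\<bar>) - 0) < r"
 proof eventually_elim
  case (elim n)
  let ?EX = "(LINT z|M. X n z)" and ?EQ = "(LINT z|M. Q n z)"
  have "\<bar>?EQ - ?EX\<bar> = \<bar>(LINT z|M. Q n z - X n z)\<bar>" by (simp add: LINT_diff[OF iQ iX])
  also have "... <= (LINT z|M. \<bar>Q n z - X n z\<bar>)" by (rule integral_abs_bound)
  finally have e1: "\<bar>?EQ - ?EX\<bar> <= dl * c" using d[of n] by linarith
  have "(LINT z|M. \<bar>Q n z - ?\<sigma>\<bar>) <= (LINT z|M. (\<bar>Q n z - X n z\<bar> + \<bar>X n z - ?EX\<bar>) + \<bar>?EX - ?\<sigma>\<bar>)"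
  by (rule integral_mono) (use iQ iX in simp_all)
  also have "... = (LINT z|M. \<bar>Q n z - X n z\<bar>) + (LINT z|M. \<bar>X n z - ?EX\<bar>) + \<bar>?EX - ?\<sigma>\<bar>"
  using iQ iX by (simp add: prob_space)
  finally have "(LINT z|M. \<bar>Q n z - ?\<sigma>\<bar>) < r"
  using elim d[of n] e1 dlc unfolding dist_real_def by linarith
  moreover have "0 <= (LINT z|M. \<bar>Q n z - ?\<sigma>\<bar>)" by (rule integral_nonneg_AE) simp
  ultimately show ?case by simp
 qed
 then show "EX no. ALL n>=no. norm ((LINT z|M. \<bar>kform K (h n) n (w n) (%i. eps i z) - ?\<sigma>\<bar>) - 0) < r"
  unfolding eventually_sequentially Q_def .
qed

text \<open>The residuals differ from the errors by a combination of finitely many columns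
  \<open>y\<close> with coefficients bounded in L2. By Schur's test the weights act with norm of
  order \<open>h n / real n\<close>, which makes the cross terms and the quadratic correction
  vanish.\<close>

theorem kform_residual_limit:
 fixes y :: "nat => int => 'j::finite => real" and W :: "nat => 'j => 'w => real"
 assumes y: "!!n j. (SUM i:{1..int n}. (y n i j)\<^sup>2) <= 1"
  and W: "!!n j. W n j : L2 M" "!!j. \<forall>\<^sub>F n in sequentially. nrm (W n j) <= V"
 shows "(%n. (LINT z|M. \<bar>kform K (h n) n (w n) (%i. eps i z - (SUM j:UNIV. y n i j * W n j z)) - (\<Sum>\<^sub>\<infinity>k. gam k * \<rho> k)\<bar>)) ----> 0"
proof -
 obtain B L where BL: "0 <= B \<and> 0 <= L \<and> (ALL n s t. \<bar>kweight K (h n) n (w n) s t\<bar> <= B * C / real n) \<and>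
  (ALL n>=1. ALL s. (SUM t:{1..int n}. \<bar>kweight K (h n) n (w n) s t\<bar>) <= (2 * (L * h n) + 1) * (B * C / real n))"
  using kweight_bounds by (elim exE)
 have B: "0 <= B" "0 <= L" using BL by simp_all
 have kb: "\<bar>kweight K (h n) n (w n) s t\<bar> <= B * C / real n" for n s t using BL by blast
 have krow: "(SUM t:{1..int n}. \<bar>kweight K (h n) n (w n) s t\<bar>) <= (2 * (L * h n) + 1) * (B * C / real n)" if "n >= 1" for n s
  using BL that by blast
 let ?\<sigma> = "\<Sum>\<^sub>\<infinity>k. gam k * \<rho> k" and ?p = "real CARD('j)"
 define d where "d n i z = (SUM j:UNIV. y n i j * W n j z)" for n i z
 define Q where "Q n z = kform K (h n) n (w n) (%i. eps i z)" for n z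
 define R where "R n z = kform K (h n) n (w n) (%i. eps i z - d n i z)" for n z
 \<comment> \<open>A bound on the row sums; the added 1 keeps it strictly positive, as
   \<open>schur_square_bound\<close> requires.\<close>
 define A where "A n = (2 * (L * (h n / real n)) + 1 / real n) * (B * C + 1)" for n
 have dL: "d n i : L2 M" for n i unfolding d_def[abs_def] by (intro L2_sum L2_cmult W)
 have iR: "integrable M (R n)" for n unfolding R_def[abs_def] by (intro kform_integrable L2_diff eps_L2 dL)
 have iQ: "integrable M (Q n)" for n unfolding Q_def[abs_def] by (rule kform_integrable[OF eps_L2])
 have "A ----> (2 * (L * 0) + 0) * (B * C + 1)"
  unfolding A_def[abs_def] by (intro tendsto_mult tendsto_add tendsto_const h(3) lim_const_over_n)
 then have A_lim: "A ----> 0" by simp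
 have bound: "(LINT z|M. \<bar>R n z - Q n z\<bar>) <= A n * (2 * (?p * (V * hannan_sum)) + ?p * (?p * (V * V)))"
  if n: "n >= 1" and V: "!!j. nrm (W n j) <= V" for n
 proof -
  let ?I = "{1..int n}" and ?a = "kweight K (h n) n (w n)"
  have A0: "A n > 0" unfolding A_def
  proof (rule mult_pos_pos)
  have "0 <= 2 * (L * (h n / real n))" using B(2) h(1)[OF n] by simp
  then show "0 < 2 * (L * (h n / real n)) + 1 / real n" using n by (simp add: add_nonneg_pos)
  show "0 < B * C + 1" using B(1) C_nonneg by (simp add: add_nonneg_pos)
  qed
  have row: "(SUM t:?I. \<bar>?a s t\<bar>) <= A n" for s
  proof -
  have "(SUM t:?I. \<bar>?a s t\<bar>) <= (2 * (L * h n) + 1) * (B * C / real n)"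
  by (rule krow[OF n])
  also have "... = (2 * (L * (h n / real n)) + 1 / real n) * (B * C)" using n by (simp add: field_simps)
  also have "... <= A n" unfolding A_def using B(2) h(1)[OF n] by (intro mult_left_mono) (simp_all add: add_nonneg_nonneg)
  finally show ?thesis .
  qed
  have sym: "?a s t = ?a t s" for s t by (rule kweight_sym)
  have col: "(SUM s:?I. \<bar>?a s t\<bar>) <= A n" for t using row[of t] by (simp only: sym[of _ t])
  define b where "b s j = (SUM t:?I. ?a s t * y n t j)" for s j
  define e where "e j z = (SUM s:?I. b s j * eps s z)" for j z
  define g where "g j l = (SUM s:?I. SUM t:?I. ?a s t * (y n s j * y n t l))" for j l
  have eL: "e j : L2 M" for j unfolding e_def[abs_def] by (rule eps_sum_L2)
  have eb: "nrm (e j) <= hannan_sum * A n" for j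
  proof -
  have "(SUM s:?I. (b s j)\<^sup>2) <= (A n)\<^sup>2 * (SUM t:?I. (y n t j)\<^sup>2)"
  unfolding b_def by (rule schur_square_bound[OF A0 row col])
  also have "... <= (A n)\<^sup>2" using mult_left_mono[OF y[of n j], of "(A n)\<^sup>2"] by simp
  finally have "sqrt (SUM s:?I. (b s j)\<^sup>2) <= A n" using A0 by (intro real_le_lsqrt) (simp_all add: sum_nonneg)
  then show ?thesis
  using sum_eps_norm[of ?I "%s. b s j"] mult_left_mono[OF _ hannan_sum_nonneg] unfolding e_def[abs_def] by fastforce
  qed
  have gb: "\<bar>g j l\<bar> <= A n" for j l
  proof -
  have "\<bar>g j l\<bar> <= A n * ((SUM s:?I. (y n s j)\<^sup>2) + (SUM t:?I. (y n t l)\<^sup>2)) / 2"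
  unfolding g_def by (rule schur_bound[OF row col])
  also have "... <= A n * (1 + 1) / 2"
  using A0 y[of n j] y[of n l] by (intro divide_right_mono mult_left_mono add_mono) simp_all
  finally show ?thesis by simp
  qed
  have expand: "R n z - Q n z = - 2 * (SUM j:UNIV. W n j z * e j z) + (SUM j:UNIV. SUM l:UNIV. g j l * (W n j z * W n l z))" for z
  proof -
  let ?E = "SUM s:?I. SUM t:?I. ?a s t * (eps s z * d n t z)" and ?E' = "SUM s:?I. SUM t:?I. ?a s t * (d n s z * eps t z)"
  and ?D = "SUM s:?I. SUM t:?I. ?a s t * (d n s z * d n t z)"
  have "R n z = (SUM s:?I. SUM t:?I. ?a s t * (eps s z * eps t z) - ?a s t * (eps s z * d n t z)
  - ?a s t * (d n s z * eps t z) + ?a s t * (d n s z * d n t z))"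
  unfolding R_def kform_def by (intro sum.cong refl) (simp add: algebra_simps)
  also have "... = Q n z - ?E - ?E' + ?D" unfolding Q_def kform_def by (simp only: sum.distrib sum_subtractf)
  finally have 1: "R n z = Q n z - ?E - ?E' + ?D" .
  have 2: "?E' = ?E" by (subst sum.swap, intro sum.cong refl, subst sym, simp only: mult.commute)
  have 3: "?E = (SUM j:UNIV. W n j z * e j z)"
  proof -
  have "?E = (SUM s:?I. SUM t:?I. SUM j:UNIV. W n j z * (?a s t * y n t j * eps s z))"
  unfolding d_def sum_distrib_left by (intro sum.cong refl) (simp add: mult_ac)
  also have "... = (SUM s:?I. SUM j:UNIV. SUM t:?I. W n j z * (?a s t * y n t j * eps s z))"
  by (intro sum.cong refl sum.swap)
  also have "... = (SUM j:UNIV. SUM s:?I. SUM t:?I. W n j z * (?a s t * y n t j * eps s z))" by (rule sum.swap)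
  also have "... = (SUM j:UNIV. W n j z * e j z)" unfolding e_def b_def sum_distrib_left sum_distrib_right ..
  finally show ?thesis .
  qed
  have 4: "?D = (SUM j:UNIV. SUM l:UNIV. g j l * (W n j z * W n l z))"
  proof -
  have "?D = (SUM s:?I. SUM t:?I. SUM j:UNIV. SUM l:UNIV. ?a s t * (y n s j * y n t l) * (W n j z * W n l z))"
  unfolding d_def sum_product unfolding sum_distrib_left by (intro sum.cong refl) (simp add: mult_ac)
  also have "... = (SUM s:?I. SUM j:UNIV. SUM t:?I. SUM l:UNIV. ?a s t * (y n s j * y n t l) * (W n j z * W n l z))"
  by (intro sum.cong refl sum.swap)
  also have "... = (SUM j:UNIV. SUM s:?I. SUM t:?I. SUM l:UNIV. ?a s t * (y n s j * y n t l) * (W n j z * W n l z))" by (rule sum.swap)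
  also have "... = (SUM j:UNIV. SUM s:?I. SUM l:UNIV. SUM t:?I. ?a s t * (y n s j * y n t l) * (W n j z * W n l z))"
  by (intro sum.cong refl sum.swap)
  also have "... = (SUM j:UNIV. SUM l:UNIV. SUM s:?I. SUM t:?I. ?a s t * (y n s j * y n t l) * (W n j z * W n l z))"
  by (intro sum.cong refl sum.swap)
  finally show ?thesis unfolding g_def sum_distrib_right .
  qed
  show ?thesis using 1 unfolding 2 unfolding 3 4 by simp
  qed
  have iWe: "integrable M (%z. \<bar>W n j z * e j z\<bar>)" for j by (intro integrable_abs L2_integrable_mult W eL)
  have iWW: "integrable M (%z. \<bar>W n j z * W n l z\<bar>)" for j l by (intro integrable_abs L2_integrable_mult W)
  let ?H = "%z. 2 * (SUM j:UNIV. \<bar>W n j z * e j z\<bar>) + A n * (SUM j:UNIV. SUM l:UNIV. \<bar>W n j z * W n l z\<bar>)"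
  have iH: "integrable M ?H"
  by (intro Lint_add integrable_mult_right Lint_sum iWe iWW)
  have "\<bar>R n z - Q n z\<bar> <= ?H z" for z
  proof -
  have "\<bar>SUM j:UNIV. W n j z * e j z\<bar> <= (SUM j:UNIV. \<bar>W n j z * e j z\<bar>)" by (rule sum_abs)
  moreover have "\<bar>SUM j:UNIV. SUM l:UNIV. g j l * (W n j z * W n l z)\<bar> <= (SUM j:UNIV. \<bar>SUM l:UNIV. g j l * (W n j z * W n l z)\<bar>)" by (rule sum_abs)
  moreover have "(SUM j:UNIV. \<bar>SUM l:UNIV. g j l * (W n j z * W n l z)\<bar>) <= (SUM j:UNIV. SUM l:UNIV. A n * \<bar>W n j z * W n l z\<bar>)"
  proof (rule sum_mono)
  fix j
  have "\<bar>SUM l:UNIV. g j l * (W n j z * W n l z)\<bar> <= (SUM l:UNIV. \<bar>g j l * (W n j z * W n l z)\<bar>)" by (rule sum_abs)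
  also have "... <= (SUM l:UNIV. A n * \<bar>W n j z * W n l z\<bar>)"
  unfolding abs_mult[of "g j _"] by (intro sum_mono mult_right_mono gb abs_ge_zero)
  finally show "\<bar>SUM l:UNIV. g j l * (W n j z * W n l z)\<bar> <= (SUM l:UNIV. A n * \<bar>W n j z * W n l z\<bar>)" .
  qed
  ultimately show ?thesis unfolding expand sum_distrib_left[symmetric] by linarith
  qed
  then have "(LINT z|M. \<bar>R n z - Q n z\<bar>) <= (LINT z|M. ?H z)"
  by (intro integral_mono[OF _ iH] integrable_abs Lint_diff iR iQ)
  also have "... = (LINT z|M. 2 * (SUM j:UNIV. \<bar>W n j z * e j z\<bar>)) + (LINT z|M. A n * (SUM j:UNIV. SUM l:UNIV. \<bar>W n j z * W n l z\<bar>))"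
  by (intro LINT_add integrable_mult_right Lint_sum iWe iWW)
  also have "... = 2 * (SUM j:UNIV. (LINT z|M. \<bar>W n j z * e j z\<bar>)) + A n * (SUM j:UNIV. (LINT z|M. (SUM l:UNIV. \<bar>W n j z * W n l z\<bar>)))"
  unfolding integral_mult_right_zero
  by (simp only: LINT_sum[OF iWe] LINT_sum[OF Lint_sum[OF iWW]])
  also have "... = 2 * (SUM j:UNIV. (LINT z|M. \<bar>W n j z * e j z\<bar>)) + A n * (SUM j:UNIV. SUM l:UNIV. (LINT z|M. \<bar>W n j z * W n l z\<bar>))"
  by (simp only: LINT_sum[OF iWW])
  also have "... <= 2 * (SUM j:(UNIV::'j set). V * (hannan_sum * A n)) + A n * (SUM j:(UNIV::'j set). SUM l:(UNIV::'j set). V * V)"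
  proof (intro add_mono mult_left_mono sum_mono)
  have V0: "0 <= V" by (rule order_trans[OF L2_norm_nonneg V])
  show "(LINT z|M. \<bar>W n j z * e j z\<bar>) <= V * (hannan_sum * A n)" for j
  by (rule order_trans[OF L2_Cauchy_Schwarz_abs[OF W(1) eL]]) (intro mult_mono V eb V0 L2_norm_nonneg)
  show "(LINT z|M. \<bar>W n j z * W n l z\<bar>) <= V * V" for j l
  by (rule order_trans[OF L2_Cauchy_Schwarz_abs[OF W(1) W(1)]]) (intro mult_mono V V0 L2_norm_nonneg)
  qed (use A0 in simp_all)
  also have "... = A n * (2 * (?p * (V * hannan_sum)) + ?p * (?p * (V * V)))" by (simp add: algebra_simps)
  finally show ?thesis .
 qed
 have "(%n. A n * (2 * (?p * (V * hannan_sum)) + ?p * (?p * (V * V))) + (LINT z|M. \<bar>Q n z - ?\<sigma>\<bar>)) ---->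
  0 * (2 * (?p * (V * hannan_sum)) + ?p * (?p * (V * V))) + 0"
  unfolding Q_def by (intro tendsto_add tendsto_mult tendsto_const A_lim kform_limit)
 then have lim: "(%n. A n * (2 * (?p * (V * hannan_sum)) + ?p * (?p * (V * V))) + (LINT z|M. \<bar>Q n z - ?\<sigma>\<bar>)) ----> 0" by simp
 have "\<forall>\<^sub>F n in sequentially. ALL j. nrm (W n j) <= V" using W(2) by (simp add: eventually_all_finite)
 then have "\<forall>\<^sub>F n in sequentially. norm (LINT z|M. \<bar>R n z - ?\<sigma>\<bar>)
  <= A n * (2 * (?p * (V * hannan_sum)) + ?p * (?p * (V * V))) + (LINT z|M. \<bar>Q n z - ?\<sigma>\<bar>)"
  using eventually_ge_at_top[of 1]
 proof eventually_elim
  case (elim n)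
  have "(LINT z|M. \<bar>R n z - ?\<sigma>\<bar>) <= (LINT z|M. \<bar>R n z - Q n z\<bar> + \<bar>Q n z - ?\<sigma>\<bar>)"
  by (rule integral_mono) (use iR iQ in simp_all)
  also have "... = (LINT z|M. \<bar>R n z - Q n z\<bar>) + (LINT z|M. \<bar>Q n z - ?\<sigma>\<bar>)"
  using iR iQ by simp
  finally have "(LINT z|M. \<bar>R n z - ?\<sigma>\<bar>) <= (LINT z|M. \<bar>R n z - Q n z\<bar>) + (LINT z|M. \<bar>Q n z - ?\<sigma>\<bar>)" .
  moreover have "(LINT z|M. \<bar>R n z - Q n z\<bar>) <= A n * (2 * (?p * (V * hannan_sum)) + ?p * (?p * (V * V)))"
  using elim by (intro bound) auto
  moreover have "0 <= (LINT z|M. \<bar>R n z - ?\<sigma>\<bar>)" by (rule integral_nonneg_AE) simp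
  ultimately show ?case by simp
 qed
 from Lim_null_comparison[OF this lim] show ?thesis unfolding R_def d_def .
qed

end

end

section \<open>Studentized least squares for a fixed design\<close>

lemma tendsto_matrix_matrix_mult:
 fixes f :: "'x => real^'n^'m" and g :: "'x => real^'k^'n"
 assumes "(f \<longlongrightarrow> A) F" "(g \<longlongrightarrow> B) F"
 shows "((%x. f x ** g x) \<longlongrightarrow> A ** B) F"
 unfolding matrix_matrix_mult_def
 by (intro vec_tendstoI) (simp, intro tendsto_sum tendsto_mult tendsto_vec_nth assms)

definition l1_norm :: "real^'n^'m => real" where
 "l1_norm A = (SUM i:UNIV. SUM j:UNIV. \<bar>A $ i $ j\<bar>)"

lemma norm_le_l1_norm: "norm A <= l1_norm A"
proof -
 have "norm A <= (SUM i:UNIV. norm (A $ i))" unfolding norm_vec_def by (rule L2_set_le_sum) simp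
 also have "... <= l1_norm A" unfolding l1_norm_def by (intro sum_mono norm_le_l1_cart)
 finally show ?thesis .
qed

lemma bilinear_l1_bound: "\<bar>u \<bullet> (A *v v)\<bar> <= l1_norm A * (norm u * norm v)"
proof -
 have "u \<bullet> (A *v v) = (SUM i:UNIV. SUM j:UNIV. A $ i $ j * (u $ i * v $ j))"
  by (simp add: inner_vec_def matrix_vector_mult_def sum_distrib_left mult_ac)
 also have "\<bar>...\<bar> <= (SUM i:UNIV. \<bar>SUM j:UNIV. A $ i $ j * (u $ i * v $ j)\<bar>)" by (rule sum_abs)
 also have "... <= (SUM i:UNIV. SUM j:UNIV. \<bar>A $ i $ j\<bar> * (norm u * norm v))"
 proof (rule sum_mono)
  fix i
  have "\<bar>SUM j:UNIV. A $ i $ j * (u $ i * v $ j)\<bar> <= (SUM j:UNIV. \<bar>A $ i $ j * (u $ i * v $ j)\<bar>)" by (rule sum_abs)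
  also have "... <= (SUM j:UNIV. \<bar>A $ i $ j\<bar> * (norm u * norm v))"
  unfolding abs_mult by (intro sum_mono mult_left_mono mult_mono component_le_norm_cart) simp_all
  finally show "\<bar>SUM j:UNIV. A $ i $ j * (u $ i * v $ j)\<bar> <= (SUM j:UNIV. \<bar>A $ i $ j\<bar> * (norm u * norm v))" .
 qed
 also have "... = l1_norm A * (norm u * norm v)" unfolding l1_norm_def sum_distrib_right ..
 finally show ?thesis .
qed

lemma tendsto_l1_norm:
 assumes "(f \<longlongrightarrow> A) F" shows "((%x. l1_norm (f x - A)) \<longlongrightarrow> 0) F"
proof -
 have "((%x. l1_norm (f x - A)) \<longlongrightarrow> l1_norm (A - A)) F"
  unfolding l1_norm_def by (intro tendsto_sum tendsto_rabs tendsto_vec_nth tendsto_diff tendsto_const assms)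
 then show ?thesis by (simp add: l1_norm_def)
qed

lemma sum4_swap:
 "(SUM a:I. SUM b:I. SUM j:J. SUM l:J. f a b j l) = (SUM j:J. SUM l:J. SUM a:I. SUM b:I. f a b j l)"
proof -
 have "(SUM a:I. SUM b:I. SUM j:J. SUM l:J. f a b j l) = (SUM a:I. SUM j:J. SUM b:I. SUM l:J. f a b j l)"
  by (intro sum.cong refl sum.swap)
 also have "... = (SUM j:J. SUM a:I. SUM b:I. SUM l:J. f a b j l)" by (rule sum.swap)
 also have "... = (SUM j:J. SUM a:I. SUM l:J. SUM b:I. f a b j l)" by (intro sum.cong refl sum.swap)
 also have "... = (SUM j:J. SUM l:J. SUM a:I. SUM b:I. f a b j l)" by (intro sum.cong refl sum.swap)
 finally show ?thesis .
qed

lemma quadratic_form_sum: "c \<bullet> ((A :: real^'n^'n) *v c) = (SUM j:UNIV. SUM l:UNIV. c $ j * c $ l * A $ j $ l)"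
 by (simp add: inner_vec_def matrix_vector_mult_def sum_distrib_left mult_ac)

lemma symmetric_polarization:
 fixes X :: "real^'n^'n"
 assumes "transpose X = X"
 shows "2 * X $ j $ l = (axis j 1 + axis l 1) \<bullet> (X *v (axis j 1 + axis l 1)) - axis j 1 \<bullet> (X *v axis j 1) - axis l 1 \<bullet> (X *v axis l 1)"
proof -
 have e: "axis a 1 \<bullet> (X *v axis b 1) = X $ a $ b" for a b
  by (simp add: inner_axis' matrix_vector_mult_basis column_def)
 have "X $ l $ j = X $ j $ l" using assms by (metis transpose_def vec_lambda_beta)
 then show ?thesis by (simp add: matrix_vector_right_distrib inner_add_left inner_add_right e)
qed

lemma has_sum_finite_sum:
 fixes f :: "'j => 'k => real"
 shows "finite I ==> (!!j. (f j has_sum s j) X) ==> ((%k. SUM j:I. f j k) has_sum (SUM j:I. s j)) X"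
 by (induction I rule: finite_induct) (auto intro!: has_sum_add)

text \<open>A measurable inverse square root: \<open>inv_sqrt\<close> is controlled only on positive
  definite matrices, and 0 fills the remainder.\<close>

definition studentizer :: "real^'n^'n => real^'n^'n" where
 "studentizer A = (if posdef A then inv_sqrt A else 0)"

lemma studentizer_measurable: "f : borel_measurable N ==> (%x. studentizer (f x)) : borel_measurable N"
 unfolding studentizer_def[abs_def] by (rule measurable_compose[OF _ borel_measurable_inv_sqrt])

text \<open>The uniform bound on the limits makes their series against the autocovariances
  absolutely convergent.\<close>

lemma lag_limit_bound:
 fixes y :: "nat => int => 'j => real"
 assumes y_supp: "!!n i j. y n i j ~= 0 ==> i : {1..int n}" and y_norm: "!!n j. (SUM i:{1..int n}. (y n i j)\<^sup>2) <= 1"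
  and R: "(%n. SUM i:{1..int n}. y n i j * y n (i + k) l) ----> R"
 shows "\<bar>R\<bar> <= 1"
proof (rule LIMSEQ_le_const2[OF tendsto_rabs[OF R]])
 have "\<bar>SUM i:{1..int n}. y n i j * y n (i + k) l\<bar> <= 1" for n
 proof -
  have "\<bar>SUM i:{1..int n}. y n i j * y n (i + k) l\<bar> <= (SUM i:{1..int n}. \<bar>y n i j * y n (i + k) l\<bar>)" by (rule sum_abs)
  also have "... <= (SUM i:{1..int n}. ((y n i j)\<^sup>2 + (y n (i + k) l)\<^sup>2) / 2)"
  proof (rule sum_mono)
  fix i
  have "0 <= (\<bar>y n i j\<bar> - \<bar>y n (i + k) l\<bar>)\<^sup>2" by simp
  then show "\<bar>y n i j * y n (i + k) l\<bar> <= ((y n i j)\<^sup>2 + (y n (i + k) l)\<^sup>2) / 2" by (simp add: power2_diff abs_mult)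
  qed
  also have "... = ((SUM i:{1..int n}. (y n i j)\<^sup>2) + (SUM i:{1..int n}. (y n (i + k) l)\<^sup>2)) / 2"
  by (simp add: sum.distrib sum_divide_distrib[symmetric])
  also have "... <= (1 + 1) / 2"
  proof (intro divide_right_mono add_mono y_norm)
  have "(SUM i:{1..int n}. (y n (i + k) l)\<^sup>2) <= (SUM i:{1..int n}. (y n i l)\<^sup>2)"
  by (rule sum_shift_le[where f = "%i. (y n i l)\<^sup>2"]) (use y_supp in auto)
  then show "(SUM i:{1..int n}. (y n (i + k) l)\<^sup>2) <= 1" using y_norm[of n l] by linarith
  qed simp
  finally show ?thesis by simp
 qed
 then show "EX N. ALL n>=N. \<bar>SUM i:{1..int n}. y n i j * y n (i + k) l\<bar> <= 1" by blast
qed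

text \<open>The design enters through its columns divided by their norms. Square sums are at most 1
  instead of equal to 1 because a column may vanish for small n. The limits \<open>R\<close> are
  indexed by all integers since the limiting covariance is a two-sided sum over lags.\<close>

locale normalized_regression = hannan_process M T F0 e0 for M :: "'w measure" and T F0 e0 +
 fixes K :: "real => real" and h :: "nat => real" and y :: "nat => int => 'p::finite => real"
  and et :: "nat => real" and R :: "int => 'p => 'p => real" and J :: "'q::finite => 'p"
 assumes K: "admissible_kernel K"
  and h: "!!n. n >= 1 ==> 0 < h n" "filterlim h at_top sequentially" "(%n. h n / real n) ----> 0"
  and y_supp: "!!n i j. y n i j ~= 0 ==> i : {1..int n}"
  and y_norm: "!!n j. (SUM i:{1..int n}. (y n i j)\<^sup>2) <= 1"
  and y_small: "!!n i j. \<bar>y n i j\<bar> <= et n" "et ----> 0"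
  and R: "!!k j l. (%n. SUM i:{1..int n}. y n i j * y n (i + k) l) ----> R k j l"
  and J: "inj J"
  and R0_pd: "posdef (\<chi> j l. R 0 j l)"
  and cov_pd: "posdef (matrix_inv (\<chi> j l. R 0 j l) ** (\<chi> j l. \<Sum>\<^sub>\<infinity>k. gam k * R k j l) ** matrix_inv (\<chi> j l. R 0 j l))"
begin

definition A :: "nat => real^'p^'p" where "A n = (\<chi> j l. SUM i:{1..int n}. y n i j * y n i l)"
definition R0 :: "real^'p^'p" where "R0 = (\<chi> j l. R 0 j l)"
definition P :: "nat => real^'p^'p" where "P n = matrix_inv (A n)"
definition P0 :: "real^'p^'p" where "P0 = matrix_inv R0"
definition \<Gamma> :: "real^'p^'p" where "\<Gamma> = (\<chi> j l. \<Sum>\<^sub>\<infinity>k. gam k * R k j l)"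
definition U :: "nat => 'w => real^'p" where "U n z = (\<chi> j. SUM i:{1..int n}. y n i j * eps i z)"
text \<open>The estimation error multiplied by the column norms: \<open>U\<close> is the normalized
  score, and \<open>P n\<close> inverts the normalized Gram matrix.\<close>

definition W :: "nat => 'w => real^'p" where "W n z = P n *v U n z"
definition resid :: "nat => 'w => int => real" where
 "resid n z i = (if i : {1..int n} then eps i z - (SUM j:UNIV. y n i j * W n z $ j) else 0)"
text \<open>The residual autocovariance at lag \<open>k\<close> multiplied by the kernel.\<close>

definition \<phi> :: "nat => 'w => int => real" where
 "\<phi> n z k = K (of_int k / h n) * lagsum n (resid n z) k / real n"
definition B :: "nat => 'w => real^'p^'p" where
 "B n z = (\<chi> j l. SUM a:{1..int n}. SUM b:{1..int n}. y n a j * y n b l * \<phi> n z (b - a))"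
definition Cov :: "nat => 'w => real^'q^'q" where
 "Cov n z = principal_submatrix J (P n ** B n z ** P n)"
definition Cov0 :: "real^'q^'q" where "Cov0 = principal_submatrix J (P0 ** \<Gamma> ** P0)"
definition Wq :: "nat => 'w => real^'q" where "Wq n z = (\<chi> a. W n z $ J a)"

section \<open>Limits of the Gram matrix and of the kernel forms\<close>

lemma pd: "posdef R0" "posdef (P0 ** \<Gamma> ** P0)"
 using R0_pd cov_pd unfolding R0_def P0_def \<Gamma>_def .

lemma A_sym: "transpose (A n) = A n"
 by (simp add: A_def transpose_def vec_eq_iff mult.commute)

lemma A_tendsto: "A ----> R0"
 unfolding R0_def A_def[abs_def] using R[of _ 0] by (intro vec_tendstoI) simp

lemma P_tendsto: "P ----> P0"
 unfolding P_def[abs_def] P0_def by (rule tendsto_matrix_inv[OF A_tendsto posdef_invertible[OF pd(1)]])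

lemma A_invertible: "\<forall>\<^sub>F n in sequentially. invertible (A n)"
proof -
 have "det R0 ~= 0" using posdef_invertible[OF pd(1)] by (simp add: invertible_det_nz)
 from tendsto_imp_eventually_ne[OF tendsto_det[OF A_tendsto] this] show ?thesis by (simp add: invertible_det_nz)
qed

lemma P_sym: "invertible (A n) ==> transpose (P n) = P n"
 using matrix_inv_transpose[of "A n"] by (simp add: P_def A_sym)

lemma P0_sym: "transpose P0 = P0"
 using matrix_inv_transpose[OF posdef_invertible[OF pd(1)]] pd(1) by (simp add: P0_def posdef_def)

text \<open>Positive definiteness of \<open>P0 ** \<Gamma> ** P0\<close> includes its symmetry;
  multiplying by \<open>R0\<close> on both sides recovers \<open>\<Gamma>\<close>.\<close>

lemma \<Gamma>_sym: "transpose \<Gamma> = \<Gamma>"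
proof -
 note inv = matrix_inv_mult[OF posdef_invertible[OF pd(1)], folded P0_def]
 have "R0 ** (P0 ** \<Gamma> ** P0) ** R0 = (R0 ** P0) ** \<Gamma> ** (P0 ** R0)" by (simp only: matrix_mul_assoc)
 then have G: "\<Gamma> = R0 ** (P0 ** \<Gamma> ** P0) ** R0" by (simp add: inv)
 have "transpose R0 = R0" "transpose (P0 ** \<Gamma> ** P0) = P0 ** \<Gamma> ** P0" using pd unfolding posdef_def by blast+
 then have "transpose (R0 ** (P0 ** \<Gamma> ** P0) ** R0) = R0 ** (P0 ** \<Gamma> ** P0) ** R0"
  by (simp only: matrix_transpose_mul matrix_mul_assoc)
 then show ?thesis unfolding G[symmetric] .
qed

lemma R_bound: "\<bar>R k j l\<bar> <= 1"
 by (rule lag_limit_bound[OF _ y_norm R]) (rule y_supp)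

definition wt :: "real^'p => nat => int => real" where "wt c n i = (SUM j:UNIV. c $ j * y n i j)"

lemma wt_supp: "wt c n i ~= 0 ==> i : {1..int n}"
proof (rule ccontr)
 assume "wt c n i ~= 0" "i ~: {1..int n}"
 moreover from this(2) have "y n i j = 0" for j using y_supp by blast
 ultimately show False by (simp add: wt_def)
qed

lemma wt_small: "\<bar>wt c n i\<bar> <= (SUM j:UNIV. \<bar>c $ j\<bar>) * et n"
 unfolding wt_def sum_distrib_right
 by (rule order_trans[OF sum_abs sum_mono]) (simp add: abs_mult mult_left_mono y_small(1))

lemma wt_square: "(SUM i:{1..int n}. (wt c n i)\<^sup>2) <= (norm c)\<^sup>2 * real CARD('p)"
proof -
 have "(wt c n i)\<^sup>2 <= (norm c)\<^sup>2 * (SUM j:UNIV. (y n i j)\<^sup>2)" for i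
 proof -
  have "wt c n i = c \<bullet> (\<chi> j. y n i j)" by (simp add: wt_def inner_vec_def)
  then have "(wt c n i)\<^sup>2 <= (c \<bullet> c) * ((\<chi> j. y n i j) \<bullet> (\<chi> j. y n i j))" by (simp only: Cauchy_Schwarz_ineq)
  also have "(\<chi> j. y n i j) \<bullet> (\<chi> j. y n i j) = (SUM j:UNIV. (y n i j)\<^sup>2)" by (simp add: inner_vec_def power2_eq_square)
  finally show ?thesis by (simp add: power2_norm_eq_inner)
 qed
 then have "(SUM i:{1..int n}. (wt c n i)\<^sup>2) <= (SUM i:{1..int n}. (norm c)\<^sup>2 * (SUM j:UNIV. (y n i j)\<^sup>2))" by (rule sum_mono)
 also have "... = (norm c)\<^sup>2 * (SUM j:UNIV. SUM i:{1..int n}. (y n i j)\<^sup>2)"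
  unfolding sum_distrib_left[symmetric] by (subst sum.swap) (rule refl)
 also have "... <= (norm c)\<^sup>2 * (SUM j:(UNIV :: 'p set). 1)" by (intro mult_left_mono sum_mono y_norm) simp
 finally show ?thesis by simp
qed

lemma wt_lagsum_tendsto:
 assumes "c ----> c0"
 shows "(%n. lagsum n (wt (c n) n) k) ----> (SUM j:UNIV. SUM l:UNIV. c0 $ j * c0 $ l * R k j l)"
proof -
 have e: "lagsum n (wt d n) k = (SUM j:UNIV. SUM l:UNIV. d $ j * d $ l * (SUM i:{1..int n}. y n i j * y n (i + k) l))" for n d
 proof -
  have "lagsum n (wt d n) k = (SUM i:{1..int n}. SUM j:UNIV. SUM l:UNIV. d $ j * d $ l * (y n i j * y n (i + k) l))"
  unfolding lagsum_def wt_def sum_product by (intro sum.cong refl) (simp add: mult_ac)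
  also have "... = (SUM j:UNIV. SUM i:{1..int n}. SUM l:UNIV. d $ j * d $ l * (y n i j * y n (i + k) l))" by (rule sum.swap)
  also have "... = (SUM j:UNIV. SUM l:UNIV. SUM i:{1..int n}. d $ j * d $ l * (y n i j * y n (i + k) l))"
  by (intro sum.cong refl sum.swap)
  finally show ?thesis unfolding sum_distrib_left .
 qed
 show ?thesis unfolding e by (intro tendsto_sum tendsto_mult tendsto_vec_nth assms R)
qed

lemma \<Gamma>_form: "(\<Sum>\<^sub>\<infinity>k. gam k * (SUM j:UNIV. SUM l:UNIV. c $ j * c $ l * R k j l)) = c \<bullet> (\<Gamma> *v c)"
proof -
 have s: "(%k. gam k * R k j l) summable_on UNIV" for j l
 proof (rule abs_summable_summable, rule Infinite_Sum.abs_summable_on_comparison_test'[OF gam_abs_summable])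
  show "norm (gam k * R k j l) <= \<bar>gam k\<bar>" for k using mult_left_mono[OF R_bound abs_ge_zero, of "gam k" k j l] by (simp add: abs_mult)
 qed
 have "((%k. SUM j:UNIV. SUM l:UNIV. c $ j * c $ l * (gam k * R k j l)) has_sum
  (SUM j:UNIV. SUM l:UNIV. c $ j * c $ l * (\<Sum>\<^sub>\<infinity>k. gam k * R k j l))) UNIV"
  by (intro has_sum_finite_sum has_sum_cmult_right has_sum_infsum s finite)
 from infsumI[OF this] show ?thesis
  unfolding quadratic_form_sum by (simp add: \<Gamma>_def sum_distrib_left mult_ac)
qed

lemma W_entry: "W n z $ j = (SUM l:UNIV. P n $ j $ l * (SUM i:{1..int n}. y n i l * eps i z))"
 by (simp add: W_def U_def matrix_vector_mult_def)

lemma W_L2: "(%z. W n z $ j) : L2 M"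
 unfolding W_entry by (intro L2_sum L2_cmult eps_sum_L2)

lemma W_bounded: "EX V. ALL n j. nrm (%z. W n z $ j) <= V"
proof -
 have "(%n. l1_norm (P n)) ----> l1_norm P0"
  unfolding l1_norm_def by (intro tendsto_sum tendsto_rabs tendsto_vec_nth P_tendsto)
 then have "Bseq (%n. l1_norm (P n))" by (rule convergent_imp_Bseq[OF convergentI])
 then obtain V where "0 < V" and V: "ALL n. norm (l1_norm (P n)) <= V" by (rule BseqE)
 have "nrm (%z. W n z $ j) <= V * hannan_sum" for n j
 proof -
  have "nrm (%z. W n z $ j) <= (SUM l:UNIV. nrm (%z. P n $ j $ l * (SUM i:{1..int n}. y n i l * eps i z)))"
  unfolding W_entry by (rule L2_norm_sum_le) (intro L2_cmult eps_sum_L2)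
  also have "... <= (SUM l:UNIV. \<bar>P n $ j $ l\<bar> * hannan_sum)"
  unfolding L2_norm_cmult
  proof (intro sum_mono mult_left_mono abs_ge_zero)
  fix l
  have "nrm (%z. SUM i:{1..int n}. y n i l * eps i z) <= hannan_sum * sqrt (SUM i:{1..int n}. (y n i l)\<^sup>2)"
  by (rule sum_eps_norm) simp
  also have "... <= hannan_sum * 1" using y_norm by (intro mult_left_mono hannan_sum_nonneg) simp
  finally show "nrm (%z. SUM i:{1..int n}. y n i l * eps i z) <= hannan_sum" by simp
  qed
  also have "... <= l1_norm (P n) * hannan_sum"
  unfolding l1_norm_def sum_distrib_right[symmetric]
  by (intro mult_right_mono hannan_sum_nonneg member_le_sum[of j UNIV "%i. SUM l:UNIV. \<bar>P n $ i $ l\<bar>"]) (simp_all add: sum_nonneg)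
  also have "... <= V * hannan_sum" using V by (intro mult_right_mono hannan_sum_nonneg) (simp add: abs_le_iff)
  finally show ?thesis .
 qed
 then show ?thesis by blast
qed

lemma resid_supp: "resid n z i ~= 0 ==> i : {1..int n}"
 by (simp add: resid_def split: if_splits)

lemma \<phi>_even: "\<phi> n z (- k) = \<phi> n z k"
proof -
 have "lagsum n (resid n z) (- k) = lagsum n (resid n z) k" by (rule lagsum_even) (rule resid_supp)
 moreover have "K (of_int (- k) / h n) = K (of_int k / h n)" using K by (simp add: admissible_kernel_def)
 ultimately show ?thesis unfolding \<phi>_def by (simp only:)
qed

lemma B_sym: "transpose (B n z) = B n z"
proof -
 have "B n z $ l $ j = B n z $ j $ l" for j l
 proof -
  have "B n z $ l $ j = (SUM b:{1..int n}. SUM a:{1..int n}. y n a l * y n b j * \<phi> n z (b - a))"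
  unfolding B_def by (simp, rule sum.swap)
  also have "... = B n z $ j $ l"
  unfolding B_def using \<phi>_even[of n z "_ - _"] by (simp add: mult_ac)
  finally show ?thesis .
 qed
 then show ?thesis by (simp add: transpose_def vec_eq_iff)
qed

text \<open>The exchange of roles: summing over lags turns a form in the design with residual
  autocovariances as weights into a form in the residuals with the sequence \<open>wt c n\<close> in
  the weights.\<close>

lemma B_form: "c \<bullet> (B n z *v c) = kform K (h n) n (wt c n) (%i. eps i z - (SUM j:UNIV. y n i j * W n z $ j))"
proof -
 have "c \<bullet> (B n z *v c) = (SUM j:UNIV. SUM l:UNIV. SUM a:{1..int n}. SUM b:{1..int n}. \<phi> n z (b - a) * ((c $ j * y n a j) * (c $ l * y n b l)))"
  unfolding quadratic_form_sum B_def by (simp add: sum_distrib_left mult_ac)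
 also have "... = (SUM a:{1..int n}. SUM b:{1..int n}. SUM j:UNIV. SUM l:UNIV. \<phi> n z (b - a) * ((c $ j * y n a j) * (c $ l * y n b l)))"
  by (rule sum4_swap[symmetric])
 also have "... = (SUM a:{1..int n}. SUM b:{1..int n}. \<phi> n z (b - a) * (wt c n a * wt c n b))"
  unfolding wt_def sum_product unfolding sum_distrib_left ..
 also have "... = (SUM k:{- int n..int n}. \<phi> n z k * lagsum n (wt c n) k)" by (rule lag_double_sum) (rule wt_supp)
 also have "... = (SUM k:{- int n..int n}. K (of_int k / h n) * lagsum n (wt c n) k / real n * lagsum n (resid n z) k)"
  unfolding \<phi>_def by (intro sum.cong refl) (simp add: mult_ac)
 also have "... = kform K (h n) n (wt c n) (resid n z)"
  by (rule kform_eq_lag[symmetric]) (use K wt_supp resid_supp in \<open>auto simp: admissible_kernel_def\<close>)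
 also have "... = kform K (h n) n (wt c n) (%i. eps i z - (SUM j:UNIV. y n i j * W n z $ j))"
  unfolding kform_def by (intro sum.cong refl) (simp add: resid_def)
 finally show ?thesis .
qed

lemma B_form_integrable: "integrable M (%z. c \<bullet> (B n z *v c))"
 unfolding B_form
proof (rule kform_integrable)
 fix i
 show "(%z. eps i z - (SUM j:UNIV. y n i j * W n z $ j)) : L2 M" by (intro L2_diff L2_sum L2_cmult eps_L2 W_L2)
qed

lemma B_form_limit: "(%n. (LINT z|M. \<bar>c \<bullet> (B n z *v c) - c \<bullet> (\<Gamma> *v c)\<bar>)) ----> 0"
proof -
 obtain V where V: "ALL n j. nrm (%z. W n z $ j) <= V" using W_bounded ..
 show ?thesis unfolding B_form \<Gamma>_form[symmetric]
 proof (rule kform_residual_limit[where w = "wt c" and C = "(norm c)\<^sup>2 * real CARD('p)" and V = V])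
  show "(%n. lagsum n (wt c n) k) ----> (SUM j:UNIV. SUM l:UNIV. c $ j * c $ l * R k j l)" for k
  by (rule wt_lagsum_tendsto[OF tendsto_const])
  show "\<forall>\<^sub>F n in sequentially. nrm (%z. W n z $ j) <= V" for j using V by simp
 qed (rule K h y_norm W_L2 wt_square | assumption | erule wt_supp)+
qed

definition dev :: "nat => 'w => real" where "dev n z = l1_norm (B n z - \<Gamma>)"

text \<open>Polarization: convergence is known for quadratic forms only, and symmetry of both
  matrices recovers the entries from three of them.\<close>

lemma B_entry: "2 * (B n z - \<Gamma>) $ j $ l
 = ((axis j 1 + axis l 1) \<bullet> (B n z *v (axis j 1 + axis l 1)) - (axis j 1 + axis l 1) \<bullet> (\<Gamma> *v (axis j 1 + axis l 1)))
  - (axis j 1 \<bullet> (B n z *v axis j 1) - axis j 1 \<bullet> (\<Gamma> *v axis j 1)) - (axis l 1 \<bullet> (B n z *v axis l 1) - axis l 1 \<bullet> (\<Gamma> *v axis l 1))"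
 using symmetric_polarization[OF B_sym, of n z j l] symmetric_polarization[OF \<Gamma>_sym, of j l] by simp

lemma B_entry_integrable: "integrable M (%z. (B n z - \<Gamma>) $ j $ l)"
proof -
 have "integrable M (%z. 2 * (B n z - \<Gamma>) $ j $ l)"
  unfolding B_entry by (intro Lint_diff B_form_integrable) simp_all
 from integrable_mult_right[OF this, of "1 / 2"] show ?thesis by (simp del: vector_minus_component)
qed

lemma dev_integrable: "integrable M (dev n)"
 unfolding dev_def[abs_def] l1_norm_def by (intro Lint_sum integrable_abs B_entry_integrable)

lemma dev_limit: "(%n. (LINT z|M. dev n z)) ----> 0"
proof (rule null_comparison)
 let ?d = "%c n. (LINT z|M. \<bar>c \<bullet> (B n z *v c) - c \<bullet> (\<Gamma> *v c)\<bar>)"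
 let ?g = "%n. SUM j:UNIV. SUM l:UNIV. ?d (axis j 1 + axis l 1) n + ?d (axis j 1) n + ?d (axis l 1) n"
 have "?g ----> (SUM j:(UNIV::'p set). SUM l:(UNIV::'p set). 0 + 0 + 0)" by (intro tendsto_sum tendsto_add B_form_limit)
 then show "?g ----> 0" by simp
 fix n
 have i: "integrable M (%z. \<bar>c \<bullet> (B n z *v c) - c \<bullet> (\<Gamma> *v c)\<bar>)" for c
  by (intro integrable_abs Lint_diff B_form_integrable) simp
 have e: "(LINT z|M. \<bar>(B n z - \<Gamma>) $ j $ l\<bar>) <= ?d (axis j 1 + axis l 1) n + ?d (axis j 1) n + ?d (axis l 1) n" for j l
 proof -
  let ?f = "%c z. \<bar>c \<bullet> (B n z *v c) - c \<bullet> (\<Gamma> *v c)\<bar>"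
  have "(LINT z|M. \<bar>(B n z - \<Gamma>) $ j $ l\<bar>) <= (LINT z|M. ?f (axis j 1 + axis l 1) z + ?f (axis j 1) z + ?f (axis l 1) z)"
  proof (rule integral_mono)
  show "integrable M (%z. \<bar>(B n z - \<Gamma>) $ j $ l\<bar>)" by (intro integrable_abs B_entry_integrable)
  show "integrable M (%z. ?f (axis j 1 + axis l 1) z + ?f (axis j 1) z + ?f (axis l 1) z)"
  by (intro Lint_add i)
  fix z
  show "\<bar>(B n z - \<Gamma>) $ j $ l\<bar> <= ?f (axis j 1 + axis l 1) z + ?f (axis j 1) z + ?f (axis l 1) z"
  using B_entry[of n z j l] by linarith
  qed
  also have "... = ?d (axis j 1 + axis l 1) n + ?d (axis j 1) n + ?d (axis l 1) n"
  by (simp only: LINT_add[OF Lint_add[OF i i] i] LINT_add[OF i i])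
  finally show ?thesis .
 qed
 have "(LINT z|M. dev n z) = (SUM j:UNIV. (LINT z|M. (SUM l:UNIV. \<bar>(B n z - \<Gamma>) $ j $ l\<bar>)))"
  unfolding dev_def l1_norm_def
  by (rule LINT_sum) (intro Lint_sum integrable_abs B_entry_integrable)
 also have "... = (SUM j:UNIV. SUM l:UNIV. (LINT z|M. \<bar>(B n z - \<Gamma>) $ j $ l\<bar>))"
  by (rule sum.cong[OF refl], rule LINT_sum) (intro integrable_abs B_entry_integrable)
 also have "... <= ?g n" by (intro sum_mono e)
 finally have "(LINT z|M. dev n z) <= ?g n" .
 moreover have "0 <= (LINT z|M. dev n z)" unfolding dev_def l1_norm_def by (intro integral_nonneg_AE AE_I2 sum_nonneg) simp
 ultimately show "\<bar>(LINT z|M. dev n z)\<bar> <= ?g n" by simp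
qed

lemma Cov0_pd: "posdef Cov0"
 unfolding posdef_def
proof (intro conjI allI impI)
 let ?C = "P0 ** \<Gamma> ** P0"
 have sym: "transpose ?C = ?C" using pd(2) unfolding posdef_def by blast
 show "transpose Cov0 = Cov0"
  using sym unfolding Cov0_def principal_submatrix_def transpose_def by (simp add: vec_eq_iff)
 fix v :: "real^'q" assume v: "v ~= 0"
 \<comment> \<open>The extension of \<open>v\<close> by zero off the image of \<open>J\<close>;
   injectivity of \<open>J\<close> gives \<open>c\<close> the entries of \<open>v\<close>
   there.\<close>
 define c :: "real^'p" where "c = (SUM a:UNIV. v $ a *\<^sub>R axis (J a) 1)"
 have cJ: "c $ J a = v $ a" for a
  unfolding c_def using J by (simp add: axis_def inj_eq if_distrib cong: if_cong)
 have "c ~= 0" using v cJ by (metis vec_eq_iff zero_index)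
 then have "0 < c \<bullet> (?C *v c)" using pd(2) unfolding posdef_def by blast
 also have "c \<bullet> (?C *v c) = v \<bullet> (Cov0 *v v)"
 proof -
  have e: "axis j 1 \<bullet> (?C *v axis l 1) = ?C $ j $ l" for j l by (simp add: inner_axis' matrix_vector_mult_basis column_def)
  have "c \<bullet> (?C *v c) = (SUM b:UNIV. SUM a:UNIV. v $ a * v $ b * (axis (J a) 1 \<bullet> (?C *v axis (J b) 1)))"
  unfolding c_def
  by (simp add: linear_sum[OF matrix_vector_mul_linear] matrix_vector_mult_scaleR inner_sum_left inner_sum_right sum_distrib_left mult_ac)
  also have "... = (SUM a:UNIV. SUM b:UNIV. v $ a * v $ b * (axis (J a) 1 \<bullet> (?C *v axis (J b) 1)))" by (rule sum.swap)
  finally show ?thesis unfolding quadratic_form_sum e by (simp add: Cov0_def principal_submatrix_def)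
 qed
 finally show "0 < v \<bullet> (Cov0 *v v)" .
qed

text \<open>Joint continuity at \<open>(\<infinity>, \<Gamma>)\<close> of the studentizing matrix as
  a function of n and of a symmetric matrix \<open>X\<close> in the place of \<open>B n z\<close>.
  The product filter yields thresholds \<open>N\<close> and \<open>dl\<close> that do not depend on
  \<open>z\<close>; its restriction to symmetric \<open>X\<close> is needed because
  \<open>posdef\<close> includes symmetry.\<close>

lemma studentizer_close:
 assumes e: "e > 0"
 shows "EX N dl. dl > 0 \<and> (ALL n>=N. ALL z. dev n z < dl --> posdef (Cov n z) \<and> l1_norm (studentizer (Cov n z) - inv_sqrt Cov0) < e)"
proof -
 let ?G = "inf (nhds \<Gamma>) (principal {X. transpose X = X})" and ?F = "sequentially \<times>\<^sub>F inf (nhds \<Gamma>) (principal {X. transpose X = X})"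
 define f :: "nat \<times> (real^'p^'p) => real^'q^'q" where "f p = principal_submatrix J (P (fst p) ** snd p ** P (fst p))" for p
 have l1: "((%p. P (fst p)) \<longlongrightarrow> P0) ?F" by (rule filterlim_compose[OF P_tendsto filterlim_fst])
 have l2: "(snd \<longlongrightarrow> \<Gamma>) ?F" by (rule filterlim_mono[OF filterlim_snd _ order_refl]) simp
 have l3: "((%p. P (fst p) ** snd p ** P (fst p)) \<longlongrightarrow> P0 ** \<Gamma> ** P0) ?F"
  by (intro tendsto_matrix_matrix_mult l1 l2)
 have lf: "(f \<longlongrightarrow> Cov0) ?F"
  unfolding f_def[abs_def] Cov0_def principal_submatrix_def
  by (intro vec_tendstoI) (simp add: tendsto_vec_nth[OF tendsto_vec_nth[OF l3]])
 have s1: "\<forall>\<^sub>F p in ?F. invertible (A (fst p))"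
  by (rule eventually_compose_filterlim[OF A_invertible filterlim_fst])
 have s2: "\<forall>\<^sub>F p in ?F. transpose (snd p) = snd p"
  by (rule eventually_compose_filterlim[OF _ filterlim_snd]) (simp add: eventually_inf_principal)
 have fs: "\<forall>\<^sub>F p in ?F. transpose (f p) = f p"
  using s1 s2
 proof eventually_elim
  case (elim p)
  have "transpose (P (fst p) ** snd p ** P (fst p)) = P (fst p) ** snd p ** P (fst p)"
  by (simp add: matrix_transpose_mul P_sym[OF elim(1)] elim(2) matrix_mul_assoc)
  then show ?case unfolding f_def principal_submatrix_def transpose_def by (simp add: vec_eq_iff)
 qed
 obtain c where c: "c > 0" "!!v. c * (norm v)\<^sup>2 <= v \<bullet> (Cov0 *v v)" using posdef_coercive[OF Cov0_pd] by blast
 have "\<forall>\<^sub>F p in ?F. l1_norm (f p - Cov0) < c" using order_tendstoD(2)[OF tendsto_l1_norm[OF lf] c(1)] .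
 then have pdf: "\<forall>\<^sub>F p in ?F. posdef (f p)"
  using fs by eventually_elim (rule posdef_near[OF c(2)], auto simp: l1_norm_def)
 have "((%p. inv_sqrt (f p)) \<longlongrightarrow> inv_sqrt Cov0) ?F" by (rule tendsto_inv_sqrt[OF lf Cov0_pd pdf])
 from order_tendstoD(2)[OF tendsto_l1_norm[OF this] e]
 have "\<forall>\<^sub>F p in ?F. posdef (f p) \<and> l1_norm (studentizer (f p) - inv_sqrt Cov0) < e"
  using pdf by eventually_elim (simp add: studentizer_def)
 then obtain P1 P2 where P1: "eventually P1 sequentially" and P2: "eventually P2 ?G"
  and imp: "ALL n X. P1 n --> P2 X --> posdef (f (n, X)) \<and> l1_norm (studentizer (f (n, X)) - inv_sqrt Cov0) < e"
  unfolding eventually_prod_filter by blast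
 obtain N where N: "ALL n>=N. P1 n" using P1 unfolding eventually_sequentially ..
 from P2 obtain dl where dl: "dl > 0" "ALL X. dist X \<Gamma> < dl --> X : {X. transpose X = X} --> P2 X"
  unfolding eventually_inf_principal eventually_nhds_metric by blast
 have "posdef (Cov n z) \<and> l1_norm (studentizer (Cov n z) - inv_sqrt Cov0) < e" if "n >= N" "dev n z < dl" for n z
 proof -
  have "dist (B n z) \<Gamma> < dl" using that(2) norm_le_l1_norm[of "B n z - \<Gamma>"] unfolding dist_norm dev_def by linarith
  then have "P2 (B n z)" using dl(2) B_sym by blast
  moreover have "P1 n" using N that(1) by blast
  ultimately have "posdef (f (n, B n z)) \<and> l1_norm (studentizer (f (n, B n z)) - inv_sqrt Cov0) < e" using imp by blast
  then show ?thesis by (simp add: f_def Cov_def)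
 qed
 then show ?thesis using dl(1) by blast
qed


section \<open>Convergence of the studentized statistic\<close>

lemma Wq_measurable: "Wq n : borel_measurable M"
 by (rule borel_measurable_vec_lambda) (simp add: Wq_def L2_measurable[OF W_L2])

lemma Cov_measurable: "Cov n : borel_measurable M"
proof -
 have "(%z. (B n z - \<Gamma>) $ j $ l + \<Gamma> $ j $ l) : borel_measurable M" for j l
  using B_entry_integrable[of n j l] by (intro borel_measurable_add borel_measurable_integrable) simp_all
 then have "B n : borel_measurable M" by (intro borel_measurable_vec_lambda) simp
 then have "(%z. P n ** B n z ** P n) : borel_measurable M"
  by (intro borel_measurable_matrix_mult) simp_all
 then show ?thesis
  by (intro borel_measurable_vec_lambda) (simp add: Cov_def principal_submatrix_def borel_measurable_vec_nth)
qed

text \<open>Markov's inequality for \<open>dev\<close>: for n large, a matrix that is not positive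
  definite forces \<open>dev n z >= dl\<close>.\<close>

lemma not_posdef_limit: "(%n. prob {z:space M. \<not> posdef (Cov n z)}) ----> 0"
proof -
 obtain N dl where dl: "dl > 0 \<and> (ALL n>=N. ALL z. dev n z < dl --> posdef (Cov n z) \<and> l1_norm (studentizer (Cov n z) - inv_sqrt Cov0) < 1)"
  using studentizer_close[OF zero_less_one] by blast
 have m: "{z:space M. \<not> posdef (Cov n z)} : sets M" for n
 proof -
  have "Cov n -` {X. posdef X} \<inter> space M : sets M" by (rule measurable_sets[OF Cov_measurable posdef_sets])
  then have "space M - (Cov n -` {X. posdef X} \<inter> space M) : sets M" by (rule sets.compl_sets)
  also have "space M - (Cov n -` {X. posdef X} \<inter> space M) = {z:space M. \<not> posdef (Cov n z)}" by auto
  finally show ?thesis .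
 qed
 have lim: "(%n. (LINT z|M. dev n z) / dl) ----> 0" using tendsto_divide[OF dev_limit tendsto_const, of dl] dl by simp
 have "\<forall>\<^sub>F n in sequentially. norm (prob {z:space M. \<not> posdef (Cov n z)}) <= (LINT z|M. dev n z) / dl"
  using eventually_ge_at_top[of N]
 proof eventually_elim
  case (elim n)
  have d0: "0 <= dev n z" for z unfolding dev_def l1_norm_def by (intro sum_nonneg) simp
  have "prob {z:space M. \<not> posdef (Cov n z)} = (LINT z|M. indicator {z:space M. \<not> posdef (Cov n z)} z)"
  using m by simp
  also have "... <= (LINT z|M. dev n z / dl)"
  proof (rule integral_mono)
  show "integrable M (%z. indicator {z:space M. \<not> posdef (Cov n z)} z :: real)"
  by (rule integrable_real_indicator[OF m]) (simp add: emeasure_eq_measure)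
  show "integrable M (%z. dev n z / dl)" using dev_integrable by simp
  fix z
  have "\<not> posdef (Cov n z) ==> \<not> dev n z < dl" using dl elim by blast
  then show "indicator {z:space M. \<not> posdef (Cov n z)} z <= dev n z / dl"
  using dl d0[of z] by (auto simp: indicator_def not_less)
  qed
  finally show ?case by simp
 qed
 from Lim_null_comparison[OF this lim] show ?thesis .
qed

lemma inner_mult_vec: "u \<bullet> ((X :: real^'m^'n) *v v) = (transpose X *v u) \<bullet> v"
 by (simp add: dot_lmul_matrix transpose_matrix_vector)

text \<open>With the limiting covariance in place of the estimate, a linear functional of the
  statistic is one weighted sum of errors. Its coefficients \<open>c n\<close> still vary with n
  through \<open>P n\<close>, so the limit theorems are used for triangular weights.\<close>

lemma oracle_char_limit:
 "(%n. (LINT z|M. iexp (u \<bullet> (inv_sqrt Cov0 *v Wq n z)))) ----> exp (- ((norm u)\<^sup>2 / 2))"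
proof -
 let ?S = "inv_sqrt Cov0"
 note S = inv_sqrt[OF Cov0_pd]
 define v where "v = ?S *v u"
 define Q where "Q X = (\<chi> a l. X $ J a $ l)" for X :: "real^'p^'p"
 define c where "c n = transpose (Q (P n)) *v v" for n
 define c0 where "c0 = transpose (Q P0) *v v"
 have c: "c ----> c0"
  unfolding c_def[abs_def] c0_def matrix_vector_mult_def transpose_def Q_def
  by (intro vec_tendstoI) (simp, intro tendsto_sum tendsto_mult tendsto_const tendsto_vec_nth P_tendsto)
 have rep: "u \<bullet> (?S *v Wq n z) = (SUM i:{1..int n}. wt (c n) n i * eps i z)" for n z
 proof -
  have "Wq n z = Q (P n) *v U n z" by (simp add: Wq_def W_def Q_def matrix_vector_mult_def vec_eq_iff)
  then have "u \<bullet> (?S *v Wq n z) = c n \<bullet> U n z" by (simp only: inner_mult_vec S(1) v_def[symmetric] c_def[symmetric])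
  also have "... = (SUM j:UNIV. SUM i:{1..int n}. c n $ j * y n i j * eps i z)"
  by (simp add: inner_vec_def U_def sum_distrib_left mult_ac)
  also have "... = (SUM i:{1..int n}. SUM j:UNIV. c n $ j * y n i j * eps i z)" by (rule sum.swap)
  finally show ?thesis unfolding wt_def sum_distrib_right .
 qed
 \<comment> \<open>The limit variance is that of \<open>Cov0\<close> sandwiched between its inverse
   square roots, which leaves the identity.\<close>
 have var: "c0 \<bullet> (\<Gamma> *v c0) = (norm u)\<^sup>2"
 proof -
  have P0s: "P0 $ l $ j = P0 $ j $ l" for j l
  using arg_cong[OF P0_sym, of "%X. X $ j $ l"] by (simp add: transpose_def)
  have "Cov0 $ a $ b = (Q P0 ** \<Gamma> ** transpose (Q P0)) $ a $ b" for a b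
  proof -
  have "Cov0 $ a $ b = (SUM k:UNIV. (P0 ** \<Gamma>) $ J a $ k * P0 $ k $ J b)"
  by (simp add: Cov0_def principal_submatrix_def matrix_matrix_mult_def[of "P0 ** \<Gamma>"])
  also have "... = (SUM k:UNIV. (P0 ** \<Gamma>) $ J a $ k * P0 $ J b $ k)" by (simp only: P0s[of _ "J b"])
  finally show ?thesis by (simp add: Q_def matrix_matrix_mult_def transpose_def)
  qed
  then have C: "Cov0 = Q P0 ** \<Gamma> ** transpose (Q P0)" by (simp add: vec_eq_iff)
  have "c0 \<bullet> (\<Gamma> *v c0) = v \<bullet> (Q P0 *v (\<Gamma> *v (transpose (Q P0) *v v)))" unfolding inner_mult_vec[of v] c0_def ..
  also have "... = v \<bullet> (Cov0 *v v)" unfolding C by (simp only: matrix_vector_mul_assoc matrix_mul_assoc)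
  also have "... = u \<bullet> (?S *v (Cov0 *v (?S *v u)))" unfolding v_def inner_mult_vec[of u] S(1) ..
  also have "... = u \<bullet> u" unfolding matrix_vector_mul_assoc S(2) matrix_mul_assoc by simp
  finally show ?thesis by (simp add: power2_norm_eq_inner)
 qed
 have "Bseq c" using c by (rule convergent_imp_Bseq[OF convergentI])
 then obtain \<kappa> where "0 < \<kappa>" and \<kappa>': "ALL n. norm (c n) <= \<kappa>" by (rule BseqE)
 have \<kappa>: "norm (c n) <= \<kappa>" for n using \<kappa>' ..
 have C: "(SUM i:{1..int n}. (wt (c n) n i)\<^sup>2) <= \<kappa>\<^sup>2 * real CARD('p)" for n
  by (rule order_trans[OF wt_square]) (intro mult_right_mono power_mono \<kappa>, simp_all)
 have et': "(%n. (SUM j:UNIV. \<bar>c n $ j\<bar>) * et n) ----> 0"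
 proof -
  have "(%n. (SUM j:UNIV. \<bar>c n $ j\<bar>) * et n) ----> (SUM j:UNIV. \<bar>c0 $ j\<bar>) * 0"
  by (intro tendsto_mult tendsto_sum tendsto_rabs tendsto_vec_nth c y_small(2))
  then show ?thesis by simp
 qed
 have V: "(%n. (nrm (%z. SUM i:{1..int n}. wt (c n) n i * eps i z))\<^sup>2) ----> (norm u)\<^sup>2"
  unfolding var[symmetric] \<Gamma>_form[symmetric]
 proof (rule weighted_sum_variance_limit[where w = "%n. wt (c n) n" and C = "\<kappa>\<^sup>2 * real CARD('p)"])
  show "(%n. lagsum n (wt (c n) n) k) ----> (SUM j:UNIV. SUM l:UNIV. c0 $ j * c0 $ l * R k j l)" for k
  by (rule wt_lagsum_tendsto[OF c])
 qed (rule K h C | assumption | erule wt_supp)+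
 have "(%n. (LINT z|M. iexp (1 * (SUM i:{1..int n}. wt (c n) n i * eps i z)))) ----> exp (- (1\<^sup>2 / 2) * (norm u)\<^sup>2)"
 proof (rule weighted_clt[where w = "%n. wt (c n) n"])
  show "\<bar>wt (c n) n i\<bar> <= (SUM j:UNIV. \<bar>c n $ j\<bar>) * et n" for n i by (rule wt_small)
 qed (rule C et' V | erule wt_supp)+
 then show ?thesis unfolding rep by simp
qed

lemma iexp_bounded_integrable: "f : borel_measurable M ==> integrable M (%z. iexp (f z))"
 by (rule integrable_const_bound[where B = 1]) simp_all

text \<open>Where \<open>dev\<close> is below \<open>dl\<close> the two statistics differ by at most
  \<open>e\<close> times a variable of bounded expectation; elsewhere the characters differ by at
  most 2, which \<open>2 / dl * dev n z\<close> dominates.\<close>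

theorem studentized_char_limit:
 "(%n. (LINT z|M. iexp (u \<bullet> (studentizer (Cov n z) *v Wq n z)))) ----> exp (- ((norm u)\<^sup>2 / 2))"
proof -
 let ?S = "inv_sqrt Cov0"
 define X where "X n z = u \<bullet> (studentizer (Cov n z) *v Wq n z)" for n z
 define Y where "Y n z = u \<bullet> (?S *v Wq n z)" for n z
 have Xm: "X n : borel_measurable M" for n
  unfolding X_def[abs_def]
  by (intro borel_measurable_inner borel_measurable_const borel_measurable_mult_vec studentizer_measurable Cov_measurable Wq_measurable)
 have Ym: "Y n : borel_measurable M" for n
  unfolding Y_def[abs_def]
  by (intro borel_measurable_inner borel_measurable_const borel_measurable_mult_vec Wq_measurable)
 obtain V where V: "ALL n j. nrm (%z. W n z $ j) <= V" using W_bounded ..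
 have V0: "0 <= V" using V L2_norm_nonneg order_trans by blast
 have iN: "integrable M (%z. SUM a:UNIV. \<bar>W n z $ J a\<bar>)" for n
  by (intro Lint_sum integrable_abs L2_int[OF W_L2])
 have EN: "(LINT z|M. (SUM a:UNIV. \<bar>W n z $ J a\<bar>)) <= real CARD('q) * V" for n
 proof -
  have "(LINT z|M. (SUM a:UNIV. \<bar>W n z $ J a\<bar>)) = (SUM a:UNIV. (LINT z|M. \<bar>W n z $ J a\<bar>))"
  by (rule LINT_sum) (intro integrable_abs L2_int[OF W_L2])
  also have "... <= (SUM a:(UNIV :: 'q set). V)"
  using V by (intro sum_mono order_trans[OF expectation_abs_le_L2_norm[OF W_L2]]) simp
  finally show ?thesis by simp
 qed
 have "(%n. (LINT z|M. iexp (X n z)) - (LINT z|M. iexp (Y n z))) ----> 0"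
 proof (rule LIMSEQ_I)
  fix r :: real assume r: "r > 0"
  define e where "e = r / (2 * (norm u * (real CARD('q) * V) + 1))"
  have den: "0 < norm u * (real CARD('q) * V) + 1" using V0 by (simp add: add_nonneg_pos)
  have e: "e > 0" unfolding e_def using r den by simp
  have e2: "e * (norm u * (real CARD('q) * V)) < r / 2"
  unfolding e_def using r den by (simp add: divide_simps)
  obtain N dl where dl: "dl > 0 \<and> (ALL n>=N. ALL z. dev n z < dl --> posdef (Cov n z) \<and> l1_norm (studentizer (Cov n z) - ?S) < e)"
  using studentizer_close[OF e] by blast
  have "(%n. 2 / dl * (LINT z|M. dev n z)) ----> 2 / dl * 0" by (intro tendsto_mult tendsto_const dev_limit)
  then have "\<forall>\<^sub>F n in sequentially. 2 / dl * (LINT z|M. dev n z) < r / 2"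
  by (rule order_tendstoD(2)) (use r in simp)
  then have "\<forall>\<^sub>F n in sequentially. norm ((LINT z|M. iexp (X n z)) - (LINT z|M. iexp (Y n z)) - 0) < r"
  using eventually_ge_at_top[of N]
  proof eventually_elim
  case (elim n)
  have d0: "0 <= dev n z" for z unfolding dev_def l1_norm_def by (intro sum_nonneg) simp
  have pw: "cmod (iexp (X n z) - iexp (Y n z)) <= 2 / dl * dev n z + e * norm u * (SUM a:UNIV. \<bar>W n z $ J a\<bar>)" for z
  proof (cases "dev n z < dl")
  case True
  then have le: "l1_norm (studentizer (Cov n z) - ?S) < e" using dl elim by blast
  have "cmod (iexp (X n z) - iexp (Y n z)) <= \<bar>X n z - Y n z\<bar>" by (rule iexp_diff_norm)
  also have "X n z - Y n z = u \<bullet> ((studentizer (Cov n z) - ?S) *v Wq n z)"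
  unfolding X_def Y_def by (simp add: matrix_vector_mult_diff_rdistrib inner_diff_right)
  also have "\<bar>...\<bar> <= l1_norm (studentizer (Cov n z) - ?S) * (norm u * norm (Wq n z))" by (rule bilinear_l1_bound)
  also have "... <= e * (norm u * (SUM a:UNIV. \<bar>W n z $ J a\<bar>))"
  proof (intro mult_mono)
  show "l1_norm (studentizer (Cov n z) - ?S) <= e" using le by simp
  show "norm (Wq n z) <= (SUM a:UNIV. \<bar>W n z $ J a\<bar>)"
  using norm_le_l1_cart[of "Wq n z"] by (simp add: Wq_def)
  qed (use e in simp_all)
  finally show ?thesis using d0[of z] dl by (simp add: mult_ac add_increasing)
  next
  case False
  have "cmod (iexp (X n z) - iexp (Y n z)) <= cmod (iexp (X n z)) + cmod (iexp (Y n z))" by (rule norm_triangle_ineq4)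
  also have "... = 2" by simp
  also have "... <= 2 / dl * dev n z" using False dl by (simp add: divide_simps)
  finally show ?thesis using e by (simp add: add_increasing2 sum_nonneg)
  qed
  have ie: "integrable M (%z. iexp (X n z) - iexp (Y n z))"
  by (intro Lint_diff iexp_bounded_integrable Xm Ym)
  have "cmod ((LINT z|M. iexp (X n z)) - (LINT z|M. iexp (Y n z))) = cmod (LINT z|M. iexp (X n z) - iexp (Y n z))"
  by (simp only: LINT_diff[OF iexp_bounded_integrable[OF Xm] iexp_bounded_integrable[OF Ym]])
  also have "... <= (LINT z|M. cmod (iexp (X n z) - iexp (Y n z)))" by (rule integral_norm_bound)
  also have "... <= (LINT z|M. 2 / dl * dev n z + e * norm u * (SUM a:UNIV. \<bar>W n z $ J a\<bar>))"
  by (rule integral_mono[OF integrable_norm[OF ie] _ pw])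
  (intro Lint_add integrable_mult_right dev_integrable iN)
  also have "... = (LINT z|M. 2 / dl * dev n z) + (LINT z|M. e * norm u * (SUM a:UNIV. \<bar>W n z $ J a\<bar>))"
  by (intro LINT_add integrable_mult_right dev_integrable iN)
  also have "... = 2 / dl * (LINT z|M. dev n z) + e * norm u * (LINT z|M. (SUM a:UNIV. \<bar>W n z $ J a\<bar>))"
  by (simp only: integral_mult_right_zero)
  also have "e * norm u * (LINT z|M. (SUM a:UNIV. \<bar>W n z $ J a\<bar>)) <= e * norm u * (real CARD('q) * V)"
  using e by (intro mult_left_mono EN) simp
  finally have "cmod ((LINT z|M. iexp (X n z)) - (LINT z|M. iexp (Y n z)))
  <= 2 / dl * (LINT z|M. dev n z) + e * norm u * (real CARD('q) * V)" by simp
  also have "... < r" using elim(1) e2 by (simp add: mult.assoc)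
  finally show ?case by simp
  qed
  then show "EX no. ALL n>=no. norm ((LINT z|M. iexp (X n z)) - (LINT z|M. iexp (Y n z)) - 0) < r"
  unfolding eventually_sequentially .
 qed
 from tendsto_add[OF this oracle_char_limit[of u, folded Y_def]] show ?thesis unfolding X_def by simp
qed

end

section \<open>The spectral form of the limiting covariance\<close>

definition cmat :: "real^'n^'m => complex^'n^'m" where
 "cmat X = (\<chi> j l. complex_of_real (X $ j $ l))"

lemma cmat_mult: "cmat (X ** Y) = cmat X ** cmat Y"
 by (simp add: cmat_def matrix_matrix_mult_def vec_eq_iff)

lemma cmat_one: "cmat (mat 1) = mat 1"
 by (simp add: cmat_def mat_def vec_eq_iff)

lemma scaleR_matrix_mult:
 fixes X :: "complex^'n^'m" and Y :: "complex^'k^'n"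
 shows "(a *\<^sub>R X) ** (b *\<^sub>R Y) = (a * b) *\<^sub>R (X ** Y)"
 by (simp add: matrix_matrix_mult_def vec_eq_iff scaleR_sum_right mult.commute)

lemma hermitian_pd_cmat:
 fixes X :: "real^'n^'n"
 assumes "hermitian_pd (cmat X)"
 shows "posdef X"
 unfolding posdef_def
proof (intro conjI allI impI)
 have herm: "cmat X $ l $ j = cnj (cmat X $ j $ l)" for j l
  using assms unfolding hermitian_pd_def hermitian_def by blast
 have "complex_of_real (X $ l $ j) = complex_of_real (X $ j $ l)" for j l using herm[of l j] by (simp add: cmat_def)
 then show "transpose X = X" by (simp add: transpose_def vec_eq_iff)
 fix v :: "real^'n" assume "v ~= 0"
 define w :: "complex^'n" where "w = (\<chi> j. complex_of_real (v $ j))"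
 have "w ~= 0" using \<open>v ~= 0\<close> by (simp add: w_def vec_eq_iff)
 then have "0 < Re (quad_form (cmat X) w)" using assms unfolding hermitian_pd_def by blast
 also have "quad_form (cmat X) w = complex_of_real (v \<bullet> (X *v v))"
  by (simp add: quad_form_def w_def cmat_def inner_vec_def matrix_vector_mult_def sum_distrib_left mult_ac)
 finally show "0 < v \<bullet> (X *v v)" by simp
qed

lemma quad_form_scale: "cmod c = 1 ==> quad_form X (c *s v) = quad_form X v"
proof -
 assume "cmod c = 1"
 then have "cnj c * c = 1" using complex_norm_square[of c] by (simp add: mult.commute)
 then have "cnj (c * a) * b * (c * d) = cnj a * b * d" for a b d
  by (metis (no_types) complex_cnj_mult mult.assoc mult.commute mult_1)
 then show ?thesis unfolding quad_form_def vector_smult_component by (simp only:)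
qed

section \<open>Matrix integrals against the spectral measure\<close>

lemma quad_measure_sets: "sets (quad_measure \<nu> v) = circle_sets" "space (quad_measure \<nu> v) = {-pi..pi}"
proof -
 have sub: "circle_sets \<subseteq> Pow {-pi..pi}" using sets.space_closed[of "restrict_space borel {-pi..pi :: real}"] by simp
 have "sets (quad_measure \<nu> v) = sigma_sets {-pi..pi} circle_sets"
  unfolding quad_measure_def by (rule sets_measure_of[OF sub])
 also have "... = circle_sets" using sets.sigma_sets_eq[of "restrict_space borel {-pi..pi :: real}"] by simp
 finally show "sets (quad_measure \<nu> v) = circle_sets" .
 show "space (quad_measure \<nu> v) = {-pi..pi}" unfolding quad_measure_def by (rule space_measure_of[OF sub])
qed

text \<open>\<open>measure_of\<close> takes either the prescribed values, which are finite, or the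
  value 0.\<close>

lemma quad_measure_finite: "finite_measure (quad_measure \<nu> v)"
proof
 show "emeasure (quad_measure \<nu> v) (space (quad_measure \<nu> v)) ~= \<infinity>"
  unfolding quad_measure_def by (simp add: emeasure_measure_of_conv)
qed

lemma quad_measure_measurable:
 fixes g :: "real => complex"
 assumes "g : borel_measurable borel"
 shows "g : borel_measurable (quad_measure \<nu> v)"
 using measurable_restrict_space1[OF assms, of "{-pi..pi}"] measurable_cong_sets[OF quad_measure_sets(1) refl] by blast

lemma quad_measure_integrable:
 fixes g :: "real => complex"
 assumes "g : borel_measurable borel" "!!t. cmod (g t) <= c"
 shows "integrable (quad_measure \<nu> v) g"
 by (rule finite_measure.integrable_const_bound[OF quad_measure_finite, where B = c])
  (use assms in \<open>auto intro: quad_measure_measurable\<close>)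

lemma matrix_integral_entry:
 "matrix_integral \<nu> g $ j $ l = (SUM r<4. (- \<i>) ^ r * (\<integral>t. g t \<partial>quad_measure \<nu> (axis j 1 + \<i> ^ r *s axis l 1))) / 4"
 by (simp add: matrix_integral_def)

lemma matrix_integral_sum:
 assumes g: "!!k. g k : borel_measurable borel" "!!k t. cmod (g k t) <= 1"
 shows "matrix_integral \<nu> (%t. SUM k:I. a k * g k t) $ j $ l = (SUM k:I. a k * matrix_integral \<nu> (g k) $ j $ l)"
proof -
 have "(\<integral>t. (SUM k:I. a k * g k t) \<partial>quad_measure \<nu> v) = (SUM k:I. a k * (\<integral>t. g k t \<partial>quad_measure \<nu> v))" for v
 proof -
  have "(\<integral>t. (SUM k:I. a k * g k t) \<partial>quad_measure \<nu> v) = (SUM k:I. (\<integral>t. a k * g k t \<partial>quad_measure \<nu> v))"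
  by (rule LINT_sum) (intro integrable_mult_right quad_measure_integrable[where c = 1] g)
  then show ?thesis by simp
 qed
 then have "matrix_integral \<nu> (%t. SUM k:I. a k * g k t) $ j $ l
  = (SUM r<4. SUM k:I. a k * ((- \<i>) ^ r * (\<integral>t. g k t \<partial>quad_measure \<nu> (axis j 1 + \<i> ^ r *s axis l 1)))) / 4"
  unfolding matrix_integral_entry by (simp add: sum_distrib_left mult_ac)
 also have "... = (SUM k:I. a k * matrix_integral \<nu> (g k) $ j $ l)"
  unfolding matrix_integral_entry by (subst sum.swap) (simp add: sum_distrib_left sum_divide_distrib)
 finally show ?thesis .
qed

lemma matrix_integral_limit:
 assumes g: "!!n. g n : borel_measurable borel" "!!n t. cmod (g n t) <= c" and g0: "!!t. (%n. g n t) ----> g0 t"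
 shows "(%n. matrix_integral \<nu> (g n) $ j $ l) ----> matrix_integral \<nu> g0 $ j $ l"
proof -
 have m0: "g0 : borel_measurable borel" by (rule borel_measurable_LIMSEQ_metric[OF g(1) g0])
 have "(%n. \<integral>t. g n t \<partial>quad_measure \<nu> v) ----> (\<integral>t. g0 t \<partial>quad_measure \<nu> v)" for v
 proof (rule integral_dominated_convergence[where w = "%_. c"])
  show "integrable (quad_measure \<nu> v) (%_. c)" using finite_measure.integrable_const[OF quad_measure_finite] .
 qed (use g g0 m0 in \<open>auto intro: quad_measure_measurable\<close>)
 then show ?thesis unfolding matrix_integral_entry by (intro tendsto_divide tendsto_sum tendsto_mult tendsto_const) simp_all
qed

text \<open>Up to a unit factor, the vectors of the polarization of the entry \<open>(l, j)\<close> are those of the entry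
 \<open>(j, l)\<close> with conjugate coefficients.\<close>

lemma matrix_integral_cnj: "matrix_integral \<nu> (%t. cnj (g t)) $ l $ j = cnj (matrix_integral \<nu> g $ j $ l)"
proof -
 define q where "q r = (\<integral>t. g t \<partial>quad_measure \<nu> (axis j 1 + \<i> ^ r *s axis l 1))" for r
 define q' where "q' r = (\<integral>t. cnj (g t) \<partial>quad_measure \<nu> (axis l 1 + \<i> ^ r *s axis j 1))" for r
 have qm: "quad_measure \<nu> (axis l 1 + \<i> ^ r *s axis j 1) = quad_measure \<nu> (axis j 1 + \<i> ^ s *s axis l 1)"
  if "\<i> ^ r * \<i> ^ s = 1" for r s
 proof -
  have "axis l 1 + \<i> ^ r *s axis j 1 = \<i> ^ r *s (axis j 1 + \<i> ^ s *s axis l 1)"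
  using that by (simp add: vec_eq_iff distrib_left mult.assoc[symmetric])
  moreover have "cmod (\<i> ^ r) = 1" by (simp add: norm_power)
  ultimately show ?thesis unfolding quad_measure_def by (simp only: quad_form_scale)
 qed
 have q': "q' r = cnj (q s)" if "\<i> ^ r * \<i> ^ s = 1" for r s
  unfolding q_def q'_def qm[OF that] by simp
 have "q' 0 = cnj (q 0)" "q' 1 = cnj (q 3)" "q' 2 = cnj (q 2)" "q' 3 = cnj (q 1)"
  by (rule q', simp add: power3_eq_cube power2_eq_square)+
 then show ?thesis
  unfolding matrix_integral_entry q_def[symmetric] q'_def[symmetric]
  by (simp add: eval_nat_numeral lessThan_Suc power3_eq_cube power2_eq_square)
qed

text \<open>The spectral measure is Hermitian, so its coefficients at negative lags are the
  transposes of those at positive lags.\<close>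

definition signed_R :: "(nat => real^'p) => int => 'p => 'p => real" where
 "signed_R x k j l = (if 0 <= k then R_matrix x (nat k) $ j $ l else R_matrix x (nat (- k)) $ l $ j)"

lemma signed_R_spectral:
 assumes "spectral_measure_of x \<nu>"
 shows "matrix_integral \<nu> (%t. cis (of_int k * t)) $ j $ l = complex_of_real (signed_R x k j l)"
proof -
 have R: "matrix_integral \<nu> (%t. cis (real k * t)) $ j $ l = complex_of_real (R_matrix x k $ j $ l)" for k j l
  using assms unfolding spectral_measure_of_def by (metis vec_lambda_beta)
 show ?thesis
 proof (cases "0 <= k")
  case True
  then show ?thesis using R[of "nat k" j l] by (simp add: signed_R_def)
 next
  case False
  then have "(%t. cis (of_int k * t)) = (%t. cnj (cis (real (nat (- k)) * t)))" by (simp add: cis_cnj fun_eq_iff)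
  then show ?thesis using False R[of "nat (- k)" l j] by (simp add: matrix_integral_cnj signed_R_def)
 qed
qed

text \<open>Termwise integration of the Fourier series of the density along symmetric partial sums,
  dominated by the sum of \<open>|\<gamma> k|\<close>.\<close>

lemma spectral_density_integral:
 fixes \<gamma> :: "int => real"
 assumes \<gamma>: "(%k. \<bar>\<gamma> k\<bar>) summable_on UNIV" and s: "spectral_measure_of x \<nu>"
  and bound: "!!k. \<bar>signed_R x k j l\<bar> <= 1"
 shows "matrix_integral \<nu> (spectral_density \<gamma>) $ j $ l = complex_of_real (\<Sum>\<^sub>\<infinity>k. \<gamma> k * signed_R x k j l) / (2 * pi)"
proof -
 let ?g = "%N t. SUM k:{- int N..int N}. (complex_of_real (\<gamma> k) / (2 * pi)) * cis (of_int k * t)"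
 have sm: "(%k. complex_of_real (\<gamma> k) * cis (of_int k * t)) summable_on UNIV" for t
  by (rule abs_summable_summable) (use \<gamma> in \<open>simp add: norm_mult\<close>)
 have lim: "(%N. ?g N t) ----> spectral_density \<gamma> t" for t
 proof -
  have "(%N. (SUM k:{- int N..int N}. complex_of_real (\<gamma> k) * cis (of_int k * t)) / (2 * pi)) ----> spectral_density \<gamma> t"
  unfolding spectral_density_def
  by (intro tendsto_divide has_sum_int_symmetric has_sum_infsum sm tendsto_const) simp
  then show ?thesis by (simp add: sum_divide_distrib)
 qed
 have "(%N. matrix_integral \<nu> (?g N) $ j $ l) ----> matrix_integral \<nu> (spectral_density \<gamma>) $ j $ l"
 proof (rule matrix_integral_limit[OF _ _ lim])
  show "?g N : borel_measurable borel" for N by (intro borel_measurable_continuous_onI continuous_intros)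
  show "cmod (?g N t) <= (\<Sum>\<^sub>\<infinity>k. \<bar>\<gamma> k\<bar>)" for N t
  proof -
  have "cmod (?g N t) <= (SUM k:{- int N..int N}. \<bar>\<gamma> k\<bar>)"
  proof (rule order_trans[OF norm_sum sum_mono])
  fix k
  have "cmod (complex_of_real (\<gamma> k) / (2 * pi) * cis (of_int k * t)) = \<bar>\<gamma> k\<bar> / (2 * pi)" by (simp add: norm_mult norm_divide)
  also have "... <= \<bar>\<gamma> k\<bar> / 1" using pi_gt3 by (intro divide_left_mono) simp_all
  finally show "cmod (complex_of_real (\<gamma> k) / (2 * pi) * cis (of_int k * t)) <= \<bar>\<gamma> k\<bar>" by simp
  qed
  also have "... <= (\<Sum>\<^sub>\<infinity>k. \<bar>\<gamma> k\<bar>)" by (rule finite_sum_le_infsum[OF \<gamma>]) simp_all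
  finally show ?thesis .
  qed
 qed
 moreover have "matrix_integral \<nu> (?g N) $ j $ l = complex_of_real (SUM k:{- int N..int N}. \<gamma> k * signed_R x k j l) / (2 * pi)" for N
 proof -
  have "matrix_integral \<nu> (?g N) $ j $ l = (SUM k:{- int N..int N}. (complex_of_real (\<gamma> k) / (2 * pi)) * matrix_integral \<nu> (%t. cis (of_int k * t)) $ j $ l)"
  by (rule matrix_integral_sum) (auto intro!: borel_measurable_continuous_onI continuous_intros)
  then show ?thesis unfolding signed_R_spectral[OF s] by (simp add: sum_divide_distrib)
 qed
 moreover have "(%N. complex_of_real (SUM k:{- int N..int N}. \<gamma> k * signed_R x k j l) / (2 * pi))
  ----> complex_of_real (\<Sum>\<^sub>\<infinity>k. \<gamma> k * signed_R x k j l) / (2 * pi)"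
 proof (intro tendsto_divide tendsto_of_real tendsto_const dominated_int_sum[OF \<gamma>])
  show "\<bar>\<gamma> k * signed_R x k j l\<bar> <= \<bar>\<gamma> k\<bar>" for k using mult_left_mono[OF bound abs_ge_zero, of "\<gamma> k" k] by (simp add: abs_mult)
 qed simp
 ultimately show ?thesis using LIMSEQ_unique by simp
qed

text \<open>\<open>F_matrix\<close> is \<open>R(0)\<close> over \<open>2 * pi\<close>, and
  \<open>G_matrix\<close> carries \<open>1 / (2 * pi)\<close> twice, once from its definition and
  once from the density; the two inverses of \<open>F_matrix\<close> cancel both. The limiting
  covariance is thereby a real matrix.\<close>

theorem posdef_of_limit_cov:
 fixes \<gamma> :: "int => real" and x :: "nat => real^'p"
 assumes \<gamma>: "(%k. \<bar>\<gamma> k\<bar>) summable_on UNIV" and s: "spectral_measure_of x \<nu>"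
  and bound: "!!k j l. \<bar>signed_R x k j l\<bar> <= 1" and R0: "posdef (\<chi> j l. signed_R x 0 j l)"
  and pd: "hermitian_pd (limit_cov (spectral_density \<gamma>) \<nu>)"
 shows "posdef (matrix_inv (\<chi> j l. signed_R x 0 j l) ** (\<chi> j l. \<Sum>\<^sub>\<infinity>k. \<gamma> k * signed_R x k j l) ** matrix_inv (\<chi> j l. signed_R x 0 j l))"
proof -
 let ?R = "(\<chi> j l. signed_R x 0 j l) :: real^'p^'p" and ?G = "(\<chi> j l. \<Sum>\<^sub>\<infinity>k. \<gamma> k * signed_R x k j l) :: real^'p^'p"
 have F: "F_matrix \<nu> = (1 / (2 * pi)) *\<^sub>R cmat ?R"
  using signed_R_spectral[OF s, of 0] by (simp add: F_matrix_def cmat_def vec_eq_iff)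
 have "((2 * pi) *\<^sub>R cmat (matrix_inv ?R)) ** F_matrix \<nu> = mat 1"
  unfolding F scaleR_matrix_mult cmat_mult[symmetric] matrix_inv_mult(2)[OF posdef_invertible[OF R0]] cmat_one by simp
 then have Fi: "matrix_inv (F_matrix \<nu>) = (2 * pi) *\<^sub>R cmat (matrix_inv ?R)" by (rule matrix_inv_unique_left)
 have G: "G_matrix (spectral_density \<gamma>) \<nu> = ((1 / (2 * pi)) * (1 / (2 * pi))) *\<^sub>R cmat ?G"
 proof -
  have e: "(1 / (2 * pi)) *\<^sub>R (z / (2 * pi)) = ((1 / (2 * pi)) * (1 / (2 * pi))) *\<^sub>R z" for z :: complex
  by (simp add: scaleR_conv_of_real)
  show ?thesis unfolding G_matrix_def vec_eq_iff
  by (simp only: vector_scaleR_component spectral_density_integral[OF \<gamma> s bound] cmat_def vec_lambda_beta e simp_thms)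
 qed
 have "limit_cov (spectral_density \<gamma>) \<nu> = cmat (matrix_inv ?R ** ?G ** matrix_inv ?R)"
  unfolding limit_cov_def Fi G scaleR_matrix_mult cmat_mult by simp
 then show ?thesis using pd by (intro hermitian_pd_cmat) simp
qed

section \<open>The least squares statistics\<close>

definition vstat :: "('q => 'p) => nat => (nat => real^'p) => (nat => real) => real^'q" where
 "vstat J n x Y = (\<chi> a. col_norm x n (J a) * least_squares x Y n $ J a)"

definition cstat :: "('q => 'p) => (real => real) => real => nat => (nat => real^'p) => (nat => real) => real^'q^'q" where
 "cstat J K h n x Y = principal_submatrix J (cov_est K h x Y n)"

text \<open>Paths in the product space are prescribed only for the indices \<open>i >= 1\<close>;
  the statistics must not see the value at 0.\<close>

lemma statistics_cong:
 assumes x: "!!i. 1 <= i ==> x i = x' i" and Y: "!!i. 1 <= i ==> Y i = Y' i"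
 shows "vstat J n x Y = vstat J n x' Y'" "cstat J K h n x Y = cstat J K h n x' Y'"
proof -
 have col: "col_norm x n = col_norm x' n"
  unfolding col_norm_def by (intro ext arg_cong[of _ _ sqrt] sum.cong refl) (simp add: x)
 have D: "norm_matrix x n = norm_matrix x' n" unfolding norm_matrix_def col ..
 have g: "gram x n = gram x' n"
  unfolding gram_def vec_eq_iff vec_lambda_beta by (intro allI sum.cong refl) (simp add: x)
 have v: "(\<chi> j. SUM i=1..n. x i $ j * Y i) = (\<chi> j. SUM i=1..n. x' i $ j * Y' i)"
  unfolding vec_eq_iff vec_lambda_beta by (intro allI sum.cong refl) (simp add: x Y)
 have ls: "least_squares x Y n = least_squares x' Y' n" unfolding least_squares_def g v ..
 have res: "residual x Y n i = residual x' Y' n i" if "1 <= i" for i by (simp add: residual_def ls x[OF that] Y[OF that])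
 have ac: "autocov_est x Y n = autocov_est x' Y' n"
  unfolding autocov_est_def by (intro ext arg_cong2[of _ _ _ _ "(*)"] refl sum.cong) (auto intro!: res)
 have m: "(\<chi> j l. SUM a=1..n. SUM b=1..n. x a $ j * Gamma_est K h x Y n a b * x b $ l)
  = (\<chi> j l. SUM a=1..n. SUM b=1..n. x' a $ j * Gamma_est K h x' Y' n a b * x' b $ l)"
  unfolding vec_eq_iff vec_lambda_beta Gamma_est_def ac by (intro allI sum.cong refl) (simp add: x)
 show "vstat J n x Y = vstat J n x' Y'" unfolding vstat_def col ls ..
 show "cstat J K h n x Y = cstat J K h n x' Y'" unfolding cstat_def cov_est_def D g m ..
qed

lemma statistics_measurable:
 fixes X :: "nat => 'z => real^'p"
 assumes X: "!!i. 1 <= i ==> X i : borel_measurable N" and Y: "!!i. 1 <= i ==> Y i : borel_measurable N"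
 shows "(%z. vstat J n (%i. X i z) (%i. Y i z)) : borel_measurable N"
  "(%z. cstat J K h n (%i. X i z) (%i. Y i z)) : borel_measurable N"
proof -
 have Xj: "(%z. X i z $ j) : borel_measurable N" if "1 <= i" for i j by (rule borel_measurable_vec_nth[OF X[OF that]])
 have col: "(%z. col_norm (%i. X i z) n j) : borel_measurable N" for j
  unfolding col_norm_def
 proof (rule measurable_compose[where g = sqrt and N = borel])
  show "(%z. SUM i=1..n. (X i z $ j)\<^sup>2) : borel_measurable N"
  by (intro borel_measurable_sum borel_measurable_power Xj) simp
  show "sqrt : borel_measurable borel" by (intro borel_measurable_continuous_onI continuous_intros)
 qed
 have D: "(%z. norm_matrix (%i. X i z) n) : borel_measurable N"
 proof (intro borel_measurable_vec_lambda)
  fix j l show "(%z. norm_matrix (%i. X i z) n $ j $ l) : borel_measurable N"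
  using col by (cases "j = l") (simp_all add: norm_matrix_def)
 qed
 have "(%z. gram (%i. X i z) n) : borel_measurable N"
  unfolding gram_def by (intro borel_measurable_vec_lambda) (simp, intro borel_measurable_sum borel_measurable_times Xj, simp_all)
 then have gi: "(%z. matrix_inv (gram (%i. X i z) n)) : borel_measurable N" by (rule borel_measurable_matrix_inv)
 have "(%z. \<chi> j. SUM i=1..n. X i z $ j * Y i z) : borel_measurable N"
  by (intro borel_measurable_vec_lambda) (simp, intro borel_measurable_sum borel_measurable_times Xj Y, simp_all)
 then have ls: "(%z. least_squares (%i. X i z) (%i. Y i z) n) : borel_measurable N"
  unfolding least_squares_def by (rule borel_measurable_mult_vec[OF gi])
 have res: "(%z. residual (%i. X i z) (%i. Y i z) n i) : borel_measurable N" if "1 <= i" for i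
  unfolding residual_def by (intro borel_measurable_diff borel_measurable_inner X Y ls that)
 have ac: "(%z. autocov_est (%i. X i z) (%i. Y i z) n k) : borel_measurable N" for k
  unfolding autocov_est_def by (intro borel_measurable_times borel_measurable_const borel_measurable_sum res) simp_all
 have m: "(%z. \<chi> j l. SUM a=1..n. SUM b=1..n. X a z $ j * Gamma_est K h (%i. X i z) (%i. Y i z) n a b * X b z $ l) : borel_measurable N"
  unfolding Gamma_est_def
  by (intro borel_measurable_vec_lambda)
  (simp, intro borel_measurable_sum borel_measurable_times borel_measurable_const Xj ac, simp_all)
 have c: "(%z. cov_est K h (%i. X i z) (%i. Y i z) n) : borel_measurable N"
  unfolding cov_est_def by (intro borel_measurable_matrix_mult D gi m)
 show "(%z. vstat J n (%i. X i z) (%i. Y i z)) : borel_measurable N"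
  unfolding vstat_def
  by (intro borel_measurable_vec_lambda) (simp, intro borel_measurable_times col borel_measurable_vec_nth ls)
 show "(%z. cstat J K h n (%i. X i z) (%i. Y i z)) : borel_measurable N"
  unfolding cstat_def principal_submatrix_def
  by (intro borel_measurable_vec_lambda) (simp, intro borel_measurable_vec_nth c)
qed

lemma sum_int_nat: "(SUM i:{1..int n}. f (nat i)) = (SUM i=1..n. f i)"
 by (rule sum.reindex_bij_witness[of _ int nat]) auto

lemma diagonal_mult:
 "(norm_matrix x n ** X) $ j $ l = col_norm x n j * X $ j $ l"
 "(X ** norm_matrix x n) $ j $ l = X $ j $ l * col_norm x n l"
 by (simp_all add: matrix_matrix_mult_def norm_matrix_def if_distrib[of "%c. _ * c"] if_distrib[of "%c. c * _"] cong: if_cong)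

text \<open>Integer indices and zero outside the window match the conventions of
  \<open>lagsum\<close>; a column of norm 0 is sent to 0 by the convention for division.\<close>

definition normalized :: "(nat => real^'p) => nat => int => 'p => real" where
 "normalized x n i j = (if i : {1..int n} then x (nat i) $ j / col_norm x n j else 0)"

lemma normalized_supp: "normalized x n i j ~= 0 ==> i : {1..int n}"
 by (simp add: normalized_def split: if_splits)

lemma normalized_square: "(SUM i:{1..int n}. (normalized x n i j)\<^sup>2) <= 1"
proof -
 have c: "(col_norm x n j)\<^sup>2 = (SUM i=1..n. (x i $ j)\<^sup>2)" unfolding col_norm_def by (simp add: sum_nonneg)
 have "(SUM i:{1..int n}. (normalized x n i j)\<^sup>2) = (SUM i:{1..int n}. (x (nat i) $ j / col_norm x n j)\<^sup>2)"
  by (intro sum.cong refl) (simp add: normalized_def)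
 also have "... = (SUM i=1..n. (x i $ j)\<^sup>2) / (col_norm x n j)\<^sup>2"
  unfolding sum_int_nat[where f = "%i. (x i $ j / col_norm x n j)\<^sup>2"] by (simp add: power_divide sum_divide_distrib)
 also have "... <= 1" unfolding c by simp
 finally show ?thesis .
qed

lemma normalized_lag:
 "(SUM i:{1..int n}. normalized x n i j * normalized x n (i + int m) l) = lag_corr x m j l n"
proof -
 have "(SUM i:{1..int n}. normalized x n i j * normalized x n (i + int m) l)
  = (SUM i:{1..int n}. normalized x n (int (nat i)) j * normalized x n (int (nat i + m)) l)"
  by (intro sum.cong refl) simp
 also have "... = (SUM i=1..n. normalized x n (int i) j * normalized x n (int (i + m)) l)"
  by (rule sum_int_nat[where f = "%i. normalized x n (int i) j * normalized x n (int (i + m)) l"])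
 also have "... = (SUM i=1..n - m. normalized x n (int i) j * normalized x n (int (i + m)) l)"
  by (rule sum.mono_neutral_right) (auto simp: normalized_def)
 also have "... = lag_corr x m j l n"
  unfolding lag_corr_def by (intro sum.cong refl) (auto simp: normalized_def nat_int_add)
 finally show ?thesis .
qed

lemma normalized_neg_lag:
 "(SUM i:{1..int n}. normalized x n i j * normalized x n (i - int m) l) = lag_corr x m l j n"
proof -
 let ?y = "normalized x n"
 have "(SUM i:{1..int n}. ?y i j * ?y (i - int m) l) = (SUM s:{1 - int m..int n + int m}. ?y (s + int m) j * ?y (s + int m - int m) l)"
  by (rule sum_shift_support) (use normalized_supp in fastforce)+
 also have "... = (SUM s:{1..int n}. ?y (s + int m) j * ?y (s + int m - int m) l)"
 proof (rule sum.mono_neutral_right)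
  show "ALL i:{1 - int m..int n + int m} - {1..int n}. ?y (i + int m) j * ?y (i + int m - int m) l = 0" by (auto simp: normalized_def)
 qed auto
 finally show ?thesis using normalized_lag[where x = x and n = n and m = m and j = l and l = j] by (simp add: mult.commute)
qed

lemma normalized_lag_limit:
 assumes "design_conditions x"
 shows "(%n. SUM i:{1..int n}. normalized x n i j * normalized x n (i + k) l) ----> signed_R x k j l"
proof -
 have lim: "lag_corr x m j l ----> R_matrix x m $ j $ l" for m j l
  using assms by (simp add: design_conditions_def R_matrix_def convergent_LIMSEQ_iff)
 show ?thesis
 proof (cases "0 <= k")
  case True
  then show ?thesis using lim[of "nat k" j l] normalized_lag[where x = x and m = "nat k" and j = j and l = l] by (simp add: signed_R_def)
 next
  case False
  then show ?thesis using lim[of "nat (- k)" l j] normalized_neg_lag[where x = x and m = "nat (- k)" and j = j and l = l] by (simp add: signed_R_def)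
 qed
qed

context hannan_process
begin

lemma fixed_design_regression:
 fixes x :: "nat => real^'p" and J :: "'q::finite => 'p"
 assumes K: "admissible_kernel K"
  and h: "!!n. n >= 1 ==> 0 < h n" "filterlim h at_top sequentially" "(%n. h n / real n) ----> 0"
  and J: "inj J" and design: "design_conditions x" and spectral: "spectral_measure_of x \<nu>"
  and pd: "hermitian_pd (limit_cov (spectral_density gam) \<nu>)"
 shows "normalized_regression M T F0 e0 K h (normalized x) (%n. SUM j:UNIV. \<bar>(SUP i\<in>{1..n}. \<bar>x i $ j\<bar>) / col_norm x n j\<bar>) (signed_R x) J"
proof
 let ?et = "%n. SUM j:UNIV. \<bar>(SUP i\<in>{1..n}. \<bar>x i $ j\<bar>) / col_norm x n j\<bar>"
 have R0: "posdef (\<chi> j l. signed_R x 0 j l)"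
 proof -
  have "(\<chi> j l. signed_R x 0 j l) = R_matrix x 0" by (simp add: vec_eq_iff signed_R_def)
  then show ?thesis using design by (simp add: design_conditions_def)
 qed
 show "posdef (\<chi> j l. signed_R x 0 j l)" by (rule R0)
 have bound: "\<bar>signed_R x k j l\<bar> <= 1" for k j l
  by (rule lag_limit_bound[OF _ normalized_square normalized_lag_limit[OF design]]) (rule normalized_supp)
 show "posdef (matrix_inv (\<chi> j l. signed_R x 0 j l) ** (\<chi> j l. \<Sum>\<^sub>\<infinity>k. gam k * signed_R x k j l) ** matrix_inv (\<chi> j l. signed_R x 0 j l))"
  by (rule posdef_of_limit_cov[OF gam_abs_summable spectral bound R0 pd])
 show "(%n. SUM i:{1..int n}. normalized x n i j * normalized x n (i + k) l) ----> signed_R x k j l" for k j l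
  by (rule normalized_lag_limit[OF design])
 show "?et ----> 0"
 proof -
  have "?et ----> (SUM j:(UNIV :: 'p set). \<bar>0\<bar>)"
  using design unfolding design_conditions_def by (intro tendsto_sum tendsto_rabs) blast
  then show ?thesis by simp
 qed
 show "\<bar>normalized x n i j\<bar> <= ?et n" for n i j
 proof (cases "i : {1..int n}")
  case True
  have "\<bar>x (nat i) $ j\<bar> <= (SUP i\<in>{1..n}. \<bar>x i $ j\<bar>)" using True by (intro cSUP_upper) auto
  moreover have c: "0 <= col_norm x n j" by (simp add: col_norm_def sum_nonneg)
  ultimately have "\<bar>normalized x n i j\<bar> <= (SUP i\<in>{1..n}. \<bar>x i $ j\<bar>) / col_norm x n j"
  using True by (simp add: normalized_def abs_divide divide_right_mono)
  also have "... <= \<bar>(SUP i\<in>{1..n}. \<bar>x i $ j\<bar>) / col_norm x n j\<bar>" by (rule abs_ge_self)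
  also have "... <= ?et n" by (rule member_le_sum[of j UNIV "%j. \<bar>(SUP i\<in>{1..n}. \<bar>x i $ j\<bar>) / col_norm x n j\<bar>"]) simp_all
  finally show ?thesis .
 qed (auto simp: normalized_def sum_nonneg)
qed (rule K h J normalized_square | assumption | erule normalized_supp)+

end

context normalized_regression
begin

text \<open>With \<open>E\<close> the inverse of the norm matrix, the Gram matrix has the inverse
  \<open>E ** P n ** E\<close>. Hence the outer norm matrices in \<open>cov_est\<close> cancel and
  leave \<open>P n ** B n z ** P n\<close>, while \<open>\<beta>\<close> drops out of the residuals
  and, under the null hypothesis, out of the selected coordinates.\<close>

lemma statistics_eq:
 fixes x :: "nat => real^'p"
 assumes y: "y = normalized x" and d: "!!j. col_norm x n j > 0" and A: "invertible (A n)" and \<beta>: "!!a. \<beta> $ J a = 0"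
 defines "Y z i \<equiv> x i \<bullet> \<beta> + eps (int i) z"
 shows "vstat J n x (Y z) = Wq n z" "cstat J K (h n) n x (Y z) = Cov n z"
proof -
 let ?D = "norm_matrix x n" and ?c = "col_norm x n"
 define E :: "real^'p^'p" where "E = (\<chi> j l. if j = l then 1 / ?c j else 0)"
 have d0: "?c j ~= 0" for j using d[of j] by simp
 have E1: "E ** ?D = mat 1" unfolding vec_eq_iff diagonal_mult(2) by (simp add: E_def mat_def d0)
 have E2: "?D ** E = mat 1" unfolding vec_eq_iff diagonal_mult(1) by (simp add: E_def mat_def d0)
 have Ev: "(E *v v) $ j = v $ j / ?c j" for v j
  by (simp add: matrix_vector_mult_def E_def if_distrib[of "%c. c * _"] cong: if_cong)
 have EXE: "(E ** X ** E) $ j $ l = X $ j $ l / (?c j * ?c l)" for X :: "real^'p^'p" and j l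
  by (simp add: matrix_matrix_mult_def E_def if_distrib[of "%c. c * _"] if_distrib[of "%c. _ * c"] cong: if_cong)
 have yn: "y n (int i) j = x i $ j / ?c j" if "i : {1..n}" for i j using that by (simp add: y normalized_def)
 have sums: "(SUM i:{1..int n}. f i) = (SUM i=1..n. f (int i))" for f :: "int => real"
  by (rule sum.reindex_bij_witness[of _ int nat]) auto
 have gram: "gram x n = ?D ** A n ** ?D"
 proof -
  have "gram x n $ j $ l = ?c j * A n $ j $ l * ?c l" for j l
  proof -
  have "?c j * A n $ j $ l * ?c l = (SUM i=1..n. ?c j * (y n (int i) j * y n (int i) l) * ?c l)"
  by (simp add: A_def sums sum_distrib_left sum_distrib_right)
  also have "... = gram x n $ j $ l" unfolding gram_def by (simp, intro sum.cong refl) (simp add: yn d0)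
  finally show ?thesis by (rule sym)
  qed
  then show ?thesis unfolding vec_eq_iff diagonal_mult by simp
 qed
 have PA: "P n ** A n = mat 1" unfolding P_def by (rule matrix_inv_mult(2)[OF A])
 have "(E ** P n ** E) ** (?D ** A n ** ?D) = E ** P n ** (E ** ?D) ** A n ** ?D" by (simp only: matrix_mul_assoc)
 also have "... = E ** (P n ** A n) ** ?D" unfolding E1 by (simp add: matrix_mul_assoc)
 also have "... = mat 1" unfolding PA by (simp add: E1)
 finally have inv: "(E ** P n ** E) ** gram x n = mat 1" unfolding gram .
 then have gi: "matrix_inv (gram x n) = E ** P n ** E" by (rule matrix_inv_unique_left)
 have XtY: "(\<chi> j. SUM i=1..n. x i $ j * Y z i) = gram x n *v \<beta> + ?D *v U n z"
 proof -
  have "(SUM i=1..n. x i $ j * Y z i) = (gram x n *v \<beta>) $ j + (?D *v U n z) $ j" for j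
  proof -
  have "(SUM i=1..n. x i $ j * (x i \<bullet> \<beta>)) = (SUM i=1..n. SUM l:UNIV. x i $ j * x i $ l * \<beta> $ l)"
  by (simp add: inner_vec_def sum_distrib_left mult.assoc)
  also have "... = (SUM l:UNIV. SUM i=1..n. x i $ j * x i $ l * \<beta> $ l)" by (rule sum.swap)
  also have "... = (gram x n *v \<beta>) $ j" by (simp add: matrix_vector_mult_def gram_def sum_distrib_right)
  finally have 1: "(SUM i=1..n. x i $ j * (x i \<bullet> \<beta>)) = (gram x n *v \<beta>) $ j" .
  have "(?D *v U n z) $ j = ?c j * U n z $ j"
  by (simp add: matrix_vector_mult_def norm_matrix_def if_distrib[of "%c. c * _"] cong: if_cong)
  also have "... = (SUM i=1..n. ?c j * (y n (int i) j * eps (int i) z))" by (simp add: U_def sums sum_distrib_left)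
  also have "... = (SUM i=1..n. x i $ j * eps (int i) z)" by (intro sum.cong refl) (simp add: yn d0)
  finally have 2: "(?D *v U n z) $ j = (SUM i=1..n. x i $ j * eps (int i) z)" .
  show ?thesis unfolding 1[symmetric] 2 Y_def by (simp add: distrib_left sum.distrib)
  qed
  then show ?thesis by (simp add: vec_eq_iff)
 qed
 have "least_squares x (Y z) n = ((E ** P n ** E) ** gram x n) *v \<beta> + (E ** P n ** (E ** ?D)) *v U n z"
  unfolding least_squares_def XtY gi by (simp only: matrix_vector_right_distrib matrix_vector_mul_assoc matrix_mul_assoc)
 also have "... = \<beta> + E *v W n z" unfolding inv E1 W_def by (simp add: matrix_vector_mul_assoc)
 finally have ls: "least_squares x (Y z) n $ j = \<beta> $ j + W n z $ j / ?c j" for j by (simp add: Ev)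
 show "vstat J n x (Y z) = Wq n z"
  unfolding vstat_def Wq_def vec_eq_iff by (simp add: ls \<beta> d0)
 have res: "residual x (Y z) n i = resid n z (int i)" if i: "i : {1..n}" for i
 proof -
  have "x i \<bullet> least_squares x (Y z) n = x i \<bullet> \<beta> + (SUM j:UNIV. y n (int i) j * W n z $ j)"
  by (simp add: inner_vec_def ls distrib_left sum.distrib yn[OF i])
  then show ?thesis using i by (simp add: residual_def Y_def resid_def)
 qed
 have lag: "lagsum n (resid n z) (int m) = (SUM i=1..n - m. residual x (Y z) n i * residual x (Y z) n (i + m))" for m
 proof -
  have "lagsum n (resid n z) (int m) = (SUM i=1..n. resid n z (int i) * resid n z (int (i + m)))"
  unfolding lagsum_def sums by simp
  also have "... = (SUM i=1..n - m. resid n z (int i) * resid n z (int (i + m)))"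
  by (rule sum.mono_neutral_right) (auto simp: resid_def)
  also have "... = (SUM i=1..n - m. residual x (Y z) n i * residual x (Y z) n (i + m))"
  by (intro sum.cong refl arg_cong2[of _ _ _ _ "(*)"] res[symmetric]) auto
  finally show ?thesis .
 qed
 have lage: "lagsum n (resid n z) (- k) = lagsum n (resid n z) k" for k by (rule lagsum_even) (rule resid_supp)
 have ac: "autocov_est x (Y z) n k = lagsum n (resid n z) k / real n" for k
 proof -
  have "lagsum n (resid n z) (int (nat \<bar>k\<bar>)) = lagsum n (resid n z) k"
  using lage[of k] by (cases "0 <= k") simp_all
  then show ?thesis unfolding autocov_est_def lag[symmetric] by simp
 qed
 have G: "Gamma_est K (h n) x (Y z) n a b = \<phi> n z (int b - int a)" for a b
  using \<phi>_even[of n z "int b - int a"] by (simp add: Gamma_est_def ac \<phi>_def)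
 let ?M = "\<chi> j l. SUM a=1..n. SUM b=1..n. x a $ j * Gamma_est K (h n) x (Y z) n a b * x b $ l"
 have B: "E ** ?M ** E = B n z"
 proof -
  have "?M $ j $ l / (?c j * ?c l) = B n z $ j $ l" for j l
  proof -
  have "B n z $ j $ l = (SUM a=1..n. SUM b=1..n. y n (int a) j * y n (int b) l * \<phi> n z (int b - int a))"
  by (simp add: B_def sums)
  also have "... = (SUM a=1..n. SUM b=1..n. x a $ j * Gamma_est K (h n) x (Y z) n a b * x b $ l / (?c j * ?c l))"
  unfolding G by (intro sum.cong refl) (simp add: yn)
  finally show ?thesis by (simp add: sum_divide_distrib)
  qed
  then show ?thesis unfolding vec_eq_iff EXE by blast
 qed
 have "cov_est K (h n) x (Y z) n = (?D ** E) ** P n ** (E ** ?M ** E) ** P n ** (E ** ?D)"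
  unfolding cov_est_def gi by (simp only: matrix_mul_assoc)
 then have "cov_est K (h n) x (Y z) n = P n ** B n z ** P n" unfolding B E1 E2 by simp
 then show "cstat J K (h n) n x (Y z) = Cov n z" by (simp add: cstat_def Cov_def)
qed

end

text \<open>The identification of the statistics starts at an n that depends on the design only, so
  it holds for all \<open>z\<close> simultaneously.\<close>

theorem (in hannan_process) fixed_design_limit:
 fixes x :: "nat => real^'p" and J :: "'q::finite => 'p"
 assumes K: "admissible_kernel K"
  and h: "!!n. n >= 1 ==> 0 < h n" "filterlim h at_top sequentially" "(%n. h n / real n) ----> 0"
  and J: "inj J" and design: "design_conditions x" and spectral: "spectral_measure_of x \<nu>"
  and pd: "hermitian_pd (limit_cov (spectral_density gam) \<nu>)" and \<beta>: "!!a. \<beta> $ J a = 0"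
 defines "Y z i \<equiv> x i \<bullet> \<beta> + eps (int i) z"
 shows "(%n. (LINT z|M. iexp (u \<bullet> (studentizer (cstat J K (h n) n x (Y z)) *v vstat J n x (Y z))))) ----> exp (- ((norm u)\<^sup>2 / 2))"
  "(%n. prob {z:space M. \<not> posdef (cstat J K (h n) n x (Y z))}) ----> 0"
proof -
 interpret N: normalized_regression M T F0 e0 K h "normalized x" "%n. SUM j:UNIV. \<bar>(SUP i\<in>{1..n}. \<bar>x i $ j\<bar>) / col_norm x n j\<bar>" "signed_R x" J
  by (rule fixed_design_regression[OF K h J design spectral pd])
 have "ALL j. \<forall>\<^sub>F n in sequentially. col_norm x n j > 0"
  using design unfolding design_conditions_def filterlim_at_top_dense by blast
 then have "\<forall>\<^sub>F n in sequentially. ALL j. col_norm x n j > 0" by (simp add: eventually_all_finite)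
 then have ev: "\<forall>\<^sub>F n in sequentially. ALL z. vstat J n x (Y z) = N.Wq n z \<and> cstat J K (h n) n x (Y z) = N.Cov n z"
  using N.A_invertible
 proof eventually_elim
  case (elim n)
  show ?case unfolding Y_def
  by (intro allI conjI N.statistics_eq[OF refl _ elim(2) \<beta>]) (use elim(1) in blast)+
 qed
 show "(%n. (LINT z|M. iexp (u \<bullet> (studentizer (cstat J K (h n) n x (Y z)) *v vstat J n x (Y z))))) ----> exp (- ((norm u)\<^sup>2 / 2))"
  by (rule Lim_transform_eventually[OF N.studentized_char_limit[of u]]) (use ev in eventually_elim, simp)
 show "(%n. prob {z:space M. \<not> posdef (cstat J K (h n) n x (Y z))}) ----> 0"
  by (rule Lim_transform_eventually[OF N.not_posdef_limit]) (use ev in eventually_elim, simp)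
qed

section \<open>Random designs\<close>

lemma generated_sigma_space: "space (generated_sigma M I V) = space M"
 and generated_sigma_sets: "sets (generated_sigma M I V) = sigma_sets (space M) (UN i:I. {V i -` A \<inter> space M | A. A : sets borel})"
proof -
 have sub: "(UN i:I. {V i -` A \<inter> space M | A. A : sets borel}) \<subseteq> Pow (space M)" by auto
 show "space (generated_sigma M I V) = space M" unfolding generated_sigma_def by (rule space_measure_of[OF sub])
 show "sets (generated_sigma M I V) = sigma_sets (space M) (UN i:I. {V i -` A \<inter> space M | A. A : sets borel})"
  unfolding generated_sigma_def by (rule sets_measure_of[OF sub])
qed

lemma generated_sigma_measurable:
 fixes V :: "'i => 'w => 'b::topological_space"
 assumes "i : I" shows "V i : borel_measurable (generated_sigma M I V)"
proof (rule measurableI)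
 fix A assume "A : sets (borel :: 'b measure)"
 then show "V i -` A \<inter> space (generated_sigma M I V) : sets (generated_sigma M I V)"
  unfolding generated_sigma_space generated_sigma_sets using assms by (intro sigma_sets.Basic) blast
qed simp

context prob_space
begin

context
 fixes e :: "int => 'a => real" and x :: "nat => 'a => 'b::topological_space"
  and g :: "(int => real) \<times> (nat => 'b) => 'c::{banach, second_countable_topology}" and c :: real
 assumes ind: "indep_set (sets (generated_sigma M UNIV e)) (sets (generated_sigma M {1..} x))"
  and e: "!!i. e i : borel_measurable M" and x: "!!i. 1 <= i ==> x i : borel_measurable M"
  and g: "g : borel_measurable ((\<Pi>\<^sub>M i\<in>UNIV. borel) \<Otimes>\<^sub>M (\<Pi>\<^sub>M i\<in>{1..}. borel))" and bound: "!!p. norm (g p) <= c"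
begin

text \<open>Independence makes the joint law of the two paths a product, so Fubini integrates over
  the errors with the design frozen at \<open>z\<close>. Path spaces supply this product structure,
  which \<open>M\<close> itself does not have.\<close>

lemma independent_paths:
 shows "(%z. (LINT z'|M. g (\<lambda>i\<in>UNIV. e i z', \<lambda>i\<in>{1..}. x i z))) : borel_measurable M"
  "(LINT z|M. g (\<lambda>i\<in>UNIV. e i z, \<lambda>i\<in>{1..}. x i z)) = (LINT z|M. (LINT z'|M. g (\<lambda>i\<in>UNIV. e i z', \<lambda>i\<in>{1..}. x i z)))"
proof -
 let ?S = "\<Pi>\<^sub>M i\<in>(UNIV :: int set). (borel :: real measure)" and ?T = "\<Pi>\<^sub>M i\<in>{1::nat..}. (borel :: 'b measure)"
 define E where "E z = (\<lambda>i\<in>UNIV. e i z)" for z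
 define X where "X z = (\<lambda>i\<in>{1..}. x i z)" for z
 have Em: "E : measurable M ?S" unfolding E_def[abs_def] by (rule measurable_restrict) (rule e)
 have Xm: "X : measurable M ?T" unfolding X_def[abs_def] by (rule measurable_restrict) (simp add: x)
 have Eg: "E : measurable (generated_sigma M UNIV e) ?S"
  unfolding E_def[abs_def] by (rule measurable_restrict) (rule generated_sigma_measurable)
 have Xg: "X : measurable (generated_sigma M {1..} x) ?T"
  unfolding X_def[abs_def] by (rule measurable_restrict) (rule generated_sigma_measurable)
 interpret PE: prob_space "distr M ?S E" by (rule prob_space_distr[OF Em])
 interpret PX: prob_space "distr M ?T X" by (rule prob_space_distr[OF Xm])
 interpret PP: pair_prob_space "distr M ?S E" "distr M ?T X" ..
 have pm: "(%z. (E z, X z)) : measurable M (?S \<Otimes>\<^sub>M ?T)" by (rule measurable_Pair[OF Em Xm])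
 have eq: "distr M ?S E \<Otimes>\<^sub>M distr M ?T X = distr M (?S \<Otimes>\<^sub>M ?T) (%z. (E z, X z))"
 proof (rule pair_measure_eqI[OF PE.sigma_finite_measure_axioms PX.sigma_finite_measure_axioms])
  show "sets (distr M ?S E \<Otimes>\<^sub>M distr M ?T X) = sets (distr M (?S \<Otimes>\<^sub>M ?T) (%z. (E z, X z)))"
  unfolding sets_distr by (rule sets_pair_measure_cong) simp_all
  fix A B assume "A : sets (distr M ?S E)" "B : sets (distr M ?T X)"
  then have A: "A : sets ?S" and B: "B : sets ?T" by (simp_all only: sets_distr)
  have "prob ((E -` A \<inter> space M) \<inter> (X -` B \<inter> space M)) = prob (E -` A \<inter> space M) * prob (X -` B \<inter> space M)"
  using indep_setD[OF ind measurable_sets[OF Eg A] measurable_sets[OF Xg B]] unfolding generated_sigma_space .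
  moreover have "(%z. (E z, X z)) -` (A \<times> B) \<inter> space M = (E -` A \<inter> space M) \<inter> (X -` B \<inter> space M)" by auto
  ultimately have "emeasure M ((%z. (E z, X z)) -` (A \<times> B) \<inter> space M) = emeasure M (E -` A \<inter> space M) * emeasure M (X -` B \<inter> space M)"
  by (simp add: emeasure_eq_measure ennreal_mult)
  then show "emeasure (distr M ?S E) A * emeasure (distr M ?T X) B = emeasure (distr M (?S \<Otimes>\<^sub>M ?T) (%z. (E z, X z))) (A \<times> B)"
  by (simp only: emeasure_distr[OF Em A] emeasure_distr[OF Xm B] emeasure_distr[OF pm pair_measureI[OF A B]])
 qed
 have gm: "g : borel_measurable (distr M ?S E \<Otimes>\<^sub>M distr M ?T X)"
  using g measurable_cong_sets[OF sets_pair_measure_cong[OF sets_distr sets_distr] refl] by blast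
 have gi: "integrable (distr M ?S E \<Otimes>\<^sub>M distr M ?T X) g"
  by (rule PP.integrable_const_bound[where B = c]) (use bound gm in auto)
 have sec: "(%a. g (a, b)) : borel_measurable ?S" if "b : space ?T" for b
  by (rule measurable_compose[OF measurable_Pair2'[OF that] g])
 have XT: "X z : space ?T" if "z : space M" for z by (rule measurable_space[OF Xm that])
 have inner: "(\<integral>a. g (a, X z) \<partial>distr M ?S E) = (LINT z'|M. g (E z', X z))" if "z : space M" for z
  by (rule integral_distr[OF Em sec[OF XT[OF that]]])
 have "(%b. \<integral>a. g (a, b) \<partial>distr M ?S E) : borel_measurable ?T"
 proof (rule PE.borel_measurable_lebesgue_integral)
  have "(%q. g ((%(b, a). (a, b)) q)) : borel_measurable (?T \<Otimes>\<^sub>M ?S)" by (rule measurable_compose[OF measurable_pair_swap' g])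
  moreover have "(%(b, a). g (a, b)) = (%q. g ((%(b, a). (a, b)) q))" by (simp add: fun_eq_iff)
  ultimately have "(%(b, a). g (a, b)) : borel_measurable (?T \<Otimes>\<^sub>M ?S)" by simp
  then show "(%(b, a). g (a, b)) : borel_measurable (?T \<Otimes>\<^sub>M distr M ?S E)"
  using measurable_cong_sets[OF sets_pair_measure_cong[OF refl sets_distr] refl] by blast
 qed
 note im = this
 have "(%z. \<integral>a. g (a, X z) \<partial>distr M ?S E) : borel_measurable M" by (rule measurable_compose[OF Xm im])
 then have "(%z. (LINT z'|M. g (E z', X z))) : borel_measurable M"
  using inner by (simp cong: measurable_cong)
 then show "(%z. (LINT z'|M. g (\<lambda>i\<in>UNIV. e i z', \<lambda>i\<in>{1..}. x i z))) : borel_measurable M"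
  unfolding E_def X_def .
 have "(LINT z|M. g (E z, X z)) = integral\<^sup>L (distr M (?S \<Otimes>\<^sub>M ?T) (%z. (E z, X z))) g"
  by (rule integral_distr[OF pm g, symmetric])
 also have "... = integral\<^sup>L (distr M ?S E \<Otimes>\<^sub>M distr M ?T X) (case_prod (%a b. g (a, b)))" unfolding eq by simp
 also have "... = (\<integral>b. (\<integral>a. g (a, b) \<partial>distr M ?S E) \<partial>distr M ?T X)"
  by (rule PP.integral_snd[symmetric]) (use gi in simp)
 also have "... = (\<integral>z. (\<integral>a. g (a, X z) \<partial>distr M ?S E) \<partial>M)" by (rule integral_distr[OF Xm im])
 also have "... = (LINT z|M. (LINT z'|M. g (E z', X z)))" by (rule LINT_cong[OF refl inner])
 finally show "(LINT z|M. g (\<lambda>i\<in>UNIV. e i z, \<lambda>i\<in>{1..}. x i z)) = (LINT z|M. (LINT z'|M. g (\<lambda>i\<in>UNIV. e i z', \<lambda>i\<in>{1..}. x i z)))"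
  unfolding E_def X_def .
qed

end

text \<open>A limit for almost every frozen design passes to the random design by dominated
  convergence.\<close>

lemma independent_paths_limit:
 fixes g :: "nat => (int => real) \<times> (nat => 'b::topological_space) => 'c::{banach, second_countable_topology}"
 assumes ind: "indep_set (sets (generated_sigma M UNIV e)) (sets (generated_sigma M {1..} x))"
  and e: "!!i. e i : borel_measurable M" and x: "!!i. 1 <= i ==> x i : borel_measurable M"
  and g: "!!n. g n : borel_measurable ((\<Pi>\<^sub>M i\<in>UNIV. borel) \<Otimes>\<^sub>M (\<Pi>\<^sub>M i\<in>{1..}. borel))" and bound: "!!n p. norm (g n p) <= c"
  and lim: "AE z in M. (%n. (LINT z'|M. g n (\<lambda>i\<in>UNIV. e i z', \<lambda>i\<in>{1..}. x i z))) ----> l"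
 shows "(%n. (LINT z|M. g n (\<lambda>i\<in>UNIV. e i z, \<lambda>i\<in>{1..}. x i z))) ----> l"
proof -
 let ?\<psi> = "%n z. (LINT z'|M. g n (\<lambda>i\<in>UNIV. e i z', \<lambda>i\<in>{1..}. x i z))"
 have c0: "0 <= c" using order_trans[OF norm_ge_zero bound] .
 have "(%n. (LINT z|M. ?\<psi> n z)) ----> (LINT z|M. l)"
 proof (rule integral_dominated_convergence[where w = "%_. c"])
  show "?\<psi> n : borel_measurable M" for n by (rule independent_paths(1)[OF ind e x g bound])
  show "AE z in M. norm (?\<psi> n z) <= c" for n
  proof (rule AE_I2)
  fix z
  have "norm (?\<psi> n z) <= (LINT z'|M. norm (g n (\<lambda>i\<in>UNIV. e i z', \<lambda>i\<in>{1..}. x i z)))" by (rule integral_norm_bound)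
  also have "... <= (LINT z'|M. c)" by (rule integral_mono') (use bound c0 in simp_all)
  finally show "norm (?\<psi> n z) <= c" by (simp add: prob_space)
  qed
 qed (use lim in simp_all)
 moreover have "(LINT z|M. g n (\<lambda>i\<in>UNIV. e i z, \<lambda>i\<in>{1..}. x i z)) = (LINT z|M. ?\<psi> n z)" for n
  by (rule independent_paths(2)[OF ind e x g bound])
 ultimately show ?thesis by (simp add: prob_space)
qed

lemma expectation_iexp_perturb:
 assumes X: "X : borel_measurable M" and Y: "Y : borel_measurable M" and A: "A : sets M"
  and eq: "!!z. z : space M ==> z ~: A ==> X z = Y z"
 shows "cmod ((LINT z|M. iexp (X z)) - (LINT z|M. iexp (Y z))) <= 2 * prob A"
proof -
 have i: "integrable M (%z. iexp (f z))" if "f : borel_measurable M" for f :: "'a => real"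
  by (rule integrable_const_bound[where B = 1]) (use that in simp_all)
 have ie: "integrable M (%z. iexp (X z) - iexp (Y z))" by (intro Lint_diff i X Y)
 have "cmod ((LINT z|M. iexp (X z)) - (LINT z|M. iexp (Y z))) = cmod (LINT z|M. iexp (X z) - iexp (Y z))"
  by (simp only: LINT_diff[OF i[OF X] i[OF Y]])
 also have "... <= (LINT z|M. cmod (iexp (X z) - iexp (Y z)))" by (rule integral_norm_bound)
 also have "... <= (LINT z|M. 2 * indicator A z)"
 proof (rule integral_mono[OF integrable_norm[OF ie]])
  show "integrable M (%z. 2 * indicator A z :: real)" using A by (intro integrable_mult_right integrable_real_indicator) (simp_all add: emeasure_eq_measure)
  fix z assume "z : space M"
  have "cmod (iexp (X z) - iexp (Y z)) <= cmod (iexp (X z)) + cmod (iexp (Y z))" by (rule norm_triangle_ineq4)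
  then show "cmod (iexp (X z) - iexp (Y z)) <= 2 * indicator A z"
  using eq[OF \<open>z : space M\<close>] by (cases "z : A") simp_all
 qed
 also have "... = 2 * prob A" using A by simp
 finally show ?thesis .
qed

end

theorem (in hannan_process) random_design_limit:
 fixes x :: "nat => 'w => real^'p" and J :: "'q::finite => 'p"
 assumes K: "admissible_kernel K"
  and h: "!!n. n >= 1 ==> 0 < h n" "filterlim h at_top sequentially" "(%n. h n / real n) ----> 0"
  and J: "inj J" and x: "!!i. i >= 1 ==> x i : borel_measurable M"
  and ind: "indep_set (sets (generated_sigma M UNIV (err M T e0))) (sets (generated_sigma M {1..} x))"
  and design: "AE z in M. design_conditions (%i. x i z)"
  and spectral: "AE z in M. spectral_measure_of (%i. x i z) (FX z)"
  and pd: "AE z in M. hermitian_pd (limit_cov (spectral_density gam) (FX z))"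
  and \<beta>: "!!a. \<beta> $ J a = 0"
 defines "Y z i \<equiv> x i z \<bullet> \<beta> + eps (int i) z"
 shows "(%n. (LINT z|M. iexp (u \<bullet> (studentizer (cstat J K (h n) n (%i. x i z) (Y z)) *v vstat J n (%i. x i z) (Y z)))))
  ----> exp (- ((norm u)\<^sup>2 / 2))"
  "(%n. prob {z:space M. \<not> posdef (cstat J K (h n) n (%i. x i z) (Y z))}) ----> 0"
proof -
 let ?N = "(\<Pi>\<^sub>M i\<in>(UNIV :: int set). (borel :: real measure)) \<Otimes>\<^sub>M (\<Pi>\<^sub>M i\<in>{1::nat..}. (borel :: (real^'p) measure))"
 define C where "C n p = cstat J K (h n) n (snd p) (%i. snd p i \<bullet> \<beta> + fst p (int i))" for n and p :: "(int => real) \<times> (nat => real^'p)"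
 define v where "v n p = vstat J n (snd p) (%i. snd p i \<bullet> \<beta> + fst p (int i))" for n and p :: "(int => real) \<times> (nat => real^'p)"
 define g where "g n p = iexp (u \<bullet> (studentizer (C n p) *v v n p))" for n p
 define b where "b n p = (indicator {X. \<not> posdef X} (C n p) :: real)" for n p
 have X: "(%p. snd p i) : borel_measurable ?N" if "1 <= i" for i
  by (rule measurable_compose[OF measurable_snd measurable_component_singleton]) (use that in simp)
 have E: "(%p. fst p i) : borel_measurable ?N" for i
  by (rule measurable_compose[OF measurable_fst measurable_component_singleton]) simp
 have Ym: "(%p. snd p i \<bullet> \<beta> + fst p (int i)) : borel_measurable ?N" if "1 <= i" for i
  by (intro borel_measurable_add borel_measurable_inner borel_measurable_const X[OF that] E)
 have Cm: "C n : borel_measurable ?N" for n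
  unfolding C_def[abs_def] using statistics_measurable(2)[of "%i p. snd p i" ?N "%i p. snd p i \<bullet> \<beta> + fst p (int i)", OF X Ym] by simp
 have vm: "v n : borel_measurable ?N" for n
  unfolding v_def[abs_def] using statistics_measurable(1)[of "%i p. snd p i" ?N "%i p. snd p i \<bullet> \<beta> + fst p (int i)", OF X Ym] by simp
 have im: "(%t. iexp t) : borel_measurable borel" by (intro borel_measurable_continuous_onI continuous_intros)
 have gm: "g n : borel_measurable ?N" for n
  unfolding g_def[abs_def]
  by (rule measurable_compose[OF _ im], intro borel_measurable_inner borel_measurable_const borel_measurable_mult_vec studentizer_measurable Cm vm)
 have npd: "{X :: real^'q^'q. \<not> posdef X} : sets borel"
 proof -
  have "- {X :: real^'q^'q. posdef X} : sets borel" using posdef_sets by (rule borel_comp)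
  then show ?thesis by (simp add: Collect_neg_eq)
 qed
 have bm: "b n : borel_measurable ?N" for n
  unfolding b_def[abs_def] by (rule measurable_compose[OF Cm borel_measurable_indicator[OF npd]])
 \<comment> \<open>Restricting the design path to positive indices alters it only at 0, which the
   statistics ignore.\<close>
 have path: "C n (\<lambda>i\<in>UNIV. eps i z', \<lambda>i\<in>{1..}. x i z) = cstat J K (h n) n (%i. x i z) (%i. x i z \<bullet> \<beta> + eps (int i) z')"
  "v n (\<lambda>i\<in>UNIV. eps i z', \<lambda>i\<in>{1..}. x i z) = vstat J n (%i. x i z) (%i. x i z \<bullet> \<beta> + eps (int i) z')" for n z z'
  unfolding C_def v_def by (rule statistics_cong; simp)+
 \<comment> \<open>\<open>f\<close> is constant when the design is frozen and the identity for the
   joint probability, so that one calculation serves both.\<close>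
 have bi: "(LINT z'|M. b n (\<lambda>i\<in>UNIV. eps i z', \<lambda>i\<in>{1..}. x i (f z')))
  = prob {z':space M. \<not> posdef (cstat J K (h n) n (%i. x i (f z')) (%i. x i (f z') \<bullet> \<beta> + eps (int i) z'))}"
  if "!!i. 1 <= i ==> (%z'. x i (f z')) : borel_measurable M" for n f
 proof -
  let ?c = "%z'. cstat J K (h n) n (%i. x i (f z')) (%i. x i (f z') \<bullet> \<beta> + eps (int i) z')"
  have "?c : borel_measurable M"
  using statistics_measurable(2)[of "%i z'. x i (f z')" M "%i z'. x i (f z') \<bullet> \<beta> + eps (int i) z'"] that by simp
  then have m: "?c -` {X. \<not> posdef X} \<inter> space M : sets M" by (rule measurable_sets[OF _ npd])
  have "b n (\<lambda>i\<in>UNIV. eps i z', \<lambda>i\<in>{1..}. x i (f z')) = indicator (?c -` {X. \<not> posdef X}) z'" for z'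
  unfolding b_def path by (simp add: indicator_def)
  then have "(LINT z'|M. b n (\<lambda>i\<in>UNIV. eps i z', \<lambda>i\<in>{1..}. x i (f z'))) = prob (?c -` {X. \<not> posdef X} \<inter> space M)"
  using m by (simp add: Int_commute)
  also have "?c -` {X. \<not> posdef X} \<inter> space M = {z':space M. \<not> posdef (?c z')}" by auto
  finally show ?thesis .
 qed
 have "(%n. (LINT z|M. g n (\<lambda>i\<in>UNIV. eps i z, \<lambda>i\<in>{1..}. x i z))) ----> exp (- ((norm u)\<^sup>2 / 2))"
 proof (rule independent_paths_limit[OF ind eps_measurable x gm])
  show "norm (g n p) <= 1" for n p by (simp add: g_def)
  show "AE z in M. (%n. (LINT z'|M. g n (\<lambda>i\<in>UNIV. eps i z', \<lambda>i\<in>{1..}. x i z))) ----> exp (- ((norm u)\<^sup>2 / 2))"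
  using design spectral pd
  proof eventually_elim
  case (elim z)
  show ?case unfolding g_def path by (rule fixed_design_limit(1)[OF K h J elim \<beta>])
  qed
 qed
 then show "(%n. (LINT z|M. iexp (u \<bullet> (studentizer (cstat J K (h n) n (%i. x i z) (Y z)) *v vstat J n (%i. x i z) (Y z)))))
  ----> exp (- ((norm u)\<^sup>2 / 2))"
  unfolding g_def path Y_def .
 have bx: "(LINT z|M. b n (\<lambda>i\<in>UNIV. eps i z, \<lambda>i\<in>{1..}. x i z))
  = prob {z:space M. \<not> posdef (cstat J K (h n) n (%i. x i z) (%i. x i z \<bullet> \<beta> + eps (int i) z))}" for n
  by (rule bi[of "%z. z"]) (rule x)
 have "(%n. (LINT z|M. b n (\<lambda>i\<in>UNIV. eps i z, \<lambda>i\<in>{1..}. x i z))) ----> 0"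
 proof (rule independent_paths_limit[OF ind eps_measurable x bm])
  show "norm (b n p) <= 1" for n p by (simp add: b_def indicator_def)
  show "AE z in M. (%n. (LINT z'|M. b n (\<lambda>i\<in>UNIV. eps i z', \<lambda>i\<in>{1..}. x i z))) ----> 0"
  using design spectral pd
  proof eventually_elim
  case (elim z)
  show ?case unfolding bi[of "%_. z", OF borel_measurable_const] by (rule fixed_design_limit(2)[OF K h J elim \<beta>])
  qed
 qed
 then show "(%n. prob {z:space M. \<not> posdef (cstat J K (h n) n (%i. x i z) (Y z))}) ----> 0"
  unfolding bx Y_def .
qed

theorem mainTheorem4:
  fixes M :: "'w measure"
    and T :: "'w \<Rightarrow> 'w"
    and F0 :: "'w measure"
    and \<epsilon>0 :: "'w \<Rightarrow> real"
    and x :: "nat \<Rightarrow> 'w \<Rightarrow> real^'p"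
    and FX :: "'w \<Rightarrow> real set \<Rightarrow> complex^'p^'p"
    and \<beta> :: "real^'p"
    and K :: "real \<Rightarrow> real"
    and h :: "nat \<Rightarrow> real"
    and J :: "'q::finite \<Rightarrow> 'p::finite"
    and Y :: "nat \<Rightarrow> 'w \<Rightarrow> real"
    and Cq S :: "nat \<Rightarrow> 'w \<Rightarrow> real^'q^'q"
    and Z :: "nat \<Rightarrow> 'w \<Rightarrow> real^'q"
    and \<Xi> :: "nat \<Rightarrow> 'w \<Rightarrow> real"
  assumes prob: "prob_space M"
    and T: "invertible_measure_preserving M T"
    and \<epsilon>0_measurable: "\<epsilon>0 \<in> borel_measurable M"
    and \<epsilon>0_square_integrable: "integrable M (\<lambda>\<omega>. (\<epsilon>0 \<omega>)\<^sup>2)"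
    and \<epsilon>0_centered: "(\<integral>\<omega>. \<epsilon>0 \<omega> \<partial>M) = 0"
    and F0: "subalgebra M F0"
    and F0_increasing: "sets F0 \<subseteq> sets (vimage_algebra (space M) T F0)"
    and trivial_past: "filt_minus_infinity_trivial M T F0"
    and \<epsilon>0_regular: "\<epsilon>0 \<in> borel_measurable (filt_infinity M T F0)"
    and hannan: "(\<lambda>i. L2_norm M (proj M T F0 0 (err M T \<epsilon>0 i))) summable_on (UNIV :: int set)"
    and x_measurable: "\<And>i. i \<ge> 1 \<Longrightarrow> x i \<in> borel_measurable M"
    and independent: "prob_space.indep_set M
          (sets (generated_sigma M UNIV (err M T \<epsilon>0)))
          (sets (generated_sigma M {1..} x))"
    and design: "AE \<omega> in M. design_conditions (\<lambda>i. x i \<omega>)"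
    and FX: "AE \<omega> in M. spectral_measure_of (\<lambda>i. x i \<omega>) (FX \<omega>)"
    and C_pd: "AE \<omega> in M. hermitian_pd (limit_cov (spectral_density (autocov M T \<epsilon>0)) (FX \<omega>))"
    and K: "admissible_kernel K"
    and h_pos: "\<And>n. n \<ge> 1 \<Longrightarrow> h n > 0"
    and h_top: "filterlim h at_top sequentially"
    and h_small: "(\<lambda>n. h n / real n) \<longlonglongrightarrow> 0"
    and h_moment: "(\<lambda>n. h n * (\<integral>\<omega>. \<bar>\<epsilon>0 \<omega>\<bar>\<^sup>2 * min 1 (h n / real n * \<bar>\<epsilon>0 \<omega>\<bar>\<^sup>2) \<partial>M)) \<longlonglongrightarrow> 0"
    and J: "inj J"
    and Y: "\<And>i \<omega>. Y i \<omega> = x i \<omega> \<bullet> \<beta> + err M T \<epsilon>0 (int i) \<omega>"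
    and Cq: "\<And>n \<omega>. Cq n \<omega> =
          principal_submatrix J (cov_est K (h n) (\<lambda>i. x i \<omega>) (\<lambda>i. Y i \<omega>) n)"
    and S_measurable: "\<And>n. S n \<in> borel_measurable M"
    and S: "\<And>n \<omega>. \<omega> \<in> space M \<Longrightarrow> posdef (Cq n \<omega>) \<Longrightarrow> S n \<omega> = inv_sqrt (Cq n \<omega>)"
    and Z: "\<And>n \<omega>. Z n \<omega> = S n \<omega> *v
          (\<chi> a. col_norm (\<lambda>i. x i \<omega>) n (J a) *
                 least_squares (\<lambda>i. x i \<omega>) (\<lambda>i. Y i \<omega>) n $ J a)"
    and \<Xi>: "\<And>n \<omega>. \<Xi> n \<omega> = (\<Sum>a\<in>UNIV. (Z n \<omega> $ a)\<^sup>2)"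
    and H0: "\<And>a. \<beta> $ J a = 0"
  shows "converges_in_distribution M Z standard_gaussian \<and>
         weak_conv_m (\<lambda>n. distr M borel (\<Xi> n)) (chi_square CARD('q))"
proof -
 interpret prob_space M by (rule prob)
 interpret hannan_process M T F0 \<epsilon>0
 proof
  show "\<epsilon>0 : L2 M" using \<epsilon>0_measurable \<epsilon>0_square_integrable by (simp add: L2_def)
 qed (fact T F0 F0_increasing \<epsilon>0_centered trivial_past \<epsilon>0_regular hannan)+
 define V where "V n z = vstat J n (%i. x i z) (%i. Y i z)" for n z
 have Cq': "Cq n z = cstat J K (h n) n (%i. x i z) (%i. Y i z)" for n z by (simp add: Cq cstat_def)
 have Z': "Z n z = S n z *v V n z" for n z by (simp add: Z V_def vstat_def)
 have YE: "(%i. Y i z) = (%i. x i z \<bullet> \<beta> + eps (int i) z)" for z by (simp add: Y fun_eq_iff)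
 have Ym: "Y i : borel_measurable M" if "1 <= i" for i
 proof -
  have "(%z. x i z \<bullet> \<beta> + eps (int i) z) : borel_measurable M"
  by (intro borel_measurable_add borel_measurable_inner borel_measurable_const x_measurable[OF that] eps_measurable)
  moreover have "Y i = (%z. x i z \<bullet> \<beta> + eps (int i) z)" by (simp add: Y fun_eq_iff)
  ultimately show ?thesis by (simp only:)
 qed
 have Vm: "V n : borel_measurable M" for n
  unfolding V_def[abs_def] by (rule statistics_measurable(1)[OF x_measurable Ym])
 have Cm: "Cq n : borel_measurable M" for n
 proof -
  have "(%z. cstat J K (h n) n (%i. x i z) (%i. Y i z)) : borel_measurable M"
  by (rule statistics_measurable(2)[OF x_measurable Ym])
  then show ?thesis unfolding Cq'[symmetric] .
 qed
 have Zm: "Z n : borel_measurable M" for n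
 proof -
  have "(%z. S n z *v V n z) : borel_measurable M" by (rule borel_measurable_mult_vec[OF S_measurable Vm])
  then show ?thesis unfolding Z'[symmetric] .
 qed
 note limits = random_design_limit[OF K h_pos h_top h_small J x_measurable independent design FX C_pd H0,
  folded YE, folded Cq', folded V_def]
 have npd: "{z:space M. \<not> posdef (Cq n z)} : sets M" for n
 proof -
  have "space M - (Cq n -` {X. posdef X} \<inter> space M) : sets M"
  by (rule sets.compl_sets[OF measurable_sets[OF Cm posdef_sets]])
  also have "space M - (Cq n -` {X. posdef X} \<inter> space M) = {z:space M. \<not> posdef (Cq n z)}" by auto
  finally show ?thesis .
 qed
 have char: "(%n. (LINT z|M. iexp (u \<bullet> Z n z))) ----> exp (- (norm u)\<^sup>2 / 2)" for u
 proof -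
  let ?X = "%n z. u \<bullet> (studentizer (Cq n z) *v V n z)"
  \<comment> \<open>\<open>S\<close> is prescribed only where \<open>Cq\<close> is positive
    definite; elsewhere the two exponents may differ, at the cost of twice a vanishing
    probability.\<close>
  have pert: "cmod ((LINT z|M. iexp (u \<bullet> Z n z)) - (LINT z|M. iexp (?X n z))) <= 2 * prob {z:space M. \<not> posdef (Cq n z)}" for n
  proof (rule expectation_iexp_perturb[OF _ _ npd])
  show "(%z. u \<bullet> Z n z) : borel_measurable M" by (intro borel_measurable_inner borel_measurable_const Zm)
  show "?X n : borel_measurable M"
  by (intro borel_measurable_inner borel_measurable_const borel_measurable_mult_vec studentizer_measurable Cm Vm)
  fix z assume "z : space M" "z ~: {z:space M. \<not> posdef (Cq n z)}"
  then show "u \<bullet> Z n z = ?X n z" using S[of z n] by (simp add: Z' studentizer_def)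
  qed
  have "(%n. 2 * prob {z:space M. \<not> posdef (Cq n z)}) ----> 2 * 0"
  by (intro tendsto_mult tendsto_const limits(2))
  then have l0: "(%n. 2 * prob {z:space M. \<not> posdef (Cq n z)}) ----> 0" by simp
  have "(%n. (LINT z|M. iexp (u \<bullet> Z n z)) - (LINT z|M. iexp (?X n z))) ----> 0"
  by (rule Lim_null_comparison[OF _ l0]) (use pert in simp)
  from tendsto_add[OF this limits(1)[of u]] show ?thesis by simp
 qed
 have conv: "converges_in_distribution M Z standard_gaussian" by (rule levy_continuity_gaussian[OF Zm char])
 then show ?thesis using chi_square_limit[OF conv \<Xi>] by blast
qed

end
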